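(* Let $A$ be a semisimple Hopf algebra over a field $k$ and let $M$ be a finite dimensional left $A$-module with character $\chi$. Let $L:=\mathrm{LKer}_M$. Then the irreducible modules of the quotient Hopf algebra $A//L$ (regarded as $A$-modules via the projection $A\to A//L$) are precisely all the irreducible constituents of the tensor powers $M^{\otimes n}$ with $n\ge 0$.
   Context: For a Hopf algebra $A$ over a field $k$ with comultiplication $\Delta(a)=a_1\otimes a_2$ (Sweedler notation, summation omitted), counit $\epsilon$, and a left $A$-module $M$, the left kernel of $M$ is $\mathrm{LKer}_M=\{a\in A : a_1\otimes a_2m=a\otimes m \text{ in } A\otimes M \text{ for all } m\in M\}$. It is a left coideal subalgebra of $A$ (a subalgebra $L$ with $\Delta(L)\subset A\otimes L$) that is stable under the left adjoint action of $A$. For such $L$ put $L^+=L\cap\ker\epsilon$; for finite dimensional $A$ one has $AL^+=L^+A$, a Hopf ideal, and $A//L:=A/AL^+$. Tensor powers are taken with the diagonal action through $\Delta$, and $M^{\otimes 0}=k$ is the trivial module. *)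

theory Defs
  imports "HOL-Algebra.Module" "HOL-Algebra.QuotRing" "HOL-Algebra.Ideal_Product" "HOL.Hull"
begin

section \<open>Left modules over arbitrary rings\<close>

text \<open>The library locale \<^locale>\<open>module\<close> requires a commutative ring of scalars.  The same record
  type and the library notion \<^locale>\<open>submodule\<close>, which mentions no ring axioms, are used here for
  left modules over arbitrary rings.  The multiplicative fields of a record standing for a module
  play no role.\<close>

locale left_module = R?: ring R + M?: abelian_group M
  for R :: "('r, 'q) ring_scheme" (structure) and M :: "('r, 'v, 'p) module_scheme" (structure) +
  assumes smult_closed:
      "\<lbrakk>a \<in> carrier R; x \<in> carrier M\<rbrakk> \<Longrightarrow> a \<odot>\<^bsub>M\<^esub> x \<in> carrier M"
    and smult_l_distr:
      "\<lbrakk>a \<in> carrier R; b \<in> carrier R; x \<in> carrier M\<rbrakk> \<Longrightarrow>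
        (a \<oplus> b) \<odot>\<^bsub>M\<^esub> x = a \<odot>\<^bsub>M\<^esub> x \<oplus>\<^bsub>M\<^esub> b \<odot>\<^bsub>M\<^esub> x"
    and smult_r_distr:
      "\<lbrakk>a \<in> carrier R; x \<in> carrier M; y \<in> carrier M\<rbrakk> \<Longrightarrow>
        a \<odot>\<^bsub>M\<^esub> (x \<oplus>\<^bsub>M\<^esub> y) = a \<odot>\<^bsub>M\<^esub> x \<oplus>\<^bsub>M\<^esub> a \<odot>\<^bsub>M\<^esub> y"
    and smult_assoc:
      "\<lbrakk>a \<in> carrier R; b \<in> carrier R; x \<in> carrier M\<rbrakk> \<Longrightarrow>
        (a \<otimes> b) \<odot>\<^bsub>M\<^esub> x = a \<odot>\<^bsub>M\<^esub> (b \<odot>\<^bsub>M\<^esub> x)"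
    and smult_one:
      "x \<in> carrier M \<Longrightarrow> \<one> \<odot>\<^bsub>M\<^esub> x = x"

definition mk_module ::
  "'v set \<Rightarrow> 'v \<Rightarrow> ('v \<Rightarrow> 'v \<Rightarrow> 'v) \<Rightarrow> ('r \<Rightarrow> 'v \<Rightarrow> 'v) \<Rightarrow> ('r, 'v) module" where
  "mk_module V z p s =
     \<lparr>carrier = V, mult = undefined, one = undefined, zero = z, add = p, smult = s\<rparr>"

definition module_hom ::
  "('r, 'q) ring_scheme \<Rightarrow> ('r, 'v, 'p) module_scheme \<Rightarrow> ('r, 'w, 's) module_scheme \<Rightarrow> ('v \<Rightarrow> 'w) set"
  where
  "module_hom R V W =
     {h \<in> hom (add_monoid V) (add_monoid W).
        \<forall>r\<in>carrier R. \<forall>v\<in>carrier V. h (r \<odot>\<^bsub>V\<^esub> v) = r \<odot>\<^bsub>W\<^esub> h v}"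

definition module_isomorphic ::
  "('r, 'q) ring_scheme \<Rightarrow> ('r, 'v, 'p) module_scheme \<Rightarrow> ('r, 'w, 's) module_scheme \<Rightarrow> bool" where
  "module_isomorphic R V W \<longleftrightarrow> (\<exists>h\<in>module_hom R V W. bij_betw h (carrier V) (carrier W))"

definition quotient_module ::
  "('r, 'v, 'p) module_scheme \<Rightarrow> 'v set \<Rightarrow> ('r, 'v set) module" where
  "quotient_module V N =
     mk_module (a_rcosets\<^bsub>V\<^esub> N) N (set_add V) (\<lambda>r C. \<Union>v\<in>C. N +>\<^bsub>V\<^esub> (r \<odot>\<^bsub>V\<^esub> v))"

definition simple_module :: "('r, 'q) ring_scheme \<Rightarrow> ('r, 'v, 'p) module_scheme \<Rightarrow> bool" where
  "simple_module R V \<longleftrightarrow>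
     left_module R V \<and> carrier V \<noteq> {\<zero>\<^bsub>V\<^esub>} \<and>
     (\<forall>N. submodule N R V \<longrightarrow> N = {\<zero>\<^bsub>V\<^esub>} \<or> N = carrier V)"

definition semisimple_module :: "('r, 'q) ring_scheme \<Rightarrow> ('r, 'v, 'p) module_scheme \<Rightarrow> bool" where
  "semisimple_module R V \<longleftrightarrow>
     left_module R V \<and>
     (\<forall>N. submodule N R V \<longrightarrow>
        (\<exists>N'. submodule N' R V \<and> N \<inter> N' = {\<zero>\<^bsub>V\<^esub>} \<and> N <+>\<^bsub>V\<^esub> N' = carrier V))"

definition regular_module :: "('r, 'q) ring_scheme \<Rightarrow> ('r, 'r) module" where
  "regular_module R = mk_module (carrier R) \<zero>\<^bsub>R\<^esub> (add R) (mult R)"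

definition semisimple_ring :: "('r, 'q) ring_scheme \<Rightarrow> bool" where
  "semisimple_ring R \<longleftrightarrow> ring R \<and> semisimple_module R (regular_module R)"

text \<open>Irreducible constituents are composition factors: simple subquotients, up to isomorphism.\<close>

definition irreducible_constituent ::
  "('r, 'q) ring_scheme \<Rightarrow> ('r, 'v, 'p) module_scheme \<Rightarrow> ('r, 'w, 's) module_scheme \<Rightarrow> bool" where
  "irreducible_constituent R V X \<longleftrightarrow>
     simple_module R V \<and>
     (\<exists>P Q. submodule P R X \<and> submodule Q R X \<and> P \<subseteq> Q \<and>
        module_isomorphic R V (quotient_module (X\<lparr>carrier := Q\<rparr>) P))"

text \<open>A module over \<open>A Quot I\<close>, regarded as an \<open>A\<close>-module via the projection.\<close>

definition pullback_module ::
  "('r, 'q) ring_scheme \<Rightarrow> 'r set \<Rightarrow> ('r set, 'v, 'p) module_scheme \<Rightarrow> ('r, 'v) module" where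
  "pullback_module R I N =
     mk_module (carrier N) \<zero>\<^bsub>N\<^esub> (add N) (\<lambda>a v. (I +>\<^bsub>R\<^esub> a) \<odot>\<^bsub>N\<^esub> v)"

definition finite_dimensional ::
  "('k, 'q) ring_scheme \<Rightarrow> ('k, 'v, 'p) module_scheme \<Rightarrow> bool" where
  "finite_dimensional K V \<longleftrightarrow>
     (\<exists>B. finite B \<and> B \<subseteq> carrier V \<and>
        (\<forall>v\<in>carrier V. \<exists>c\<in>B \<rightarrow> carrier K. v = (\<Oplus>\<^bsub>V\<^esub>b\<in>B. c b \<odot>\<^bsub>V\<^esub> b)))"


section \<open>Vector spaces given by generators and relations\<close>

definition free_module :: "('k, 'q) ring_scheme \<Rightarrow> 'x set \<Rightarrow> ('k, 'x \<Rightarrow> 'k) module" where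
  "free_module K X =
     mk_module
       {f. (\<forall>x. f x \<in> carrier K) \<and> (\<forall>x. x \<notin> X \<longrightarrow> f x = \<zero>\<^bsub>K\<^esub>) \<and> finite {x. f x \<noteq> \<zero>\<^bsub>K\<^esub>}}
       (\<lambda>x. \<zero>\<^bsub>K\<^esub>) (\<lambda>f g x. f x \<oplus>\<^bsub>K\<^esub> g x) (\<lambda>c f x. c \<otimes>\<^bsub>K\<^esub> f x)"

definition single :: "('k, 'q) ring_scheme \<Rightarrow> 'x \<Rightarrow> 'x \<Rightarrow> 'k" where
  "single K x = (\<lambda>y. if y = x then \<one>\<^bsub>K\<^esub> else \<zero>\<^bsub>K\<^esub>)"

definition span_rel :: "('k, 'q) ring_scheme \<Rightarrow> 'x set \<Rightarrow> ('x \<Rightarrow> 'k) set \<Rightarrow> ('x \<Rightarrow> 'k) set" where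
  "span_rel K X r = (\<lambda>N. submodule N K (free_module K X)) hull r"

definition presented_module ::
  "('k, 'q) ring_scheme \<Rightarrow> 'x set \<Rightarrow> ('x \<Rightarrow> 'k) set \<Rightarrow> ('k, ('x \<Rightarrow> 'k) set) module" where
  "presented_module K X r = quotient_module (free_module K X) (span_rel K X r)"

definition generator ::
  "('k, 'q) ring_scheme \<Rightarrow> 'x set \<Rightarrow> ('x \<Rightarrow> 'k) set \<Rightarrow> 'x \<Rightarrow> ('x \<Rightarrow> 'k) set" where
  "generator K X r x = span_rel K X r +>\<^bsub>free_module K X\<^esub> single K x"

text \<open>The value at \<open>t\<close> of the linear map to \<open>U\<close> that sends the generator of index \<open>x\<close> to \<open>\<beta> x\<close>.
  It is meaningful when \<open>\<beta>\<close> respects the relations (for tensor products: when \<open>\<beta>\<close> is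
  multilinear), as then all formal sums in the class \<open>t\<close> evaluate to the same vector.\<close>

definition lift ::
  "('k, 'q) ring_scheme \<Rightarrow> ('k, 'u, 's) module_scheme \<Rightarrow> ('x \<Rightarrow> 'u) \<Rightarrow> ('x \<Rightarrow> 'k) set \<Rightarrow> 'u" where
  "lift K U \<beta> t =
     the_elem ((\<lambda>f. \<Oplus>\<^bsub>U\<^esub>x\<in>{x. f x \<noteq> \<zero>\<^bsub>K\<^esub>}. f x \<odot>\<^bsub>U\<^esub> \<beta> x) ` t)"


section \<open>Tensor products and tensor powers of vector spaces\<close>

definition tensor_rel ::
  "('k, 'q) ring_scheme \<Rightarrow> ('k, 'v, 'p) module_scheme \<Rightarrow> ('k, 'w, 's) module_scheme \<Rightarrow>
   ('v \<times> 'w \<Rightarrow> 'k) set" where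
  "tensor_rel K V W =
    (let F = free_module K (carrier V \<times> carrier W); e = single K in
      {e (v \<oplus>\<^bsub>V\<^esub> v', w) \<ominus>\<^bsub>F\<^esub> (e (v, w) \<oplus>\<^bsub>F\<^esub> e (v', w)) | v v' w.
         v \<in> carrier V \<and> v' \<in> carrier V \<and> w \<in> carrier W} \<union>
      {e (v, w \<oplus>\<^bsub>W\<^esub> w') \<ominus>\<^bsub>F\<^esub> (e (v, w) \<oplus>\<^bsub>F\<^esub> e (v, w')) | v w w'.
         v \<in> carrier V \<and> w \<in> carrier W \<and> w' \<in> carrier W} \<union>
      {e (c \<odot>\<^bsub>V\<^esub> v, w) \<ominus>\<^bsub>F\<^esub> (c \<odot>\<^bsub>F\<^esub> e (v, w)) | c v w.
         c \<in> carrier K \<and> v \<in> carrier V \<and> w \<in> carrier W} \<union>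
      {e (v, c \<odot>\<^bsub>W\<^esub> w) \<ominus>\<^bsub>F\<^esub> (c \<odot>\<^bsub>F\<^esub> e (v, w)) | c v w.
         c \<in> carrier K \<and> v \<in> carrier V \<and> w \<in> carrier W})"

definition tensor ::
  "('k, 'q) ring_scheme \<Rightarrow> ('k, 'v, 'p) module_scheme \<Rightarrow> ('k, 'w, 's) module_scheme \<Rightarrow>
   ('k, ('v \<times> 'w \<Rightarrow> 'k) set) module" where
  "tensor K V W = presented_module K (carrier V \<times> carrier W) (tensor_rel K V W)"

definition pure ::
  "('k, 'q) ring_scheme \<Rightarrow> ('k, 'v, 'p) module_scheme \<Rightarrow> ('k, 'w, 's) module_scheme \<Rightarrow>
   'v \<Rightarrow> 'w \<Rightarrow> ('v \<times> 'w \<Rightarrow> 'k) set" where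
  "pure K V W v w = generator K (carrier V \<times> carrier W) (tensor_rel K V W) (v, w)"

text \<open>The \<open>n\<close>-th tensor power is generated by the words of length \<open>n\<close> in \<open>V\<close>, modulo linearity in
  each letter.  For \<open>n = 0\<close> there is one generator, the empty word, and no relation.\<close>

definition words :: "('k, 'v, 'p) module_scheme \<Rightarrow> nat \<Rightarrow> 'v list set" where
  "words V n = {vs. length vs = n \<and> set vs \<subseteq> carrier V}"

definition power_rel ::
  "('k, 'q) ring_scheme \<Rightarrow> ('k, 'v, 'p) module_scheme \<Rightarrow> nat \<Rightarrow> ('v list \<Rightarrow> 'k) set" where
  "power_rel K V n =
    (let F = free_module K (words V n); e = single K in
      {e (us @ (v \<oplus>\<^bsub>V\<^esub> v') # ws) \<ominus>\<^bsub>F\<^esub> (e (us @ v # ws) \<oplus>\<^bsub>F\<^esub> e (us @ v' # ws)) | us v v' ws.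
         us @ v # ws \<in> words V n \<and> v' \<in> carrier V} \<union>
      {e (us @ (c \<odot>\<^bsub>V\<^esub> v) # ws) \<ominus>\<^bsub>F\<^esub> (c \<odot>\<^bsub>F\<^esub> e (us @ v # ws)) | us c v ws.
         us @ v # ws \<in> words V n \<and> c \<in> carrier K})"

definition tensor_power ::
  "('k, 'q) ring_scheme \<Rightarrow> ('k, 'v, 'p) module_scheme \<Rightarrow> nat \<Rightarrow> ('k, ('v list \<Rightarrow> 'k) set) module" where
  "tensor_power K V n = presented_module K (words V n) (power_rel K V n)"

definition pure_word ::
  "('k, 'q) ring_scheme \<Rightarrow> ('k, 'v, 'p) module_scheme \<Rightarrow> 'v list \<Rightarrow> ('v list \<Rightarrow> 'k) set" where
  "pure_word K V vs =
     generator K (words V (length vs)) (power_rel K V (length vs)) vs"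

text \<open>\<open>tensor_cons K V n v\<close> is the map \<open>t \<mapsto> v \<otimes> t\<close> from the \<open>n\<close>-th to the \<open>(n+1)\<close>-st tensor power.\<close>

definition tensor_cons ::
  "('k, 'q) ring_scheme \<Rightarrow> ('k, 'v, 'p) module_scheme \<Rightarrow> nat \<Rightarrow> 'v \<Rightarrow>
   ('v list \<Rightarrow> 'k) set \<Rightarrow> ('v list \<Rightarrow> 'k) set" where
  "tensor_cons K V n v t =
     lift K (tensor_power K V (Suc n)) (\<lambda>vs. pure_word K V (v # vs)) t"


section \<open>Hopf algebras\<close>

text \<open>\<open>sweedler K \<Delta> U \<beta> a\<close> is the element \<open>\<beta>(a\<^sub>1, a\<^sub>2)\<close> of \<open>U\<close> in Sweedler notation.\<close>

definition sweedler ::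
  "('k, 'q) ring_scheme \<Rightarrow> ('a \<Rightarrow> ('a \<times> 'a \<Rightarrow> 'k) set) \<Rightarrow> ('k, 'u, 's) module_scheme \<Rightarrow>
   ('a \<Rightarrow> 'a \<Rightarrow> 'u) \<Rightarrow> 'a \<Rightarrow> 'u" where
  "sweedler K \<Delta> U \<beta> a = lift K U (\<lambda>(x, y). \<beta> x y) (\<Delta> a)"

text \<open>The library locale \<^locale>\<open>algebra\<close> covers commutative algebras only.\<close>

locale k_algebra = K?: field K + A?: ring A + V?: module K A
  for K :: "('k, 'q) ring_scheme" (structure) and A :: "('k, 'a, 'p) module_scheme" (structure) +
  assumes smult_mult_left:
      "\<lbrakk>c \<in> carrier K; x \<in> carrier A; y \<in> carrier A\<rbrakk> \<Longrightarrow>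
        (c \<odot>\<^bsub>A\<^esub> x) \<otimes>\<^bsub>A\<^esub> y = c \<odot>\<^bsub>A\<^esub> (x \<otimes>\<^bsub>A\<^esub> y)"
    and smult_mult_right:
      "\<lbrakk>c \<in> carrier K; x \<in> carrier A; y \<in> carrier A\<rbrakk> \<Longrightarrow>
        x \<otimes>\<^bsub>A\<^esub> (c \<odot>\<^bsub>A\<^esub> y) = c \<odot>\<^bsub>A\<^esub> (x \<otimes>\<^bsub>A\<^esub> y)"

locale hopf_algebra = k_algebra K A
  for K :: "('k, 'q) ring_scheme" and A :: "('k, 'a, 'p) module_scheme" +
  fixes \<Delta> :: "'a \<Rightarrow> ('a \<times> 'a \<Rightarrow> 'k) set" and \<epsilon> :: "'a \<Rightarrow> 'k" and S :: "'a \<Rightarrow> 'a"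
  assumes comult_linear: "\<Delta> \<in> module_hom K A (tensor K A A)"
    and comult_one: "\<Delta> \<one>\<^bsub>A\<^esub> = pure K A A \<one>\<^bsub>A\<^esub> \<one>\<^bsub>A\<^esub>"
    and comult_mult:
      "\<lbrakk>a \<in> carrier A; b \<in> carrier A\<rbrakk> \<Longrightarrow>
        \<Delta> (a \<otimes>\<^bsub>A\<^esub> b) =
          sweedler K \<Delta> (tensor K A A)
            (\<lambda>a1 a2. sweedler K \<Delta> (tensor K A A)
               (\<lambda>b1 b2. pure K A A (a1 \<otimes>\<^bsub>A\<^esub> b1) (a2 \<otimes>\<^bsub>A\<^esub> b2)) b) a"
    and counit_ring_hom: "\<epsilon> \<in> ring_hom A K"
    and counit_smult:
      "\<lbrakk>c \<in> carrier K; a \<in> carrier A\<rbrakk> \<Longrightarrow> \<epsilon> (c \<odot>\<^bsub>A\<^esub> a) = c \<otimes>\<^bsub>K\<^esub> \<epsilon> a"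
    and coassoc:
      "a \<in> carrier A \<Longrightarrow>
        sweedler K \<Delta> (tensor K A (tensor K A A))
          (\<lambda>a1 a2. sweedler K \<Delta> (tensor K A (tensor K A A))
             (\<lambda>x y. pure K A (tensor K A A) x (pure K A A y a2)) a1) a =
        sweedler K \<Delta> (tensor K A (tensor K A A))
          (\<lambda>a1 a2. pure K A (tensor K A A) a1 (\<Delta> a2)) a"
    and counit_left: "a \<in> carrier A \<Longrightarrow> sweedler K \<Delta> A (\<lambda>a1 a2. \<epsilon> a1 \<odot>\<^bsub>A\<^esub> a2) a = a"
    and counit_right: "a \<in> carrier A \<Longrightarrow> sweedler K \<Delta> A (\<lambda>a1 a2. \<epsilon> a2 \<odot>\<^bsub>A\<^esub> a1) a = a"
    and antipode_linear: "S \<in> module_hom K A A"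
    and antipode_left:
      "a \<in> carrier A \<Longrightarrow> sweedler K \<Delta> A (\<lambda>a1 a2. S a1 \<otimes>\<^bsub>A\<^esub> a2) a = \<epsilon> a \<odot>\<^bsub>A\<^esub> \<one>\<^bsub>A\<^esub>"
    and antipode_right:
      "a \<in> carrier A \<Longrightarrow> sweedler K \<Delta> A (\<lambda>a1 a2. a1 \<otimes>\<^bsub>A\<^esub> S a2) a = \<epsilon> a \<odot>\<^bsub>A\<^esub> \<one>\<^bsub>A\<^esub>"


section \<open>Modules over a Hopf algebra\<close>

text \<open>The vector space underlying an \<open>A\<close>-module: \<open>K\<close> acts through the unit map
  \<open>c \<mapsto> c \<odot> \<one>\<close> of \<open>A\<close>.\<close>

definition underlying_space ::
  "('k, 'a, 'p) module_scheme \<Rightarrow> ('a, 'm, 's) module_scheme \<Rightarrow> ('k, 'm) module" where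
  "underlying_space A M =
     mk_module (carrier M) \<zero>\<^bsub>M\<^esub> (add M) (\<lambda>c m. (c \<odot>\<^bsub>A\<^esub> \<one>\<^bsub>A\<^esub>) \<odot>\<^bsub>M\<^esub> m)"

text \<open>The diagonal action on words: \<open>a\<close> acts on the empty word by \<open>\<epsilon>(a)\<close>, and
  \<open>a \<cdot> (m \<otimes> t) = a\<^sub>1 m \<otimes> a\<^sub>2 \<cdot> t\<close>.\<close>

fun word_act ::
  "('k, 'q) ring_scheme \<Rightarrow> ('k, 'a, 'p) module_scheme \<Rightarrow> ('a \<Rightarrow> ('a \<times> 'a \<Rightarrow> 'k) set) \<Rightarrow> ('a \<Rightarrow> 'k) \<Rightarrow>
   ('a, 'm, 's) module_scheme \<Rightarrow> 'a \<Rightarrow> 'm list \<Rightarrow> ('m list \<Rightarrow> 'k) set" where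
  "word_act K A \<Delta> \<epsilon> M a [] =
     (let V = underlying_space A M in \<epsilon> a \<odot>\<^bsub>tensor_power K V 0\<^esub> pure_word K V [])"
| "word_act K A \<Delta> \<epsilon> M a (m # ms) =
     (let V = underlying_space A M; n = length ms in
       sweedler K \<Delta> (tensor_power K V (Suc n))
         (\<lambda>a1 a2. tensor_cons K V n (a1 \<odot>\<^bsub>M\<^esub> m) (word_act K A \<Delta> \<epsilon> M a2 ms)) a)"

definition tensor_power_module ::
  "('k, 'q) ring_scheme \<Rightarrow> ('k, 'a, 'p) module_scheme \<Rightarrow> ('a \<Rightarrow> ('a \<times> 'a \<Rightarrow> 'k) set) \<Rightarrow> ('a \<Rightarrow> 'k) \<Rightarrow>
   ('a, 'm, 's) module_scheme \<Rightarrow> nat \<Rightarrow> ('a, ('m list \<Rightarrow> 'k) set) module" where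
  "tensor_power_module K A \<Delta> \<epsilon> M n =
     (let T = tensor_power K (underlying_space A M) n in
       mk_module (carrier T) \<zero>\<^bsub>T\<^esub> (add T) (\<lambda>a. lift K T (word_act K A \<Delta> \<epsilon> M a)))"

definition left_kernel ::
  "('k, 'q) ring_scheme \<Rightarrow> ('k, 'a, 'p) module_scheme \<Rightarrow> ('a \<Rightarrow> ('a \<times> 'a \<Rightarrow> 'k) set) \<Rightarrow>
   ('a, 'm, 's) module_scheme \<Rightarrow> 'a set" where
  "left_kernel K A \<Delta> M =
     (let V = underlying_space A M in
       {a \<in> carrier A. \<forall>m\<in>carrier M.
          sweedler K \<Delta> (tensor K A V) (\<lambda>a1 a2. pure K A V a1 (a2 \<odot>\<^bsub>M\<^esub> m)) a = pure K A V a m})"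

definition augmentation_part ::
  "('k, 'q) ring_scheme \<Rightarrow> ('a \<Rightarrow> 'k) \<Rightarrow> 'a set \<Rightarrow> 'a set" where
  "augmentation_part K \<epsilon> L = {l \<in> L. \<epsilon> l = \<zero>\<^bsub>K\<^esub>}"

text \<open>\<^const>\<open>ideal_prod\<close> makes sense for arbitrary subsets: it is the set of all finite nonempty sums
  of products.\<close>

definition hopf_ideal_of ::
  "('k, 'q) ring_scheme \<Rightarrow> ('k, 'a, 'p) module_scheme \<Rightarrow> ('a \<Rightarrow> 'k) \<Rightarrow> 'a set \<Rightarrow> 'a set" where
  "hopf_ideal_of K A \<epsilon> L = carrier A \<cdot>\<^bsub>A\<^esub> augmentation_part K \<epsilon> L"

text \<open>Only the ring structure of \<open>A//L\<close> is recorded, as this determines its modules.\<close>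

definition hopf_quotient ::
  "('k, 'q) ring_scheme \<Rightarrow> ('k, 'a, 'p) module_scheme \<Rightarrow> ('a \<Rightarrow> 'k) \<Rightarrow> 'a set \<Rightarrow> 'a set ring" where
  "hopf_quotient K A \<epsilon> L = A Quot hopf_ideal_of K A \<epsilon> L"

end

theory Submission
  imports Defs
begin

text \<open>Let \<open>C\<close> be the space of matrix coefficients of all tensor powers \<open>M\<^sup>\<otimes>\<^sup>n\<close>, a space of linear functions on
\<open>A\<close>, and let \<open>J\<close> be the ideal of the elements of \<open>A\<close> on which all of \<open>C\<close> vanishes, that is, of those
that act as zero on all tensor powers.  A simple module \<open>V\<close> is isomorphic to a left ideal \<open>A e\<close> with \<open>e\<close>
idempotent.  If \<open>J\<close> annihilates \<open>V\<close> then \<open>e\<close> is not in \<open>J\<close>, so \<open>e\<close> moves some vector \<open>t\<close> of a tensor power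
to a nonzero vector, and \<open>V\<close> embeds into this tensor power by \<open>a e \<mapsto> a e t\<close>
(\<open>annihilated_imp_constituent\<close>).  Since \<open>A//L\<close>-modules are the \<open>A\<close>-modules annihilated by \<open>A L\<^sup>+\<close>, it
remains to show that \<open>J = A L\<^sup>+\<close> (\<open>hopf_ideal_eq_Ann\<close>).

The property \<open>l\<^sub>1 \<otimes> l\<^sub>2 m = l \<otimes> m\<close> that defines \<open>L\<close> passes from \<open>M\<close> to its tensor powers
(\<open>left_kernel_wact\<close>), and applying the counit to the first factor shows that \<open>L\<^sup>+\<close> lies in \<open>J\<close>.

For the converse, \<open>C\<close> is finite-dimensional: the annihilators of the coefficients of the first \<open>n\<close> tensor
powers form a descending chain of ideals, which is stationary as each of them is generated by a central
idempotent (\<open>Coefs_separating\<close>).  Being closed under convolution products and translations, \<open>C\<close> is a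
finite-dimensional bialgebra of functions, and such a space is stable under the antipode by a dimension
argument (\<open>antipode_C\<close>).  The algebra \<open>A\<close> has a two-sided integral \<open>\<Lambda>\<close> with \<open>\<epsilon>(\<Lambda>) = 1\<close>, the complement of
the unit of the augmentation ideal (\<open>ex_integral\<close>).  The pairing \<open>d(\<Lambda>\<^sub>1) c(\<Lambda>\<^sub>2)\<close> on \<open>C\<close> is nondegenerate,
so some \<open>t\<close> in \<open>C\<close> represents evaluation at the unit; it satisfies \<open>c * t = c(1) t\<close> for \<open>c\<close> in \<open>C\<close> and
\<open>t(\<Lambda>) = 1\<close> (\<open>ex_function_integral\<close>).  With \<open>tr(x) = x\<^sub>1 t(x\<^sub>2)\<close> one has

  \<open>S(\<Lambda>\<^sub>1) tr(\<Lambda>\<^sub>2 a) = S(\<Lambda>\<^sub>1) \<Lambda>\<^sub>2 a\<^sub>1 t(\<Lambda>\<^sub>3 a\<^sub>2) = a\<^sub>1 t(\<Lambda> a\<^sub>2) = a\<close>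

for all \<open>a\<close> (\<open>trace_formula\<close>).  All traces lie in \<open>L\<close> because of \<open>c * t = c(1) t\<close>, and \<open>\<epsilon>(tr(x)) = t(x)\<close>
vanishes for \<open>x\<close> in \<open>J\<close>.  Hence every \<open>a\<close> in \<open>J\<close> is a sum of products of elements of \<open>A\<close> and of \<open>L\<^sup>+\<close>.\<close>

section \<open>Linear maps\<close>

lemma module_homI:
  assumes "\<And>v. v \<in> carrier V \<Longrightarrow> f v \<in> carrier W"
    and "\<And>u v. u \<in> carrier V \<Longrightarrow> v \<in> carrier V \<Longrightarrow> f (u \<oplus>\<^bsub>V\<^esub> v) = f u \<oplus>\<^bsub>W\<^esub> f v"
    and "\<And>r v. r \<in> carrier R \<Longrightarrow> v \<in> carrier V \<Longrightarrow> f (r \<odot>\<^bsub>V\<^esub> v) = r \<odot>\<^bsub>W\<^esub> f v"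
  shows "f \<in> module_hom R V W"
  using assms unfolding module_hom_def hom_def by auto

lemma module_homD:
  assumes "f \<in> module_hom R V W"
  shows module_hom_closed: "v \<in> carrier V \<Longrightarrow> f v \<in> carrier W"
    and module_hom_add: "u \<in> carrier V \<Longrightarrow> v \<in> carrier V \<Longrightarrow> f (u \<oplus>\<^bsub>V\<^esub> v) = f u \<oplus>\<^bsub>W\<^esub> f v"
    and module_hom_smult: "r \<in> carrier R \<Longrightarrow> v \<in> carrier V \<Longrightarrow> f (r \<odot>\<^bsub>V\<^esub> v) = r \<odot>\<^bsub>W\<^esub> f v"
  using assms unfolding module_hom_def hom_def by auto

lemma module_hom_zero:
  assumes "f \<in> module_hom R V W" "abelian_group V" "abelian_group W"
  shows "f \<zero>\<^bsub>V\<^esub> = \<zero>\<^bsub>W\<^esub>"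
proof -
  interpret V: abelian_group V by fact
  interpret W: abelian_group W by fact
  have "f \<zero>\<^bsub>V\<^esub> \<oplus>\<^bsub>W\<^esub> f \<zero>\<^bsub>V\<^esub> = f \<zero>\<^bsub>V\<^esub> \<oplus>\<^bsub>W\<^esub> \<zero>\<^bsub>W\<^esub>"
    using module_hom_add[OF assms(1), of "\<zero>\<^bsub>V\<^esub>" "\<zero>\<^bsub>V\<^esub>"] module_hom_closed[OF assms(1)] by simp
  then show ?thesis
    using module_hom_closed[OF assms(1)] by simp
qed

lemma module_hom_finsum:
  assumes f: "f \<in> module_hom R V W" and V: "abelian_group V" and W: "abelian_group W"
    and g: "g \<in> I \<rightarrow> carrier V" and fin: "finite I"
  shows "f (\<Oplus>\<^bsub>V\<^esub>i\<in>I. g i) = (\<Oplus>\<^bsub>W\<^esub>i\<in>I. f (g i))"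
proof -
  interpret V: abelian_group V by fact
  interpret W: abelian_group W by fact
  show ?thesis using fin g
  proof (induction rule: finite_induct)
    case empty then show ?case using module_hom_zero[OF f V W] by simp
  next
    case (insert x F)
    have "(\<lambda>i. f (g i)) \<in> F \<rightarrow> carrier W"
      using insert.prems module_hom_closed[OF f] by blast
    then show ?case
      using insert module_hom_closed[OF f] module_hom_add[OF f]
      by (simp add: Pi_def V.finsum_closed)
  qed
qed

lemma module_hom_minus:
  assumes f: "f \<in> module_hom R V W" and V: "abelian_group V" and W: "abelian_group W"
    and v: "v \<in> carrier V"
  shows "f (\<ominus>\<^bsub>V\<^esub> v) = \<ominus>\<^bsub>W\<^esub> f v"
proof -
  interpret V: abelian_group V by fact
  interpret W: abelian_group W by fact
  have "f (\<ominus>\<^bsub>V\<^esub> v) \<oplus>\<^bsub>W\<^esub> f v = \<zero>\<^bsub>W\<^esub>"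
    using module_hom_add[OF f, of "\<ominus>\<^bsub>V\<^esub> v" v] v module_hom_zero[OF f V W] by (simp add: V.l_neg)
  then show ?thesis
    using v module_hom_closed[OF f] W.minus_equality V.a_inv_closed by metis
qed

lemma module_hom_ident: "(\<lambda>x. x) \<in> module_hom R V V"
  by (rule module_homI) auto

lemma module_hom_comp:
  assumes "g \<in> module_hom R W U" "f \<in> module_hom R V W"
  shows "(\<lambda>x. g (f x)) \<in> module_hom R V U"
  using assms by (intro module_homI) (simp_all add: module_homD[OF assms(1)] module_homD[OF assms(2)])

lemma module_hom_cong:
  assumes "g \<in> module_hom R V U" "\<And>x. x \<in> carrier V \<Longrightarrow> f x = g x" "abelian_group V"
    "\<And>r x. r \<in> carrier R \<Longrightarrow> x \<in> carrier V \<Longrightarrow> r \<odot>\<^bsub>V\<^esub> x \<in> carrier V"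
  shows "f \<in> module_hom R V U"
proof -
  interpret V: abelian_group V by fact
  show ?thesis using assms(2,4) by (intro module_homI) (simp_all add: module_homD[OF assms(1)])
qed

lemma (in module) module_hom_addf:
  assumes "f \<in> module_hom R V M" "g \<in> module_hom R V M"
  shows "(\<lambda>x. f x \<oplus>\<^bsub>M\<^esub> g x) \<in> module_hom R V M"
  by (rule module_homI) (simp_all add: module_homD[OF assms(1)] module_homD[OF assms(2)]
      M.add.m_ac smult_r_distr)

lemma (in module) module_hom_zerof: "(\<lambda>x. \<zero>\<^bsub>M\<^esub>) \<in> module_hom R V M"
  by (rule module_homI) simp_all

lemma (in module) module_hom_smultf:
  assumes "f \<in> module_hom R V M" "c \<in> carrier R"
  shows "(\<lambda>x. c \<odot>\<^bsub>M\<^esub> f x) \<in> module_hom R V M"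
  using assms(2) by (intro module_homI) (simp_all add: module_homD[OF assms(1)]
      smult_r_distr smult_assoc1[symmetric] R.m_comm)

lemma (in module) module_hom_finsumf:
  assumes "finite I" "\<And>i. i \<in> I \<Longrightarrow> f i \<in> module_hom R V M"
  shows "(\<lambda>x. \<Oplus>\<^bsub>M\<^esub>i\<in>I. f i x) \<in> module_hom R V M"
proof (rule module_homI)
  show "(\<Oplus>\<^bsub>M\<^esub>i\<in>I. f i v) \<in> carrier M" if "v \<in> carrier V" for v
    using that module_hom_closed[OF assms(2)] by (intro M.finsum_closed) auto
  show "(\<Oplus>\<^bsub>M\<^esub>i\<in>I. f i (u \<oplus>\<^bsub>V\<^esub> v)) = (\<Oplus>\<^bsub>M\<^esub>i\<in>I. f i u) \<oplus>\<^bsub>M\<^esub> (\<Oplus>\<^bsub>M\<^esub>i\<in>I. f i v)"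
    if uv: "u \<in> carrier V" "v \<in> carrier V" for u v
  proof -
    have "(\<Oplus>\<^bsub>M\<^esub>i\<in>I. f i (u \<oplus>\<^bsub>V\<^esub> v)) = (\<Oplus>\<^bsub>M\<^esub>i\<in>I. f i u \<oplus>\<^bsub>M\<^esub> f i v)"
      using uv module_homD[OF assms(2)] by (intro M.finsum_cong') auto
    also have "\<dots> = (\<Oplus>\<^bsub>M\<^esub>i\<in>I. f i u) \<oplus>\<^bsub>M\<^esub> (\<Oplus>\<^bsub>M\<^esub>i\<in>I. f i v)"
      using uv module_hom_closed[OF assms(2)] by (intro M.finsum_addf) auto
    finally show ?thesis .
  qed
  show "(\<Oplus>\<^bsub>M\<^esub>i\<in>I. f i (r \<odot>\<^bsub>V\<^esub> v)) = r \<odot>\<^bsub>M\<^esub> (\<Oplus>\<^bsub>M\<^esub>i\<in>I. f i v)"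
    if rv: "r \<in> carrier R" "v \<in> carrier V" for r v
  proof -
    have "(\<Oplus>\<^bsub>M\<^esub>i\<in>I. f i (r \<odot>\<^bsub>V\<^esub> v)) = (\<Oplus>\<^bsub>M\<^esub>i\<in>I. r \<odot>\<^bsub>M\<^esub> f i v)"
      using rv module_homD[OF assms(2)] by (intro M.finsum_cong') auto
    also have "\<dots> = r \<odot>\<^bsub>M\<^esub> (\<Oplus>\<^bsub>M\<^esub>i\<in>I. f i v)"
      using rv module_hom_closed[OF assms(2)] assms(1)
      by (intro finsum_smult_ldistr[symmetric]) auto
    finally show ?thesis .
  qed
qed

section \<open>Presented modules and their universal property\<close>

lemma mk_module_simps [simp]:
  "carrier (mk_module V z p s) = V" "zero (mk_module V z p s) = z"
  "add (mk_module V z p s) = p" "smult (mk_module V z p s) = s"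
  by (simp_all add: mk_module_def)

context module begin

lemma submodule_abelian_subgroup:
  assumes "submodule N R M" shows "abelian_subgroup N M"
  using assms M.abelian_group_axioms
  by (intro abelian_subgroupI3 additive_subgroupI) (auto simp: submodule_def)

lemma quotient_module_ops:
  assumes N: "submodule N R M" and v: "v \<in> carrier M"
  shows "w \<in> carrier M \<Longrightarrow>
      (N +>\<^bsub>M\<^esub> v) \<oplus>\<^bsub>quotient_module M N\<^esub> (N +>\<^bsub>M\<^esub> w) = N +>\<^bsub>M\<^esub> (v \<oplus>\<^bsub>M\<^esub> w)"
    and "c \<in> carrier R \<Longrightarrow> c \<odot>\<^bsub>quotient_module M N\<^esub> (N +>\<^bsub>M\<^esub> v) = N +>\<^bsub>M\<^esub> (c \<odot>\<^bsub>M\<^esub> v)"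
proof -
  interpret N: abelian_subgroup N M using N by (rule submodule_abelian_subgroup)
  show "w \<in> carrier M \<Longrightarrow>
      (N +>\<^bsub>M\<^esub> v) \<oplus>\<^bsub>quotient_module M N\<^esub> (N +>\<^bsub>M\<^esub> w) = N +>\<^bsub>M\<^esub> (v \<oplus>\<^bsub>M\<^esub> w)"
    using v by (simp add: quotient_module_def N.a_rcos_sum)
  assume c: "c \<in> carrier R"
  have *: "N +>\<^bsub>M\<^esub> (c \<odot>\<^bsub>M\<^esub> v') = N +>\<^bsub>M\<^esub> (c \<odot>\<^bsub>M\<^esub> v)" if v': "v' \<in> N +>\<^bsub>M\<^esub> v" for v'
  proof -
    have c': "v' \<in> carrier M" using N.a_elemrcos_carrier[OF v v'] .
    have "v' \<oplus>\<^bsub>M\<^esub> \<ominus>\<^bsub>M\<^esub> v \<in> N" using N.a_rcos_module_imp[OF v v'] .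
    then have "c \<odot>\<^bsub>M\<^esub> (v' \<oplus>\<^bsub>M\<^esub> \<ominus>\<^bsub>M\<^esub> v) \<in> N"
      using c submodule.smult_closed[OF N] by blast
    then have "c \<odot>\<^bsub>M\<^esub> v' \<oplus>\<^bsub>M\<^esub> \<ominus>\<^bsub>M\<^esub> (c \<odot>\<^bsub>M\<^esub> v) \<in> N"
      using c c' v by (simp add: smult_r_distr smult_r_minus)
    then show ?thesis
      using c c' v N.a_repr_independence'[OF N.a_rcos_module_rev, of "c \<odot>\<^bsub>M\<^esub> v" "c \<odot>\<^bsub>M\<^esub> v'"] by simp
  qed
  have "(\<Union>v'\<in>N +>\<^bsub>M\<^esub> v. N +>\<^bsub>M\<^esub> (c \<odot>\<^bsub>M\<^esub> v')) = (\<Union>v'\<in>N +>\<^bsub>M\<^esub> v. N +>\<^bsub>M\<^esub> (c \<odot>\<^bsub>M\<^esub> v))"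
    by (rule SUP_cong[OF refl *])
  also have "\<dots> = N +>\<^bsub>M\<^esub> (c \<odot>\<^bsub>M\<^esub> v)" by (rule UN_constant_eq[OF N.a_rcos_self[OF v]]) simp
  finally show "c \<odot>\<^bsub>quotient_module M N\<^esub> (N +>\<^bsub>M\<^esub> v) = N +>\<^bsub>M\<^esub> (c \<odot>\<^bsub>M\<^esub> v)"
    by (simp add: quotient_module_def)
qed

lemma quotient_module_carrier:
  "carrier (quotient_module M N) = (\<lambda>v. N +>\<^bsub>M\<^esub> v) ` carrier M"
  by (auto simp: quotient_module_def A_RCOSETS_def' a_r_coset_def')

lemma quotient_module_module:
  assumes N: "submodule N R M"
  shows "module R (quotient_module M N)" (is "module R ?Q")
proof -
  interpret N: abelian_subgroup N M using N by (rule submodule_abelian_subgroup)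
  note ops = quotient_module_ops[OF N] and car = quotient_module_carrier[of N]
  have z: "\<zero>\<^bsub>?Q\<^esub> = N +>\<^bsub>M\<^esub> \<zero>\<^bsub>M\<^esub>"
    using N.a_subset by (simp add: quotient_module_def)
  show ?thesis
  proof (rule moduleI)
    show "cring R" ..
    show "abelian_group ?Q"
    proof (rule abelian_groupI)
      show "\<exists>y\<in>carrier ?Q. y \<oplus>\<^bsub>?Q\<^esub> x = \<zero>\<^bsub>?Q\<^esub>" if "x \<in> carrier ?Q" for x
      proof -
        from that[unfolded car] obtain v where v: "x = N +>\<^bsub>M\<^esub> v" "v \<in> carrier M" by (rule imageE)
        then have "(N +>\<^bsub>M\<^esub> (\<ominus>\<^bsub>M\<^esub> v)) \<oplus>\<^bsub>?Q\<^esub> x = \<zero>\<^bsub>?Q\<^esub>"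
          by (simp add: ops(1) z M.l_neg)
        then show ?thesis using v car by auto
      qed
    qed (auto simp: car ops z M.a_assoc, simp_all add: M.a_comm)
  qed (auto simp: car ops smult_l_distr smult_r_distr smult_assoc1)
qed

lemma quotient_module_proj:
  assumes N: "submodule N R M"
  shows "(\<lambda>v. N +>\<^bsub>M\<^esub> v) \<in> module_hom R M (quotient_module M N)"
  using quotient_module_ops[OF N] by (intro module_homI) (auto simp: quotient_module_carrier)

lemma submodule_kernel:
  assumes f: "f \<in> module_hom R M W" and W: "module R W"
  shows "submodule {v \<in> carrier M. f v = \<zero>\<^bsub>W\<^esub>} R M"
proof -
  interpret W: module R W by fact
  show ?thesis
    using module_hom_zero[OF f M.abelian_group_axioms W.M.abelian_group_axioms]
      module_hom_minus[OF f M.abelian_group_axioms W.M.abelian_group_axioms]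
    by (intro submoduleI) (auto simp: module_hom_add[OF f] module_hom_smult[OF f])
qed

end

abbreviation evaluation :: "('k, 'q) ring_scheme \<Rightarrow> ('k, 'u, 's) module_scheme \<Rightarrow> ('x \<Rightarrow> 'u) \<Rightarrow> ('x \<Rightarrow> 'k) \<Rightarrow> 'u"
  where "evaluation K U \<beta> f \<equiv> (\<Oplus>\<^bsub>U\<^esub>x\<in>{x. f x \<noteq> \<zero>\<^bsub>K\<^esub>}. f x \<odot>\<^bsub>U\<^esub> \<beta> x)"

context cring begin

lemma free_module_carrier:
  "f \<in> carrier (free_module R X) \<longleftrightarrow>
    (\<forall>x. f x \<in> carrier R) \<and> (\<forall>x. x \<notin> X \<longrightarrow> f x = \<zero>) \<and> finite {x. f x \<noteq> \<zero>}"
  by (simp add: free_module_def)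

lemma free_moduleD:
  assumes "f \<in> carrier (free_module R X)"
  shows "f x \<in> carrier R" "f x \<noteq> \<zero> \<Longrightarrow> x \<in> X" "finite {x. f x \<noteq> \<zero>}"
  using assms by (auto simp: free_module_carrier)

lemma free_module_ops [simp]:
  "\<zero>\<^bsub>free_module R X\<^esub> = (\<lambda>x. \<zero>)"
  "f \<oplus>\<^bsub>free_module R X\<^esub> g = (\<lambda>x. f x \<oplus> g x)"
  "c \<odot>\<^bsub>free_module R X\<^esub> f = (\<lambda>x. c \<otimes> f x)"
  by (simp_all add: free_module_def)

lemma free_module_module: "module R (free_module R X)"
proof (rule moduleI)
  show "cring R" ..
  have fin: "finite {x. f x \<oplus> g x \<noteq> \<zero>}" if "finite {x. f x \<noteq> \<zero>}" "finite {x. g x \<noteq> \<zero>}" for f g :: "_ \<Rightarrow> 'a"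
    by (rule finite_subset[OF _ finite_UnI[OF that]]) auto
  show "abelian_group (free_module R X)"
  proof (rule abelian_groupI)
    show "\<exists>y\<in>carrier (free_module R X). y \<oplus>\<^bsub>free_module R X\<^esub> x = \<zero>\<^bsub>free_module R X\<^esub>"
      if "x \<in> carrier (free_module R X)" for x
    proof (rule bexI[of _ "\<lambda>y. \<ominus> x y"])
      have "{y. \<ominus> x y \<noteq> \<zero>} \<subseteq> {y. x y \<noteq> \<zero>}" by auto
      then show "(\<lambda>y. \<ominus> x y) \<in> carrier (free_module R X)"
        using that by (auto simp: free_module_carrier intro: finite_subset)
    qed (use that in \<open>auto simp: free_module_carrier l_neg\<close>)
  qed (auto simp: free_module_carrier fin a_ac)
  show "a \<odot>\<^bsub>free_module R X\<^esub> x \<in> carrier (free_module R X)"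
    if "a \<in> carrier R" "x \<in> carrier (free_module R X)" for a x
  proof -
    have "{y. a \<otimes> x y \<noteq> \<zero>} \<subseteq> {y. x y \<noteq> \<zero>}" using that by auto
    then show ?thesis using that by (auto simp: free_module_carrier intro: finite_subset)
  qed
qed (auto simp: free_module_carrier l_distr r_distr m_assoc)

lemma single_closed: "x \<in> X \<Longrightarrow> single R x \<in> carrier (free_module R X)"
proof -
  assume "x \<in> X"
  moreover have "{y. single R x y \<noteq> \<zero>} \<subseteq> {x}" by (auto simp: single_def)
  ultimately show ?thesis by (auto simp: free_module_carrier single_def intro: finite_subset)
qed

lemma evaluation_superset:
  assumes U: "module R U" and b: "\<beta> \<in> X \<rightarrow> carrier U"
    and f: "f \<in> carrier (free_module R X)" and I: "finite I" "{x. f x \<noteq> \<zero>} \<subseteq> I" "I \<subseteq> X"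
  shows "evaluation R U \<beta> f = (\<Oplus>\<^bsub>U\<^esub>x\<in>I. f x \<odot>\<^bsub>U\<^esub> \<beta> x)"
proof -
  interpret U: module R U by fact
  show ?thesis
    using I b f by (intro U.M.add.finprod_mono_neutral_cong_left) (auto simp: free_module_carrier Pi_def subset_eq)
qed

lemma evaluation_hom:
  assumes U: "module R U" and b: "\<beta> \<in> X \<rightarrow> carrier U"
  shows "evaluation R U \<beta> \<in> module_hom R (free_module R X) U"
proof -
  interpret U: module R U by fact
  interpret F: module R "free_module R X" by (rule free_module_module)
  note car = free_module_carrier[of _ X]
  show ?thesis
  proof (rule module_homI)
    show "evaluation R U \<beta> f \<in> carrier U" if "f \<in> carrier (free_module R X)" for f
      using that b by (intro U.M.finsum_closed) (auto simp: car)
  next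
    fix f g assume f: "f \<in> carrier (free_module R X)" and g: "g \<in> carrier (free_module R X)"
    define I where "I = {x. f x \<noteq> \<zero>} \<union> {x. g x \<noteq> \<zero>}"
    have I: "finite I" "I \<subseteq> X" using f g by (auto simp: car I_def)
    have fg: "f \<oplus>\<^bsub>free_module R X\<^esub> g \<in> carrier (free_module R X)" using f g by (rule F.M.a_closed)
    have "evaluation R U \<beta> (f \<oplus>\<^bsub>free_module R X\<^esub> g) = (\<Oplus>\<^bsub>U\<^esub>x\<in>I. (f x \<oplus> g x) \<odot>\<^bsub>U\<^esub> \<beta> x)"
      by (rule trans[OF evaluation_superset[OF U b fg I(1) _ I(2)]]) (use f g in \<open>auto simp: I_def car\<close>)
    also have "\<dots> = (\<Oplus>\<^bsub>U\<^esub>x\<in>I. f x \<odot>\<^bsub>U\<^esub> \<beta> x \<oplus>\<^bsub>U\<^esub> g x \<odot>\<^bsub>U\<^esub> \<beta> x)"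
      using I b f g by (intro U.M.finsum_cong') (auto simp: car Pi_def subset_eq U.smult_l_distr)
    also have "\<dots> = (\<Oplus>\<^bsub>U\<^esub>x\<in>I. f x \<odot>\<^bsub>U\<^esub> \<beta> x) \<oplus>\<^bsub>U\<^esub> (\<Oplus>\<^bsub>U\<^esub>x\<in>I. g x \<odot>\<^bsub>U\<^esub> \<beta> x)"
      using I b f g by (intro U.M.finsum_addf) (auto simp: car Pi_def subset_eq)
    also have "\<dots> = evaluation R U \<beta> f \<oplus>\<^bsub>U\<^esub> evaluation R U \<beta> g"
      using evaluation_superset[OF U b f I(1) _ I(2)] evaluation_superset[OF U b g I(1) _ I(2)]
      by (auto simp: I_def)
    finally show "evaluation R U \<beta> (f \<oplus>\<^bsub>free_module R X\<^esub> g) = evaluation R U \<beta> f \<oplus>\<^bsub>U\<^esub> evaluation R U \<beta> g" .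
  next
    fix c f assume c: "c \<in> carrier R" and f: "f \<in> carrier (free_module R X)"
    define I where "I = {x. f x \<noteq> \<zero>}"
    have I: "finite I" "I \<subseteq> X" using f by (auto simp: car I_def)
    have cf: "c \<odot>\<^bsub>free_module R X\<^esub> f \<in> carrier (free_module R X)" using c f by (rule F.smult_closed)
    have "evaluation R U \<beta> (c \<odot>\<^bsub>free_module R X\<^esub> f) = (\<Oplus>\<^bsub>U\<^esub>x\<in>I. (c \<otimes> f x) \<odot>\<^bsub>U\<^esub> \<beta> x)"
      by (rule trans[OF evaluation_superset[OF U b cf I(1) _ I(2)]]) (use c f in \<open>auto simp: I_def car\<close>)
    also have "\<dots> = (\<Oplus>\<^bsub>U\<^esub>x\<in>I. c \<odot>\<^bsub>U\<^esub> (f x \<odot>\<^bsub>U\<^esub> \<beta> x))"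
      using I b f c by (intro U.M.finsum_cong') (auto simp: car Pi_def subset_eq U.smult_assoc1)
    also have "\<dots> = c \<odot>\<^bsub>U\<^esub> evaluation R U \<beta> f"
      unfolding I_def[symmetric]
      using I b f c by (intro U.finsum_smult_ldistr[symmetric]) (auto simp: car Pi_def subset_eq)
    finally show "evaluation R U \<beta> (c \<odot>\<^bsub>free_module R X\<^esub> f) = c \<odot>\<^bsub>U\<^esub> evaluation R U \<beta> f" .
  qed
qed

lemma evaluation_single:
  assumes U: "module R U" and b: "\<beta> \<in> X \<rightarrow> carrier U" and x: "x \<in> X"
  shows "evaluation R U \<beta> (single R x) = \<beta> x"
proof -
  interpret U: module R U by fact
  have bx: "\<beta> x \<in> carrier U" using b x by auto
  have "evaluation R U \<beta> (single R x) = (\<Oplus>\<^bsub>U\<^esub>y\<in>{x}. single R x y \<odot>\<^bsub>U\<^esub> \<beta> y)"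
    by (rule evaluation_superset[OF U b single_closed[OF x]]) (use x in \<open>auto simp: single_def\<close>)
  also have "\<dots> = \<beta> x" using bx by (simp add: single_def)
  finally show ?thesis .
qed

text \<open>By induction on the support, with the value at each point followed separately.\<close>
lemma free_module_expand:
  assumes f: "f \<in> carrier (free_module R X)"
  shows "f = evaluation R (free_module R X) (single R) f"
proof -
  interpret F: module R "free_module R X" by (rule free_module_module)
  have *: "(\<Oplus>\<^bsub>free_module R X\<^esub>x\<in>I. f x \<odot>\<^bsub>free_module R X\<^esub> single R x) = (\<lambda>y. if y \<in> I then f y else \<zero>)"
    if "finite I" "I \<subseteq> X" for I
    using that
  proof (induction rule: finite_induct)
    case (insert x I)
    have "(\<lambda>x. f x \<odot>\<^bsub>free_module R X\<^esub> single R x) \<in> insert x I \<rightarrow> carrier (free_module R X)"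
      using insert f F.smult_closed[OF _ single_closed] by (auto simp: free_module_carrier)
    then have "(\<Oplus>\<^bsub>free_module R X\<^esub>x\<in>insert x I. f x \<odot>\<^bsub>free_module R X\<^esub> single R x)
      = f x \<odot>\<^bsub>free_module R X\<^esub> single R x \<oplus>\<^bsub>free_module R X\<^esub> (\<lambda>y. if y \<in> I then f y else \<zero>)"
      using insert by (subst F.M.finsum_insert) auto
    then show ?case using insert f by (auto simp: single_def fun_eq_iff free_module_carrier)
  qed simp
  have "evaluation R (free_module R X) (single R) f = (\<lambda>y. if y \<in> {x. f x \<noteq> \<zero>} then f y else \<zero>)"
    using f by (intro *) (auto simp: free_module_carrier)
  then show ?thesis by auto
qed

declare free_module_ops [simp del]

text \<open>The condition under which the formal sums in one class have the same value, so that \<^const>\<open>lift\<close> is well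
defined.\<close>
definition compatible :: "'x set \<Rightarrow> ('x \<Rightarrow> 'a) set \<Rightarrow> ('a, 'u, 's) module_scheme \<Rightarrow> ('x \<Rightarrow> 'u) \<Rightarrow> bool" where
  "compatible X r U \<beta> \<longleftrightarrow> \<beta> \<in> X \<rightarrow> carrier U \<and> (\<forall>\<rho>\<in>r. evaluation R U \<beta> \<rho> = \<zero>\<^bsub>U\<^esub>)"

context
  fixes X :: "'x set" and r :: "('x \<Rightarrow> 'a) set"
  assumes r: "r \<subseteq> carrier (free_module R X)"
begin

interpretation F: module R "free_module R X" by (rule free_module_module)

lemma span_rel_submodule: "submodule (span_rel R X r) R (free_module R X)"
proof -
  define T where "T = {t. submodule t R (free_module R X) \<and> r \<subseteq> t}"
  have T: "submodule t R (free_module R X)" "r \<subseteq> t" if "t \<in> T" for t using that by (auto simp: T_def)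
  have c: "carrier (free_module R X) \<in> T" using r F.carrier_is_submodule by (auto simp: T_def)
  have "submodule (\<Inter>T) R (free_module R X)"
  proof (intro F.submoduleI)
    have "\<zero>\<^bsub>free_module R X\<^esub> \<in> t" if "t \<in> T" for t
      using subgroup.one_closed[OF submodule.axioms(1)[OF T(1)[OF that]]] by simp
    then show "\<zero>\<^bsub>free_module R X\<^esub> \<in> \<Inter>T" by blast
  qed (use c F.submoduleE[OF T(1)] in \<open>auto simp del: free_module_ops\<close>)
  then show ?thesis by (simp add: span_rel_def hull_def T_def)
qed

lemma presented_module_module: "module R (presented_module R X r)"
  unfolding presented_module_def by (rule F.quotient_module_module[OF span_rel_submodule])

interpretation N: abelian_subgroup "span_rel R X r" "free_module R X"
  by (rule F.submodule_abelian_subgroup[OF span_rel_submodule])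

lemma presented_proj:
  "(\<lambda>f. span_rel R X r +>\<^bsub>free_module R X\<^esub> f) \<in> module_hom R (free_module R X) (presented_module R X r)"
  unfolding presented_module_def by (rule F.quotient_module_proj[OF span_rel_submodule])

lemma presented_carrier:
  "carrier (presented_module R X r) = (\<lambda>f. span_rel R X r +>\<^bsub>free_module R X\<^esub> f) ` carrier (free_module R X)"
  unfolding presented_module_def by (rule F.quotient_module_carrier)

lemma presented_rel_zero:
  assumes "\<rho> \<in> r"
  shows "span_rel R X r +>\<^bsub>free_module R X\<^esub> \<rho> = \<zero>\<^bsub>presented_module R X r\<^esub>"
proof -
  have "\<rho> \<in> span_rel R X r" using assms by (simp add: span_rel_def hull_inc)
  then show ?thesis
    using N.a_rcos_const by (simp add: presented_module_def quotient_module_def)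
qed

lemma presented_expand:
  assumes f: "f \<in> carrier (free_module R X)"
  shows "span_rel R X r +>\<^bsub>free_module R X\<^esub> f = evaluation R (presented_module R X r) (generator R X r) f"
proof -
  interpret P: module R "presented_module R X r" by (rule presented_module_module)
  have c: "(\<lambda>x. f x \<odot>\<^bsub>free_module R X\<^esub> single R x) \<in> {x. f x \<noteq> \<zero>} \<rightarrow> carrier (free_module R X)"
    using f by (intro Pi_I F.smult_closed single_closed) (auto simp: free_module_carrier)
  have "span_rel R X r +>\<^bsub>free_module R X\<^esub> f
    = span_rel R X r +>\<^bsub>free_module R X\<^esub> (evaluation R (free_module R X) (single R) f)"
    using free_module_expand[OF f] by simp
  also have "\<dots> = (\<Oplus>\<^bsub>presented_module R X r\<^esub>x\<in>{x. f x \<noteq> \<zero>}. span_rel R X r +>\<^bsub>free_module R X\<^esub>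
     (f x \<odot>\<^bsub>free_module R X\<^esub> single R x))"
    using f by (intro module_hom_finsum[OF presented_proj F.M.abelian_group_axioms P.M.abelian_group_axioms c])
      (auto simp: free_module_carrier)
  also have "\<dots> = evaluation R (presented_module R X r) (generator R X r) f"
  proof (rule P.M.finsum_cong'[OF refl])
    have X: "x \<in> X" if "f x \<noteq> \<zero>" for x using that f by (auto simp: free_module_carrier)
    have R: "f x \<in> carrier R" for x using f by (auto simp: free_module_carrier)
    show "(\<lambda>x. f x \<odot>\<^bsub>presented_module R X r\<^esub> generator R X r x) \<in> {x. f x \<noteq> \<zero>} \<rightarrow> carrier (presented_module R X r)"
      unfolding generator_def using R X module_hom_closed[OF presented_proj single_closed] by auto
    show "span_rel R X r +>\<^bsub>free_module R X\<^esub> (f x \<odot>\<^bsub>free_module R X\<^esub> single R x)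
      = f x \<odot>\<^bsub>presented_module R X r\<^esub> generator R X r x" if "x \<in> {x. f x \<noteq> \<zero>}" for x
      unfolding generator_def using that R X by (intro module_hom_smult[OF presented_proj] single_closed) auto
  qed
  finally show ?thesis .
qed

lemma generator_closed: "x \<in> X \<Longrightarrow> generator R X r x \<in> carrier (presented_module R X r)"
  unfolding generator_def by (rule module_hom_closed[OF presented_proj single_closed])

lemma lift_coset:
  assumes U: "module R U" and b: "compatible X r U \<beta>" and f: "f \<in> carrier (free_module R X)"
  shows "lift R U \<beta> (span_rel R X r +>\<^bsub>free_module R X\<^esub> f) = evaluation R U \<beta> f"
proof -
  interpret U: module R U by fact
  have b': "\<beta> \<in> X \<rightarrow> carrier U" using b by (simp add: compatible_def)
  note hom = evaluation_hom[OF U b']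
  have "r \<subseteq> {f \<in> carrier (free_module R X). evaluation R U \<beta> f = \<zero>\<^bsub>U\<^esub>}"
    using b r by (auto simp: compatible_def)
  then have N0: "span_rel R X r \<subseteq> {f \<in> carrier (free_module R X). evaluation R U \<beta> f = \<zero>\<^bsub>U\<^esub>}"
    unfolding span_rel_def by (rule hull_minimal) (rule F.submodule_kernel[OF hom U])
  have *: "evaluation R U \<beta> f' = evaluation R U \<beta> f" if "f' \<in> span_rel R X r +>\<^bsub>free_module R X\<^esub> f" for f'
  proof -
    obtain n where n: "n \<in> span_rel R X r" "f' = n \<oplus>\<^bsub>free_module R X\<^esub> f"
      using \<open>f' \<in> _\<close> by (auto simp: a_r_coset_def')
    have n0: "n \<in> carrier (free_module R X)" "evaluation R U \<beta> n = \<zero>\<^bsub>U\<^esub>" using n(1) N0 by blast+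
    show ?thesis
      unfolding n(2) module_hom_add[OF hom n0(1) f] n0(2) using module_hom_closed[OF hom f] by simp
  qed
  have "evaluation R U \<beta> ` (span_rel R X r +>\<^bsub>free_module R X\<^esub> f)
      = (\<lambda>_. evaluation R U \<beta> f) ` (span_rel R X r +>\<^bsub>free_module R X\<^esub> f)"
    by (rule image_cong[OF refl *])
  also have "\<dots> = {evaluation R U \<beta> f}" by (rule image_constant[OF N.a_rcos_self[OF f]])
  finally have "evaluation R U \<beta> ` (span_rel R X r +>\<^bsub>free_module R X\<^esub> f) = {evaluation R U \<beta> f}" .
  then show ?thesis by (simp add: lift_def)
qed

lemma lift_hom:
  assumes U: "module R U" and b: "compatible X r U \<beta>"
  shows "lift R U \<beta> \<in> module_hom R (presented_module R X r) U"
proof -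
  interpret U: module R U by fact
  have b': "\<beta> \<in> X \<rightarrow> carrier U" using b by (simp add: compatible_def)
  note hom = evaluation_hom[OF U b']
  note proj = module_homD(2,3)[OF presented_proj, symmetric]
  show ?thesis
  proof (rule module_homI)
    show "lift R U \<beta> v \<in> carrier U" if "v \<in> carrier (presented_module R X r)" for v
      using that module_hom_closed[OF hom] by (auto simp: presented_carrier lift_coset[OF U b])
    show "lift R U \<beta> (u \<oplus>\<^bsub>presented_module R X r\<^esub> v) = lift R U \<beta> u \<oplus>\<^bsub>U\<^esub> lift R U \<beta> v"
      if uv: "u \<in> carrier (presented_module R X r)" "v \<in> carrier (presented_module R X r)" for u v
    proof -
      obtain f g where f: "f \<in> carrier (free_module R X)" "u = span_rel R X r +>\<^bsub>free_module R X\<^esub> f"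
        and g: "g \<in> carrier (free_module R X)" "v = span_rel R X r +>\<^bsub>free_module R X\<^esub> g"
        using uv by (auto simp: presented_carrier)
      then show ?thesis using proj(1)[OF f(1) g(1)] module_hom_add[OF hom f(1) g(1)] F.M.a_closed[OF f(1) g(1)]
        by (simp add: lift_coset[OF U b])
    qed
    show "lift R U \<beta> (c \<odot>\<^bsub>presented_module R X r\<^esub> u) = c \<odot>\<^bsub>U\<^esub> lift R U \<beta> u"
      if cu: "c \<in> carrier R" "u \<in> carrier (presented_module R X r)" for c u
    proof -
      obtain f where f: "f \<in> carrier (free_module R X)" "u = span_rel R X r +>\<^bsub>free_module R X\<^esub> f"
        using cu by (auto simp: presented_carrier)
      then show ?thesis using proj(2)[OF cu(1) f(1)] module_hom_smult[OF hom cu(1) f(1)] F.smult_closed[OF cu(1) f(1)]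
        by (simp add: lift_coset[OF U b])
    qed
  qed
qed

lemma lift_generator:
  assumes U: "module R U" and b: "compatible X r U \<beta>" and x: "x \<in> X"
  shows "lift R U \<beta> (generator R X r x) = \<beta> x"
  using evaluation_single[OF U _ x] b lift_coset[OF U b single_closed[OF x]]
  by (simp add: generator_def compatible_def)

lemma hom_eq_on_generators:
  assumes U: "module R U" and g: "g \<in> module_hom R (presented_module R X r) U"
    and h: "h \<in> module_hom R (presented_module R X r) U"
    and eq: "\<And>x. x \<in> X \<Longrightarrow> g (generator R X r x) = h (generator R X r x)"
    and t: "t \<in> carrier (presented_module R X r)"
  shows "g t = h t"
proof -
  interpret U: module R U by fact
  interpret P: module R "presented_module R X r" by (rule presented_module_module)
  obtain f where f: "f \<in> carrier (free_module R X)" "t = span_rel R X r +>\<^bsub>free_module R X\<^esub> f"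
    using t by (auto simp: presented_carrier)
  have t: "t = evaluation R (presented_module R X r) (generator R X r) f"
    using presented_expand f by simp
  have c: "(\<lambda>x. f x \<odot>\<^bsub>presented_module R X r\<^esub> generator R X r x) \<in> {x. f x \<noteq> \<zero>} \<rightarrow> carrier (presented_module R X r)"
    using f generator_closed by (auto simp: free_module_carrier)
  have fin: "finite {x. f x \<noteq> \<zero>}" using f by (auto simp: free_module_carrier)
  have *: "k t = (\<Oplus>\<^bsub>U\<^esub>x\<in>{x. f x \<noteq> \<zero>}. f x \<odot>\<^bsub>U\<^esub> k (generator R X r x))"
    if k: "k \<in> module_hom R (presented_module R X r) U" for k
  proof -
    have "k t = (\<Oplus>\<^bsub>U\<^esub>x\<in>{x. f x \<noteq> \<zero>}. k (f x \<odot>\<^bsub>presented_module R X r\<^esub> generator R X r x))"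
      unfolding t by (rule module_hom_finsum[OF k P.M.abelian_group_axioms U.M.abelian_group_axioms c fin])
    also have "\<dots> = (\<Oplus>\<^bsub>U\<^esub>x\<in>{x. f x \<noteq> \<zero>}. f x \<odot>\<^bsub>U\<^esub> k (generator R X r x))"
      using free_moduleD[OF f(1)] generator_closed module_homD[OF k]
      by (intro U.M.finsum_cong') auto
    finally show ?thesis .
  qed
  have "(\<Oplus>\<^bsub>U\<^esub>x\<in>{x. f x \<noteq> \<zero>}. f x \<odot>\<^bsub>U\<^esub> g (generator R X r x))
     = (\<Oplus>\<^bsub>U\<^esub>x\<in>{x. f x \<noteq> \<zero>}. f x \<odot>\<^bsub>U\<^esub> h (generator R X r x))"
    using free_moduleD[OF f(1)] generator_closed module_hom_closed[OF h] eq
    by (intro U.M.finsum_cong') auto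
  then show ?thesis using *[OF g] *[OF h] by simp
qed

end

end

lemma (in abelian_group) eq_if_minus_zero:
  assumes "x \<in> carrier G" "y \<in> carrier G" "x \<ominus> y = \<zero>" shows "x = y"
proof -
  have "x = (x \<ominus> y) \<oplus> y" using assms(1,2) by (simp add: a_minus_def a_assoc l_neg)
  then show ?thesis using assms by simp
qed

lemma (in abelian_group) sum_eq_imp_eq_minus:
  assumes "x \<in> carrier G" "y \<in> carrier G" "z = x \<oplus> y" shows "y = z \<ominus> x"
proof -
  have "z \<ominus> x = (y \<oplus> x) \<oplus> \<ominus> x" using assms by (simp add: a_minus_def a_comm)
  also have "\<dots> = y" using assms(1,2) by (simp add: a_assoc r_neg)
  finally show ?thesis by simp
qed

section \<open>Finite-dimensional spaces of functions\<close>

context field begin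

text \<open>Only the values on \<open>X\<close> matter: a space contains with a function all functions that agree with it on \<open>X\<close>, so
functions need not be normalised outside \<open>X\<close>.\<close>
definition fun_space :: "'x set \<Rightarrow> ('x \<Rightarrow> 'a) set \<Rightarrow> bool" where
  "fun_space X C \<longleftrightarrow> C \<noteq> {} \<and> (\<forall>c\<in>C. \<forall>x\<in>X. c x \<in> carrier R) \<and>
     (\<forall>c\<in>C. \<forall>d\<in>C. \<forall>k\<in>carrier R. \<forall>e. (\<forall>x\<in>X. e x = k \<otimes> c x \<oplus> d x) \<longrightarrow> e \<in> C)"

text \<open>A finite separating set of points expresses that the space is finite-dimensional: restriction to \<open>P\<close> embeds
it into \<open>K\<^sup>P\<close>.\<close>
definition separating :: "'x set \<Rightarrow> ('x \<Rightarrow> 'a) set \<Rightarrow> 'x set \<Rightarrow> bool" where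
  "separating X C P \<longleftrightarrow> finite P \<and> P \<subseteq> X \<and>
     (\<forall>c\<in>C. (\<forall>p\<in>P. c p = \<zero>) \<longrightarrow> (\<forall>x\<in>X. c x = \<zero>))"

definition dual_basis :: "('x \<Rightarrow> 'a) set \<Rightarrow> 'x set \<Rightarrow> ('x \<Rightarrow> 'x \<Rightarrow> 'a) \<Rightarrow> bool" where
  "dual_basis C P e \<longleftrightarrow> (\<forall>p\<in>P. e p \<in> C \<and> (\<forall>q\<in>P. e p q = (if q = p then \<one> else \<zero>)))"

lemma fun_space_closed: "fun_space X C \<Longrightarrow> c \<in> C \<Longrightarrow> x \<in> X \<Longrightarrow> c x \<in> carrier R"
  by (auto simp: fun_space_def)

lemma fun_space_comb:
  "fun_space X C \<Longrightarrow> c \<in> C \<Longrightarrow> d \<in> C \<Longrightarrow> k \<in> carrier R \<Longrightarrow>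
    (\<And>x. x \<in> X \<Longrightarrow> e x = k \<otimes> c x \<oplus> d x) \<Longrightarrow> e \<in> C"
  unfolding fun_space_def by blast

lemma fun_space_zero:
  assumes C: "fun_space X C" and z: "\<And>x. x \<in> X \<Longrightarrow> e x = \<zero>" shows "e \<in> C"
proof -
  obtain c where c: "c \<in> C" using C by (auto simp: fun_space_def)
  show ?thesis
    by (rule fun_space_comb[OF C c c, of "\<ominus> \<one>"])
      (use z fun_space_closed[OF C c] in \<open>auto simp: l_minus l_neg\<close>)
qed

lemma fun_space_cong:
  assumes C: "fun_space X C" and c: "c \<in> C" and "\<And>x. x \<in> X \<Longrightarrow> e x = c x" shows "e \<in> C"
  by (rule fun_space_comb[OF C c fun_space_zero[OF C], of "\<lambda>_. \<zero>" \<one>])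
    (use assms fun_space_closed[OF C c] in auto)

lemma fun_space_add:
  assumes C: "fun_space X C" and c: "c \<in> C" "d \<in> C" shows "(\<lambda>x. c x \<oplus> d x) \<in> C"
  by (rule fun_space_comb[OF C c, of \<one>]) (use fun_space_closed[OF C c(1)] in auto)

lemma fun_space_smult:
  assumes C: "fun_space X C" and c: "c \<in> C" "k \<in> carrier R" shows "(\<lambda>x. k \<otimes> c x) \<in> C"
  by (rule fun_space_comb[OF C c(1) fun_space_zero[OF C] c(2), of "\<lambda>_. \<zero>"])
    (use c fun_space_closed[OF C c(1)] in auto)

lemma fun_space_diff:
  assumes C: "fun_space X C" and c: "c \<in> C" "d \<in> C" shows "(\<lambda>x. c x \<ominus> d x) \<in> C"
  by (rule fun_space_comb[OF C c(2,1), of "\<ominus> \<one>"])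
    (use fun_space_closed[OF C c(1)] fun_space_closed[OF C c(2)] in \<open>auto simp: l_minus a_minus_def a_comm\<close>)

lemma fun_space_finsum:
  assumes C: "fun_space X C" and "finite I" and "\<And>i. i \<in> I \<Longrightarrow> f i \<in> C"
  shows "(\<lambda>x. \<Oplus>i\<in>I. f i x) \<in> C"
  using assms(2,3)
proof (induction rule: finite_induct)
  case empty show ?case by (rule fun_space_zero[OF C]) simp
next
  case (insert i I)
  have "(\<lambda>x. f i x \<oplus> (\<Oplus>i\<in>I. f i x)) \<in> C" by (rule fun_space_add[OF C]) (use insert in auto)
  then show ?case
    by (rule fun_space_cong[OF C])
      (use insert fun_space_closed[OF C insert.prems] in \<open>auto simp: finsum_insert\<close>)
qed

lemma separating_eqI:
  assumes C: "fun_space X C" and P: "separating X C P" and c: "c \<in> C" "d \<in> C"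
    and eq: "\<And>p. p \<in> P \<Longrightarrow> c p = d p" and x: "x \<in> X"
  shows "c x = d x"
proof -
  have "(\<lambda>x. c x \<ominus> d x) \<in> C" by (rule fun_space_diff[OF C c])
  moreover have "c p \<ominus> d p = \<zero>" if "p \<in> P" for p
    using that eq P fun_space_closed[OF C c(2)] by (auto simp: separating_def a_minus_def r_neg)
  ultimately have "c x \<ominus> d x = \<zero>" using P x by (auto simp: separating_def)
  then show ?thesis using fun_space_closed[OF C _ x] c eq_if_minus_zero by blast
qed

text \<open>If the point \<open>p\<close> cannot be spared, some function vanishes at all other points of \<open>P\<close> without being zero; it
is nonzero at \<open>p\<close> and can be scaled.\<close>
lemma minimal_separating_dual_basis:
  assumes C: "fun_space X C" and P: "separating X C P"
    and min: "\<And>Q. Q \<subset> P \<Longrightarrow> \<not> separating X C Q"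
  shows "\<exists>e. dual_basis C P e"
proof -
  have "\<exists>e\<in>C. \<forall>q\<in>P. e q = (if q = p then \<one> else \<zero>)" if p: "p \<in> P" for p
  proof -
    have "\<not> separating X C (P - {p})" using p by (intro min) auto
    then obtain c where c: "c \<in> C" "\<And>q. q \<in> P - {p} \<Longrightarrow> c q = \<zero>" "\<not> (\<forall>x\<in>X. c x = \<zero>)"
      using P unfolding separating_def by (metis Diff_subset finite_Diff subset_trans)
    then have n: "c p \<noteq> \<zero>" using P unfolding separating_def by (metis Diff_iff singletonD)
    have pX: "p \<in> X" using P p by (auto simp: separating_def)
    have cp: "c p \<in> Units R" using fun_space_closed[OF C c(1) pX] n by (simp add: field_Units)
    have "(\<lambda>x. inv (c p) \<otimes> c x) \<in> C" by (rule fun_space_smult[OF C c(1)]) (use cp in simp)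
    then show ?thesis using c(2) cp by (intro bexI[of _ "\<lambda>x. inv (c p) \<otimes> c x"]) auto
  qed
  then have "\<exists>e. \<forall>p\<in>P. e p \<in> C \<and> (\<forall>q\<in>P. e p q = (if q = p then \<one> else \<zero>))" by (intro bchoice) blast
  then show ?thesis by (simp add: dual_basis_def)
qed

lemma minimal_separating_subset:
  assumes "separating X C P"
  obtains P' where "P' \<subseteq> P" "separating X C P'" "\<And>Q. Q \<subset> P' \<Longrightarrow> \<not> separating X C Q"
proof -
  have "finite P" using assms by (simp add: separating_def)
  then have "\<exists>P'\<subseteq>P. separating X C P' \<and> (\<forall>Q. Q \<subset> P' \<longrightarrow> \<not> separating X C Q)" using assms
  proof (induction rule: finite_psubset_induct)
    case (psubset P)
    then show ?case by (meson order_refl psubset_imp_subset subset_trans)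
  qed
  then show ?thesis using that by blast
qed

lemma ex_dual_basis:
  assumes "fun_space X C" "separating X C P"
  obtains P' e where "P' \<subseteq> P" "separating X C P'" "dual_basis C P' e"
  using minimal_separating_subset[OF assms(2)] minimal_separating_dual_basis[OF assms(1)] by metis

text \<open>Both sides agree on \<open>P\<close>.  The basis may lie in a subspace, which then is the whole space.\<close>
lemma dual_basis_expand:
  assumes C: "fun_space X C" and P: "separating X C P"
    and e: "dual_basis D P e" "D \<subseteq> C" and c: "c \<in> C" and x: "x \<in> X"
  shows "c x = (\<Oplus>p\<in>P. c p \<otimes> e p x)"
proof -
  have fin: "finite P" and PX: "P \<subseteq> X" using P by (auto simp: separating_def)
  have eC: "e p \<in> C" if "p \<in> P" for p using e that by (auto simp: dual_basis_def)
  have "(\<lambda>x. \<Oplus>p\<in>P. c p \<otimes> e p x) \<in> C"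
    by (rule fun_space_finsum[OF C fin fun_space_smult[OF C eC]]) (use PX fun_space_closed[OF C c] in auto)
  moreover have "c q = (\<Oplus>p\<in>P. c p \<otimes> e p q)" if q: "q \<in> P" for q
  proof -
    have "(\<Oplus>p\<in>P. c p \<otimes> e p q) = (\<Oplus>p\<in>P. if q = p then c p else \<zero>)"
      using e q PX fun_space_closed[OF C c] by (intro finsum_cong') (auto simp: dual_basis_def)
    also have "\<dots> = c q"
      using q fin PX fun_space_closed[OF C c] by (intro finsum_singleton) auto
    finally show ?thesis by simp
  qed
  ultimately show ?thesis using separating_eqI[OF C P c _ _ x] by blast
qed

text \<open>Let \<open>W\<close> be the image, and let \<open>P'\<close> be a minimal separating set of \<open>C\<close>.  If \<open>P'\<close> is also minimal for \<open>W\<close>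
then \<open>W\<close> contains a dual basis on \<open>P'\<close>, hence is all of \<open>C\<close>.  Otherwise \<open>W\<close> has a smaller separating set,
so by induction the restriction of the map to \<open>W\<close> is onto \<open>W\<close>; by injectivity, \<open>C\<close> is contained in \<open>W\<close>.\<close>
lemma injective_imp_surjective:
  assumes "fun_space X C" "separating X C P"
    and "\<And>c. c \<in> C \<Longrightarrow> \<phi> c \<in> C"
    and "\<And>c d e k x. c \<in> C \<Longrightarrow> d \<in> C \<Longrightarrow> e \<in> C \<Longrightarrow> k \<in> carrier R \<Longrightarrow>
      (\<And>x. x \<in> X \<Longrightarrow> e x = k \<otimes> c x \<oplus> d x) \<Longrightarrow> x \<in> X \<Longrightarrow> \<phi> e x = k \<otimes> \<phi> c x \<oplus> \<phi> d x"
    and "\<And>c x. c \<in> C \<Longrightarrow> (\<And>x. x \<in> X \<Longrightarrow> \<phi> c x = \<zero>) \<Longrightarrow> x \<in> X \<Longrightarrow> c x = \<zero>"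
    and "c \<in> C"
  shows "\<exists>d\<in>C. \<forall>x\<in>X. \<phi> d x = c x"
  using assms
proof (induction "card P" arbitrary: C P c rule: less_induct)
  case less
  note C = less.prems(1) and closed = less.prems(3) and lin = less.prems(4) and inj = less.prems(5)
  obtain P' where P': "P' \<subseteq> P" "separating X C P'" "\<And>Q. Q \<subset> P' \<Longrightarrow> \<not> separating X C Q"
    using minimal_separating_subset[OF less.prems(2)] by metis
  have fin: "finite P" "finite P'" using less.prems(2) P'(2) by (auto simp: separating_def)
  define W where "W = {w. \<exists>c\<in>C. \<forall>x\<in>X. w x = \<phi> c x}"
  have WC: "W \<subseteq> C"
  proof
    fix w assume "w \<in> W"
    then obtain c where "c \<in> C" "\<forall>x\<in>X. w x = \<phi> c x" by (auto simp: W_def)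
    then show "w \<in> C" by - (rule fun_space_cong[OF C closed[of c]]; auto)
  qed
  have W: "fun_space X W"
    unfolding fun_space_def
  proof (intro conjI ballI allI impI)
    show "W \<noteq> {}" using less.prems(6) unfolding W_def by blast
    show "w x \<in> carrier R" if "w \<in> W" "x \<in> X" for w x
      by (rule fun_space_closed[OF C _ that(2)]) (use that(1) WC in blast)
    fix u w k e assume uw: "u \<in> W" "w \<in> W" and k: "k \<in> carrier R" and e: "\<forall>x\<in>X. e x = k \<otimes> u x \<oplus> w x"
    obtain c where c: "c \<in> C" "\<forall>x\<in>X. u x = \<phi> c x" using uw by (auto simp: W_def)
    obtain d where d: "d \<in> C" "\<forall>x\<in>X. w x = \<phi> d x" using uw by (auto simp: W_def)
    have f: "(\<lambda>x. k \<otimes> c x \<oplus> d x) \<in> C" by (rule fun_space_comb[OF C c(1) d(1) k]) auto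
    show "e \<in> W"
      unfolding W_def using lin[OF c(1) d(1) f k] e c(2) d(2) f by (intro CollectI bexI[of _ "\<lambda>x. k \<otimes> c x \<oplus> d x"]) auto
  qed
  have "c \<in> W" if c: "c \<in> C" for c
  proof (cases "\<exists>Q. Q \<subset> P' \<and> separating X W Q")
    case True
    then obtain Q where Q: "Q \<subset> P'" "separating X W Q" by blast
    have cardQ: "card Q < card P" using Q(1) P'(1) fin by (intro psubset_card_mono) auto
    have "\<exists>d\<in>W. \<forall>x\<in>X. \<phi> d x = \<phi> c x"
    proof (rule less.hyps[OF cardQ W Q(2)])
      show "\<phi> w \<in> W" if "w \<in> W" for w using that WC unfolding W_def by blast
      show "\<phi> e x = k \<otimes> \<phi> u x \<oplus> \<phi> d x"
        if "u \<in> W" "d \<in> W" "e \<in> W" "k \<in> carrier R"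
          "\<And>x. x \<in> X \<Longrightarrow> e x = k \<otimes> u x \<oplus> d x" "x \<in> X" for u d e k x
        using that(1-3) WC by (intro lin[OF _ _ _ that(4,5,6)]) auto
      show "u x = \<zero>" if "u \<in> W" "\<And>x. x \<in> X \<Longrightarrow> \<phi> u x = \<zero>" "x \<in> X" for u x
        using that(1) WC by (intro inj[OF _ that(2,3)]) auto
      show "\<phi> c \<in> W" using c unfolding W_def by blast
    qed
    then obtain d where d: "d \<in> W" "\<forall>x\<in>X. \<phi> d x = \<phi> c x" by blast
    have dC: "d \<in> C" using d WC by auto
    define e where "e = (\<lambda>x. \<ominus> \<one> \<otimes> d x \<oplus> c x)"
    have eC: "e \<in> C" by (rule fun_space_comb[OF C dC c, of "\<ominus> \<one>"]) (simp_all add: e_def)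
    have "\<phi> e x = \<zero>" if x: "x \<in> X" for x
    proof -
      have "\<phi> e x = \<ominus> \<one> \<otimes> \<phi> d x \<oplus> \<phi> c x" by (rule lin[OF dC c eC]) (use x in \<open>simp_all add: e_def\<close>)
      then show ?thesis using d x fun_space_closed[OF C closed[OF c] x] by (simp add: l_minus l_neg)
    qed
    then have e0: "e x = \<zero>" if "x \<in> X" for x using inj[OF eC] that by blast
    have "c x = d x" if x: "x \<in> X" for x
    proof -
      note cl = fun_space_closed[OF C c x] fun_space_closed[OF C dC x]
      have "d x \<oplus> e x = c x" using cl by (simp add: e_def l_minus r_neg1 a_assoc[symmetric] r_neg)
      then show ?thesis using e0[OF x] cl by simp
    qed
    then show ?thesis by (rule fun_space_cong[OF W d(1)])
  next
    case False
    have sep: "separating X W P'" using P'(2) WC by (auto simp: separating_def)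
    obtain e where e: "dual_basis W P' e"
      using minimal_separating_dual_basis[OF W sep] False by blast
    have "(\<lambda>x. \<Oplus>p\<in>P'. c p \<otimes> e p x) \<in> W"
      by (rule fun_space_finsum[OF W fin(2) fun_space_smult[OF W]])
        (use e fun_space_closed[OF C c] sep in \<open>auto simp: dual_basis_def separating_def\<close>)
    then show ?thesis
      by (rule fun_space_cong[OF W]) (use dual_basis_expand[OF C P'(2) e WC c] in auto)
  qed
  then have "c \<in> W" using less.prems(6) by blast
  then obtain d where "d \<in> C" "\<forall>x\<in>X. c x = \<phi> d x" unfolding W_def by blast
  then show ?case by (intro bexI[of _ d]) simp_all
qed

text \<open>Linear combinations, built up one generator at a time; the conditions again concern values on \<open>X\<close> only.\<close>
inductive_set fun_span :: "'x set \<Rightarrow> ('x \<Rightarrow> 'a) set \<Rightarrow> ('x \<Rightarrow> 'a) set" for X G where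
  zero: "(\<And>x. x \<in> X \<Longrightarrow> c x = \<zero>) \<Longrightarrow> c \<in> fun_span X G"
| comb: "g \<in> G \<Longrightarrow> d \<in> fun_span X G \<Longrightarrow> k \<in> carrier R \<Longrightarrow> (\<And>x. x \<in> X \<Longrightarrow> c x = k \<otimes> g x \<oplus> d x) \<Longrightarrow>
    c \<in> fun_span X G"

lemma fun_span_closed:
  assumes G: "\<And>g x. g \<in> G \<Longrightarrow> x \<in> X \<Longrightarrow> g x \<in> carrier R" and c: "c \<in> fun_span X G" and x: "x \<in> X"
  shows "c x \<in> carrier R"
  using c x by (induction rule: fun_span.induct) (auto simp: G)

lemma fun_span_space:
  assumes G: "\<And>g x. g \<in> G \<Longrightarrow> x \<in> X \<Longrightarrow> g x \<in> carrier R"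
  shows "fun_space X (fun_span X G)"
  unfolding fun_space_def
proof (intro conjI ballI allI impI)
  have cl: "c x \<in> carrier R" if "c \<in> fun_span X G" "x \<in> X" for c x
    by (rule fun_span_closed[of G X]) (use G that in auto)
  show "fun_span X G \<noteq> {}" using fun_span.zero[of X "\<lambda>_. \<zero>"] by auto
  show "c x \<in> carrier R" if "c \<in> fun_span X G" "x \<in> X" for c x using cl that by blast
  have cong: "e \<in> fun_span X G" if "c \<in> fun_span X G" "\<And>x. x \<in> X \<Longrightarrow> e x = c x" for c e
    using that(1)
  proof (cases rule: fun_span.cases)
    case zero then show ?thesis using that(2) by (intro fun_span.zero) auto
  next
    case (comb g d k) then show ?thesis using that(2) by - (rule fun_span.comb[of g G d X k]; auto)
  qed
  fix c d k e
  assume "c \<in> fun_span X G" and d: "d \<in> fun_span X G" and k: "k \<in> carrier R"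
    and "\<forall>x\<in>X. e x = k \<otimes> c x \<oplus> d x"
  then show "e \<in> fun_span X G"
  proof (induction arbitrary: e rule: fun_span.induct)
    case (zero c)
    then show ?case using cl[OF d] by (intro cong[OF d]) auto
  next
    case (comb g c' l c)
    have "(\<lambda>x. k \<otimes> c' x \<oplus> d x) \<in> fun_span X G" using comb.IH k d by auto
    moreover have "e x = (k \<otimes> l) \<otimes> g x \<oplus> (k \<otimes> c' x \<oplus> d x)" if x: "x \<in> X" for x
      using comb x k cl[OF comb.hyps(2) x] cl[OF d x] G[OF comb.hyps(1) x]
      by (simp add: r_distr m_assoc a_assoc)
    ultimately show ?case using comb.hyps k by - (rule fun_span.comb[of g G _ X "k \<otimes> l"]; auto)
  qed
qed

lemma fun_span_base:
  assumes "g \<in> G" "\<And>x. x \<in> X \<Longrightarrow> g x \<in> carrier R" shows "g \<in> fun_span X G"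
  by (rule fun_span.comb[of g G "\<lambda>_. \<zero>" X \<one>]) (use assms in \<open>auto intro: fun_span.zero\<close>)

lemma fun_span_least:
  assumes C: "fun_space X C" and "G \<subseteq> C" shows "fun_span X G \<subseteq> C"
proof
  fix c assume "c \<in> fun_span X G"
  then show "c \<in> C"
  proof (induction rule: fun_span.induct)
    case (zero c) then show ?case by (rule fun_space_zero[OF C])
  next
    case (comb g d k c)
    show ?case by (rule fun_space_comb[OF C, of g d k]) (use comb assms(2) in auto)
  qed
qed

lemma fun_span_mono: "G \<subseteq> H \<Longrightarrow> fun_span X G \<subseteq> fun_span X H"
proof
  fix c assume GH: "G \<subseteq> H" and "c \<in> fun_span X G"
  from this(2) show "c \<in> fun_span X H"
    by (induction rule: fun_span.induct) (use GH in \<open>auto intro: fun_span.intros\<close>)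
qed

text \<open>A further generator \<open>g\<close> costs at most one further point.  If some \<open>h\<close> in the larger span vanishes on the old
points but not at \<open>x\<close>, it involves \<open>g\<close>, so every function of the larger span is a multiple of \<open>h\<close> plus a
function \<open>f\<close> of the smaller span.  If it vanishes at the old points then \<open>f = 0\<close>, and vanishing at \<open>x\<close> kills
the multiple of \<open>h\<close>.\<close>
lemma finite_span_separating:
  assumes "finite G" and "\<And>g x. g \<in> G \<Longrightarrow> x \<in> X \<Longrightarrow> g x \<in> carrier R"
  shows "\<exists>P. separating X (fun_span X G) P"
  using assms
proof (induction rule: finite_induct)
  case empty
  have "c x = \<zero>" if "c \<in> fun_span X {}" "x \<in> X" for c x
    using that by (cases rule: fun_span.cases) auto
  then show ?case by (intro exI[of _ "{}"]) (auto simp: separating_def)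
next
  case (insert g G)
  then obtain P where P: "separating X (fun_span X G) P" by auto
  have G: "fun_space X (fun_span X G)" by (rule fun_span_space) (use insert in auto)
  note clg = insert.prems[of g, simplified]
  have split: "\<exists>d\<in>fun_span X G. \<exists>k\<in>carrier R. \<forall>x\<in>X. c x = k \<otimes> g x \<oplus> d x" if "c \<in> fun_span X (insert g G)" for c
    using that
  proof (induction rule: fun_span.induct)
    case (zero c)
    have "(\<lambda>_. \<zero>) \<in> fun_span X G" by (rule fun_span.zero) simp
    then show ?case using zero clg by (intro bexI[of _ "\<lambda>_. \<zero>"] bexI[of _ \<zero>]) auto
  next
    case (comb h d l c)
    obtain d' k where d': "d' \<in> fun_span X G" "k \<in> carrier R" "\<forall>x\<in>X. d x = k \<otimes> g x \<oplus> d' x"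
      using comb.IH by auto
    note cl = fun_space_closed[OF G d'(1)]
    show ?case
    proof (cases "h = g")
      case True
      have "c x = (l \<oplus> k) \<otimes> g x \<oplus> d' x" if "x \<in> X" for x
        using that comb d' True clg[OF that] cl[OF that] by (simp add: l_distr a_assoc)
      then show ?thesis using d' comb by (intro bexI[of _ d'] bexI[of _ "l \<oplus> k"]) auto
    next
      case False
      then have h: "h \<in> G" using comb by auto
      then have clh: "h x \<in> carrier R" if "x \<in> X" for x using that insert.prems by auto
      have "c x = k \<otimes> g x \<oplus> (l \<otimes> h x \<oplus> d' x)" if "x \<in> X" for x
        using that comb d' clg[OF that] cl[OF that] clh[OF that] by (simp add: a_ac)
      moreover have "(\<lambda>x. l \<otimes> h x \<oplus> d' x) \<in> fun_span X G"
        using h d' comb by - (rule fun_span.comb[of h G d' X l]; auto)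
      ultimately show ?thesis using d' by (intro bexI[of _ "\<lambda>x. l \<otimes> h x \<oplus> d' x"] bexI[of _ k]) auto
    qed
  qed
  show ?case
  proof (cases "separating X (fun_span X (insert g G)) P")
    case False
    then obtain h x where h: "h \<in> fun_span X (insert g G)" "\<And>p. p \<in> P \<Longrightarrow> h p = \<zero>" and x: "x \<in> X" "h x \<noteq> \<zero>"
      using P by (auto simp: separating_def)
    obtain d k where d: "d \<in> fun_span X G" "k \<in> carrier R" "\<forall>x\<in>X. h x = k \<otimes> g x \<oplus> d x"
      using split[OF h(1)] by auto
    note cld = fun_space_closed[OF G d(1)]
    have k0: "k \<noteq> \<zero>"
    proof
      assume "k = \<zero>"
      then have "h y = d y" if "y \<in> X" for y using d that clg[OF that] cld[OF that] by simp
      then have "h x = \<zero>" using P h(2) x(1) d(1) unfolding separating_def by (metis subsetD)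
      with x show False by simp
    qed
    have kU: "k \<in> Units R" using k0 d by (simp add: field_Units)
    have "separating X (fun_span X (insert g G)) (insert x P)"
      unfolding separating_def
    proof (intro conjI ballI impI)
      show "finite (insert x P)" "insert x P \<subseteq> X" using P x by (auto simp: separating_def)
      fix c y assume c: "c \<in> fun_span X (insert g G)" and c0: "\<forall>p\<in>insert x P. c p = \<zero>" and y: "y \<in> X"
      obtain d' l where d': "d' \<in> fun_span X G" "l \<in> carrier R" "\<forall>x\<in>X. c x = l \<otimes> g x \<oplus> d' x"
        using split[OF c] by auto
      note cld' = fun_space_closed[OF G d'(1)]
      define f where "f = (\<lambda>z. (\<ominus> (l \<otimes> inv k)) \<otimes> d z \<oplus> d' z)"
      have f: "f \<in> fun_span X G"
        by (rule fun_space_comb[OF G d(1) d'(1), of "\<ominus> (l \<otimes> inv k)"]) (use kU d' in \<open>auto simp: f_def\<close>)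
      have c': "c z = (l \<otimes> inv k) \<otimes> h z \<oplus> f z" if z: "z \<in> X" for z
      proof -
        have "(l \<otimes> inv k) \<otimes> (k \<otimes> g z \<oplus> d z) = l \<otimes> g z \<oplus> (l \<otimes> inv k) \<otimes> d z"
        proof -
          have "(l \<otimes> inv k) \<otimes> (k \<otimes> g z) = l \<otimes> (inv k \<otimes> k) \<otimes> g z"
            using kU d'(2) clg[OF z] Units_inv_closed[OF kU] Units_closed[OF kU] by (simp only: m_assoc m_closed)
          then show ?thesis using kU d(2) d' clg[OF z] cld[OF z] by (simp add: r_distr)
        qed
        moreover have "(l \<otimes> g z \<oplus> (l \<otimes> inv k) \<otimes> d z) \<oplus> f z = l \<otimes> g z \<oplus> d' z"
          using kU d' clg[OF z] cld[OF z] cld'[OF z] by (simp add: f_def l_minus a_assoc r_neg1 r_neg2)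
        ultimately show ?thesis using d d' z by simp
      qed
      have clf: "f z \<in> carrier R" if "z \<in> X" for z using fun_space_closed[OF G f that] .
      have PX: "P \<subseteq> X" using P by (auto simp: separating_def)
      have "f p = \<zero>" if "p \<in> P" for p
        using c'[of p] h(2)[OF that] c0 that PX clf[of p] kU d'(2) by (simp add: subset_eq)
      then have f0: "f z = \<zero>" if "z \<in> X" for z using P f that by (auto simp: separating_def)
      have hx: "h x \<in> carrier R" using x d clg cld by auto
      have "(l \<otimes> inv k) \<otimes> h x = \<zero>" using c'[OF x(1)] f0[OF x(1)] c0 kU d'(2) hx by simp
      then have "l \<otimes> inv k = \<zero>" using hx x(2) kU d'(2) by (simp add: integral_iff)
      then show "c y = \<zero>" using c'[OF y] f0[OF y] d clg[OF y] cld[OF y] y by simp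
    qed
    then show ?thesis by blast
  qed blast
qed

end

section \<open>Ideals of semisimple rings\<close>

context ring begin

lemma regular_module_simps [simp]:
  "carrier (regular_module R) = carrier R" "\<zero>\<^bsub>regular_module R\<^esub> = \<zero>"
  "x \<oplus>\<^bsub>regular_module R\<^esub> y = x \<oplus> y" "x \<odot>\<^bsub>regular_module R\<^esub> y = x \<otimes> y"
  by (simp_all add: regular_module_def)

definition left_ideal :: "'a set \<Rightarrow> bool" where
  "left_ideal N \<longleftrightarrow> N \<subseteq> carrier R \<and> \<zero> \<in> N \<and> (\<forall>x\<in>N. \<forall>y\<in>N. x \<oplus> y \<in> N) \<and>
     (\<forall>a\<in>carrier R. \<forall>x\<in>N. a \<otimes> x \<in> N)"

lemma left_idealD:
  assumes "left_ideal N"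
  shows "x \<in> N \<Longrightarrow> x \<in> carrier R" "\<zero> \<in> N" "x \<in> N \<Longrightarrow> y \<in> N \<Longrightarrow> x \<oplus> y \<in> N"
    "a \<in> carrier R \<Longrightarrow> x \<in> N \<Longrightarrow> a \<otimes> x \<in> N"
  using assms by (auto simp: left_ideal_def)

lemma left_ideal_neg: "left_ideal N \<Longrightarrow> x \<in> N \<Longrightarrow> \<ominus> x \<in> N"
  using left_idealD(4)[of N "\<ominus> \<one>" x] left_idealD(1)[of N x] by (simp add: l_minus)

lemma add_monoid_regular: "a_inv (regular_module R) = a_inv R"
proof -
  have "m_inv (add_monoid (regular_module R)) = m_inv (add_monoid R)"
    by (simp add: fun_eq_iff m_inv_def regular_module_def)
  then show ?thesis by (simp add: a_inv_def fun_eq_iff)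
qed

lemma regular_abelian_group: "abelian_group (regular_module R)"
  by (rule abelian_groupI) (auto simp: a_ac intro: l_neg)

lemma left_ideal_submodule: "left_ideal N \<longleftrightarrow> submodule N R (regular_module R)"
proof
  assume N: "left_ideal N"
  show "submodule N R (regular_module R)"
  proof (intro submodule.intro subgroup.intro submodule_axioms.intro)
    fix x assume "x \<in> N"
    then show "inv\<^bsub>add_monoid (regular_module R)\<^esub> x \<in> N"
      using left_ideal_neg[OF N] add_monoid_regular by (simp add: a_inv_def)
  qed (use left_idealD[OF N] in auto)
next
  assume "submodule N R (regular_module R)"
  then interpret submodule N R "regular_module R" .
  show "left_ideal N"
    unfolding left_ideal_def
  proof (intro conjI ballI)
    show "N \<subseteq> carrier R" using subset by simp
    show "\<zero> \<in> N" using one_closed by simp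
    show "x \<oplus> y \<in> N" if "x \<in> N" "y \<in> N" for x y using m_closed[OF that] by simp
    show "a \<otimes> x \<in> N" if "a \<in> carrier R" "x \<in> N" for a x using smult_closed[OF that] by simp
  qed
qed

end

locale semisimple = ring R for R (structure) +
  assumes semisimple: "semisimple_ring R"
begin

text \<open>The component \<open>e\<close> of the unit in \<open>N\<close>, along a complement of \<open>N\<close>, is a right unit of \<open>N\<close>: both \<open>x e\<close> and
\<open>x\<close> are in \<open>N\<close>, so the component \<open>x (1 - e)\<close> of \<open>x\<close> in the complement is zero.\<close>
lemma left_ideal_complement:
  assumes N: "left_ideal N"
  obtains e N' where "left_ideal N'" "N \<inter> N' = {\<zero>}" "e \<in> N" "\<one> \<ominus> e \<in> N'"
    "\<And>x. x \<in> N \<Longrightarrow> x \<otimes> e = x"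
proof -
  obtain N' where N': "left_ideal N'" "N \<inter> N' = {\<zero>}" "N <+>\<^bsub>regular_module R\<^esub> N' = carrier R"
    using semisimple N unfolding semisimple_ring_def semisimple_module_def left_ideal_submodule by auto
  have "\<one> \<in> N <+>\<^bsub>regular_module R\<^esub> N'" using N'(3) by simp
  then obtain e e' where e: "e \<in> N" "e' \<in> N'" "\<one> = e \<oplus> e'" by (auto simp: set_add_def set_mult_def)
  have c: "e \<in> carrier R" "e' \<in> carrier R" using e left_idealD(1) N N'(1) by auto
  have e': "e' = \<one> \<ominus> e" using sum_eq_imp_eq_minus[OF c e(3)] .
  have "x \<otimes> e = x" if x: "x \<in> N" for x
  proof -
    have xc: "x \<in> carrier R" using x left_idealD(1)[OF N] by auto
    have eq: "x = x \<otimes> e \<oplus> x \<otimes> e'" using e(3)[symmetric] xc c r_distr[of e e' x] by simp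
    have "x \<otimes> e' \<in> N'" using left_idealD(4)[OF N'(1) xc e(2)] .
    moreover have "x \<otimes> e' = x \<oplus> \<ominus> (x \<otimes> e)"
      using sum_eq_imp_eq_minus[OF _ _ eq] xc c by (simp add: a_minus_def)
    then have "x \<otimes> e' \<in> N"
      using left_idealD(3)[OF N x left_ideal_neg[OF N left_idealD(4)[OF N xc e(1)]]] by simp
    ultimately have "x \<otimes> e' = \<zero>" using N'(2) by blast
    then show ?thesis using eq xc c by simp
  qed
  then show ?thesis using that N' e e' by blast
qed

text \<open>A right unit \<open>e\<close> of a two-sided ideal \<open>J\<close> is a left unit: the elements \<open>x - e x\<close> generate a
  left ideal of square zero, and such an ideal is zero as it has a right unit itself.\<close>
lemma ideal_central_idempotent:
  assumes J: "left_ideal J" and r: "\<And>a x. a \<in> carrier R \<Longrightarrow> x \<in> J \<Longrightarrow> x \<otimes> a \<in> J"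
  obtains e where "e \<in> J" "\<And>x. x \<in> J \<Longrightarrow> x \<otimes> e = x" "\<And>x. x \<in> J \<Longrightarrow> e \<otimes> x = x"
    "\<And>a. a \<in> carrier R \<Longrightarrow> e \<otimes> a = a \<otimes> e"
proof -
  obtain e where e: "e \<in> J" "\<And>x. x \<in> J \<Longrightarrow> x \<otimes> e = x" using left_ideal_complement[OF J] by metis
  have ec: "e \<in> carrier R" using e left_idealD(1)[OF J] by auto
  have l: "e \<otimes> x = x" if x: "x \<in> J" for x
  proof -
    have xc: "x \<in> carrier R" using x left_idealD(1)[OF J] by auto
    \<comment> \<open>The left ideal generated by \<open>z\<close> has square zero because \<open>J z = 0\<close>.\<close>
    define z where "z = x \<ominus> e \<otimes> x"
    have zc: "z \<in> carrier R" using xc ec by (simp add: z_def)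
    have zJ: "z \<in> J" unfolding z_def a_minus_def
      using left_idealD(3)[OF J x left_ideal_neg[OF J left_idealD(4)[OF J ec x]]] .
    have yz: "y \<otimes> z = \<zero>" if y: "y \<in> J" for y
    proof -
      have yc: "y \<in> carrier R" using y left_idealD(1)[OF J] by auto
      have "y \<otimes> z = y \<otimes> x \<ominus> (y \<otimes> e) \<otimes> x" using yc xc ec by (simp add: z_def a_minus_def r_distr r_minus m_assoc)
      then show ?thesis using e(2)[OF y] yc xc by (simp add: a_minus_def r_neg)
    qed
    define N where "N = (\<lambda>a. a \<otimes> z) ` carrier R"
    have N: "left_ideal N"
      unfolding left_ideal_def
    proof (intro conjI ballI)
      show "N \<subseteq> carrier R" using zc by (auto simp: N_def)
      show "\<zero> \<in> N" using zc by (auto simp: N_def intro!: image_eqI[of _ _ \<zero>])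
      show "u \<oplus> v \<in> N" if uv: "u \<in> N" "v \<in> N" for u v
      proof -
        obtain a b where "a \<in> carrier R" "b \<in> carrier R" "u = a \<otimes> z" "v = b \<otimes> z" using uv by (auto simp: N_def)
        then show ?thesis using zc by (auto simp: N_def l_distr intro!: image_eqI[of _ _ "a \<oplus> b"])
      qed
      show "a \<otimes> u \<in> N" if au: "a \<in> carrier R" "u \<in> N" for a u
      proof -
        obtain b where "b \<in> carrier R" "u = b \<otimes> z" using au by (auto simp: N_def)
        then show ?thesis using zc au by (auto simp: N_def m_assoc intro!: image_eqI[of _ _ "a \<otimes> b"])
      qed
    qed
    obtain f where f: "f \<in> N" "\<And>x. x \<in> N \<Longrightarrow> x \<otimes> f = x" using left_ideal_complement[OF N] by metis
    obtain b where b: "b \<in> carrier R" "f = b \<otimes> z" using f(1) by (auto simp: N_def)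
    have zN: "z \<in> N" using zc by (auto simp: N_def intro!: image_eqI[of _ _ \<one>])
    have "z = (z \<otimes> b) \<otimes> z" using f(2)[OF zN] b zc by (simp add: m_assoc)
    also have "\<dots> = \<zero>" using yz r[OF b(1) zJ] by simp
    finally have "x \<ominus> e \<otimes> x = \<zero>" by (simp add: z_def)
    then show ?thesis using xc ec eq_if_minus_zero[of x "e \<otimes> x"] by simp
  qed
  have "e \<otimes> a = a \<otimes> e" if a: "a \<in> carrier R" for a
    using e(2)[OF r[OF a e(1)]] l[OF left_idealD(4)[OF J a e(1)]] a ec by (simp add: m_assoc)
  then show ?thesis using that e l by blast
qed

end

section \<open>Bilinear maps and tensor products\<close>

definition bilinear ::
  "('k, 'q) ring_scheme \<Rightarrow> ('k, 'v, 'p) module_scheme \<Rightarrow> ('k, 'w, 's) module_scheme \<Rightarrow>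
   ('k, 'u, 't) module_scheme \<Rightarrow> ('v \<Rightarrow> 'w \<Rightarrow> 'u) \<Rightarrow> bool" where
  "bilinear K V W U \<beta> \<longleftrightarrow> (\<forall>v\<in>carrier V. (\<lambda>w. \<beta> v w) \<in> module_hom K W U) \<and>
     (\<forall>w\<in>carrier W. (\<lambda>v. \<beta> v w) \<in> module_hom K V U)"

lemma bilinearI:
  assumes "\<And>v. v \<in> carrier V \<Longrightarrow> (\<lambda>w. \<beta> v w) \<in> module_hom K W U"
    and "\<And>w. w \<in> carrier W \<Longrightarrow> (\<lambda>v. \<beta> v w) \<in> module_hom K V U"
  shows "bilinear K V W U \<beta>"
  using assms by (auto simp: bilinear_def)

lemma bilinearD:
  assumes "bilinear K V W U \<beta>"
  shows "v \<in> carrier V \<Longrightarrow> (\<lambda>w. \<beta> v w) \<in> module_hom K W U"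
    and "w \<in> carrier W \<Longrightarrow> (\<lambda>v. \<beta> v w) \<in> module_hom K V U"
    and "v \<in> carrier V \<Longrightarrow> w \<in> carrier W \<Longrightarrow> \<beta> v w \<in> carrier U"
  using assms by (auto simp: bilinear_def dest: module_hom_closed)

lemma module_hom_cong':
  assumes "module K V" "f \<in> module_hom K V U" "\<And>x. x \<in> carrier V \<Longrightarrow> f x = g x"
  shows "g \<in> module_hom K V U"
proof -
  interpret V: module K V by fact
  show ?thesis by (rule module_hom_cong[OF assms(2)]) (use assms(3) V.abelian_group_axioms in auto)
qed

lemma bilinear_cong:
  assumes "module K V" "module K W" "bilinear K V W U \<beta>"
    and "\<And>v w. v \<in> carrier V \<Longrightarrow> w \<in> carrier W \<Longrightarrow> \<beta> v w = \<beta>' v w"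
  shows "bilinear K V W U \<beta>'"
  using module_hom_cong'[OF assms(1) bilinearD(2)[OF assms(3)]]
    module_hom_cong'[OF assms(2) bilinearD(1)[OF assms(3)]] assms(4)
  by (intro bilinearI) auto

lemma bilinear_comp:
  assumes "bilinear K V W U \<beta>" "g \<in> module_hom K U U'"
  shows "bilinear K V W U' (\<lambda>x y. g (\<beta> x y))"
  using module_hom_comp[OF assms(2) bilinearD(1)[OF assms(1)]]
    module_hom_comp[OF assms(2) bilinearD(2)[OF assms(1)]]
  by (intro bilinearI) auto

lemma module_hom_a_minus:
  assumes f: "f \<in> module_hom R V W" and V: "abelian_group V" and W: "abelian_group W"
    and v: "u \<in> carrier V" "v \<in> carrier V"
  shows "f (u \<ominus>\<^bsub>V\<^esub> v) = f u \<ominus>\<^bsub>W\<^esub> f v"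
proof -
  interpret V: abelian_group V by fact
  show ?thesis using v module_hom_minus[OF f V W v(2)] module_hom_add[OF f, of u "\<ominus>\<^bsub>V\<^esub> v"]
    by (simp add: a_minus_def)
qed

context cring begin

text \<open>All relations that define tensor products and tensor powers have the form \<open>e\<^sub>x - f\<close>.  Such a relation is
respected by \<open>\<beta>\<close> if \<open>f\<close> evaluates to \<open>\<beta> x\<close>, and it identifies the generator \<open>x\<close> with the class of \<open>f\<close>.\<close>
lemma evaluation_relation:
  assumes U: "module R U" and b: "\<beta> \<in> X \<rightarrow> carrier U" and x: "x \<in> X"
    and f: "f \<in> carrier (free_module R X)" and eq: "\<beta> x = evaluation R U \<beta> f"
  shows "evaluation R U \<beta> (single R x \<ominus>\<^bsub>free_module R X\<^esub> f) = \<zero>\<^bsub>U\<^esub>"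
proof -
  interpret U: module R U by fact
  interpret F: module R "free_module R X" by (rule free_module_module)
  have "evaluation R U \<beta> (single R x \<ominus>\<^bsub>free_module R X\<^esub> f) = \<beta> x \<ominus>\<^bsub>U\<^esub> evaluation R U \<beta> f"
    using module_hom_a_minus[OF evaluation_hom[OF U b] F.M.abelian_group_axioms U.M.abelian_group_axioms
        single_closed[OF x] f] evaluation_single[OF U b x] by simp
  also have "\<dots> = \<zero>\<^bsub>U\<^esub>"
    unfolding eq[symmetric] a_minus_def by (rule U.M.r_neg) (rule funcset_mem[OF b x])
  finally show ?thesis .
qed

lemma generator_relation:
  assumes r: "r \<subseteq> carrier (free_module R X)" and x: "x \<in> X" and f: "f \<in> carrier (free_module R X)"
    and rel: "single R x \<ominus>\<^bsub>free_module R X\<^esub> f \<in> r"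
  shows "generator R X r x = span_rel R X r +>\<^bsub>free_module R X\<^esub> f"
proof -
  interpret F: module R "free_module R X" by (rule free_module_module)
  interpret P: module R "presented_module R X r" by (rule presented_module_module[OF r])
  have "generator R X r x \<ominus>\<^bsub>presented_module R X r\<^esub> (span_rel R X r +>\<^bsub>free_module R X\<^esub> f)
      = \<zero>\<^bsub>presented_module R X r\<^esub>"
    using module_hom_a_minus[OF presented_proj[OF r] F.M.abelian_group_axioms P.M.abelian_group_axioms
        single_closed[OF x] f] presented_rel_zero[OF r rel] by (simp add: generator_def)
  then show ?thesis
    by (rule P.M.eq_if_minus_zero[OF generator_closed[OF r x] module_hom_closed[OF presented_proj[OF r] f]])
qed

lemma presented_proj_ops:
  assumes r: "r \<subseteq> carrier (free_module R X)" and x: "x \<in> X"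
  shows "y \<in> X \<Longrightarrow> span_rel R X r +>\<^bsub>free_module R X\<^esub> (single R x \<oplus>\<^bsub>free_module R X\<^esub> single R y)
      = generator R X r x \<oplus>\<^bsub>presented_module R X r\<^esub> generator R X r y"
    and "c \<in> carrier R \<Longrightarrow> span_rel R X r +>\<^bsub>free_module R X\<^esub> (c \<odot>\<^bsub>free_module R X\<^esub> single R x)
      = c \<odot>\<^bsub>presented_module R X r\<^esub> generator R X r x"
  using module_hom_add[OF presented_proj[OF r] single_closed[OF x] single_closed]
    module_hom_smult[OF presented_proj[OF r] _ single_closed[OF x]]
  by (simp_all add: generator_def)

lemma evaluation_ops:
  assumes U: "module R U" and b: "\<beta> \<in> X \<rightarrow> carrier U" and x: "x \<in> X"
  shows "y \<in> X \<Longrightarrow> evaluation R U \<beta> (single R x \<oplus>\<^bsub>free_module R X\<^esub> single R y) = \<beta> x \<oplus>\<^bsub>U\<^esub> \<beta> y"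
    and "c \<in> carrier R \<Longrightarrow> evaluation R U \<beta> (c \<odot>\<^bsub>free_module R X\<^esub> single R x) = c \<odot>\<^bsub>U\<^esub> \<beta> x"
  using module_hom_add[OF evaluation_hom[OF U b] single_closed[OF x] single_closed]
    module_hom_smult[OF evaluation_hom[OF U b] _ single_closed[OF x]]
  by (simp_all add: evaluation_single[OF U b] x)

text \<open>On a fixed formal sum, \<^const>\<open>lift\<close> is a fixed linear combination of values of \<open>\<beta>\<close>.\<close>
lemma lift_hom_param:
  assumes r: "r \<subseteq> carrier (free_module R X)" and U: "module R U"
    and b: "\<And>v. v \<in> carrier V \<Longrightarrow> compatible X r U (\<beta> v)" and V: "module R V"
    and lin: "\<And>x. x \<in> X \<Longrightarrow> (\<lambda>v. \<beta> v x) \<in> module_hom R V U"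
    and t: "t \<in> carrier (presented_module R X r)"
  shows "(\<lambda>v. lift R U (\<beta> v) t) \<in> module_hom R V U"
proof -
  interpret U: module R U by fact
  obtain f where f: "f \<in> carrier (free_module R X)" "t = span_rel R X r +>\<^bsub>free_module R X\<^esub> f"
    using t by (auto simp: presented_carrier[OF r])
  have "(\<lambda>v. evaluation R U (\<beta> v) f) \<in> module_hom R V U"
    using free_moduleD[OF f(1)] by (intro U.module_hom_finsumf U.module_hom_smultf lin) auto
  then show ?thesis
    by (rule module_hom_cong'[OF V]) (use lift_coset[OF r U b f(1)] f(2) in simp)
qed

context
  fixes V :: "('a, 'v, 'p) module_scheme" and W :: "('a, 'w, 's) module_scheme"
  assumes V: "module R V" and W: "module R W"
begin

interpretation V: module R V by (rule V)
interpretation W: module R W by (rule W)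

lemma tensor_rel_subset: "tensor_rel R V W \<subseteq> carrier (free_module R (carrier V \<times> carrier W))"
proof -
  interpret F: module R "free_module R (carrier V \<times> carrier W)" by (rule free_module_module)
  show ?thesis
    unfolding tensor_rel_def Let_def
    by (auto intro!: F.M.minus_closed F.M.a_closed F.smult_closed single_closed)
qed

lemma bilinear_compatible:
  assumes U: "module R U" and b: "bilinear R V W U \<beta>"
  shows "compatible (carrier V \<times> carrier W) (tensor_rel R V W) U (\<lambda>(x, y). \<beta> x y)"
proof -
  interpret F: module R "free_module R (carrier V \<times> carrier W)" by (rule free_module_module)
  note bD = bilinearD[OF b]
  have c: "(\<lambda>(x, y). \<beta> x y) \<in> carrier V \<times> carrier W \<rightarrow> carrier U" using bD(3) by auto
  note ops = evaluation_ops[OF U c]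
  have s: "single R (v, w) \<in> carrier (free_module R (carrier V \<times> carrier W))"
    if "v \<in> carrier V" "w \<in> carrier W" for v w using that by (intro single_closed) auto
  note rel = evaluation_relation[OF U c]
  show ?thesis
    unfolding compatible_def
  proof (intro conjI c ballI)
    fix \<rho> assume "\<rho> \<in> tensor_rel R V W"
    then show "evaluation R U (\<lambda>(x, y). \<beta> x y) \<rho> = \<zero>\<^bsub>U\<^esub>"
      unfolding tensor_rel_def Let_def Un_iff mem_Collect_eq
    proof (elim disjE exE conjE, goal_cases)
      case (1 v v' w)
      show ?case unfolding 1(1)
        by (rule rel) (use 1 ops s module_hom_add[OF bD(2)] F.M.a_closed in \<open>simp_all\<close>)
    next
      case (2 v w w')
      show ?case unfolding 2(1)
        by (rule rel) (use 2 ops s module_hom_add[OF bD(1)] F.M.a_closed in \<open>simp_all\<close>)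
    next
      case (3 c v w)
      show ?case unfolding 3(1)
        by (rule rel) (use 3 ops s module_hom_smult[OF bD(2)] F.smult_closed in \<open>simp_all\<close>)
    next
      case (4 c v w)
      show ?case unfolding 4(1)
        by (rule rel) (use 4 ops s module_hom_smult[OF bD(1)] F.smult_closed in \<open>simp_all\<close>)
    qed
  qed
qed

lemma tensor_module: "module R (tensor R V W)"
  unfolding tensor_def by (rule presented_module_module[OF tensor_rel_subset])

lemma pure_bilinear: "bilinear R V W (tensor R V W) (pure R V W)"
proof -
  interpret F: module R "free_module R (carrier V \<times> carrier W)" by (rule free_module_module)
  have s: "single R (v, w) \<in> carrier (free_module R (carrier V \<times> carrier W))"
    if "v \<in> carrier V" "w \<in> carrier W" for v w using that by (intro single_closed) auto
  note ops = presented_proj_ops[OF tensor_rel_subset, symmetric]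
  note rel = generator_relation[OF tensor_rel_subset]
  note defs = tensor_def pure_def
  have cl: "pure R V W v w \<in> carrier (tensor R V W)" if "v \<in> carrier V" "w \<in> carrier W" for v w
    unfolding defs using that by (intro generator_closed[OF tensor_rel_subset]) auto
  have 1: "single R (v \<oplus>\<^bsub>V\<^esub> v', w) \<ominus>\<^bsub>free_module R (carrier V \<times> carrier W)\<^esub>
      (single R (v, w) \<oplus>\<^bsub>free_module R (carrier V \<times> carrier W)\<^esub> single R (v', w)) \<in> tensor_rel R V W"
    if "v \<in> carrier V" "v' \<in> carrier V" "w \<in> carrier W" for v v' w
    using that unfolding tensor_rel_def Let_def by blast
  have 2: "single R (v, w \<oplus>\<^bsub>W\<^esub> w') \<ominus>\<^bsub>free_module R (carrier V \<times> carrier W)\<^esub>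
      (single R (v, w) \<oplus>\<^bsub>free_module R (carrier V \<times> carrier W)\<^esub> single R (v, w')) \<in> tensor_rel R V W"
    if "v \<in> carrier V" "w' \<in> carrier W" "w \<in> carrier W" for v w w'
    using that unfolding tensor_rel_def Let_def by blast
  have 3: "single R (c \<odot>\<^bsub>V\<^esub> v, w) \<ominus>\<^bsub>free_module R (carrier V \<times> carrier W)\<^esub>
      (c \<odot>\<^bsub>free_module R (carrier V \<times> carrier W)\<^esub> single R (v, w)) \<in> tensor_rel R V W"
    if "v \<in> carrier V" "c \<in> carrier R" "w \<in> carrier W" for v c w
    using that unfolding tensor_rel_def Let_def by blast
  have 4: "single R (v, c \<odot>\<^bsub>W\<^esub> w) \<ominus>\<^bsub>free_module R (carrier V \<times> carrier W)\<^esub>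
      (c \<odot>\<^bsub>free_module R (carrier V \<times> carrier W)\<^esub> single R (v, w)) \<in> tensor_rel R V W"
    if "v \<in> carrier V" "c \<in> carrier R" "w \<in> carrier W" for v c w
    using that unfolding tensor_rel_def Let_def by blast
  show ?thesis
  proof (intro bilinearI module_homI cl)
    fix v w w' assume "v \<in> carrier V" "w \<in> carrier W" "w' \<in> carrier W"
    then show "pure R V W v (w \<oplus>\<^bsub>W\<^esub> w') = pure R V W v w \<oplus>\<^bsub>tensor R V W\<^esub> pure R V W v w'"
      unfolding defs by (simp add: rel[OF _ _ 2] ops s F.M.a_closed)
  next
    fix v v' w assume "v \<in> carrier V" "w \<in> carrier W" "v' \<in> carrier V"
    then show "pure R V W (v \<oplus>\<^bsub>V\<^esub> v') w = pure R V W v w \<oplus>\<^bsub>tensor R V W\<^esub> pure R V W v' w"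
      unfolding defs by (simp add: rel[OF _ _ 1] ops s F.M.a_closed)
  next
    fix v c w assume "v \<in> carrier V" "c \<in> carrier R" "w \<in> carrier W"
    then show "pure R V W (c \<odot>\<^bsub>V\<^esub> v) w = c \<odot>\<^bsub>tensor R V W\<^esub> pure R V W v w"
      unfolding defs by (simp add: rel[OF _ _ 3] ops s F.smult_closed)
  next
    fix v c w assume "v \<in> carrier V" "c \<in> carrier R" "w \<in> carrier W"
    then show "pure R V W v (c \<odot>\<^bsub>W\<^esub> w) = c \<odot>\<^bsub>tensor R V W\<^esub> pure R V W v w"
      unfolding defs by (simp add: rel[OF _ _ 4] ops s F.smult_closed)
  qed auto
qed

lemma tensor_lift_hom:
  assumes "module R U" "bilinear R V W U \<beta>"
  shows "lift R U (\<lambda>(x, y). \<beta> x y) \<in> module_hom R (tensor R V W) U"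
  unfolding tensor_def by (rule lift_hom[OF tensor_rel_subset assms(1) bilinear_compatible[OF assms]])

lemma tensor_lift_pure:
  assumes "module R U" "bilinear R V W U \<beta>" "v \<in> carrier V" "w \<in> carrier W"
  shows "lift R U (\<lambda>(x, y). \<beta> x y) (pure R V W v w) = \<beta> v w"
  unfolding pure_def
  using lift_generator[OF tensor_rel_subset assms(1) bilinear_compatible[OF assms(1,2)], of "(v, w)"] assms(3,4)
  by simp

lemma tensor_lift_hom_param:
  assumes "module R U" "module R V'" "\<And>v. v \<in> carrier V' \<Longrightarrow> bilinear R V W U (\<beta> v)"
    and "\<And>x y. x \<in> carrier V \<Longrightarrow> y \<in> carrier W \<Longrightarrow> (\<lambda>v. \<beta> v x y) \<in> module_hom R V' U"
    and "t \<in> carrier (tensor R V W)"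
  shows "(\<lambda>v. lift R U (\<lambda>(x, y). \<beta> v x y) t) \<in> module_hom R V' U"
  by (rule lift_hom_param[OF tensor_rel_subset assms(1) bilinear_compatible[OF assms(1,3)] assms(2)])
    (use assms(4,5) in \<open>auto simp: tensor_def\<close>)

lemma tensor_hom_eq:
  assumes "module R U" "g \<in> module_hom R (tensor R V W) U" "h \<in> module_hom R (tensor R V W) U"
    and "\<And>v w. v \<in> carrier V \<Longrightarrow> w \<in> carrier W \<Longrightarrow> g (pure R V W v w) = h (pure R V W v w)"
    and "t \<in> carrier (tensor R V W)"
  shows "g t = h t"
  by (rule hom_eq_on_generators[OF tensor_rel_subset assms(1)])
    (use assms(2-) in \<open>auto simp: tensor_def pure_def\<close>)

end

lemma regular_module_module: "module R (regular_module R)"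
  by (rule moduleI) (auto simp: regular_abelian_group l_distr r_distr m_assoc is_cring)

end

section \<open>Sweedler notation\<close>

context hopf_algebra begin

abbreviation KK where "KK \<equiv> regular_module K"
abbreviation sw where "sw \<equiv> sweedler K \<Delta>"
abbreviation lin where "lin \<equiv> module_hom K"
abbreviation mult_A (infixl "\<bullet>" 70) where "x \<bullet> y \<equiv> x \<otimes>\<^bsub>A\<^esub> y"
abbreviation mult_K (infixl "\<ast>" 70) where "x \<ast> y \<equiv> x \<otimes>\<^bsub>K\<^esub> y"

lemma A_module: "module K A" ..
lemma KK_module: "module K KK" by (rule K.regular_module_module)
lemma AA_module: "module K (tensor K A A)" by (rule K.tensor_module[OF A_module A_module])

lemma comult_closed: "a \<in> carrier A \<Longrightarrow> \<Delta> a \<in> carrier (tensor K A A)"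
  by (rule module_hom_closed[OF comult_linear])

lemma sw_hom:
  assumes "module K U" "bilinear K A A U \<beta>" "f \<in> lin X A"
  shows "(\<lambda>x. sw U \<beta> (f x)) \<in> lin X U"
  unfolding sweedler_def
  by (rule module_hom_comp[OF K.tensor_lift_hom[OF A_module A_module assms(1,2)]
        module_hom_comp[OF comult_linear assms(3)]])

lemma sw_closed:
  assumes "module K U" "bilinear K A A U \<beta>" "a \<in> carrier A"
  shows "sw U \<beta> a \<in> carrier U"
  using module_hom_closed[OF sw_hom[OF assms(1,2) module_hom_ident] assms(3)] .

lemma sw_hom_param:
  assumes "module K U" "module K X" "a \<in> carrier A"
    and "\<And>x. x \<in> carrier X \<Longrightarrow> bilinear K A A U (\<beta> x)"
    and "\<And>p q. p \<in> carrier A \<Longrightarrow> q \<in> carrier A \<Longrightarrow> (\<lambda>x. \<beta> x p q) \<in> lin X U"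
  shows "(\<lambda>x. sw U (\<lambda>p q. \<beta> x p q) a) \<in> lin X U"
  unfolding sweedler_def
  by (rule K.tensor_lift_hom_param[OF A_module A_module]) (use assms comult_closed in auto)

lemma lift_eq:
  assumes "module K U" "module K W" "bilinear K A A U \<beta>" "g \<in> lin U W" "t \<in> carrier (tensor K A A)"
  shows "g (lift K U (\<lambda>(x, y). \<beta> x y) t) = lift K W (\<lambda>(x, y). g (\<beta> x y)) t"
  by (rule K.tensor_hom_eq[OF A_module A_module assms(2) module_hom_comp[OF assms(4)
        K.tensor_lift_hom[OF A_module A_module assms(1,3)]]
        K.tensor_lift_hom[OF A_module A_module assms(2) bilinear_comp[OF assms(3,4)]] _ assms(5)])
    (simp add: K.tensor_lift_pure[OF A_module A_module assms(1,3)]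
        K.tensor_lift_pure[OF A_module A_module assms(2) bilinear_comp[OF assms(3,4)]])

text \<open>Both sides are linear in \<open>\<Delta> a\<close> and agree on pure tensors.\<close>
lemma sw_apply:
  assumes "module K U" "module K W" "bilinear K A A U \<beta>" "g \<in> lin U W" "a \<in> carrier A"
  shows "g (sw U \<beta> a) = sw W (\<lambda>x y. g (\<beta> x y)) a"
  unfolding sweedler_def by (rule lift_eq[OF assms(1-4) comult_closed[OF assms(5)]])

lemma sw_cong:
  assumes "module K U" "bilinear K A A U \<beta>" "a \<in> carrier A"
    and eq: "\<And>x y. x \<in> carrier A \<Longrightarrow> y \<in> carrier A \<Longrightarrow> \<beta> x y = \<beta>' x y"
  shows "sw U \<beta> a = sw U \<beta>' a"
proof -
  have b': "bilinear K A A U \<beta>'" by (rule bilinear_cong[OF A_module A_module assms(2) eq])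
  show ?thesis
    unfolding sweedler_def
    by (rule K.tensor_hom_eq[OF A_module A_module assms(1) K.tensor_lift_hom[OF A_module A_module assms(1,2)]
          K.tensor_lift_hom[OF A_module A_module assms(1) b'] _ comult_closed[OF assms(3)]])
      (simp add: K.tensor_lift_pure[OF A_module A_module assms(1,2)]
        K.tensor_lift_pure[OF A_module A_module assms(1) b'] eq)
qed

text \<open>The rules \<open>lin_intros\<close> prove linearity and bilinearity of an expression by following its structure.\<close>

lemma lin_smult: "module K U \<Longrightarrow> f \<in> lin X KK \<Longrightarrow> u \<in> carrier U \<Longrightarrow> (\<lambda>x. f x \<odot>\<^bsub>U\<^esub> u) \<in> lin X U"
proof -
  assume U: "module K U" and f: "f \<in> lin X KK" and u: "u \<in> carrier U"
  interpret U: module K U by fact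
  show ?thesis using u module_homD[OF f]
    by (intro module_homI) (simp_all add: U.smult_l_distr U.smult_assoc1)
qed

lemma lin_smultr: "module K U \<Longrightarrow> f \<in> lin X U \<Longrightarrow> k \<in> carrier K \<Longrightarrow> (\<lambda>x. k \<odot>\<^bsub>U\<^esub> f x) \<in> lin X U"
  by (rule module.module_hom_smultf)

lemma lin_mult_left: "f \<in> lin X A \<Longrightarrow> a \<in> carrier A \<Longrightarrow> (\<lambda>x. f x \<bullet> a) \<in> lin X A"
  by (intro module_homI) (simp_all add: module_homD[of f] A.l_distr smult_mult_left)

lemma lin_mult_right: "f \<in> lin X A \<Longrightarrow> a \<in> carrier A \<Longrightarrow> (\<lambda>x. a \<bullet> f x) \<in> lin X A"
  by (intro module_homI) (simp_all add: module_homD[of f] A.r_distr smult_mult_right)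

lemma lin_K_mult_left: "f \<in> lin X KK \<Longrightarrow> k \<in> carrier K \<Longrightarrow> (\<lambda>x. f x \<ast> k) \<in> lin X KK"
  using lin_smult[OF KK_module] by simp

lemma lin_K_mult_right: "f \<in> lin X KK \<Longrightarrow> k \<in> carrier K \<Longrightarrow> (\<lambda>x. k \<ast> f x) \<in> lin X KK"
  using lin_smultr[OF KK_module] by simp

lemma counit_lin: "\<epsilon> \<in> lin A KK"
  using counit_ring_hom counit_smult by (intro module_homI) (auto simp: ring_hom_def)

lemma lin_counit: "f \<in> lin X A \<Longrightarrow> (\<lambda>x. \<epsilon> (f x)) \<in> lin X KK"
  by (rule module_hom_comp[OF counit_lin])

lemma lin_antipode: "f \<in> lin X A \<Longrightarrow> (\<lambda>x. S (f x)) \<in> lin X A"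
  by (rule module_hom_comp[OF antipode_linear])

lemma counit_closed [simp]: "a \<in> carrier A \<Longrightarrow> \<epsilon> a \<in> carrier K"
  using module_hom_closed[OF counit_lin] by simp

lemma antipode_closed [simp]: "a \<in> carrier A \<Longrightarrow> S a \<in> carrier A"
  using module_hom_closed[OF antipode_linear] by simp

lemma counit_one [simp]: "\<epsilon> \<one>\<^bsub>A\<^esub> = \<one>\<^bsub>K\<^esub>"
  using counit_ring_hom by (simp add: ring_hom_def)

lemma counit_mult: "a \<in> carrier A \<Longrightarrow> b \<in> carrier A \<Longrightarrow> \<epsilon> (a \<bullet> b) = \<epsilon> a \<ast> \<epsilon> b"
  using counit_ring_hom by (simp add: ring_hom_def)

lemmas lin_intros = module_hom_ident lin_mult_left lin_mult_right lin_K_mult_left lin_K_mult_right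
  lin_smult lin_smultr lin_counit lin_antipode bilinearI sw_hom sw_hom_param sw_closed
  A_module KK_module

section \<open>The axioms of a Hopf algebra in Sweedler notation\<close>

lemma sw_one:
  assumes "module K U" "bilinear K A A U \<beta>"
  shows "sw U \<beta> \<one>\<^bsub>A\<^esub> = \<beta> \<one>\<^bsub>A\<^esub> \<one>\<^bsub>A\<^esub>"
  unfolding sweedler_def comult_one
  by (rule K.tensor_lift_pure[OF A_module A_module assms]) auto

lemma pure_lin: "bilinear K A A (tensor K A A) (pure K A A)"
  by (rule K.pure_bilinear[OF A_module A_module])

lemma pure_lin1: "f \<in> lin X A \<Longrightarrow> y \<in> carrier A \<Longrightarrow> (\<lambda>x. pure K A A (f x) y) \<in> lin X (tensor K A A)"
  by (rule module_hom_comp[OF bilinearD(2)[OF pure_lin]])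

lemma pure_lin2: "f \<in> lin X A \<Longrightarrow> y \<in> carrier A \<Longrightarrow> (\<lambda>x. pure K A A y (f x)) \<in> lin X (tensor K A A)"
  by (rule module_hom_comp[OF bilinearD(1)[OF pure_lin]])

text \<open>The linear map induced by \<open>\<beta>\<close> on \<open>A \<otimes> A\<close>, applied to the multiplicativity axiom.\<close>
lemma sw_mult:
  assumes U: "module K U" and b: "bilinear K A A U \<beta>" and a: "a \<in> carrier A" "b \<in> carrier A"
  shows "sw U \<beta> (a \<bullet> b) =
    sw U (\<lambda>a1 a2. sw U (\<lambda>b1 b2. \<beta> (a1 \<bullet> b1) (a2 \<bullet> b2)) b) a"
proof -
  let ?G = "lift K U (\<lambda>(x, y). \<beta> x y)"
  have G: "?G \<in> lin (tensor K A A) U" by (rule K.tensor_lift_hom[OF A_module A_module U b])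
  note i = lin_intros pure_lin1 pure_lin2 AA_module A.m_closed a
  have b2: "bilinear K A A (tensor K A A)
      (\<lambda>b1 b2. pure K A A (a1 \<bullet> b1) (a2 \<bullet> b2))" if "a1 \<in> carrier A" "a2 \<in> carrier A" for a1 a2
    using that by (intro i)
  have b1: "bilinear K A A (tensor K A A)
      (\<lambda>a1 a2. sw (tensor K A A) (\<lambda>b1 b2. pure K A A (a1 \<bullet> b1) (a2 \<bullet> b2)) b)"
    by (intro i)
  have "sw U \<beta> (a \<bullet> b) = ?G (sw (tensor K A A)
      (\<lambda>a1 a2. sw (tensor K A A) (\<lambda>b1 b2. pure K A A (a1 \<bullet> b1) (a2 \<bullet> b2)) b) a)"
    unfolding sweedler_def[of K \<Delta> U] comult_mult[OF a] ..
  also have "\<dots> = sw U (\<lambda>a1 a2. ?G (sw (tensor K A A) (\<lambda>b1 b2. pure K A A (a1 \<bullet> b1) (a2 \<bullet> b2)) b)) a"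
    by (rule sw_apply[OF AA_module U b1 G a(1)])
  also have "\<dots> = sw U (\<lambda>a1 a2. sw U (\<lambda>b1 b2. \<beta> (a1 \<bullet> b1) (a2 \<bullet> b2)) b) a"
  proof (rule sw_cong[OF U bilinear_comp[OF b1 G] a(1)])
    fix a1 a2 assume a12: "a1 \<in> carrier A" "a2 \<in> carrier A"
    have "?G (sw (tensor K A A) (\<lambda>b1 b2. pure K A A (a1 \<bullet> b1) (a2 \<bullet> b2)) b)
      = sw U (\<lambda>b1 b2. ?G (pure K A A (a1 \<bullet> b1) (a2 \<bullet> b2))) b"
      by (rule sw_apply[OF AA_module U b2[OF a12] G a(2)])
    also have "\<dots> = sw U (\<lambda>b1 b2. \<beta> (a1 \<bullet> b1) (a2 \<bullet> b2)) b"
      by (rule sw_cong[OF U bilinear_comp[OF b2[OF a12] G] a(2)])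
        (use a12 in \<open>simp add: K.tensor_lift_pure[OF A_module A_module U b]\<close>)
    finally show "?G (sw (tensor K A A) (\<lambda>b1 b2. pure K A A (a1 \<bullet> b1) (a2 \<bullet> b2)) b)
      = sw U (\<lambda>b1 b2. \<beta> (a1 \<bullet> b1) (a2 \<bullet> b2)) b" .
  qed
  finally show ?thesis .
qed

text \<open>The trilinear map \<open>\<gamma>\<close> induces a linear map on \<open>A \<otimes> (A \<otimes> A)\<close>, which is applied to the coassociativity
axiom.\<close>
lemma sw_coassoc:
  assumes U: "module K U" and a: "a \<in> carrier A"
    and g23: "\<And>x. x \<in> carrier A \<Longrightarrow> bilinear K A A U (\<gamma> x)"
    and g1: "\<And>y z. y \<in> carrier A \<Longrightarrow> z \<in> carrier A \<Longrightarrow> (\<lambda>x. \<gamma> x y z) \<in> lin A U"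
  shows "sw U (\<lambda>x y. sw U (\<lambda>u v. \<gamma> u v y) x) a = sw U (\<lambda>x y. sw U (\<lambda>u v. \<gamma> x u v) y) a"
proof -
  let ?T = "tensor K A (tensor K A A)"
  let ?p = "pure K A (tensor K A A)"
  have T: "module K ?T" by (rule K.tensor_module[OF A_module AA_module])
  define h where "h = (\<lambda>x. lift K U (\<lambda>(y, z). \<gamma> x y z))"
  have h1: "h x \<in> lin (tensor K A A) U" if "x \<in> carrier A" for x
    unfolding h_def by (rule K.tensor_lift_hom[OF A_module A_module U g23[OF that]])
  have h2: "(\<lambda>x. h x t) \<in> lin A U" if "t \<in> carrier (tensor K A A)" for t
    unfolding h_def by (rule K.tensor_lift_hom_param[OF A_module A_module U A_module g23 g1 that])
  have hb: "bilinear K A (tensor K A A) U h" using h1 h2 by (intro bilinearI)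
  let ?G = "lift K U (\<lambda>(x, t). h x t)"
  have G: "?G \<in> lin ?T U" by (rule K.tensor_lift_hom[OF A_module AA_module U hb])
  have pb: "bilinear K A (tensor K A A) ?T ?p" by (rule K.pure_bilinear[OF A_module AA_module])
  have Gp: "?G (?p x t) = h x t" if "x \<in> carrier A" "t \<in> carrier (tensor K A A)" for x t
    using that by (rule K.tensor_lift_pure[OF A_module AA_module U hb])
  have hp: "h x (pure K A A y z) = \<gamma> x y z" if "x \<in> carrier A" "y \<in> carrier A" "z \<in> carrier A" for x y z
    unfolding h_def using that by (intro K.tensor_lift_pure[OF A_module A_module U g23])
  have pc: "pure K A A x y \<in> carrier (tensor K A A)" if "x \<in> carrier A" "y \<in> carrier A" for x y
    using that bilinearD(3)[OF pure_lin] by blast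
  note i = lin_intros pure_lin1 pure_lin2 AA_module T module_hom_comp[OF bilinearD(2)[OF pb]]
    module_hom_comp[OF bilinearD(1)[OF pb]] pc
  have b2: "bilinear K A A ?T (\<lambda>x y. ?p x (pure K A A y a2))" if "a2 \<in> carrier A" for a2
    using that by (intro i)
  have b1: "bilinear K A A ?T (\<lambda>a1 a2. sw ?T (\<lambda>x y. ?p x (pure K A A y a2)) a1)"
    by (intro i)
  have r1: "bilinear K A A ?T (\<lambda>a1 a2. ?p a1 (\<Delta> a2))"
    by (intro bilinearI module_hom_comp[OF bilinearD(1)[OF pb] comult_linear] bilinearD(2)[OF pb] comult_closed)
  have "?G (sw ?T (\<lambda>a1 a2. sw ?T (\<lambda>x y. ?p x (pure K A A y a2)) a1) a)
    = sw U (\<lambda>a1 a2. ?G (sw ?T (\<lambda>x y. ?p x (pure K A A y a2)) a1)) a"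
    by (rule sw_apply[OF T U b1 G a])
  also have "\<dots> = sw U (\<lambda>x y. sw U (\<lambda>u v. \<gamma> u v y) x) a"
  proof (rule sw_cong[OF U bilinear_comp[OF b1 G] a])
    fix a1 a2 assume a12: "a1 \<in> carrier A" "a2 \<in> carrier A"
    have "?G (sw ?T (\<lambda>x y. ?p x (pure K A A y a2)) a1) = sw U (\<lambda>x y. ?G (?p x (pure K A A y a2))) a1"
      by (rule sw_apply[OF T U b2[OF a12(2)] G a12(1)])
    also have "\<dots> = sw U (\<lambda>u v. \<gamma> u v a2) a1"
      by (rule sw_cong[OF U bilinear_comp[OF b2[OF a12(2)] G] a12(1)]) (simp add: Gp hp pc a12)
    finally show "?G (sw ?T (\<lambda>x y. ?p x (pure K A A y a2)) a1) = sw U (\<lambda>u v. \<gamma> u v a2) a1" .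
  qed
  finally have L: "?G (sw ?T (\<lambda>a1 a2. sw ?T (\<lambda>x y. ?p x (pure K A A y a2)) a1) a)
    = sw U (\<lambda>x y. sw U (\<lambda>u v. \<gamma> u v y) x) a" .
  have "?G (sw ?T (\<lambda>a1 a2. ?p a1 (\<Delta> a2)) a) = sw U (\<lambda>a1 a2. ?G (?p a1 (\<Delta> a2))) a"
    by (rule sw_apply[OF T U r1 G a])
  also have "\<dots> = sw U (\<lambda>x y. sw U (\<lambda>u v. \<gamma> x u v) y) a"
    by (rule sw_cong[OF U bilinear_comp[OF r1 G] a]) (simp add: Gp comult_closed, simp add: sweedler_def h_def)
  finally show ?thesis using L coassoc[OF a] by simp
qed

lemma sw_counit_left:
  assumes U: "module K U" and f: "f \<in> lin A U" and a: "a \<in> carrier A"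
  shows "sw U (\<lambda>x y. \<epsilon> x \<odot>\<^bsub>U\<^esub> f y) a = f a"
proof -
  have b: "bilinear K A A A (\<lambda>x y. \<epsilon> x \<odot>\<^bsub>A\<^esub> y)" by (intro lin_intros counit_closed)
  have "f a = f (sw A (\<lambda>x y. \<epsilon> x \<odot>\<^bsub>A\<^esub> y) a)" using counit_left[OF a] by simp
  also have "\<dots> = sw U (\<lambda>x y. f (\<epsilon> x \<odot>\<^bsub>A\<^esub> y)) a" by (rule sw_apply[OF A_module U b f a])
  also have "\<dots> = sw U (\<lambda>x y. \<epsilon> x \<odot>\<^bsub>U\<^esub> f y) a"
    by (rule sw_cong[OF U bilinear_comp[OF b f] a]) (simp add: module_hom_smult[OF f])
  finally show ?thesis by simp
qed

lemma sw_counit_right: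
  assumes U: "module K U" and f: "f \<in> lin A U" and a: "a \<in> carrier A"
  shows "sw U (\<lambda>x y. \<epsilon> y \<odot>\<^bsub>U\<^esub> f x) a = f a"
proof -
  have b: "bilinear K A A A (\<lambda>x y. \<epsilon> y \<odot>\<^bsub>A\<^esub> x)" by (intro lin_intros counit_closed)
  have "f a = f (sw A (\<lambda>x y. \<epsilon> y \<odot>\<^bsub>A\<^esub> x) a)" using counit_right[OF a] by simp
  also have "\<dots> = sw U (\<lambda>x y. f (\<epsilon> y \<odot>\<^bsub>A\<^esub> x)) a" by (rule sw_apply[OF A_module U b f a])
  also have "\<dots> = sw U (\<lambda>x y. \<epsilon> y \<odot>\<^bsub>U\<^esub> f x) a"
    by (rule sw_cong[OF U bilinear_comp[OF b f] a]) (simp add: module_hom_smult[OF f])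
  finally show ?thesis by simp
qed

lemma sw_antipode_left:
  assumes U: "module K U" and f: "f \<in> lin A U" and a: "a \<in> carrier A"
  shows "sw U (\<lambda>x y. f (S x \<bullet> y)) a = \<epsilon> a \<odot>\<^bsub>U\<^esub> f \<one>\<^bsub>A\<^esub>"
proof -
  have b: "bilinear K A A A (\<lambda>x y. S x \<bullet> y)" by (intro lin_intros antipode_closed)
  show ?thesis
    using sw_apply[OF A_module U b f a] antipode_left[OF a] module_hom_smult[OF f counit_closed[OF a]] by simp
qed

lemma sw_antipode_right:
  assumes U: "module K U" and f: "f \<in> lin A U" and a: "a \<in> carrier A"
  shows "sw U (\<lambda>x y. f (x \<bullet> S y)) a = \<epsilon> a \<odot>\<^bsub>U\<^esub> f \<one>\<^bsub>A\<^esub>"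
proof -
  have b: "bilinear K A A A (\<lambda>x y. x \<bullet> S y)" by (intro lin_intros antipode_closed)
  show ?thesis
    using sw_apply[OF A_module U b f a] antipode_right[OF a] module_hom_smult[OF f counit_closed[OF a]] by simp
qed

end

section \<open>Linear combinations of Sweedler sums\<close>

context hopf_algebra begin

text \<open>A formal sum that represents \<open>\<Delta> a\<close>, for the places where a Sweedler sum has to be a sum over a finite
index set.\<close>
definition formal_comult :: "'a \<Rightarrow> 'a \<times> 'a \<Rightarrow> 'k" where
  "formal_comult a = (SOME f. f \<in> carrier (free_module K (carrier A \<times> carrier A)) \<and>
     \<Delta> a = span_rel K (carrier A \<times> carrier A) (tensor_rel K A A)
       +>\<^bsub>free_module K (carrier A \<times> carrier A)\<^esub> f)"

lemma formal_comult:
  assumes "a \<in> carrier A"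
  shows "formal_comult a \<in> carrier (free_module K (carrier A \<times> carrier A))"
    and "\<Delta> a = span_rel K (carrier A \<times> carrier A) (tensor_rel K A A)
       +>\<^bsub>free_module K (carrier A \<times> carrier A)\<^esub> formal_comult a"
proof -
  have "\<exists>f. f \<in> carrier (free_module K (carrier A \<times> carrier A)) \<and>
     \<Delta> a = span_rel K (carrier A \<times> carrier A) (tensor_rel K A A)
       +>\<^bsub>free_module K (carrier A \<times> carrier A)\<^esub> f"
    using comult_closed[OF assms] K.presented_carrier[OF K.tensor_rel_subset[OF A_module A_module]]
    unfolding tensor_def by blast
  from someI_ex[OF this]
  show "formal_comult a \<in> carrier (free_module K (carrier A \<times> carrier A))"
    and "\<Delta> a = span_rel K (carrier A \<times> carrier A) (tensor_rel K A A)
       +>\<^bsub>free_module K (carrier A \<times> carrier A)\<^esub> formal_comult a"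
    unfolding formal_comult_def by blast+
qed

lemma formal_comultD:
  assumes "a \<in> carrier A"
  shows "finite {p. formal_comult a p \<noteq> \<zero>\<^bsub>K\<^esub>}" "formal_comult a p \<in> carrier K"
    "formal_comult a (x, y) \<noteq> \<zero>\<^bsub>K\<^esub> \<Longrightarrow> x \<in> carrier A \<and> y \<in> carrier A"
  using K.free_moduleD[OF formal_comult(1)[OF assms]] by auto

lemma sw_eq:
  assumes "module K U" "bilinear K A A U \<beta>" "a \<in> carrier A"
  shows "sw U \<beta> a = evaluation K U (\<lambda>(x, y). \<beta> x y) (formal_comult a)"
  unfolding sweedler_def formal_comult(2)[OF assms(3)]
  by (rule K.lift_coset[OF K.tensor_rel_subset[OF A_module A_module] assms(1)
        K.bilinear_compatible[OF A_module A_module assms(1,2)] formal_comult(1)[OF assms(3)]])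

lemma sw_finsum:
  assumes U: "module K U" and I: "finite I" and b: "\<And>i. i \<in> I \<Longrightarrow> bilinear K A A U (\<beta> i)"
    and a: "a \<in> carrier A"
  shows "sw U (\<lambda>x y. \<Oplus>\<^bsub>U\<^esub>i\<in>I. \<beta> i x y) a = (\<Oplus>\<^bsub>U\<^esub>i\<in>I. sw U (\<beta> i) a)"
proof -
  interpret U: module K U by fact
  have s: "bilinear K A A U (\<lambda>x y. \<Oplus>\<^bsub>U\<^esub>i\<in>I. \<beta> i x y)"
    using bilinearD(1,2)[OF b] by (intro bilinearI U.module_hom_finsumf I) auto
  note L = K.tensor_lift_hom[OF A_module A_module U] and Lp = K.tensor_lift_pure[OF A_module A_module U]
  have "lift K U (\<lambda>(x, y). \<Oplus>\<^bsub>U\<^esub>i\<in>I. \<beta> i x y) (\<Delta> a) = (\<Oplus>\<^bsub>U\<^esub>i\<in>I. lift K U (\<lambda>(x, y). \<beta> i x y) (\<Delta> a))"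
  proof (rule K.tensor_hom_eq[OF A_module A_module U L[OF s] U.module_hom_finsumf[OF I L[OF b]] _
        comult_closed[OF a]])
    fix v w assume vw: "v \<in> carrier A" "w \<in> carrier A"
    show "lift K U (\<lambda>(x, y). \<Oplus>\<^bsub>U\<^esub>i\<in>I. \<beta> i x y) (pure K A A v w)
      = (\<Oplus>\<^bsub>U\<^esub>i\<in>I. lift K U (\<lambda>(x, y). \<beta> i x y) (pure K A A v w))"
      unfolding Lp[OF s vw]
      by (rule U.M.finsum_cong'[OF refl]) (use Lp[OF b vw] bilinearD(3)[OF b vw] in auto)
  qed
  then show ?thesis by (simp add: sweedler_def)
qed

lemma sw_comb:
  assumes b: "bilinear K A A KK \<beta>" "bilinear K A A KK \<gamma>" and k: "k \<in> carrier K" and a: "a \<in> carrier A"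
  shows "sw KK (\<lambda>x y. k \<ast> \<beta> x y \<oplus>\<^bsub>K\<^esub> \<gamma> x y) a = k \<ast> sw KK \<beta> a \<oplus>\<^bsub>K\<^esub> sw KK \<gamma> a"
proof -
  interpret U: module K KK by (rule KK_module)
  note hom = U.module_hom_addf[OF U.module_hom_smultf[OF _ k], simplified]
  have s: "bilinear K A A KK (\<lambda>x y. k \<ast> \<beta> x y \<oplus>\<^bsub>K\<^esub> \<gamma> x y)"
    by (intro bilinearI hom bilinearD(1,2)[OF b(1)] bilinearD(1,2)[OF b(2)])
  note L = K.tensor_lift_hom[OF A_module A_module KK_module]
  note Lp = K.tensor_lift_pure[OF A_module A_module KK_module]
  show ?thesis
    unfolding sweedler_def
    by (rule K.tensor_hom_eq[OF A_module A_module KK_module L[OF s] hom[OF L[OF b(1)] L[OF b(2)]] _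
          comult_closed[OF a]]) (simp add: Lp[OF s] Lp[OF b(1)] Lp[OF b(2)])
qed

lemma finsum_KK [simp]: "finsum KK f I = finsum K f I"
proof -
  have eq: "carrier (add_monoid KK) = carrier (add_monoid K)" "mult (add_monoid KK) = mult (add_monoid K)"
    "one (add_monoid KK) = one (add_monoid K)" by (simp_all add: regular_module_def)
  show ?thesis unfolding finsum_def finprod_def eq ..
qed

lemma sw_zero:
  assumes "a \<in> carrier A" shows "sw KK (\<lambda>x y. \<zero>\<^bsub>K\<^esub>) a = \<zero>\<^bsub>K\<^esub>"
  using sw_finsum[OF KK_module finite.emptyI _ assms, of "\<lambda>_ _ _. \<zero>\<^bsub>K\<^esub>"] by simp

section \<open>The convolution algebra of functionals\<close>

lemma lin_functionals_space: "K.fun_space (carrier A) (lin A KK)"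
  unfolding K.fun_space_def
proof (intro conjI ballI allI impI)
  show "lin A KK \<noteq> {}" using counit_lin by auto
  show "c x \<in> carrier K" if "c \<in> lin A KK" "x \<in> carrier A" for c x using module_hom_closed[OF that] by simp
  fix c d k e assume c: "c \<in> lin A KK" and d: "d \<in> lin A KK" and k: "k \<in> carrier K"
    and e: "\<forall>x\<in>carrier A. e x = k \<ast> c x \<oplus>\<^bsub>K\<^esub> d x"
  have "(\<lambda>x. k \<odot>\<^bsub>KK\<^esub> c x \<oplus>\<^bsub>KK\<^esub> d x) \<in> lin A KK"
    by (intro module.module_hom_addf[OF KK_module] module.module_hom_smultf[OF KK_module] c d k)
  then show "e \<in> lin A KK" by (rule module_hom_cong'[OF A_module]) (use e in simp)
qed

lemma lin_K_closed: "c \<in> lin A KK \<Longrightarrow> a \<in> carrier A \<Longrightarrow> c a \<in> carrier K"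
  using module_hom_closed[of c K A KK] by simp

lemma conv_bilinear: "c \<in> lin A KK \<Longrightarrow> d \<in> lin A KK \<Longrightarrow> bilinear K A A KK (\<lambda>x y. c x \<ast> d y)"
  using module_hom_closed[of c K A KK] module_hom_closed[of d K A KK] by (intro lin_intros) auto

text \<open>The product of the algebra dual to the coalgebra \<open>A\<close>.\<close>
definition conv :: "('a \<Rightarrow> 'k) \<Rightarrow> ('a \<Rightarrow> 'k) \<Rightarrow> 'a \<Rightarrow> 'k" where
  "conv c d a = sw KK (\<lambda>x y. c x \<ast> d y) a"

lemma conv_lin: "c \<in> lin A KK \<Longrightarrow> d \<in> lin A KK \<Longrightarrow> conv c d \<in> lin A KK"
  using sw_hom[OF KK_module conv_bilinear module_hom_ident] by (simp add: conv_def[abs_def])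

lemma conv_closed: "c \<in> lin A KK \<Longrightarrow> d \<in> lin A KK \<Longrightarrow> a \<in> carrier A \<Longrightarrow> conv c d a \<in> carrier K"
  using module_hom_closed[OF conv_lin] by simp

lemma conv_cong:
  assumes "c \<in> lin A KK" "d \<in> lin A KK" "a \<in> carrier A"
    "\<And>x. x \<in> carrier A \<Longrightarrow> c x = c' x" "\<And>x. x \<in> carrier A \<Longrightarrow> d x = d' x"
  shows "conv c d a = conv c' d' a"
  unfolding conv_def by (rule sw_cong[OF KK_module conv_bilinear]) (use assms in auto)

lemma conv_comb_right:
  assumes c: "c \<in> lin A KK" and d: "d \<in> lin A KK" "d' \<in> lin A KK" "e \<in> lin A KK" and k: "k \<in> carrier K"
    and e: "\<And>x. x \<in> carrier A \<Longrightarrow> e x = k \<ast> d x \<oplus>\<^bsub>K\<^esub> d' x" and a: "a \<in> carrier A"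
  shows "conv c e a = k \<ast> conv c d a \<oplus>\<^bsub>K\<^esub> conv c d' a"
proof -
  have "conv c e a = sw KK (\<lambda>x y. k \<ast> (c x \<ast> d y) \<oplus>\<^bsub>K\<^esub> c x \<ast> d' y) a"
    unfolding conv_def
    by (rule sw_cong[OF KK_module conv_bilinear[OF c d(3)] a])
      (simp add: e lin_K_closed c d k K.r_distr K.m_lcomm)
  also have "\<dots> = k \<ast> conv c d a \<oplus>\<^bsub>K\<^esub> conv c d' a"
    unfolding conv_def by (rule sw_comb[OF conv_bilinear[OF c d(1)] conv_bilinear[OF c d(2)] k a])
  finally show ?thesis .
qed

lemma conv_comb_left:
  assumes c: "c \<in> lin A KK" and d: "d \<in> lin A KK" "d' \<in> lin A KK" "e \<in> lin A KK" and k: "k \<in> carrier K"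
    and e: "\<And>x. x \<in> carrier A \<Longrightarrow> e x = k \<ast> d x \<oplus>\<^bsub>K\<^esub> d' x" and a: "a \<in> carrier A"
  shows "conv e c a = k \<ast> conv d c a \<oplus>\<^bsub>K\<^esub> conv d' c a"
proof -
  have "conv e c a = sw KK (\<lambda>x y. k \<ast> (d x \<ast> c y) \<oplus>\<^bsub>K\<^esub> d' x \<ast> c y) a"
    unfolding conv_def
    by (rule sw_cong[OF KK_module conv_bilinear[OF d(3) c] a])
      (simp add: e lin_K_closed c d k K.l_distr K.m_assoc)
  also have "\<dots> = k \<ast> conv d c a \<oplus>\<^bsub>K\<^esub> conv d' c a"
    unfolding conv_def by (rule sw_comb[OF conv_bilinear[OF d(1) c] conv_bilinear[OF d(2) c] k a])
  finally show ?thesis .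
qed

lemma conv_counit_left: "c \<in> lin A KK \<Longrightarrow> a \<in> carrier A \<Longrightarrow> conv \<epsilon> c a = c a"
  using sw_counit_left[OF KK_module] by (simp add: conv_def)

lemma conv_counit_right:
  assumes "c \<in> lin A KK" "a \<in> carrier A" shows "conv c \<epsilon> a = c a"
proof -
  have "conv c \<epsilon> a = sw KK (\<lambda>x y. \<epsilon> y \<odot>\<^bsub>KK\<^esub> c x) a"
    unfolding conv_def
    by (rule sw_cong[OF KK_module conv_bilinear[OF assms(1) counit_lin] assms(2)])
      (simp add: K.m_comm lin_K_closed[OF assms(1)])
  then show ?thesis using sw_counit_right[OF KK_module assms] by simp
qed

lemma sw_lin_comb:
  assumes I: "finite I" and f: "\<And>i. i \<in> I \<Longrightarrow> f i \<in> lin A KK" and g: "\<And>i. i \<in> I \<Longrightarrow> g i \<in> lin A KK"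
    and k: "\<And>i. i \<in> I \<Longrightarrow> k i \<in> carrier K" and a: "a \<in> carrier A"
    and eq: "\<And>x y. x \<in> carrier A \<Longrightarrow> y \<in> carrier A \<Longrightarrow> \<beta> x y = (\<Oplus>\<^bsub>K\<^esub>i\<in>I. k i \<ast> (f i x \<ast> g i y))"
  shows "sw KK \<beta> a = (\<Oplus>\<^bsub>K\<^esub>i\<in>I. k i \<ast> conv (f i) (g i) a)"
proof -
  interpret U: module K KK by (rule KK_module)
  have b: "bilinear K A A KK (\<lambda>x y. k i \<ast> (f i x \<ast> g i y))" if "i \<in> I" for i
    by (rule bilinear_comp[OF conv_bilinear[OF f[OF that] g[OF that]] lin_K_mult_right[OF module_hom_ident k[OF that]]])
  have s: "bilinear K A A KK (\<lambda>x y. \<Oplus>\<^bsub>KK\<^esub>i\<in>I. k i \<ast> (f i x \<ast> g i y))"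
    by (intro bilinearI U.module_hom_finsumf I bilinearD(1,2)[OF b])
  have "sw KK \<beta> a = sw KK (\<lambda>x y. \<Oplus>\<^bsub>KK\<^esub>i\<in>I. k i \<ast> (f i x \<ast> g i y)) a"
    by (rule sw_cong[OF KK_module s a, symmetric]) (simp add: eq)
  also have "\<dots> = (\<Oplus>\<^bsub>K\<^esub>i\<in>I. sw KK (\<lambda>x y. k i \<ast> (f i x \<ast> g i y)) a)"
    using sw_finsum[OF KK_module I b a] by simp
  also have "\<dots> = (\<Oplus>\<^bsub>K\<^esub>i\<in>I. k i \<ast> conv (f i) (g i) a)"
  proof (rule K.finsum_cong'[OF refl])
    show "(\<lambda>i. k i \<ast> conv (f i) (g i) a) \<in> I \<rightarrow> carrier K" using k conv_closed[OF f g a] by auto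
    show "sw KK (\<lambda>x y. k i \<ast> (f i x \<ast> g i y)) a = k i \<ast> conv (f i) (g i) a" if i: "i \<in> I" for i
      unfolding conv_def
      using sw_apply[OF KK_module KK_module conv_bilinear[OF f[OF i] g[OF i]]
          lin_K_mult_right[OF module_hom_ident k[OF i]] a] by simp
  qed
  finally show ?thesis .
qed

lemma conv_lin_comb:
  assumes I: "finite I" and f: "\<And>i. i \<in> I \<Longrightarrow> f i \<in> lin A KK" and d: "d \<in> lin A KK"
    and k: "\<And>i. i \<in> I \<Longrightarrow> k i \<in> carrier K" and a: "a \<in> carrier A"
    and c: "\<And>x. x \<in> carrier A \<Longrightarrow> c x = (\<Oplus>\<^bsub>K\<^esub>i\<in>I. k i \<ast> f i x)"
  shows "conv c d a = (\<Oplus>\<^bsub>K\<^esub>i\<in>I. k i \<ast> conv (f i) d a)"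
  unfolding conv_def[of c]
proof (rule sw_lin_comb[OF I f d k a])
  fix x y assume xy: "x \<in> carrier A" "y \<in> carrier A"
  note cl = k lin_K_closed[OF f xy(1)] lin_K_closed[OF d xy(2)]
  have "c x \<ast> d y = (\<Oplus>\<^bsub>K\<^esub>i\<in>I. k i \<ast> f i x \<ast> d y)"
    unfolding c[OF xy(1)] using cl I by (intro K.finsum_ldistr) auto
  also have "\<dots> = (\<Oplus>\<^bsub>K\<^esub>i\<in>I. k i \<ast> (f i x \<ast> d y))"
    using cl by (intro K.finsum_cong') (auto simp: K.m_assoc)
  finally show "c x \<ast> d y = (\<Oplus>\<^bsub>K\<^esub>i\<in>I. k i \<ast> (f i x \<ast> d y))" .
qed

lemma conv_assoc:
  assumes c: "c \<in> lin A KK" and d: "d \<in> lin A KK" and e: "e \<in> lin A KK" and a: "a \<in> carrier A"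
  shows "conv (conv c d) e a = conv c (conv d e) a"
proof -
  note i = lin_intros module_hom_comp[OF c] module_hom_comp[OF d] module_hom_comp[OF e]
    lin_K_closed[OF c] lin_K_closed[OF d] lin_K_closed[OF e] K.m_closed
  have "conv (conv c d) e a = sw KK (\<lambda>x y. sw KK (\<lambda>u v. c u \<ast> (d v \<ast> e y)) x) a"
    unfolding conv_def[of "conv c d"]
  proof (rule sw_cong[OF KK_module conv_bilinear[OF conv_lin[OF c d] e] a])
    fix x y assume xy: "x \<in> carrier A" "y \<in> carrier A"
    have "conv c d x \<ast> e y = sw KK (\<lambda>u v. c u \<ast> d v \<ast> e y) x"
      unfolding conv_def
      by (rule sw_apply[OF KK_module KK_module conv_bilinear[OF c d] _ xy(1)])
        (intro lin_intros lin_K_closed[OF e] xy)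
    also have "\<dots> = sw KK (\<lambda>u v. c u \<ast> (d v \<ast> e y)) x"
    proof (rule sw_cong[OF KK_module _ xy(1)])
      show "bilinear K A A KK (\<lambda>u v. c u \<ast> d v \<ast> e y)" using xy by (intro i)
    qed (simp add: K.m_assoc lin_K_closed c d e xy)
    finally show "conv c d x \<ast> e y = sw KK (\<lambda>u v. c u \<ast> (d v \<ast> e y)) x" .
  qed
  also have "\<dots> = sw KK (\<lambda>x y. sw KK (\<lambda>u v. c x \<ast> (d u \<ast> e v)) y) a"
    by (rule sw_coassoc[OF KK_module a]; intro i; assumption?)
  also have "\<dots> = conv c (conv d e) a"
    unfolding conv_def[of c]
  proof (rule sw_cong[OF KK_module _ a])
    show "bilinear K A A KK (\<lambda>x y. sw KK (\<lambda>u v. c x \<ast> (d u \<ast> e v)) y)" by (intro i)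
    fix x y assume xy: "x \<in> carrier A" "y \<in> carrier A"
    show "sw KK (\<lambda>u v. c x \<ast> (d u \<ast> e v)) y = c x \<ast> conv d e y"
      unfolding conv_def
      by (rule sw_apply[OF KK_module KK_module conv_bilinear[OF d e] _ xy(2), symmetric])
        (intro lin_intros lin_K_closed[OF c] xy)
  qed
  finally show ?thesis .
qed

lemma translate_lin:
  assumes "c \<in> lin A KK" "x \<in> carrier A"
  shows "(\<lambda>a. c (x \<bullet> a)) \<in> lin A KK" "(\<lambda>a. c (a \<bullet> x)) \<in> lin A KK"
  using module_hom_comp[OF assms(1)] lin_mult_left[OF module_hom_ident assms(2)]
    lin_mult_right[OF module_hom_ident assms(2)] by blast+

text \<open>By multiplicativity of \<open>\<Delta>\<close>, the value at \<open>x a\<close> is \<open>c(x\<^sub>1 a\<^sub>1) d(x\<^sub>2 a\<^sub>2)\<close>.  For fixed \<open>x\<close> this is a linear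
combination of convolution products of translates, evaluated at \<open>a\<close>, and conversely.\<close>
lemma conv_translate:
  assumes c: "c \<in> lin A KK" and d: "d \<in> lin A KK" and x: "x \<in> carrier A" and a: "a \<in> carrier A"
  shows "conv c d (x \<bullet> a) = (\<Oplus>\<^bsub>K\<^esub>p\<in>{p. formal_comult x p \<noteq> \<zero>\<^bsub>K\<^esub>}. formal_comult x p \<ast>
      conv (\<lambda>a. c (fst p \<bullet> a)) (\<lambda>a. d (snd p \<bullet> a)) a)" (is ?L)
    and "conv c d (x \<bullet> a) = (\<Oplus>\<^bsub>K\<^esub>p\<in>{p. formal_comult a p \<noteq> \<zero>\<^bsub>K\<^esub>}. formal_comult a p \<ast>
      conv (\<lambda>x. c (x \<bullet> fst p)) (\<lambda>x. d (x \<bullet> snd p)) x)" (is ?R)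
proof -
  note i = lin_intros module_hom_comp[OF c] module_hom_comp[OF d] lin_K_closed[OF c] lin_K_closed[OF d]
    K.m_closed A.m_closed x a
  have E: "conv c d (x \<bullet> a) = sw KK (\<lambda>x1 x2. sw KK (\<lambda>a1 a2. c (x1 \<bullet> a1) \<ast> d (x2 \<bullet> a2)) a) x"
    unfolding conv_def by (rule sw_mult[OF KK_module conv_bilinear[OF c d] x a])
  have b1: "bilinear K A A KK (\<lambda>x1 x2. sw KK (\<lambda>a1 a2. c (x1 \<bullet> a1) \<ast> d (x2 \<bullet> a2)) a)" by (intro i)
  show ?L
    unfolding E sw_eq[OF KK_module b1 x] by (simp add: conv_def case_prod_unfold)
  let ?I = "{p. formal_comult a p \<noteq> \<zero>\<^bsub>K\<^esub>}"
  have b2: "bilinear K A A KK (\<lambda>a1 a2. c (x1 \<bullet> a1) \<ast> d (x2 \<bullet> a2))"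
    if "x1 \<in> carrier A" "x2 \<in> carrier A" for x1 x2 using that by (intro i)
  have pA: "fst p \<in> carrier A" "snd p \<in> carrier A" if "p \<in> ?I" for p
    using that formal_comultD(3)[OF a, of "fst p" "snd p"] by auto
  have b3: "bilinear K A A KK (\<lambda>x1 x2. c (x1 \<bullet> fst p) \<ast> d (x2 \<bullet> snd p))" if "p \<in> ?I" for p
    using pA[OF that] by (intro i)
  note fc = formal_comultD(2)[OF a]
  have b4: "bilinear K A A KK (\<lambda>x1 x2. formal_comult a p \<ast> (c (x1 \<bullet> fst p) \<ast> d (x2 \<bullet> snd p)))"
    if "p \<in> ?I" for p
    using pA[OF that] by (intro i fc)
  have "conv c d (x \<bullet> a) = sw KK (\<lambda>x1 x2. \<Oplus>\<^bsub>KK\<^esub>p\<in>?I. formal_comult a p \<ast>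
      (c (x1 \<bullet> fst p) \<ast> d (x2 \<bullet> snd p))) x"
    unfolding E by (rule sw_cong[OF KK_module b1 x]) (simp add: sw_eq[OF KK_module b2 a] case_prod_unfold)
  also have "\<dots> = (\<Oplus>\<^bsub>K\<^esub>p\<in>?I. sw KK (\<lambda>x1 x2. formal_comult a p \<ast>
      (c (x1 \<bullet> fst p) \<ast> d (x2 \<bullet> snd p))) x)"
    using sw_finsum[OF KK_module formal_comultD(1)[OF a] b4 x] by simp
  also have "\<dots> = (\<Oplus>\<^bsub>K\<^esub>p\<in>?I. formal_comult a p \<ast>
      conv (\<lambda>x. c (x \<bullet> fst p)) (\<lambda>x. d (x \<bullet> snd p)) x)"
  proof (rule K.finsum_cong'[OF refl])
    have "(\<lambda>x. c (x \<bullet> fst p)) \<in> lin A KK" "(\<lambda>x. d (x \<bullet> snd p)) \<in> lin A KK" if "p \<in> ?I" for p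
      using translate_lin(2)[OF c pA(1)[OF that]] translate_lin(2)[OF d pA(2)[OF that]] .
    then show "(\<lambda>p. formal_comult a p \<ast> conv (\<lambda>x. c (x \<bullet> fst p)) (\<lambda>x. d (x \<bullet> snd p)) x) \<in> ?I \<rightarrow> carrier K"
      using fc conv_closed[OF _ _ x] by blast
    fix p assume p: "p \<in> ?I"
    show "sw KK (\<lambda>x1 x2. formal_comult a p \<ast> (c (x1 \<bullet> fst p) \<ast> d (x2 \<bullet> snd p))) x
      = formal_comult a p \<ast> conv (\<lambda>x. c (x \<bullet> fst p)) (\<lambda>x. d (x \<bullet> snd p)) x"
      unfolding conv_def
      using sw_apply[OF KK_module KK_module b3[OF p] lin_K_mult_right[OF module_hom_ident fc[of p]] x] by simp
  qed
  finally show ?R .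
qed

end

section \<open>Finite-dimensional bialgebras of functions on a Hopf algebra\<close>

text \<open>A finite-dimensional subspace \<open>C\<close> of the dual of \<open>A\<close> that is a subalgebra for convolution and stable under
translations.  Translation stability makes \<open>C\<close> a coalgebra: \<open>c(x y)\<close>, as a function of \<open>x\<close> and of \<open>y\<close>, is a
sum of products of functions in \<open>C\<close>.\<close>
locale function_bialgebra = hopf_algebra K A \<Delta> \<epsilon> S
  for K :: "('k, 'q) ring_scheme" and A :: "('k, 'a, 'p) module_scheme" and \<Delta> \<epsilon> S +
  fixes C :: "('a \<Rightarrow> 'k) set" and P :: "'a set"
  assumes C: "K.fun_space (carrier A) C"
    and sepP: "K.separating (carrier A) C P"
    and C_lin: "c \<in> C \<Longrightarrow> c \<in> lin A KK"
    and counit_C: "\<epsilon> \<in> C"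
    and conv_C: "c \<in> C \<Longrightarrow> d \<in> C \<Longrightarrow> conv c d \<in> C"
    and left_C: "c \<in> C \<Longrightarrow> b \<in> carrier A \<Longrightarrow> (\<lambda>a. c (b \<bullet> a)) \<in> C"
    and right_C: "c \<in> C \<Longrightarrow> b \<in> carrier A \<Longrightarrow> (\<lambda>a. c (a \<bullet> b)) \<in> C"
begin

lemma C_comp: "c \<in> C \<Longrightarrow> f \<in> lin X A \<Longrightarrow> (\<lambda>x. c (f x)) \<in> lin X KK"
  by (rule module_hom_comp[OF C_lin])

lemma C_closed: "c \<in> C \<Longrightarrow> a \<in> carrier A \<Longrightarrow> c a \<in> carrier K"
  by (rule K.fun_space_closed[OF C])

lemma finite_P: "finite P" and P_subset: "P \<subseteq> carrier A"
  using sepP by (auto simp: K.separating_def)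

text \<open>The map \<open>F(a, b) \<mapsto> F(a\<^sub>1, a\<^sub>2 b)\<close> on functions of two variables is undone by
\<open>F(a, b) \<mapsto> F(a\<^sub>1, S(a\<^sub>2) b)\<close>.\<close>
lemma galois_inverse:
  assumes F1: "\<And>b. b \<in> carrier A \<Longrightarrow> (\<lambda>a. F (a, b)) \<in> lin A KK"
    and F2: "\<And>a. a \<in> carrier A \<Longrightarrow> (\<lambda>b. F (a, b)) \<in> lin A KK"
    and a: "a \<in> carrier A" and b: "b \<in> carrier A"
  shows "sw KK (\<lambda>x y. sw KK (\<lambda>u v. F (u, v \<bullet> (S y \<bullet> b))) x) a = F (a, b)"
proof -
  note i = lin_intros module_hom_comp[OF F1] module_hom_comp[OF F2] A.m_closed antipode_closed b
  have "sw KK (\<lambda>x y. sw KK (\<lambda>u v. F (u, v \<bullet> (S y \<bullet> b))) x) a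
    = sw KK (\<lambda>x y. sw KK (\<lambda>u v. F (x, u \<bullet> (S v \<bullet> b))) y) a"
    by (rule sw_coassoc[OF KK_module a, where \<gamma> = "\<lambda>u v y. F (u, v \<bullet> (S y \<bullet> b))"]; intro i; assumption?)
  also have "\<dots> = sw KK (\<lambda>x y. \<epsilon> y \<odot>\<^bsub>KK\<^esub> F (x, b)) a"
  proof (rule sw_cong[OF KK_module _ a])
    show "bilinear K A A KK (\<lambda>x y. sw KK (\<lambda>u v. F (x, u \<bullet> (S v \<bullet> b))) y)"
      by (intro i)
    fix x y assume xy: "x \<in> carrier A" "y \<in> carrier A"
    have "sw KK (\<lambda>u v. F (x, u \<bullet> (S v \<bullet> b))) y = sw KK (\<lambda>u v. F (x, (u \<bullet> S v) \<bullet> b)) y"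
    proof (rule sw_cong[OF KK_module _ xy(2)])
      show "bilinear K A A KK (\<lambda>u v. F (x, u \<bullet> (S v \<bullet> b)))" using xy by (intro i)
    qed (use b in \<open>simp add: A.m_assoc\<close>)
    also have "\<dots> = \<epsilon> y \<odot>\<^bsub>KK\<^esub> F (x, \<one>\<^bsub>A\<^esub> \<bullet> b)"
      by (rule sw_antipode_right[OF KK_module _ xy(2), where f = "\<lambda>z. F (x, z \<bullet> b)"]) (use xy in \<open>intro i\<close>)
    finally show "sw KK (\<lambda>u v. F (x, u \<bullet> (S v \<bullet> b))) y = \<epsilon> y \<odot>\<^bsub>KK\<^esub> F (x, b)" using b by simp
  qed
  also have "\<dots> = F (a, b)" by (rule sw_counit_right[OF KK_module F1[OF b] a])
  finally show ?thesis .
qed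

text \<open>The functions of two variables that lie in \<open>C\<close> in each variable form a finite-dimensional space \<open>Z\<close>, which is
\<open>C \<otimes> C\<close>.  The map \<open>F(a, b) \<mapsto> F(a\<^sub>1, a\<^sub>2 b)\<close> preserves \<open>Z\<close> and is injective, hence surjective, whereas its
inverse \<open>F(a, b) \<mapsto> F(a\<^sub>1, S(a\<^sub>2) b)\<close> is not visibly a map of \<open>Z\<close>.  It therefore preserves \<open>Z\<close>, and it takes
\<open>\<epsilon>(a) c(b)\<close> to \<open>c(S(a) b)\<close>, which lies in \<open>C\<close> as a function of \<open>a\<close>, in particular for \<open>b = 1\<close>.\<close>
lemma antipode_C:
  assumes c: "c \<in> C" shows "(\<lambda>a. c (S a)) \<in> C"
proof -
  let ?X = "carrier A \<times> carrier A"
  define Z where "Z = {F. (\<forall>b\<in>carrier A. (\<lambda>a. F (a, b)) \<in> C) \<and> (\<forall>a\<in>carrier A. (\<lambda>b. F (a, b)) \<in> C)}"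
  define \<phi> where "\<phi> = (\<lambda>F (a, b). sw KK (\<lambda>x y. F (x, y \<bullet> b)) a)"
  have Z1: "(\<lambda>a. F (a, b)) \<in> C" and Z2: "(\<lambda>b. F (a, b)) \<in> C"
    if "F \<in> Z" "a \<in> carrier A" "b \<in> carrier A" for F a b using that by (auto simp: Z_def)
  have ZK: "F (a, b) \<in> carrier K" if "F \<in> Z" "a \<in> carrier A" "b \<in> carrier A" for F a b
    using C_closed[OF Z1[OF that] that(2)] .
  have l1: "(\<lambda>x. F (f x, b)) \<in> lin X KK" if "F \<in> Z" "b \<in> carrier A" "f \<in> lin X A" for F b f and X :: "('k, 'a, 'p) module_scheme"
    using module_hom_comp[OF C_lin[OF Z1[OF that(1) that(2) that(2)]] that(3)] .
  have l2: "(\<lambda>x. F (b, f x)) \<in> lin X KK" if "F \<in> Z" "b \<in> carrier A" "f \<in> lin X A" for F b f and X :: "('k, 'a, 'p) module_scheme"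
    using module_hom_comp[OF C_lin[OF Z2[OF that(1) that(2) that(2)]] that(3)] .
  have bil: "bilinear K A A KK (\<lambda>x y. F (x, y \<bullet> b))" if "F \<in> Z" "b \<in> carrier A" for F b
    using that by (intro lin_intros l1 l2 A.m_closed)
  have comb: "K.fun_space ?X Z"
    unfolding K.fun_space_def
  proof (intro conjI ballI allI impI)
    show "Z \<noteq> {}" using K.fun_space_zero[OF C, of "\<lambda>_. \<zero>\<^bsub>K\<^esub>"] by (auto simp: Z_def)
    show "F x \<in> carrier K" if "F \<in> Z" "x \<in> ?X" for F x using that ZK by auto
    fix F G k H assume FG: "F \<in> Z" "G \<in> Z" and k: "k \<in> carrier K" and H: "\<forall>x\<in>?X. H x = k \<ast> F x \<oplus>\<^bsub>K\<^esub> G x"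
    have "(\<lambda>a. H (a, b)) \<in> C" if b: "b \<in> carrier A" for b
      by (rule K.fun_space_comb[OF C Z1[OF FG(1) b b] Z1[OF FG(2) b b] k]) (use H b in auto)
    moreover have "(\<lambda>b. H (a, b)) \<in> C" if b: "a \<in> carrier A" for a
      by (rule K.fun_space_comb[OF C Z2[OF FG(1) b b] Z2[OF FG(2) b b] k]) (use H b in auto)
    ultimately show "H \<in> Z" by (auto simp: Z_def)
  qed
  have sep: "K.separating ?X Z (P \<times> P)"
    unfolding K.separating_def
  proof (intro conjI ballI impI)
    show "finite (P \<times> P)" "P \<times> P \<subseteq> ?X" using finite_P P_subset by auto
    fix F x assume F: "F \<in> Z" and F0: "\<forall>p\<in>P \<times> P. F p = \<zero>\<^bsub>K\<^esub>" and x: "x \<in> ?X"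
    obtain a b where ab: "x = (a, b)" "a \<in> carrier A" "b \<in> carrier A" using x by auto
    have "F (a', q) = \<zero>\<^bsub>K\<^esub>" if q: "q \<in> P" and a': "a' \<in> carrier A" for a' q
    proof -
      have "q \<in> carrier A" using q P_subset by auto
      then have "(\<lambda>a. F (a, q)) \<in> C" using Z1 F by blast
      then show ?thesis using sepP F0 q a' unfolding K.separating_def by fastforce
    qed
    then have "\<forall>q\<in>P. F (a, q) = \<zero>\<^bsub>K\<^esub>" using ab by blast
    moreover have "(\<lambda>b. F (a, b)) \<in> C" using Z2 F ab by blast
    ultimately show "F x = \<zero>\<^bsub>K\<^esub>" using sepP ab unfolding K.separating_def by fastforce
  qed
  obtain P' e where P': "P' \<subseteq> P" "K.separating (carrier A) C P'" "K.dual_basis C P' e"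
    using K.ex_dual_basis[OF C sepP] by metis
  have P'A: "P' \<subseteq> carrier A" "finite P'" using P' P_subset finite_P finite_subset by auto
  have eC: "e p \<in> C" if "p \<in> P'" for p using P'(3) that by (auto simp: K.dual_basis_def)
  have \<phi>Z: "\<phi> F \<in> Z" if F: "F \<in> Z" for F
  proof -
    have "(\<lambda>a. \<phi> F (a, b)) \<in> C" if b: "b \<in> carrier A" for b
    proof -
      have F': "(\<lambda>y. F (p, y \<bullet> b)) \<in> C" if "p \<in> P'" for p
        using that P'A b by (intro right_C[OF Z2[OF F]]) auto
      have "(\<lambda>a. \<Oplus>\<^bsub>K\<^esub>p\<in>P'. \<one>\<^bsub>K\<^esub> \<ast> conv (e p) (\<lambda>y. F (p, y \<bullet> b)) a) \<in> C"
        by (intro K.fun_space_finsum[OF C P'A(2)] K.fun_space_smult[OF C conv_C[OF eC F']] K.one_closed)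
      then show ?thesis
      proof (rule K.fun_space_cong[OF C])
        fix a assume a: "a \<in> carrier A"
        show "\<phi> F (a, b) = (\<Oplus>\<^bsub>K\<^esub>p\<in>P'. \<one>\<^bsub>K\<^esub> \<ast> conv (e p) (\<lambda>y. F (p, y \<bullet> b)) a)"
          unfolding \<phi>_def prod.case
        proof (rule sw_lin_comb[OF P'A(2) C_lin[OF eC] C_lin[OF F'] K.one_closed a])
          fix x y assume xy: "x \<in> carrier A" "y \<in> carrier A"
          have yb: "y \<bullet> b \<in> carrier A" using xy b by simp
          have "F (x, y \<bullet> b) = (\<Oplus>\<^bsub>K\<^esub>p\<in>P'. F (p, y \<bullet> b) \<ast> e p x)"
            using K.dual_basis_expand[OF C P'(2,3) order_refl Z1[OF F yb yb] xy(1)] .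
          also have "\<dots> = (\<Oplus>\<^bsub>K\<^esub>p\<in>P'. \<one>\<^bsub>K\<^esub> \<ast> (e p x \<ast> F (p, y \<bullet> b)))"
            using P'A xy yb F C_closed[OF eC] ZK by (intro K.finsum_cong') (auto simp: K.m_comm subset_eq)
          finally show "F (x, y \<bullet> b) = (\<Oplus>\<^bsub>K\<^esub>p\<in>P'. \<one>\<^bsub>K\<^esub> \<ast> (e p x \<ast> F (p, y \<bullet> b)))" .
        qed
      qed
    qed
    moreover have "(\<lambda>b. \<phi> F (a, b)) \<in> C" if a: "a \<in> carrier A" for a
    proof -
      let ?I = "{p. formal_comult a p \<noteq> \<zero>\<^bsub>K\<^esub>}"
      have "(\<lambda>b. \<Oplus>\<^bsub>K\<^esub>p\<in>?I. formal_comult a p \<ast> F (fst p, snd p \<bullet> b)) \<in> C"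
      proof (rule K.fun_space_finsum[OF C formal_comultD(1)[OF a]])
        fix p assume "p \<in> ?I"
        then have p: "fst p \<in> carrier A" "snd p \<in> carrier A" using formal_comultD(3)[OF a, of "fst p" "snd p"] by auto
        show "(\<lambda>b. formal_comult a p \<ast> F (fst p, snd p \<bullet> b)) \<in> C"
          by (rule K.fun_space_smult[OF C left_C[OF Z2[OF F p(1) p(2)] p(2)] formal_comultD(2)[OF a]])
      qed
      then show ?thesis
        by (rule K.fun_space_cong[OF C])
          (simp add: \<phi>_def sw_eq[OF KK_module bil[OF F] a] case_prod_unfold)
    qed
    ultimately show ?thesis by (simp add: Z_def)
  qed
  have lin: "\<phi> H x = k \<ast> \<phi> F x \<oplus>\<^bsub>K\<^esub> \<phi> G x"
    if FG: "F \<in> Z" "G \<in> Z" "H \<in> Z" and k: "k \<in> carrier K"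
      and H: "\<And>x. x \<in> ?X \<Longrightarrow> H x = k \<ast> F x \<oplus>\<^bsub>K\<^esub> G x" and x: "x \<in> ?X" for F G H k x
  proof -
    obtain a b where ab: "x = (a, b)" "a \<in> carrier A" "b \<in> carrier A" using x by auto
    have "\<phi> H x = sw KK (\<lambda>x y. k \<ast> F (x, y \<bullet> b) \<oplus>\<^bsub>K\<^esub> G (x, y \<bullet> b)) a"
      unfolding \<phi>_def ab(1) prod.case
      by (rule sw_cong[OF KK_module bil[OF FG(3) ab(3)] ab(2)]) (use H ab in auto)
    also have "\<dots> = k \<ast> \<phi> F x \<oplus>\<^bsub>K\<^esub> \<phi> G x"
      unfolding \<phi>_def ab(1) prod.case by (rule sw_comb[OF bil[OF FG(1) ab(3)] bil[OF FG(2) ab(3)] k ab(2)])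
    finally show ?thesis .
  qed
  have inv: "sw KK (\<lambda>x y. \<phi> F (x, S y \<bullet> b)) a = F (a, b)"
    if "F \<in> Z" "a \<in> carrier A" "b \<in> carrier A" for F a b
    unfolding \<phi>_def prod.case
    by (rule galois_inverse) (use that in \<open>auto intro: C_lin Z1 Z2\<close>)
  have bilS: "bilinear K A A KK (\<lambda>x y. F (x, S y \<bullet> b))" if "F \<in> Z" "b \<in> carrier A" for F b
    using that by (intro lin_intros l1 l2 A.m_closed antipode_closed)
  have inj: "F x = \<zero>\<^bsub>K\<^esub>"
    if F: "F \<in> Z" and F0: "\<And>x. x \<in> ?X \<Longrightarrow> \<phi> F x = \<zero>\<^bsub>K\<^esub>" and x: "x \<in> ?X" for F x
  proof -
    obtain a b where ab: "x = (a, b)" "a \<in> carrier A" "b \<in> carrier A" using x by auto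
    have "sw KK (\<lambda>x y. \<phi> F (x, S y \<bullet> b)) a = sw KK (\<lambda>x y. \<zero>\<^bsub>K\<^esub>) a"
      by (rule sw_cong[OF KK_module bilS[OF \<phi>Z[OF F] ab(3)] ab(2)]) (use F0 ab in auto)
    then show ?thesis using inv[OF F ab(2,3)] sw_zero[OF ab(2)] ab by simp
  qed
  \<comment> \<open>The preimage \<open>F\<close> of \<open>\<epsilon>(a) c(b)\<close> is \<open>c(S(a) b)\<close>.\<close>
  define F0 where "F0 = (\<lambda>(a, b). \<epsilon> a \<ast> c b)"
  have F0: "F0 \<in> Z"
  proof -
    have "(\<lambda>a. F0 (a, b)) \<in> C" if "b \<in> carrier A" for b
      by (rule K.fun_space_cong[OF C K.fun_space_smult[OF C counit_C C_closed[OF c that]]])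
        (use C_closed[OF c that] in \<open>simp add: F0_def K.m_comm\<close>)
    moreover have "(\<lambda>b. F0 (a, b)) \<in> C" if "a \<in> carrier A" for a
      using K.fun_space_smult[OF C c counit_closed[OF that]] by (simp add: F0_def)
    ultimately show ?thesis by (simp add: Z_def)
  qed
  have "\<exists>F\<in>Z. \<forall>x\<in>?X. \<phi> F x = F0 x"
  proof (rule K.injective_imp_surjective[where \<phi> = \<phi>, OF comb sep \<phi>Z _ _ F0])
    show "\<phi> H x = k \<ast> \<phi> F x \<oplus>\<^bsub>K\<^esub> \<phi> G x"
      if "F \<in> Z" "G \<in> Z" "H \<in> Z" "k \<in> carrier K"
        "\<And>x. x \<in> ?X \<Longrightarrow> H x = k \<ast> F x \<oplus>\<^bsub>K\<^esub> G x" "x \<in> ?X" for F G H k x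
      by (rule lin[OF that])
    show "F x = \<zero>\<^bsub>K\<^esub>" if "F \<in> Z" "\<And>x. x \<in> ?X \<Longrightarrow> \<phi> F x = \<zero>\<^bsub>K\<^esub>" "x \<in> ?X" for F x
      by (rule inj[OF that])
  qed
  then obtain F where F: "F \<in> Z" "\<forall>x\<in>?X. \<phi> F x = F0 x" by blast
  show ?thesis
  proof (rule K.fun_space_cong[OF C Z1[OF F(1) A.one_closed A.one_closed]])
    fix a assume a: "a \<in> carrier A"
    have "F (a, \<one>\<^bsub>A\<^esub>) = sw KK (\<lambda>x y. \<phi> F (x, S y \<bullet> \<one>\<^bsub>A\<^esub>)) a" using inv[OF F(1) a A.one_closed] by simp
    also have "\<dots> = sw KK (\<lambda>x y. \<epsilon> x \<odot>\<^bsub>KK\<^esub> c (S y)) a"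
      by (rule sw_cong[OF KK_module bilS[OF \<phi>Z[OF F(1)] A.one_closed] a]) (use F(2) in \<open>auto simp: F0_def\<close>)
    also have "\<dots> = c (S a)"
      by (rule sw_counit_left[OF KK_module _ a]) (intro C_comp[OF c] lin_intros)
    finally show "c (S a) = F (a, \<one>\<^bsub>A\<^esub>)" by simp
  qed
qed

end

section \<open>Integrals\<close>

context hopf_algebra begin

text \<open>As \<open>a\<^sub>2 \<Lambda> = \<epsilon>(a\<^sub>2) \<Lambda>\<close>, the tensor \<open>S(a\<^sub>1) a\<^sub>2 \<Lambda>\<^sub>1 \<otimes> a\<^sub>3 \<Lambda>\<^sub>2\<close> equals \<open>S(a) \<Lambda>\<^sub>1 \<otimes> \<Lambda>\<^sub>2\<close>; by the antipode axiom
it also equals \<open>\<Lambda>\<^sub>1 \<otimes> a \<Lambda>\<^sub>2\<close>.\<close>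
lemma integral_shift:
  assumes U: "module K U" and b: "bilinear K A A U \<beta>" and \<Lambda>: "\<Lambda> \<in> carrier A"
    and int: "\<And>a. a \<in> carrier A \<Longrightarrow> a \<bullet> \<Lambda> = \<epsilon> a \<odot>\<^bsub>A\<^esub> \<Lambda>" and a: "a \<in> carrier A"
  shows "sw U (\<lambda>x y. \<beta> x (a \<bullet> y)) \<Lambda> = sw U (\<lambda>x y. \<beta> (S a \<bullet> x) y) \<Lambda>"
proof -
  note i = lin_intros module_hom_comp[OF bilinearD(1)[OF b]] module_hom_comp[OF bilinearD(2)[OF b]]
    A.m_closed antipode_closed bilinearD(3)[OF b] \<Lambda> U
  have f: "(\<lambda>z. sw U (\<lambda>x y. \<beta> (z \<bullet> x) (v \<bullet> y)) \<Lambda>) \<in> lin A U" if "v \<in> carrier A" for v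
    using that by (intro i)
  have E1: "bilinear K A A U (\<lambda>a1 a2. sw U (\<lambda>x y. \<beta> (S a1 \<bullet> x) y) (a2 \<bullet> \<Lambda>))"
    by (intro i)
  have "sw U (\<lambda>a1 a2. sw U (\<lambda>x y. \<beta> (S a1 \<bullet> x) y) (a2 \<bullet> \<Lambda>)) a
    = sw U (\<lambda>a1 a2. \<epsilon> a2 \<odot>\<^bsub>U\<^esub> sw U (\<lambda>x y. \<beta> (S a1 \<bullet> x) y) \<Lambda>) a"
  proof (rule sw_cong[OF U E1 a])
    fix a1 a2 assume a12: "a1 \<in> carrier A" "a2 \<in> carrier A"
    have h: "(\<lambda>z. sw U (\<lambda>x y. \<beta> (S a1 \<bullet> x) y) z) \<in> lin A U" using a12 by (intro i)
    show "sw U (\<lambda>x y. \<beta> (S a1 \<bullet> x) y) (a2 \<bullet> \<Lambda>) = \<epsilon> a2 \<odot>\<^bsub>U\<^esub> sw U (\<lambda>x y. \<beta> (S a1 \<bullet> x) y) \<Lambda>"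
      using module_hom_smult[OF h counit_closed[OF a12(2)] \<Lambda>] int[OF a12(2)] by simp
  qed
  also have "\<dots> = sw U (\<lambda>x y. \<beta> (S a \<bullet> x) y) \<Lambda>"
    by (rule sw_counit_right[OF U _ a]) (intro i)
  finally have E: "sw U (\<lambda>a1 a2. sw U (\<lambda>x y. \<beta> (S a1 \<bullet> x) y) (a2 \<bullet> \<Lambda>)) a
    = sw U (\<lambda>x y. \<beta> (S a \<bullet> x) y) \<Lambda>" .
  let ?\<gamma> = "\<lambda>a1 u v. sw U (\<lambda>x y. \<beta> (S a1 \<bullet> (u \<bullet> x)) (v \<bullet> y)) \<Lambda>"
  have "sw U (\<lambda>a1 a2. sw U (\<lambda>x y. \<beta> (S a1 \<bullet> x) y) (a2 \<bullet> \<Lambda>)) a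
    = sw U (\<lambda>a1 a2. sw U (?\<gamma> a1) a2) a"
  proof (rule sw_cong[OF U E1 a])
    fix a1 a2 assume a12: "a1 \<in> carrier A" "a2 \<in> carrier A"
    show "sw U (\<lambda>x y. \<beta> (S a1 \<bullet> x) y) (a2 \<bullet> \<Lambda>) = sw U (?\<gamma> a1) a2"
      by (rule sw_mult[OF U _ a12(2) \<Lambda>]) (use a12 in \<open>intro i\<close>)
  qed
  also have "\<dots> = sw U (\<lambda>z v. sw U (\<lambda>a1 u. ?\<gamma> a1 u v) z) a"
    by (rule sw_coassoc[OF U a, symmetric]; intro i; assumption?)
  also have "\<dots> = sw U (\<lambda>z v. \<epsilon> z \<odot>\<^bsub>U\<^esub> sw U (\<lambda>x y. \<beta> x (v \<bullet> y)) \<Lambda>) a"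
  proof (rule sw_cong[OF U _ a])
    show "bilinear K A A U (\<lambda>z v. sw U (\<lambda>a1 u. ?\<gamma> a1 u v) z)" by (intro i)
    fix z v assume zv: "z \<in> carrier A" "v \<in> carrier A"
    have "sw U (\<lambda>a1 u. ?\<gamma> a1 u v) z
      = sw U (\<lambda>a1 u. sw U (\<lambda>x y. \<beta> ((S a1 \<bullet> u) \<bullet> x) (v \<bullet> y)) \<Lambda>) z"
    proof (rule sw_cong[OF U _ zv(1)])
      show "bilinear K A A U (\<lambda>a1 u. ?\<gamma> a1 u v)" using zv by (intro i)
      fix a1 u assume au: "a1 \<in> carrier A" "u \<in> carrier A"
      show "?\<gamma> a1 u v = sw U (\<lambda>x y. \<beta> ((S a1 \<bullet> u) \<bullet> x) (v \<bullet> y)) \<Lambda>"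
      proof (rule sw_cong[OF U _ \<Lambda>])
        show "bilinear K A A U (\<lambda>x y. \<beta> (S a1 \<bullet> (u \<bullet> x)) (v \<bullet> y))" using zv au by (intro i)
      qed (use au in \<open>simp add: A.m_assoc\<close>)
    qed
    also have "\<dots> = \<epsilon> z \<odot>\<^bsub>U\<^esub> sw U (\<lambda>x y. \<beta> (\<one>\<^bsub>A\<^esub> \<bullet> x) (v \<bullet> y)) \<Lambda>"
      by (rule sw_antipode_left[OF U f[OF zv(2)] zv(1)])
    also have "sw U (\<lambda>x y. \<beta> (\<one>\<^bsub>A\<^esub> \<bullet> x) (v \<bullet> y)) \<Lambda> = sw U (\<lambda>x y. \<beta> x (v \<bullet> y)) \<Lambda>"
    proof (rule sw_cong[OF U _ \<Lambda>])
      show "bilinear K A A U (\<lambda>x y. \<beta> (\<one>\<^bsub>A\<^esub> \<bullet> x) (v \<bullet> y))" using zv by (intro i A.one_closed)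
    qed simp
    finally show "sw U (\<lambda>a1 u. ?\<gamma> a1 u v) z = \<epsilon> z \<odot>\<^bsub>U\<^esub> sw U (\<lambda>x y. \<beta> x (v \<bullet> y)) \<Lambda>" .
  qed
  also have "\<dots> = sw U (\<lambda>x y. \<beta> x (a \<bullet> y)) \<Lambda>"
    by (rule sw_counit_left[OF U _ a]) (intro i)
  finally show ?thesis using E by simp
qed

text \<open>The element \<open>x\<^sub>1 t(x\<^sub>2)\<close>.  For an integral \<open>t\<close> it is the analogue of the average of \<open>x\<close> over a group.\<close>
definition trace :: "('a \<Rightarrow> 'k) \<Rightarrow> 'a \<Rightarrow> 'a" where
  "trace t x = sw A (\<lambda>u v. t v \<odot>\<^bsub>A\<^esub> u) x"

lemma trace_bilinear:
  assumes t: "t \<in> lin A KK" shows "bilinear K A A A (\<lambda>u v. t v \<odot>\<^bsub>A\<^esub> u)"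
  using module_hom_closed[OF t] by (intro lin_intros t) auto

lemma trace_closed: "t \<in> lin A KK \<Longrightarrow> x \<in> carrier A \<Longrightarrow> trace t x \<in> carrier A"
  unfolding trace_def by (rule sw_closed[OF A_module trace_bilinear])

text \<open>The left-hand side is \<open>S(\<Lambda>\<^sub>1) \<Lambda>\<^sub>2 a\<^sub>1 t(\<Lambda>\<^sub>3 a\<^sub>2) = a\<^sub>1 t(\<Lambda> a\<^sub>2) = a\<^sub>1 \<epsilon>(a\<^sub>2) t(\<Lambda>)\<close>.\<close>
lemma trace_formula:
  assumes t: "t \<in> lin A KK" and \<Lambda>: "\<Lambda> \<in> carrier A"
    and int: "\<And>a. a \<in> carrier A \<Longrightarrow> \<Lambda> \<bullet> a = \<epsilon> a \<odot>\<^bsub>A\<^esub> \<Lambda>" and one: "t \<Lambda> = \<one>\<^bsub>K\<^esub>"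
    and a: "a \<in> carrier A"
  shows "sw A (\<lambda>x y. S x \<bullet> trace t (y \<bullet> a)) \<Lambda> = a"
proof -
  have tc: "t x \<in> carrier K" if "x \<in> carrier A" for x using module_hom_closed[OF t that] by simp
  note i = lin_intros module_hom_comp[OF t] tc A.m_closed antipode_closed a V.smult_closed
    module_hom_comp[OF t module_hom_ident]
  define f where "f = (\<lambda>v z. sw A (\<lambda>a1 a2. t (v \<bullet> a2) \<odot>\<^bsub>A\<^esub> (z \<bullet> a1)) a)"
  have fb: "bilinear K A A A (\<lambda>a1 a2. t (v \<bullet> a2) \<odot>\<^bsub>A\<^esub> (z \<bullet> a1))"
    if "v \<in> carrier A" "z \<in> carrier A" for v z using that by (intro i)
  have f1: "(\<lambda>x. f v (g x)) \<in> lin X A" if "v \<in> carrier A" "g \<in> lin X A" "module K X"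
    for v g and X :: "('k, 'a, 'p) module_scheme"
    unfolding f_def using that module_hom_closed[OF that(2)] by (intro i)
  have f2: "(\<lambda>x. f (g x) z) \<in> lin X A" if "z \<in> carrier A" "g \<in> lin X A" "module K X"
    for z g and X :: "('k, 'a, 'p) module_scheme"
    unfolding f_def using that module_hom_closed[OF that(2)] by (intro i)
  have step: "S u \<bullet> trace t (v \<bullet> a) = sw A (\<lambda>v1 v2. f v2 (S u \<bullet> v1)) v"
    if uv: "u \<in> carrier A" "v \<in> carrier A" for u v
  proof -
    have mS: "(\<bullet>) (S u) \<in> lin A A"
      using lin_mult_right[OF module_hom_ident antipode_closed[OF uv(1)]] by simp
    have "S u \<bullet> trace t (v \<bullet> a) = S u \<bullet> sw A (\<lambda>v1 v2. f v2 v1) v"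
      unfolding trace_def f_def by (simp add: sw_mult[OF A_module trace_bilinear[OF t] uv(2) a])
    also have "\<dots> = sw A (\<lambda>v1 v2. S u \<bullet> f v2 v1) v"
      by (rule sw_apply[OF A_module A_module _ mS uv(2)]) (intro i f1 f2)
    also have "\<dots> = sw A (\<lambda>v1 v2. f v2 (S u \<bullet> v1)) v"
    proof (rule sw_cong[OF A_module _ uv(2)])
      show "bilinear K A A A (\<lambda>v1 v2. S u \<bullet> f v2 v1)" using uv by (intro i f1 f2)
      fix v1 v2 assume v: "v1 \<in> carrier A" "v2 \<in> carrier A"
      have "S u \<bullet> f v2 v1 = sw A (\<lambda>a1 a2. S u \<bullet> (t (v2 \<bullet> a2) \<odot>\<^bsub>A\<^esub> (v1 \<bullet> a1))) a"
        unfolding f_def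
        by (rule sw_apply[OF A_module A_module fb[OF v(2,1)] mS a])
      also have "\<dots> = f v2 (S u \<bullet> v1)"
        unfolding f_def
      proof (rule sw_cong[OF A_module _ a])
        show "bilinear K A A A (\<lambda>a1 a2. S u \<bullet> (t (v2 \<bullet> a2) \<odot>\<^bsub>A\<^esub> (v1 \<bullet> a1)))"
          using uv v by (intro i)
      qed (use uv v tc in \<open>simp add: smult_mult_right A.m_assoc\<close>)
      finally show "S u \<bullet> f v2 v1 = f v2 (S u \<bullet> v1)" .
    qed
    finally show ?thesis .
  qed
  have trl: "trace t \<in> lin A A"
    using sw_hom[OF A_module trace_bilinear[OF t] module_hom_ident] by (simp add: trace_def[abs_def])
  have "sw A (\<lambda>x y. S x \<bullet> trace t (y \<bullet> a)) \<Lambda> = sw A (\<lambda>u v. sw A (\<lambda>v1 v2. f v2 (S u \<bullet> v1)) v) \<Lambda>"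
  proof (rule sw_cong[OF A_module _ \<Lambda> step])
    show "bilinear K A A A (\<lambda>x y. S x \<bullet> trace t (y \<bullet> a))"
      by (intro i module_hom_comp[OF trl] trace_closed t)
  qed
  also have "\<dots> = sw A (\<lambda>x v. sw A (\<lambda>u w. f v (S u \<bullet> w)) x) \<Lambda>"
    by (rule sw_coassoc[OF A_module \<Lambda>, where \<gamma> = "\<lambda>u w v. f v (S u \<bullet> w)", symmetric]; intro i f1 f2; assumption?)
  also have "\<dots> = sw A (\<lambda>x v. \<epsilon> x \<odot>\<^bsub>A\<^esub> f v \<one>\<^bsub>A\<^esub>) \<Lambda>"
  proof (rule sw_cong[OF A_module _ \<Lambda>])
    show "bilinear K A A A (\<lambda>x v. sw A (\<lambda>u w. f v (S u \<bullet> w)) x)" by (intro i f1 f2)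
    fix x v assume xv: "x \<in> carrier A" "v \<in> carrier A"
    show "sw A (\<lambda>u w. f v (S u \<bullet> w)) x = \<epsilon> x \<odot>\<^bsub>A\<^esub> f v \<one>\<^bsub>A\<^esub>"
      by (rule sw_antipode_left[OF A_module f1[OF xv(2) module_hom_ident A_module] xv(1)])
  qed
  also have "\<dots> = f \<Lambda> \<one>\<^bsub>A\<^esub>"
    by (rule sw_counit_left[OF A_module _ \<Lambda>]) (intro i f2 A.one_closed)
  also have "\<dots> = sw A (\<lambda>a1 a2. \<epsilon> a2 \<odot>\<^bsub>A\<^esub> a1) a"
    unfolding f_def
  proof (rule sw_cong[OF A_module fb[OF \<Lambda> A.one_closed] a])
    fix x y assume xy: "x \<in> carrier A" "y \<in> carrier A"
    have "t (\<Lambda> \<bullet> y) = \<epsilon> y"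
      using int[OF xy(2)] module_hom_smult[OF t counit_closed[OF xy(2)] \<Lambda>] one xy by simp
    then show "t (\<Lambda> \<bullet> y) \<odot>\<^bsub>A\<^esub> (\<one>\<^bsub>A\<^esub> \<bullet> x) = \<epsilon> y \<odot>\<^bsub>A\<^esub> x" using xy by simp
  qed
  also have "\<dots> = a" by (rule sw_counit_right[OF A_module module_hom_ident a])
  finally show ?thesis .
qed

end

context function_bialgebra begin

text \<open>The pairing is \<open>d, c \<mapsto> (d * c)(\<Lambda>) = d(\<Lambda>\<^sub>1) c(\<Lambda>\<^sub>2)\<close>.  Its right radical is stable under the translations
\<open>c \<mapsto> c(b \<cdot>)\<close>, because \<open>d(\<Lambda>\<^sub>1) c(b \<Lambda>\<^sub>2) = d(S(b) \<Lambda>\<^sub>1) c(\<Lambda>\<^sub>2)\<close>.  It therefore suffices that \<open>c(1) = 0\<close> for \<open>c\<close>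
in the radical.  Now \<open>c(1) = c(S(\<Lambda>\<^sub>1) \<Lambda>\<^sub>2)\<close>, and expanding \<open>c(x y)\<close> in \<open>x\<close> gives a sum of values
\<open>d(S(\<Lambda>\<^sub>1)) c(p \<Lambda>\<^sub>2)\<close>, which are zero since \<open>d \<circ> S\<close> is in \<open>C\<close> and \<open>c(p \<cdot>)\<close> is in the radical.\<close>
lemma pairing_nondegenerate:
  assumes \<Lambda>: "\<Lambda> \<in> carrier A" and int: "\<And>a. a \<in> carrier A \<Longrightarrow> a \<bullet> \<Lambda> = \<epsilon> a \<odot>\<^bsub>A\<^esub> \<Lambda>"
    and norm: "\<epsilon> \<Lambda> = \<one>\<^bsub>K\<^esub>"
    and c: "c \<in> C" and c0: "\<And>d. d \<in> C \<Longrightarrow> conv d c \<Lambda> = \<zero>\<^bsub>K\<^esub>" and b: "b \<in> carrier A"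
  shows "c b = \<zero>\<^bsub>K\<^esub>"
proof -
  obtain P' e where P': "P' \<subseteq> P" "K.separating (carrier A) C P'" "K.dual_basis C P' e"
    using K.ex_dual_basis[OF C sepP] by metis
  have fin: "finite P'" and pA: "\<And>p. p \<in> P' \<Longrightarrow> p \<in> carrier A"
    using P' P_subset finite_P finite_subset by auto
  have eC: "e p \<in> C" if "p \<in> P'" for p using P'(3) that by (auto simp: K.dual_basis_def)
  have shift: "conv d (\<lambda>y. c (b \<bullet> y)) \<Lambda> = \<zero>\<^bsub>K\<^esub>"
    if c: "c \<in> C" and c0: "\<And>d. d \<in> C \<Longrightarrow> conv d c \<Lambda> = \<zero>\<^bsub>K\<^esub>" and d: "d \<in> C" and b: "b \<in> carrier A" for c d b
  proof -
    have "conv d (\<lambda>y. c (b \<bullet> y)) \<Lambda> = conv (\<lambda>x. d (S b \<bullet> x)) c \<Lambda>"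
      unfolding conv_def using integral_shift[OF KK_module conv_bilinear[OF C_lin[OF d] C_lin[OF c]] \<Lambda> int b]
      by simp
    then show ?thesis using c0[OF left_C[OF d antipode_closed[OF b]]] by simp
  qed
  have at_one: "c \<one>\<^bsub>A\<^esub> = \<zero>\<^bsub>K\<^esub>" if c: "c \<in> C" and c0: "\<And>d. d \<in> C \<Longrightarrow> conv d c \<Lambda> = \<zero>\<^bsub>K\<^esub>" for c
  proof -
    have eS: "(\<lambda>x. e p (S x)) \<in> C" if "p \<in> P'" for p by (rule antipode_C[OF eC[OF that]])
    have "c \<one>\<^bsub>A\<^esub> = sw KK (\<lambda>x y. c (S x \<bullet> y)) \<Lambda>"
      using sw_antipode_left[OF KK_module C_lin[OF c] \<Lambda>] norm C_closed[OF c] by simp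
    also have "\<dots> = (\<Oplus>\<^bsub>K\<^esub>p\<in>P'. \<one>\<^bsub>K\<^esub> \<ast> conv (\<lambda>x. e p (S x)) (\<lambda>y. c (p \<bullet> y)) \<Lambda>)"
    proof (rule sw_lin_comb[OF fin C_lin[OF eS] C_lin[OF left_C[OF c pA]] K.one_closed \<Lambda>])
      fix x y assume xy: "x \<in> carrier A" "y \<in> carrier A"
      have "c (S x \<bullet> y) = (\<Oplus>\<^bsub>K\<^esub>p\<in>P'. c (p \<bullet> y) \<ast> e p (S x))"
        by (rule K.dual_basis_expand[OF C P'(2,3) order_refl right_C[OF c xy(2)] antipode_closed[OF xy(1)]])
      also have "\<dots> = (\<Oplus>\<^bsub>K\<^esub>p\<in>P'. \<one>\<^bsub>K\<^esub> \<ast> (e p (S x) \<ast> c (p \<bullet> y)))"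
        using pA xy C_closed[OF c] C_closed[OF eC] by (intro K.finsum_cong') (auto simp: K.m_comm)
      finally show "c (S x \<bullet> y) = (\<Oplus>\<^bsub>K\<^esub>p\<in>P'. \<one>\<^bsub>K\<^esub> \<ast> (e p (S x) \<ast> c (p \<bullet> y)))" .
    qed
    also have "\<dots> = (\<Oplus>\<^bsub>K\<^esub>p\<in>P'. \<zero>\<^bsub>K\<^esub>)"
      by (rule K.finsum_cong'[OF refl]) (simp_all add: shift[OF c c0] eS pA)
    finally show ?thesis by simp
  qed
  show ?thesis using at_one[OF left_C[OF c b] shift[OF c c0 _ b]] b by simp
qed

text \<open>By nondegeneracy there is a \<open>t\<close> with \<open>(d * t)(\<Lambda>) = d(1)\<close> for all \<open>d\<close> in \<open>C\<close>.  Then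
\<open>(d * (c * t))(\<Lambda>) = (d * c)(1) = d(1) c(1)\<close>, so \<open>c * t\<close> and \<open>c(1) t\<close> pair equally with all \<open>d\<close>.\<close>
lemma ex_function_integral:
  assumes \<Lambda>: "\<Lambda> \<in> carrier A" and int: "\<And>a. a \<in> carrier A \<Longrightarrow> a \<bullet> \<Lambda> = \<epsilon> a \<odot>\<^bsub>A\<^esub> \<Lambda>"
    and norm: "\<epsilon> \<Lambda> = \<one>\<^bsub>K\<^esub>"
  shows "\<exists>t\<in>C. t \<Lambda> = \<one>\<^bsub>K\<^esub> \<and> (\<forall>c\<in>C. \<forall>a\<in>carrier A. conv c t a = c \<one>\<^bsub>A\<^esub> \<ast> t a)"
proof -
  note Cc = C_closed[OF _ A.one_closed]
  have radical: "c x = \<zero>\<^bsub>K\<^esub>"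
    if "c \<in> C" "\<And>d. d \<in> C \<Longrightarrow> conv d c \<Lambda> = \<zero>\<^bsub>K\<^esub>" "x \<in> carrier A" for c x
    by (rule pairing_nondegenerate[OF \<Lambda> int norm that])
  obtain P' e where P': "P' \<subseteq> P" "K.separating (carrier A) C P'" "K.dual_basis C P' e"
    using K.ex_dual_basis[OF C sepP] by metis
  have P'A: "P' \<subseteq> carrier A" "finite P'" using P' P_subset finite_P finite_subset by auto
  have eC: "e p \<in> C" if "p \<in> P'" for p using P'(3) that by (auto simp: K.dual_basis_def)
  have expand: "c x = (\<Oplus>\<^bsub>K\<^esub>p\<in>P'. c p \<ast> e p x)" if "c \<in> C" "x \<in> carrier A" for c x
    by (rule K.dual_basis_expand[OF C P'(2,3) order_refl that])
  have BK: "conv d c \<Lambda> \<in> carrier K" if "d \<in> C" "c \<in> C" for d c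
    by (rule conv_closed[OF C_lin[OF that(1)] C_lin[OF that(2)] \<Lambda>])
  have Bexpand: "conv d c \<Lambda> = (\<Oplus>\<^bsub>K\<^esub>p\<in>P'. d p \<ast> conv (e p) c \<Lambda>)" if d: "d \<in> C" and c: "c \<in> C" for d c
    using P'A C_closed[OF d] by (intro conv_lin_comb[OF P'A(2) C_lin[OF eC] C_lin[OF c] _ \<Lambda> expand[OF d]]) auto
  have at_point: "(\<Oplus>\<^bsub>K\<^esub>p\<in>P'. k p \<ast> e p q) = k q" if k: "\<And>p. p \<in> P' \<Longrightarrow> k p \<in> carrier K" and q: "q \<in> P'" for k q
  proof -
    have "(\<Oplus>\<^bsub>K\<^esub>p\<in>P'. k p \<ast> e p q) = (\<Oplus>\<^bsub>K\<^esub>p\<in>P'. if q = p then k p else \<zero>\<^bsub>K\<^esub>)"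
      using P'(3) q k by (intro K.finsum_cong') (auto simp: K.dual_basis_def)
    also have "\<dots> = k q" by (rule K.finsum_singleton[OF q P'A(2)]) (use k in auto)
    finally show ?thesis .
  qed
  \<comment> \<open>The map \<open>\<phi>\<close> records the values of the pairing with the dual basis, so it is injective by
    nondegeneracy; the function \<open>\<eta>\<close> records the values of the dual basis at the unit.\<close>
  define \<phi> where "\<phi> = (\<lambda>c x. \<Oplus>\<^bsub>K\<^esub>p\<in>P'. conv (e p) c \<Lambda> \<ast> e p x)"
  have \<phi>C: "\<phi> c \<in> C" if "c \<in> C" for c
    unfolding \<phi>_def by (rule K.fun_space_finsum[OF C P'A(2) K.fun_space_smult[OF C eC BK[OF eC that]]])
  have \<phi>p: "\<phi> c q = conv (e q) c \<Lambda>" if c: "c \<in> C" and q: "q \<in> P'" for c q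
    unfolding \<phi>_def by (rule at_point[OF BK[OF eC c] q])
  define \<eta> where "\<eta> = (\<lambda>x. \<Oplus>\<^bsub>K\<^esub>p\<in>P'. e p \<one>\<^bsub>A\<^esub> \<ast> e p x)"
  have \<eta>C: "\<eta> \<in> C"
    unfolding \<eta>_def by (rule K.fun_space_finsum[OF C P'A(2) K.fun_space_smult[OF C eC Cc[OF eC]]])
  have \<eta>p: "\<eta> q = e q \<one>\<^bsub>A\<^esub>" if q: "q \<in> P'" for q
    unfolding \<eta>_def by (rule at_point[OF Cc[OF eC] q])
  have "\<exists>t\<in>C. \<forall>x\<in>carrier A. \<phi> t x = \<eta> x"
  proof (rule K.injective_imp_surjective[where \<phi> = \<phi>, OF C P'(2) \<phi>C _ _ \<eta>C])
    fix c d g k x assume c: "c \<in> C" "d \<in> C" "g \<in> C" and k: "k \<in> carrier K"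
      and g: "\<And>x. x \<in> carrier A \<Longrightarrow> g x = k \<ast> c x \<oplus>\<^bsub>K\<^esub> d x" and x: "x \<in> carrier A"
    have h: "(\<lambda>x. k \<ast> \<phi> c x \<oplus>\<^bsub>K\<^esub> \<phi> d x) \<in> C"
      by (rule K.fun_space_comb[OF C \<phi>C[OF c(1)] \<phi>C[OF c(2)] k]) simp
    show "\<phi> g x = k \<ast> \<phi> c x \<oplus>\<^bsub>K\<^esub> \<phi> d x"
      by (rule K.separating_eqI[OF C P'(2) \<phi>C[OF c(3)] h _ x])
        (simp add: \<phi>p c conv_comb_right[OF C_lin[OF eC] C_lin[OF c(1)] C_lin[OF c(2)] C_lin[OF c(3)] k g \<Lambda>])
  next
    fix c x assume c: "c \<in> C" and c0: "\<And>x. x \<in> carrier A \<Longrightarrow> \<phi> c x = \<zero>\<^bsub>K\<^esub>" and x: "x \<in> carrier A"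
    have Be: "conv (e p) c \<Lambda> = \<zero>\<^bsub>K\<^esub>" if p: "p \<in> P'" for p using c0 \<phi>p[OF c p] p P'A by auto
    have "conv d c \<Lambda> = \<zero>\<^bsub>K\<^esub>" if d: "d \<in> C" for d
    proof -
      have "conv d c \<Lambda> = (\<Oplus>\<^bsub>K\<^esub>p\<in>P'. \<zero>\<^bsub>K\<^esub>)"
        unfolding Bexpand[OF d c] using Be P'A C_closed[OF d]
        by (intro K.finsum_cong') (auto simp: subset_eq)
      then show ?thesis by simp
    qed
    then show "c x = \<zero>\<^bsub>K\<^esub>" by (rule radical[OF c _ x])
  qed
  then obtain t where t: "t \<in> C" "\<And>x. x \<in> carrier A \<Longrightarrow> \<phi> t x = \<eta> x" by blast
  have Bt: "conv d t \<Lambda> = d \<one>\<^bsub>A\<^esub>" if d: "d \<in> C" for d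
  proof -
    have "conv d t \<Lambda> = (\<Oplus>\<^bsub>K\<^esub>p\<in>P'. d p \<ast> e p \<one>\<^bsub>A\<^esub>)"
      unfolding Bexpand[OF d t(1)] using t(2) \<phi>p[OF t(1)] \<eta>p P'A C_closed[OF d] Cc[OF eC]
      by (intro K.finsum_cong') (auto simp: subset_eq)
    then show ?thesis using expand[OF d A.one_closed] by simp
  qed
  have "t \<Lambda> = \<one>\<^bsub>K\<^esub>" using Bt[OF counit_C] conv_counit_left[OF C_lin[OF t(1)] \<Lambda>] by simp
  moreover have "conv c t a = c \<one>\<^bsub>A\<^esub> \<ast> t a" if c: "c \<in> C" and a: "a \<in> carrier A" for c a
  proof -
    define g where "g = (\<lambda>a. \<ominus>\<^bsub>K\<^esub> c \<one>\<^bsub>A\<^esub> \<ast> t a \<oplus>\<^bsub>K\<^esub> conv c t a)"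
    have ctC: "conv c t \<in> C" by (rule conv_C[OF c t(1)])
    have k: "\<ominus>\<^bsub>K\<^esub> c \<one>\<^bsub>A\<^esub> \<in> carrier K" using Cc[OF c] by simp
    have gC: "g \<in> C" by (rule K.fun_space_comb[OF C t(1) ctC k]) (simp add: g_def)
    have "conv d g \<Lambda> = \<zero>\<^bsub>K\<^esub>" if d: "d \<in> C" for d
    proof -
      have "conv d (conv c t) \<Lambda> = conv d c \<one>\<^bsub>A\<^esub>"
        using Bt[OF conv_C[OF d c]] conv_assoc[OF C_lin[OF d] C_lin[OF c] C_lin[OF t(1)] \<Lambda>] by simp
      also have "\<dots> = d \<one>\<^bsub>A\<^esub> \<ast> c \<one>\<^bsub>A\<^esub>"
        unfolding conv_def by (rule sw_one[OF KK_module conv_bilinear[OF C_lin[OF d] C_lin[OF c]]])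
      finally show ?thesis
        using conv_comb_right[OF C_lin[OF d] C_lin[OF t(1)] C_lin[OF ctC] C_lin[OF gC] k _ \<Lambda>] Bt[OF d] Cc[OF c] Cc[OF d]
        by (simp add: g_def K.l_minus K.r_minus K.m_comm K.l_neg)
    qed
    then have "g a = \<zero>\<^bsub>K\<^esub>" by (rule radical[OF gC _ a])
    then have "conv c t a \<ominus>\<^bsub>K\<^esub> c \<one>\<^bsub>A\<^esub> \<ast> t a = \<zero>\<^bsub>K\<^esub>"
      using Cc[OF c] C_closed[OF t(1) a] C_closed[OF ctC a] by (simp add: g_def K.l_minus a_minus_def K.a_comm)
    then show ?thesis
      using Cc[OF c] C_closed[OF t(1) a] C_closed[OF ctC a] by - (rule K.eq_if_minus_zero; simp)
  qed
  ultimately show ?thesis using t(1) by blast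
qed

end

section \<open>Coordinates on a finite-dimensional space\<close>

text \<open>A spanning set of least size is linearly independent, so coordinates are unique, and unique coordinates are
linear.\<close>
lemma (in field) ex_coordinates:
  assumes V: "module R V" and fd: "finite_dimensional R V"
  obtains B \<xi> where "finite B" "B \<subseteq> carrier V" "\<And>b. b \<in> B \<Longrightarrow> \<xi> b \<in> module_hom R V (regular_module R)"
    "\<And>v. v \<in> carrier V \<Longrightarrow> v = (\<Oplus>\<^bsub>V\<^esub>b\<in>B. \<xi> b v \<odot>\<^bsub>V\<^esub> b)"
proof -
  interpret V: module R V by fact
  define spans where "spans = (\<lambda>B. finite B \<and> B \<subseteq> carrier V \<and>
    (\<forall>v\<in>carrier V. \<exists>c\<in>B \<rightarrow> carrier R. v = (\<Oplus>\<^bsub>V\<^esub>b\<in>B. c b \<odot>\<^bsub>V\<^esub> b)))"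
  have "\<exists>B. spans B" using fd by (simp add: finite_dimensional_def spans_def)
  then obtain B where B: "spans B" and min: "\<And>B'. spans B' \<Longrightarrow> card B \<le> card B'"
    using ex_has_least_nat[of spans _ card] by blast
  have fin: "finite B" and BV: "B \<subseteq> carrier V" using B by (auto simp: spans_def)
  have comb: "(\<Oplus>\<^bsub>V\<^esub>b\<in>B. (k \<otimes> c b \<oplus> d b) \<odot>\<^bsub>V\<^esub> b)
      = k \<odot>\<^bsub>V\<^esub> (\<Oplus>\<^bsub>V\<^esub>b\<in>B. c b \<odot>\<^bsub>V\<^esub> b) \<oplus>\<^bsub>V\<^esub> (\<Oplus>\<^bsub>V\<^esub>b\<in>B. d b \<odot>\<^bsub>V\<^esub> b)"
    if c: "c \<in> B \<rightarrow> carrier R" and d: "d \<in> B \<rightarrow> carrier R" and k: "k \<in> carrier R" for c d k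
  proof -
    have "(\<Oplus>\<^bsub>V\<^esub>b\<in>B. (k \<otimes> c b \<oplus> d b) \<odot>\<^bsub>V\<^esub> b) = (\<Oplus>\<^bsub>V\<^esub>b\<in>B. k \<odot>\<^bsub>V\<^esub> (c b \<odot>\<^bsub>V\<^esub> b) \<oplus>\<^bsub>V\<^esub> d b \<odot>\<^bsub>V\<^esub> b)"
      using c d k BV by (intro V.M.finsum_cong') (auto simp: Pi_iff subset_eq V.smult_l_distr V.smult_assoc1)
    also have "\<dots> = (\<Oplus>\<^bsub>V\<^esub>b\<in>B. k \<odot>\<^bsub>V\<^esub> (c b \<odot>\<^bsub>V\<^esub> b)) \<oplus>\<^bsub>V\<^esub> (\<Oplus>\<^bsub>V\<^esub>b\<in>B. d b \<odot>\<^bsub>V\<^esub> b)"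
      using c d k BV by (intro V.M.finsum_addf) (auto simp: Pi_iff subset_eq)
    also have "(\<Oplus>\<^bsub>V\<^esub>b\<in>B. k \<odot>\<^bsub>V\<^esub> (c b \<odot>\<^bsub>V\<^esub> b)) = k \<odot>\<^bsub>V\<^esub> (\<Oplus>\<^bsub>V\<^esub>b\<in>B. c b \<odot>\<^bsub>V\<^esub> b)"
      using c k BV fin by (intro V.finsum_smult_ldistr[symmetric]) (auto simp: Pi_iff subset_eq)
    finally show ?thesis .
  qed
  have sumc: "(\<Oplus>\<^bsub>V\<^esub>b\<in>B. c b \<odot>\<^bsub>V\<^esub> b) \<in> carrier V" if "c \<in> B \<rightarrow> carrier R" for c
    using that BV by (intro V.M.finsum_closed) (auto simp: Pi_iff subset_eq)
  have indep: "c b0 = \<zero>" if c: "c \<in> B \<rightarrow> carrier R" and c0: "(\<Oplus>\<^bsub>V\<^esub>b\<in>B. c b \<odot>\<^bsub>V\<^esub> b) = \<zero>\<^bsub>V\<^esub>" and b0: "b0 \<in> B" for c b0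
  proof (rule ccontr)
    assume n: "c b0 \<noteq> \<zero>"
    have cU: "c b0 \<in> Units R" using c b0 n by (auto simp: field_Units)
    have "spans (B - {b0})"
      unfolding spans_def
    proof (intro conjI ballI)
      show "finite (B - {b0})" "B - {b0} \<subseteq> carrier V" using fin BV by auto
      fix v assume "v \<in> carrier V"
      then obtain d where d: "d \<in> B \<rightarrow> carrier R" "v = (\<Oplus>\<^bsub>V\<^esub>b\<in>B. d b \<odot>\<^bsub>V\<^esub> b)"
        using B by (auto simp: spans_def)
      \<comment> \<open>The multiple of the relation \<open>c\<close> that removes \<open>b\<^sub>0\<close> from the representation \<open>d\<close> of \<open>v\<close>.\<close>
      define k where "k = \<ominus> (d b0 \<otimes> inv (c b0))"
      have dc: "d b0 \<in> carrier R" using d(1) b0 by auto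
      have k: "k \<in> carrier R" using dc cU by (simp add: k_def)
      define d' where "d' = (\<lambda>b. k \<otimes> c b \<oplus> d b)"
      have d'c: "d' \<in> B \<rightarrow> carrier R" using c d k by (auto simp: d'_def)
      have "k \<otimes> c b0 = \<ominus> (d b0 \<otimes> (inv (c b0) \<otimes> c b0))"
        using dc cU Units_closed[OF cU] Units_inv_closed[OF cU] by (simp only: k_def l_minus m_assoc m_closed)
      then have d'0: "d' b0 = \<zero>" using dc cU by (simp add: d'_def l_neg)
      have "v = (\<Oplus>\<^bsub>V\<^esub>b\<in>B. d' b \<odot>\<^bsub>V\<^esub> b)"
        unfolding d'_def comb[OF c d(1) k] c0 using d(2) sumc[OF d(1)] k by simp
      also have "\<dots> = (\<Oplus>\<^bsub>V\<^esub>b\<in>B - {b0}. d' b \<odot>\<^bsub>V\<^esub> b)"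
        using fin d'c d'0 BV by (intro V.M.add.finprod_mono_neutral_cong_right) (auto simp: Pi_iff subset_eq)
      finally show "\<exists>c\<in>B - {b0} \<rightarrow> carrier R. v = (\<Oplus>\<^bsub>V\<^esub>b\<in>B - {b0}. c b \<odot>\<^bsub>V\<^esub> b)"
        using d'c by (intro bexI[of _ d']) auto
    qed
    from min[OF this] show False using b0 fin by (metis card_Diff1_less leD)
  qed
  have "\<forall>v. \<exists>c. v \<in> carrier V \<longrightarrow> c \<in> B \<rightarrow> carrier R \<and> v = (\<Oplus>\<^bsub>V\<^esub>b\<in>B. c b \<odot>\<^bsub>V\<^esub> b)"
    using B unfolding spans_def by blast
  then obtain f where f: "\<And>v. v \<in> carrier V \<Longrightarrow> f v \<in> B \<rightarrow> carrier R"
      "\<And>v. v \<in> carrier V \<Longrightarrow> v = (\<Oplus>\<^bsub>V\<^esub>b\<in>B. f v b \<odot>\<^bsub>V\<^esub> b)"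
    unfolding choice_iff by blast
  have uniq: "f v b = c b" if v: "v \<in> carrier V" and c: "c \<in> B \<rightarrow> carrier R"
    and eq: "v = (\<Oplus>\<^bsub>V\<^esub>b\<in>B. c b \<odot>\<^bsub>V\<^esub> b)" and b: "b \<in> B" for v c b
  proof -
    have k: "\<ominus> \<one> \<in> carrier R" by simp
    have "(\<Oplus>\<^bsub>V\<^esub>b\<in>B. (\<ominus> \<one> \<otimes> c b \<oplus> f v b) \<odot>\<^bsub>V\<^esub> b) = \<ominus> \<one> \<odot>\<^bsub>V\<^esub> v \<oplus>\<^bsub>V\<^esub> v"
      unfolding comb[OF c f(1)[OF v] k] using eq f(2)[OF v] by simp
    also have "\<dots> = \<zero>\<^bsub>V\<^esub>" using v by (simp add: V.smult_l_minus V.M.l_neg)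
    finally have 0: "\<ominus> \<one> \<otimes> c b \<oplus> f v b = \<zero>"
      using c f(1)[OF v] b by (intro indep[of "\<lambda>b. \<ominus> \<one> \<otimes> c b \<oplus> f v b"]) auto
    have cb: "c b \<in> carrier R" "f v b \<in> carrier R" using c f(1)[OF v] b by auto
    have "f v b \<ominus> c b = \<zero>" using 0 cb by (simp add: l_minus a_minus_def a_comm)
    then show ?thesis using cb eq_if_minus_zero by blast
  qed
  show ?thesis
  proof (rule that[of B "\<lambda>b v. f v b"])
    fix b assume b: "b \<in> B"
    show "(\<lambda>v. f v b) \<in> module_hom R V (regular_module R)"
    proof (rule module_homI)
      show "f v b \<in> carrier (regular_module R)" if "v \<in> carrier V" for v using f(1)[OF that] b by auto
      show "f (u \<oplus>\<^bsub>V\<^esub> v) b = f u b \<oplus>\<^bsub>regular_module R\<^esub> f v b" if uv: "u \<in> carrier V" "v \<in> carrier V" for u v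
      proof -
        have "f (u \<oplus>\<^bsub>V\<^esub> v) b = \<one> \<otimes> f u b \<oplus> f v b"
        proof (rule uniq[OF _ _ _ b])
          show "u \<oplus>\<^bsub>V\<^esub> v = (\<Oplus>\<^bsub>V\<^esub>b\<in>B. (\<one> \<otimes> f u b \<oplus> f v b) \<odot>\<^bsub>V\<^esub> b)"
            unfolding comb[OF f(1)[OF uv(1)] f(1)[OF uv(2)] one_closed] using f(2) uv by simp
        qed (use uv f(1) in \<open>auto simp: Pi_iff\<close>)
        then show ?thesis using f(1)[OF uv(1)] b by (auto simp: Pi_iff)
      qed
      show "f (k \<odot>\<^bsub>V\<^esub> v) b = k \<odot>\<^bsub>regular_module R\<^esub> f v b" if kv: "k \<in> carrier R" "v \<in> carrier V" for k v
      proof -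
        have z: "(\<lambda>b. \<zero>) \<in> B \<rightarrow> carrier R" by simp
        have "(\<Oplus>\<^bsub>V\<^esub>b\<in>B. \<zero> \<odot>\<^bsub>V\<^esub> b) = (\<Oplus>\<^bsub>V\<^esub>b\<in>B. \<zero>\<^bsub>V\<^esub>)"
          using BV by (intro V.M.finsum_cong') auto
        then have z0: "(\<Oplus>\<^bsub>V\<^esub>b\<in>B. \<zero> \<odot>\<^bsub>V\<^esub> b) = \<zero>\<^bsub>V\<^esub>" by simp
        have "f (k \<odot>\<^bsub>V\<^esub> v) b = k \<otimes> f v b \<oplus> \<zero>"
        proof (rule uniq[OF _ _ _ b])
          show "k \<odot>\<^bsub>V\<^esub> v = (\<Oplus>\<^bsub>V\<^esub>b\<in>B. (k \<otimes> f v b \<oplus> \<zero>) \<odot>\<^bsub>V\<^esub> b)"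
            unfolding comb[OF f(1)[OF kv(2)] z kv(1)] z0 using f(2)[OF kv(2)] kv by simp
        qed (use kv f(1) in \<open>auto simp: Pi_iff\<close>)
        then show ?thesis using f(1)[OF kv(2)] b kv by (auto simp: Pi_iff)
      qed
    qed
  qed (use fin BV f(2) in auto)
qed

text \<open>Used to extend a property of generators to their linear span.\<close>
lemma (in field) fun_space_vimage:
  fixes X :: "'x set"
  assumes E: "fun_space X E" and D: "fun_space Y D"
    and T: "\<And>c d e k y. c \<in> E \<Longrightarrow> d \<in> E \<Longrightarrow> e \<in> E \<Longrightarrow> k \<in> carrier R \<Longrightarrow>
      (\<And>x. x \<in> X \<Longrightarrow> e x = k \<otimes> c x \<oplus> d x) \<Longrightarrow> y \<in> Y \<Longrightarrow> T e y = k \<otimes> T c y \<oplus> T d y"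
    and cl: "\<And>c y. c \<in> E \<Longrightarrow> y \<in> Y \<Longrightarrow> T c y \<in> carrier R"
  shows "fun_space X {c \<in> E. T c \<in> D}"
  unfolding fun_space_def
proof (intro conjI ballI allI impI)
  define z where "z = (\<lambda>x :: 'x. \<zero>)"
  have z: "z \<in> E" by (rule fun_space_zero[OF E]) (simp add: z_def)
  have "T z y = \<zero>" if y: "y \<in> Y" for y
    using T[OF z z z, of "\<ominus> \<one>" y] y cl[OF z y] by (simp add: z_def l_minus l_neg)
  then have "T z \<in> D" by (rule fun_space_zero[OF D])
  then show "{c \<in> E. T c \<in> D} \<noteq> {}" using z by auto
  show "c x \<in> carrier R" if "c \<in> {c \<in> E. T c \<in> D}" "x \<in> X" for c x
    using that fun_space_closed[OF E] by auto
  fix c d k e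
  assume c: "c \<in> {c \<in> E. T c \<in> D}" and d: "d \<in> {c \<in> E. T c \<in> D}" and k: "k \<in> carrier R"
    and e: "\<forall>x\<in>X. e x = k \<otimes> c x \<oplus> d x"
  have eE: "e \<in> E" by (rule fun_space_comb[OF E, of c d k]) (use c d k e in auto)
  have "T e \<in> D" by (rule fun_space_comb[OF D, of "T c" "T d" k]) (use c d k e eE T[of c d e k] in auto)
  then show "e \<in> {c \<in> E. T c \<in> D}" using eE by simp
qed

section \<open>Matrix coefficients of tensor powers\<close>

locale hopf_module = hopf_algebra K A \<Delta> \<epsilon> S
  for K :: "('k, 'q) ring_scheme" and A :: "('k, 'a, 'p) module_scheme" and \<Delta> \<epsilon> S +
  fixes M :: "('a, 'm, 's) module_scheme"
  assumes M: "left_module A M"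
begin

abbreviation V where "V \<equiv> underlying_space A M"

lemma V_simps [simp]:
  "carrier V = carrier M" "\<zero>\<^bsub>V\<^esub> = \<zero>\<^bsub>M\<^esub>" "u \<oplus>\<^bsub>V\<^esub> v = u \<oplus>\<^bsub>M\<^esub> v" "c \<odot>\<^bsub>V\<^esub> m = (c \<odot>\<^bsub>A\<^esub> \<one>\<^bsub>A\<^esub>) \<odot>\<^bsub>M\<^esub> m"
  by (simp_all add: underlying_space_def)

sublocale LM: left_module A M by (rule M)

lemma V_module: "module K V"
proof (rule moduleI)
  show "cring K" by (rule K.is_cring)
  show "abelian_group V"
    by (rule abelian_groupI) (auto simp: LM.M.a_ac intro: LM.M.l_neg)
  show "(a \<ast> b) \<odot>\<^bsub>V\<^esub> x = a \<odot>\<^bsub>V\<^esub> (b \<odot>\<^bsub>V\<^esub> x)"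
    if "a \<in> carrier K" "b \<in> carrier K" "x \<in> carrier V" for a b x
    using that by (simp add: LM.smult_assoc[symmetric] smult_mult_left V.smult_assoc1)
qed (auto simp: LM.smult_closed V.smult_l_distr LM.smult_l_distr LM.smult_r_distr LM.smult_one)

lemma act_lin: "m \<in> carrier M \<Longrightarrow> (\<lambda>a. a \<odot>\<^bsub>M\<^esub> m) \<in> lin A V"
proof (rule module_homI)
  fix r v assume "m \<in> carrier M" "r \<in> carrier K" "v \<in> carrier A"
  then show "(r \<odot>\<^bsub>A\<^esub> v) \<odot>\<^bsub>M\<^esub> m = r \<odot>\<^bsub>V\<^esub> (v \<odot>\<^bsub>M\<^esub> m)"
    by (simp add: LM.smult_assoc[symmetric] smult_mult_left)
qed (simp_all add: LM.smult_closed LM.smult_l_distr)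

lemma act_lin2: "a \<in> carrier A \<Longrightarrow> (\<lambda>m. a \<odot>\<^bsub>M\<^esub> m) \<in> lin V V"
proof (rule module_homI)
  fix r m assume "a \<in> carrier A" "r \<in> carrier K" "m \<in> carrier V"
  then show "a \<odot>\<^bsub>M\<^esub> (r \<odot>\<^bsub>V\<^esub> m) = r \<odot>\<^bsub>V\<^esub> (a \<odot>\<^bsub>M\<^esub> m)"
    by (simp add: LM.smult_assoc[symmetric] smult_mult_left smult_mult_right)
qed (simp_all add: LM.smult_closed LM.smult_r_distr)

end

locale fd_hopf_module = hopf_module K A \<Delta> \<epsilon> S M
  for K :: "('k, 'q) ring_scheme" and A :: "('k, 'a, 'p) module_scheme" and \<Delta> \<epsilon> S
    and M :: "('a, 'm, 's) module_scheme" +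
  fixes B :: "'m set" and \<xi> :: "'m \<Rightarrow> 'm \<Rightarrow> 'k"
  assumes finite_B: "finite B" and B_subset: "B \<subseteq> carrier M"
    and \<xi>_lin: "b \<in> B \<Longrightarrow> \<xi> b \<in> lin V KK"
    and \<xi>_expand: "v \<in> carrier M \<Longrightarrow> v = (\<Oplus>\<^bsub>V\<^esub>b\<in>B. \<xi> b v \<odot>\<^bsub>V\<^esub> b)"
begin

lemma \<xi>_closed: "b \<in> B \<Longrightarrow> v \<in> carrier M \<Longrightarrow> \<xi> b v \<in> carrier K"
  using module_hom_closed[OF \<xi>_lin, of b v] by simp

definition coef :: "'m \<Rightarrow> 'm \<Rightarrow> 'a \<Rightarrow> 'k" where "coef b m a = \<xi> b (a \<odot>\<^bsub>M\<^esub> m)"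

lemma coef_lin: "b \<in> B \<Longrightarrow> m \<in> carrier M \<Longrightarrow> coef b m \<in> lin A KK"
  unfolding coef_def[abs_def] by (rule module_hom_comp[OF \<xi>_lin act_lin])

text \<open>The coefficients of the tensor power \<open>M\<^sup>\<otimes>\<^sup>n\<close>, indexed by the pairs of words of length \<open>n\<close> in the basis; such
a pair is represented as a word of pairs.\<close>
primrec word_coef :: "('m \<times> 'm) list \<Rightarrow> 'a \<Rightarrow> 'k" where
  "word_coef [] = \<epsilon>"
| "word_coef (p # ps) = conv (coef (fst p) (snd p)) (word_coef ps)"

lemma word_coef_lin: "ps \<in> lists (B \<times> B) \<Longrightarrow> word_coef ps \<in> lin A KK"
  using B_subset by (induction ps) (auto intro!: counit_lin conv_lin coef_lin)

definition Coef :: "nat \<Rightarrow> ('a \<Rightarrow> 'k) set" where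
  "Coef n = K.fun_span (carrier A) (word_coef ` {ps \<in> lists (B \<times> B). length ps \<le> n})"

lemma Coef_gen_closed:
  "g \<in> word_coef ` {ps \<in> lists (B \<times> B). length ps \<le> n} \<Longrightarrow> x \<in> carrier A \<Longrightarrow> g x \<in> carrier K"
  using lin_K_closed[OF word_coef_lin] by auto

lemma Coef_space: "K.fun_space (carrier A) (Coef n)"
  unfolding Coef_def by (rule K.fun_span_space) (rule Coef_gen_closed)

lemma Coef_lin: "Coef n \<subseteq> lin A KK"
  unfolding Coef_def by (rule K.fun_span_least[OF lin_functionals_space]) (auto intro: word_coef_lin)

lemma Coef_mono: "n \<le> m \<Longrightarrow> Coef n \<subseteq> Coef m"
  unfolding Coef_def by (rule K.fun_span_mono) auto

lemma Coef_word: "ps \<in> lists (B \<times> B) \<Longrightarrow> length ps \<le> n \<Longrightarrow> word_coef ps \<in> Coef n"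
  unfolding Coef_def by (rule K.fun_span_base) (auto intro: lin_K_closed[OF word_coef_lin])

lemma Coef_least:
  assumes "K.fun_space (carrier A) D" "\<And>ps. ps \<in> lists (B \<times> B) \<Longrightarrow> length ps \<le> n \<Longrightarrow> word_coef ps \<in> D"
  shows "Coef n \<subseteq> D"
  unfolding Coef_def by (rule K.fun_span_least[OF assms(1)]) (use assms(2) in auto)

lemma Coef_separating: "\<exists>P. K.separating (carrier A) (Coef n) P"
  unfolding Coef_def
proof (rule K.finite_span_separating)
  have "finite {ps. set ps \<subseteq> B \<times> B \<and> length ps \<le> n}"
    using finite_B by (intro finite_lists_length_le) auto
  moreover have "{ps \<in> lists (B \<times> B). length ps \<le> n} = {ps. set ps \<subseteq> B \<times> B \<and> length ps \<le> n}"
    by (auto simp: lists_eq_set)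
  ultimately show "finite (word_coef ` {ps \<in> lists (B \<times> B). length ps \<le> n})" by simp
qed (rule Coef_gen_closed)

lemma coef_expand:
  assumes b: "b \<in> B" and m: "m \<in> carrier M" and a: "a \<in> carrier A"
  shows "coef b m a = (\<Oplus>\<^bsub>K\<^esub>b'\<in>B. \<xi> b' m \<ast> coef b b' a)"
proof -
  interpret W: module K V by (rule V_module)
  interpret U: module K KK by (rule KK_module)
  have h: "(\<lambda>m. coef b m a) \<in> lin V KK"
    unfolding coef_def by (rule module_hom_comp[OF \<xi>_lin[OF b] act_lin2[OF a]])
  have c: "(\<lambda>b'. \<xi> b' m \<odot>\<^bsub>V\<^esub> b') \<in> B \<rightarrow> carrier V"
    using \<xi>_closed[OF _ m] B_subset by (intro Pi_I W.smult_closed) auto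
  have "coef b m a = coef b (\<Oplus>\<^bsub>V\<^esub>b'\<in>B. \<xi> b' m \<odot>\<^bsub>V\<^esub> b') a" using \<xi>_expand[OF m] by simp
  also have "\<dots> = (\<Oplus>\<^bsub>KK\<^esub>b'\<in>B. coef b (\<xi> b' m \<odot>\<^bsub>V\<^esub> b') a)"
    by (rule module_hom_finsum[OF h W.M.abelian_group_axioms U.M.abelian_group_axioms c finite_B])
  also have "\<dots> = (\<Oplus>\<^bsub>KK\<^esub>b'\<in>B. \<xi> b' m \<ast> coef b b' a)"
    using \<xi>_closed[OF _ m] B_subset lin_K_closed[OF coef_lin[OF b] a] module_hom_smult[OF h]
    by (intro U.M.finsum_cong') (auto simp del: V_simps(4))
  finally show ?thesis by simp
qed

lemma conv_coef_expand:
  assumes b: "b \<in> B" and m: "m \<in> carrier M" and a: "a \<in> carrier A" and d: "d \<in> lin A KK"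
  shows "conv (coef b m) d a = (\<Oplus>\<^bsub>K\<^esub>b'\<in>B. \<xi> b' m \<ast> conv (coef b b') d a)"
  using B_subset \<xi>_closed[OF _ m]
  by (intro conv_lin_comb[OF finite_B coef_lin[OF b] d _ a coef_expand[OF b m]]) auto

text \<open>For \<open>m\<close> in the basis the left factor only adds a letter to the words; other \<open>m\<close> are expanded in the
basis.\<close>
lemma conv_coef_Coef:
  assumes b: "b \<in> B" and m: "m \<in> carrier M" and d: "d \<in> Coef n"
  shows "conv (coef b m) d \<in> Coef (Suc n)"
proof -
  have dl: "d \<in> lin A KK" using d Coef_lin by auto
  have "conv (coef b b') d \<in> Coef (Suc n)" if b': "b' \<in> B" for b'
  proof -
    have cl: "coef b b' \<in> lin A KK" using coef_lin[OF b] b' B_subset by auto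
    have sp: "K.fun_space (carrier A) {d \<in> lin A KK. conv (coef b b') d \<in> Coef (Suc n)}"
    proof (rule K.fun_space_vimage[OF lin_functionals_space Coef_space])
      show "conv (coef b b') e y = k \<ast> conv (coef b b') c y \<oplus>\<^bsub>K\<^esub> conv (coef b b') d y"
        if "c \<in> lin A KK" "d \<in> lin A KK" "e \<in> lin A KK" "k \<in> carrier K"
          "\<And>x. x \<in> carrier A \<Longrightarrow> e x = k \<ast> c x \<oplus>\<^bsub>K\<^esub> d x" "y \<in> carrier A" for c d e k y
        by (rule conv_comb_right[OF cl that])
    qed (rule conv_closed[OF cl])
    have "Coef n \<subseteq> {d \<in> lin A KK. conv (coef b b') d \<in> Coef (Suc n)}"
    proof (rule Coef_least[OF sp])
      fix ps assume ps: "ps \<in> lists (B \<times> B)" "length ps \<le> n"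
      have "word_coef ((b, b') # ps) \<in> Coef (Suc n)" using ps b b' by (intro Coef_word) auto
      then show "word_coef ps \<in> {d \<in> lin A KK. conv (coef b b') d \<in> Coef (Suc n)}"
        using word_coef_lin[OF ps(1)] by simp
    qed
    then show ?thesis using d by auto
  qed
  then have "(\<lambda>a. \<Oplus>\<^bsub>K\<^esub>b'\<in>B. \<xi> b' m \<ast> conv (coef b b') d a) \<in> Coef (Suc n)"
    by (intro K.fun_space_finsum[OF Coef_space finite_B] K.fun_space_smult[OF Coef_space _ \<xi>_closed[OF _ m]])
  then show ?thesis by (rule K.fun_space_cong[OF Coef_space]) (rule conv_coef_expand[OF b m _ dl])
qed

text \<open>By induction on the word.  Right translation by \<open>u\<close> turns the coefficient \<open>\<xi>\<^sub>b(a b')\<close> into \<open>\<xi>\<^sub>b(a (u b'))\<close>;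
left translation by \<open>u\<close> turns it into the sum of \<open>\<xi>\<^sub>b(u b'') \<xi>\<^bsub>b''\<^esub>(a b')\<close> over the basis vectors \<open>b''\<close>.\<close>
lemma word_coef_translate:
  assumes "ps \<in> lists (B \<times> B)" "x \<in> carrier A"
  shows "(\<lambda>a. word_coef ps (x \<bullet> a)) \<in> Coef (length ps) \<and> (\<lambda>a. word_coef ps (a \<bullet> x)) \<in> Coef (length ps)"
  using assms
proof (induction ps arbitrary: x)
  case Nil
  have e: "\<epsilon> \<in> Coef 0" using Coef_word[of "[]" 0] by simp
  show ?case
    using K.fun_space_cong[OF Coef_space K.fun_space_smult[OF Coef_space e counit_closed[OF Nil]]]
    by (auto simp: counit_mult Nil K.m_comm)
next
  case (Cons p ps)
  obtain b b' where p: "p = (b, b')" "b \<in> B" "b' \<in> B" using Cons.hyps by auto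
  have ps: "ps \<in> lists (B \<times> B)" and x: "x \<in> carrier A" using Cons.hyps Cons.prems by auto
  have b'M: "b' \<in> carrier M" using p B_subset by auto
  note cl = coef_lin[OF p(2) b'M] and wl = word_coef_lin[OF ps]
  let ?n = "Suc (length ps)"
  let ?I = "{p. formal_comult x p \<noteq> \<zero>\<^bsub>K\<^esub>}"
  have pA: "fst q \<in> carrier A" "snd q \<in> carrier A" if "q \<in> ?I" for q
    using that formal_comultD(3)[OF x, of "fst q" "snd q"] by auto
  note fc = formal_comultD(2)[OF x]
  have L: "conv (\<lambda>a. coef b b' (u \<bullet> a)) (\<lambda>a. word_coef ps (v \<bullet> a)) \<in> Coef ?n"
    if uv: "u \<in> carrier A" "v \<in> carrier A" for u v
  proof -
    have w: "(\<lambda>a. word_coef ps (v \<bullet> a)) \<in> Coef (length ps)" using Cons.IH[OF uv(2)] by simp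
    have wl': "(\<lambda>a. word_coef ps (v \<bullet> a)) \<in> lin A KK" using w Coef_lin by auto
    define h where "h = (\<lambda>a. \<Oplus>\<^bsub>K\<^esub>b''\<in>B. coef b b'' u \<ast> coef b'' b' a)"
    have heq: "coef b b' (u \<bullet> a) = h a" if a: "a \<in> carrier A" for a
    proof -
      have am: "a \<odot>\<^bsub>M\<^esub> b' \<in> carrier M" using a b'M by (rule LM.smult_closed)
      have "coef b b' (u \<bullet> a) = coef b (a \<odot>\<^bsub>M\<^esub> b') u"
        using uv a b'M by (simp add: coef_def LM.smult_assoc)
      also have "\<dots> = (\<Oplus>\<^bsub>K\<^esub>b''\<in>B. \<xi> b'' (a \<odot>\<^bsub>M\<^esub> b') \<ast> coef b b'' u)" by (rule coef_expand[OF p(2) am uv(1)])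
      also have "\<dots> = h a"
        unfolding h_def
        using \<xi>_closed[OF _ am] lin_K_closed[OF coef_lin[OF p(2)] uv(1)] B_subset
        by (intro K.finsum_cong') (auto simp: coef_def K.m_comm subset_eq)
      finally show ?thesis .
    qed
    have "(\<lambda>a. \<Oplus>\<^bsub>K\<^esub>b''\<in>B. coef b b'' u \<ast> conv (coef b'' b') (\<lambda>a. word_coef ps (v \<bullet> a)) a) \<in> Coef ?n"
      using lin_K_closed[OF coef_lin[OF p(2)] uv(1)] B_subset
      by (intro K.fun_space_finsum[OF Coef_space finite_B] K.fun_space_smult[OF Coef_space conv_coef_Coef[OF _ b'M w]]) auto
    then show ?thesis
    proof (rule K.fun_space_cong[OF Coef_space])
      fix a assume a: "a \<in> carrier A"
      show "conv (\<lambda>a. coef b b' (u \<bullet> a)) (\<lambda>a. word_coef ps (v \<bullet> a)) a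
        = (\<Oplus>\<^bsub>K\<^esub>b''\<in>B. coef b b'' u \<ast> conv (coef b'' b') (\<lambda>a. word_coef ps (v \<bullet> a)) a)"
        using lin_K_closed[OF coef_lin[OF p(2)] uv(1)] B_subset
        by (intro conv_lin_comb[OF finite_B coef_lin[OF _ b'M] wl' _ a]) (auto simp: heq h_def)
    qed
  qed
  have R: "conv (\<lambda>a. coef b b' (a \<bullet> u)) (\<lambda>a. word_coef ps (a \<bullet> v)) \<in> Coef ?n"
    if uv: "u \<in> carrier A" "v \<in> carrier A" for u v
  proof -
    have w: "(\<lambda>a. word_coef ps (a \<bullet> v)) \<in> Coef (length ps)" using Cons.IH[OF uv(2)] by simp
    have wl': "(\<lambda>a. word_coef ps (a \<bullet> v)) \<in> lin A KK" using w Coef_lin by auto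
    have um: "u \<odot>\<^bsub>M\<^esub> b' \<in> carrier M" using uv b'M by (auto intro: LM.smult_closed)
    show ?thesis
    proof (rule K.fun_space_cong[OF Coef_space conv_coef_Coef[OF p(2) um w]])
      fix a assume a: "a \<in> carrier A"
      show "conv (\<lambda>a. coef b b' (a \<bullet> u)) (\<lambda>a. word_coef ps (a \<bullet> v)) a
        = conv (coef b (u \<odot>\<^bsub>M\<^esub> b')) (\<lambda>a. word_coef ps (a \<bullet> v)) a"
        by (rule conv_cong[OF translate_lin(2)[OF cl uv(1)] wl' a])
          (use uv b'M in \<open>simp_all add: coef_def LM.smult_assoc\<close>)
    qed
  qed
  have "(\<lambda>a. \<Oplus>\<^bsub>K\<^esub>q\<in>?I. formal_comult x q \<ast>
      conv (\<lambda>a. coef b b' (fst q \<bullet> a)) (\<lambda>a. word_coef ps (snd q \<bullet> a)) a) \<in> Coef ?n"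
    by (intro K.fun_space_finsum[OF Coef_space formal_comultD(1)[OF x]] K.fun_space_smult[OF Coef_space L fc] pA)
  then have 1: "(\<lambda>a. word_coef (p # ps) (x \<bullet> a)) \<in> Coef ?n"
    by (rule K.fun_space_cong[OF Coef_space]) (simp add: p conv_translate(1)[OF cl wl x])
  have "(\<lambda>a. \<Oplus>\<^bsub>K\<^esub>q\<in>?I. formal_comult x q \<ast>
      conv (\<lambda>a. coef b b' (a \<bullet> fst q)) (\<lambda>a. word_coef ps (a \<bullet> snd q)) a) \<in> Coef ?n"
    by (intro K.fun_space_finsum[OF Coef_space formal_comultD(1)[OF x]] K.fun_space_smult[OF Coef_space R fc] pA)
  then have 2: "(\<lambda>a. word_coef (p # ps) (a \<bullet> x)) \<in> Coef ?n"
    by (rule K.fun_space_cong[OF Coef_space]) (simp add: p conv_translate(2)[OF cl wl _ x])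
  show ?case using 1 2 by simp
qed

lemma Coef_translate:
  assumes c: "c \<in> Coef n" and x: "x \<in> carrier A"
  shows "(\<lambda>a. c (x \<bullet> a)) \<in> Coef n" "(\<lambda>a. c (a \<bullet> x)) \<in> Coef n"
proof -
  have "K.fun_space (carrier A) {c \<in> lin A KK. (\<lambda>a. c (x \<bullet> a)) \<in> Coef n}"
    by (rule K.fun_space_vimage[OF lin_functionals_space Coef_space]) (use x in \<open>auto simp: lin_K_closed\<close>)
  then have "Coef n \<subseteq> {c \<in> lin A KK. (\<lambda>a. c (x \<bullet> a)) \<in> Coef n}"
    by (rule Coef_least) (use word_coef_translate[OF _ x] Coef_mono in \<open>auto intro: word_coef_lin\<close>)
  then show "(\<lambda>a. c (x \<bullet> a)) \<in> Coef n" using c by auto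
  have "K.fun_space (carrier A) {c \<in> lin A KK. (\<lambda>a. c (a \<bullet> x)) \<in> Coef n}"
    by (rule K.fun_space_vimage[OF lin_functionals_space Coef_space]) (use x in \<open>auto simp: lin_K_closed\<close>)
  then have "Coef n \<subseteq> {c \<in> lin A KK. (\<lambda>a. c (a \<bullet> x)) \<in> Coef n}"
    by (rule Coef_least) (use word_coef_translate[OF _ x] Coef_mono in \<open>auto intro: word_coef_lin\<close>)
  then show "(\<lambda>a. c (a \<bullet> x)) \<in> Coef n" using c by auto
qed

lemma Coef_conv:
  assumes c: "c \<in> Coef n" and d: "d \<in> Coef m"
  shows "conv c d \<in> Coef (n + m)"
proof -
  have dl: "d \<in> lin A KK" using d Coef_lin by auto
  have w: "conv (word_coef ps) d \<in> Coef (length ps + m)" if "ps \<in> lists (B \<times> B)" for ps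
    using that
  proof (induction ps)
    case Nil
    show ?case using K.fun_space_cong[OF Coef_space d] conv_counit_left[OF dl] by auto
  next
    case (Cons p ps)
    obtain b b' where p: "p = (b, b')" "b \<in> B" "b' \<in> B" using Cons.hyps by auto
    have b'M: "b' \<in> carrier M" using p B_subset by auto
    show ?case
      using K.fun_space_cong[OF Coef_space conv_coef_Coef[OF p(2) b'M Cons.IH]]
        conv_assoc[OF coef_lin[OF p(2) b'M] word_coef_lin dl] Cons.hyps p by auto
  qed
  have "K.fun_space (carrier A) {c \<in> lin A KK. conv c d \<in> Coef (n + m)}"
  proof (rule K.fun_space_vimage[OF lin_functionals_space Coef_space])
    show "conv e d y = k \<ast> conv c d y \<oplus>\<^bsub>K\<^esub> conv c' d y"
      if "c \<in> lin A KK" "c' \<in> lin A KK" "e \<in> lin A KK" "k \<in> carrier K"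
        "\<And>x. x \<in> carrier A \<Longrightarrow> e x = k \<ast> c x \<oplus>\<^bsub>K\<^esub> c' x" "y \<in> carrier A" for c c' e k y
      by (rule conv_comb_left[OF dl that])
  qed (rule conv_closed[OF _ dl])
  then have "Coef n \<subseteq> {c \<in> lin A KK. conv c d \<in> Coef (n + m)}"
  proof (rule Coef_least)
    fix ps assume ps: "ps \<in> lists (B \<times> B)" "length ps \<le> n"
    have "Coef (length ps + m) \<subseteq> Coef (n + m)" using ps by (intro Coef_mono) auto
    then show "word_coef ps \<in> {c \<in> lin A KK. conv c d \<in> Coef (n + m)}"
      using w[OF ps(1)] word_coef_lin[OF ps(1)] by auto
  qed
  then show ?thesis using c by auto
qed

end

section \<open>The annihilator of the tensor powers\<close>

locale semisimple_hopf_module = fd_hopf_module K A \<Delta> \<epsilon> S M B \<xi>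
  for K :: "('k, 'q) ring_scheme" and A :: "('k, 'a, 'p) module_scheme" and \<Delta> \<epsilon> S
    and M :: "('a, 'm, 's) module_scheme" and B \<xi> +
  assumes semisimple_A: "semisimple_ring A"
begin

sublocale SS: semisimple A
  by (intro semisimple.intro semisimple_axioms.intro semisimple_A) (rule A.ring_axioms)

definition Coefs :: "('a \<Rightarrow> 'k) set" where "Coefs = (\<Union>n. Coef n)"

lemma Coefs_lin: "c \<in> Coefs \<Longrightarrow> c \<in> lin A KK"
  using Coef_lin by (auto simp: Coefs_def)

lemma Coefs_translate:
  assumes c: "c \<in> Coefs" and b: "b \<in> carrier A"
  shows "(\<lambda>a. c (b \<bullet> a)) \<in> Coefs" "(\<lambda>a. c (a \<bullet> b)) \<in> Coefs"
proof -
  obtain n where "c \<in> Coef n" using c by (auto simp: Coefs_def)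
  from Coef_translate[OF this b]
  show "(\<lambda>a. c (b \<bullet> a)) \<in> Coefs" "(\<lambda>a. c (a \<bullet> b)) \<in> Coefs"
    unfolding Coefs_def by blast+
qed

lemma Coefs_space: "K.fun_space (carrier A) Coefs"
  unfolding K.fun_space_def
proof (intro conjI ballI allI impI)
  have "word_coef [] \<in> Coefs" using Coef_word[of "[]" 0] by (auto simp: Coefs_def)
  then show "Coefs \<noteq> {}" by auto
  show "c x \<in> carrier K" if "c \<in> Coefs" "x \<in> carrier A" for c x using lin_K_closed[OF Coefs_lin] that .
  fix c d k e assume c: "c \<in> Coefs" and d: "d \<in> Coefs" and k: "k \<in> carrier K"
    and e: "\<forall>x\<in>carrier A. e x = k \<ast> c x \<oplus>\<^bsub>K\<^esub> d x"
  obtain n m where "c \<in> Coef n" "d \<in> Coef m" using c d by (auto simp: Coefs_def)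
  then have cd: "c \<in> Coef (max n m)" "d \<in> Coef (max n m)"
    using Coef_mono[of n "max n m"] Coef_mono[of m "max n m"] by auto
  have "e \<in> Coef (max n m)" by (rule K.fun_space_comb[OF Coef_space cd k]) (use e in auto)
  then show "e \<in> Coefs" by (auto simp: Coefs_def)
qed

definition ann :: "nat \<Rightarrow> 'a set" where "ann n = {a \<in> carrier A. \<forall>c\<in>Coef n. c a = \<zero>\<^bsub>K\<^esub>}"

lemma lin_zero: "c \<in> lin A KK \<Longrightarrow> c \<zero>\<^bsub>A\<^esub> = \<zero>\<^bsub>K\<^esub>"
  using module_hom_zero[of c K A KK, OF _ A.abelian_group_axioms K.regular_abelian_group] by simp

lemma lin_add: "c \<in> lin A KK \<Longrightarrow> x \<in> carrier A \<Longrightarrow> y \<in> carrier A \<Longrightarrow> c (x \<oplus>\<^bsub>A\<^esub> y) = c x \<oplus>\<^bsub>K\<^esub> c y"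
  using module_hom_add[of c K A KK] by simp

lemma lin_minus: "c \<in> lin A KK \<Longrightarrow> x \<in> carrier A \<Longrightarrow> y \<in> carrier A \<Longrightarrow> c (x \<ominus>\<^bsub>A\<^esub> y) = c x \<ominus>\<^bsub>K\<^esub> c y"
  using module_hom_a_minus[of c K A KK, OF _ A.abelian_group_axioms K.regular_abelian_group]
    K.add_monoid_regular by (simp add: a_minus_def)

lemma annihilator_left_ideal:
  assumes C: "C \<subseteq> lin A KK" and l: "\<And>c b. c \<in> C \<Longrightarrow> b \<in> carrier A \<Longrightarrow> (\<lambda>a. c (b \<bullet> a)) \<in> C"
  shows "A.left_ideal {a \<in> carrier A. \<forall>c\<in>C. c a = \<zero>\<^bsub>K\<^esub>}"
  unfolding A.left_ideal_def
proof (intro conjI ballI)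
  show "\<zero>\<^bsub>A\<^esub> \<in> {a \<in> carrier A. \<forall>c\<in>C. c a = \<zero>\<^bsub>K\<^esub>}" using lin_zero C by auto
  show "x \<oplus>\<^bsub>A\<^esub> y \<in> {a \<in> carrier A. \<forall>c\<in>C. c a = \<zero>\<^bsub>K\<^esub>}"
    if "x \<in> {a \<in> carrier A. \<forall>c\<in>C. c a = \<zero>\<^bsub>K\<^esub>}" "y \<in> {a \<in> carrier A. \<forall>c\<in>C. c a = \<zero>\<^bsub>K\<^esub>}" for x y
  proof -
    have xy: "x \<in> carrier A" "y \<in> carrier A" using that by auto
    have "c (x \<oplus>\<^bsub>A\<^esub> y) = \<zero>\<^bsub>K\<^esub>" if c: "c \<in> C" for c
    proof -
      have "c x = \<zero>\<^bsub>K\<^esub>" "c y = \<zero>\<^bsub>K\<^esub>"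
        using c \<open>x \<in> {a \<in> carrier A. _}\<close> \<open>y \<in> {a \<in> carrier A. _}\<close> by auto
      moreover have "c (x \<oplus>\<^bsub>A\<^esub> y) = c x \<oplus>\<^bsub>K\<^esub> c y" by (rule lin_add[OF _ xy]) (use C c in auto)
      ultimately show ?thesis by simp
    qed
    then show ?thesis using xy by simp
  qed
  show "b \<bullet> x \<in> {a \<in> carrier A. \<forall>c\<in>C. c a = \<zero>\<^bsub>K\<^esub>}"
    if b: "b \<in> carrier A" and x: "x \<in> {a \<in> carrier A. \<forall>c\<in>C. c a = \<zero>\<^bsub>K\<^esub>}" for b x
  proof -
    have "c (b \<bullet> x) = \<zero>\<^bsub>K\<^esub>" if "c \<in> C" for c using x l[OF that b] by fastforce
    then show ?thesis using b x by simp
  qed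
qed auto

lemma annihilator_right_ideal:
  assumes r: "\<And>c b. c \<in> C \<Longrightarrow> b \<in> carrier A \<Longrightarrow> (\<lambda>a. c (a \<bullet> b)) \<in> C"
    and b: "b \<in> carrier A" and x: "x \<in> {a \<in> carrier A. \<forall>c\<in>C. c a = \<zero>\<^bsub>K\<^esub>}"
  shows "x \<bullet> b \<in> {a \<in> carrier A. \<forall>c\<in>C. c a = \<zero>\<^bsub>K\<^esub>}"
proof -
  have "c (x \<bullet> b) = \<zero>\<^bsub>K\<^esub>" if "c \<in> C" for c using x r[OF that b] by fastforce
  then show ?thesis using b x by simp
qed

text \<open>The annihilators of the spaces \<open>Coef n\<close> form a descending chain of ideals \<open>A (1 - f\<^sub>n)\<close> with \<open>f\<^sub>n\<close> central
idempotents.  The ascending union of the ideals \<open>A f\<^sub>n\<close> is generated by a single element, which lies in some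
\<open>A f\<^sub>N\<close>; thus \<open>f\<^sub>n = f\<^sub>n f\<^sub>N\<close> for all \<open>n\<close>, and whatever \<open>Coef N\<close> annihilates is annihilated by all
\<open>Coef n\<close>.  A dual basis of \<open>Coef N\<close> on a separating set \<open>P\<close> shows that modulo this annihilator every element
is a combination of points of \<open>P\<close>, so \<open>P\<close> separates all coefficients.\<close>
lemma Coefs_separating: "\<exists>P. K.separating (carrier A) Coefs P"
proof -
  have J: "A.left_ideal (ann n)" for n
    unfolding ann_def using Coef_lin Coef_translate(1) by (intro annihilator_left_ideal)
  have Jr: "x \<bullet> a \<in> ann n" if "a \<in> carrier A" "x \<in> ann n" for n a x
    unfolding ann_def by (rule annihilator_right_ideal) (use that Coef_translate(2) in \<open>auto simp: ann_def\<close>)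
  have Jmono: "ann m \<subseteq> ann n" if "n \<le> m" for n m using Coef_mono[OF that] by (auto simp: ann_def)
  have "\<exists>e. e \<in> ann n \<and> (\<forall>x\<in>ann n. x \<bullet> e = x \<and> e \<bullet> x = x) \<and>
      (\<forall>a\<in>carrier A. e \<bullet> a = a \<bullet> e)" for n
    using SS.ideal_central_idempotent[OF J[of n] Jr] by metis
  then obtain e where e: "\<And>n. e n \<in> ann n" "\<And>n x. x \<in> ann n \<Longrightarrow> x \<bullet> e n = x"
      "\<And>n x. x \<in> ann n \<Longrightarrow> e n \<bullet> x = x" by metis
  define f where "f = (\<lambda>n. \<one>\<^bsub>A\<^esub> \<ominus>\<^bsub>A\<^esub> e n)"
  have ec: "e n \<in> carrier A" for n using e(1)[of n] by (simp add: ann_def)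
  have fc: "f n \<in> carrier A" for n using ec by (simp add: f_def)
  have lf: "f n \<bullet> a = a \<ominus>\<^bsub>A\<^esub> e n \<bullet> a" "a \<bullet> f n = a \<ominus>\<^bsub>A\<^esub> a \<bullet> e n" if "a \<in> carrier A" for a n
    using that ec by (simp_all add: f_def a_minus_def A.l_distr A.r_distr A.l_minus A.r_minus)
  have ff: "f n \<bullet> f m = f n" if nm: "n \<le> m" for n m
  proof -
    have "e m \<in> ann n" using e(1) Jmono[OF nm] by blast
    then have "f n \<bullet> e m = \<zero>\<^bsub>A\<^esub>" using lf(1)[OF ec] e(3) ec by (simp add: a_minus_def A.r_neg)
    then show ?thesis using lf(2)[OF fc] fc by (simp add: a_minus_def)
  qed
  define U where "U = {a \<in> carrier A. \<exists>n. a \<bullet> f n = a}"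
  have U: "A.left_ideal U"
    unfolding A.left_ideal_def
  proof (intro conjI ballI)
    show "\<zero>\<^bsub>A\<^esub> \<in> U" using fc by (auto simp: U_def)
    show "x \<oplus>\<^bsub>A\<^esub> y \<in> U" if xy: "x \<in> U" "y \<in> U" for x y
    proof -
      obtain n m where nm: "x \<in> carrier A" "x \<bullet> f n = x" "y \<in> carrier A" "y \<bullet> f m = y"
        using xy by (auto simp: U_def)
      have "(x \<bullet> f n) \<bullet> f (max n m) = x \<bullet> (f n \<bullet> f (max n m))"
        by (rule A.m_assoc[OF nm(1) fc fc])
      then have x: "x \<bullet> f (max n m) = x" using nm(2) ff[of n "max n m"] by simp
      have "(y \<bullet> f m) \<bullet> f (max n m) = y \<bullet> (f m \<bullet> f (max n m))"
        by (rule A.m_assoc[OF nm(3) fc fc])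
      then have y: "y \<bullet> f (max n m) = y" using nm(4) ff[of m "max n m"] by simp
      show ?thesis using x y nm fc by (auto simp: U_def A.l_distr intro!: exI[of _ "max n m"])
    qed
    show "a \<bullet> x \<in> U" if ax: "a \<in> carrier A" "x \<in> U" for a x
    proof -
      obtain n where "x \<in> carrier A" "x \<bullet> f n = x" using ax by (auto simp: U_def)
      then show ?thesis using ax fc by (auto simp: U_def A.m_assoc intro!: exI[of _ n])
    qed
  qed (auto simp: U_def)
  obtain g where g: "g \<in> U" "\<And>x. x \<in> U \<Longrightarrow> x \<bullet> g = x"
    using SS.left_ideal_complement[OF U] by metis
  obtain N where N: "g \<in> carrier A" "g \<bullet> f N = g" using g(1) by (auto simp: U_def)
  \<comment> \<open>The chain is stationary from \<open>N\<close> on.\<close>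
  have fN: "f n \<bullet> f N = f n" for n
  proof -
    have "f n \<in> U" using fc ff[of n n] by (auto simp: U_def)
    then have "f n \<bullet> g = f n" by (rule g(2))
    then show ?thesis using N fc by (metis A.m_assoc)
  qed
  obtain P0 where P0: "K.separating (carrier A) (Coef N) P0" using Coef_separating by blast
  obtain P d where P: "K.separating (carrier A) (Coef N) P" "K.dual_basis (Coef N) P d"
    using K.ex_dual_basis[OF Coef_space P0] by metis
  have finP: "finite P" and PA: "P \<subseteq> carrier A" using P(1) by (auto simp: K.separating_def)
  have dC: "d p \<in> Coef N" if "p \<in> P" for p using P(2) that by (auto simp: K.dual_basis_def)
  have cf: "c (f n \<bullet> a) = c a" if c: "c \<in> Coef n" and a: "a \<in> carrier A" for c n a
  proof -
    have cl: "c \<in> lin A KK" using c Coef_lin by auto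
    have "e n \<bullet> a \<in> ann n" by (rule Jr[OF a e(1)])
    then have "c (e n \<bullet> a) = \<zero>\<^bsub>K\<^esub>" using c by (simp add: ann_def)
    then show ?thesis using lf(1)[OF a] lin_minus[OF cl a] a ec lin_K_closed[OF cl a]
      by (simp add: a_minus_def)
  qed
  have fz: "f N \<bullet> z = \<zero>\<^bsub>A\<^esub>" if "z \<in> ann N" for z
  proof -
    have "z \<in> carrier A" using that by (simp add: ann_def)
    then show ?thesis using lf(1) e(3)[OF that] by (simp add: a_minus_def A.r_neg)
  qed
  have vanish: "c z = \<zero>\<^bsub>K\<^esub>" if c: "c \<in> Coef n" and z: "z \<in> ann N" for c n z
  proof -
    have zc: "z \<in> carrier A" using z by (simp add: ann_def)
    have cl: "c \<in> lin A KK" using c Coef_lin by auto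
    have "c z = c ((f n \<bullet> f N) \<bullet> z)" using cf[OF c zc] fN by simp
    also have "\<dots> = c \<zero>\<^bsub>A\<^esub>" using fz[OF z] fc zc by (simp add: A.m_assoc)
    finally show ?thesis using lin_zero[OF cl] by simp
  qed
  have "K.separating (carrier A) Coefs P"
    unfolding K.separating_def
  proof (intro conjI ballI impI finP PA)
    fix c x assume "c \<in> Coefs" and c0: "\<forall>p\<in>P. c p = \<zero>\<^bsub>K\<^esub>" and x: "x \<in> carrier A"
    then obtain n where c: "c \<in> Coef n" by (auto simp: Coefs_def)
    have cl: "c \<in> lin A KK" using c Coef_lin by auto
    define s where "s = (\<Oplus>\<^bsub>A\<^esub>p\<in>P. d p x \<odot>\<^bsub>A\<^esub> p)"
    have dl: "d p \<in> lin A KK" if "p \<in> P" for p using dC[OF that] Coef_lin by auto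
    have t: "(\<lambda>p. d p x \<odot>\<^bsub>A\<^esub> p) \<in> P \<rightarrow> carrier A"
      using lin_K_closed[OF dl x] PA by auto
    have sc: "s \<in> carrier A" unfolding s_def by (rule A.finsum_closed[OF t])
    have cs: "c' s = (\<Oplus>\<^bsub>K\<^esub>p\<in>P. c' p \<ast> d p x)" if c': "c' \<in> lin A KK" for c'
    proof -
      have "c' s = (\<Oplus>\<^bsub>KK\<^esub>p\<in>P. c' (d p x \<odot>\<^bsub>A\<^esub> p))"
        unfolding s_def by (rule module_hom_finsum[OF c' A.abelian_group_axioms K.regular_abelian_group t finP])
      also have "\<dots> = (\<Oplus>\<^bsub>K\<^esub>p\<in>P. c' p \<ast> d p x)"
        unfolding finsum_KK
      proof (rule K.finsum_cong'[OF refl])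
        show "(\<lambda>p. c' p \<ast> d p x) \<in> P \<rightarrow> carrier K" using lin_K_closed[OF c'] lin_K_closed[OF dl x] PA by auto
        fix p assume p: "p \<in> P"
        then have "p \<in> carrier A" using PA by auto
        then show "c' (d p x \<odot>\<^bsub>A\<^esub> p) = c' p \<ast> d p x"
          using module_hom_smult[OF c' lin_K_closed[OF dl[OF p] x]] lin_K_closed[OF c'] lin_K_closed[OF dl[OF p] x]
          by (simp add: K.m_comm)
      qed
      finally show ?thesis .
    qed
    have "c' (x \<ominus>\<^bsub>A\<^esub> s) = \<zero>\<^bsub>K\<^esub>" if c': "c' \<in> Coef N" for c'
    proof -
      have l: "c' \<in> lin A KK" using c' Coef_lin by auto
      have "c' x = c' s" unfolding cs[OF l] by (rule K.dual_basis_expand[OF Coef_space P order_refl c' x])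
      then show ?thesis using lin_minus[OF l x sc] lin_K_closed[OF l sc] by (simp add: a_minus_def K.r_neg)
    qed
    then have "x \<ominus>\<^bsub>A\<^esub> s \<in> ann N" using x sc by (simp add: ann_def)
    then have "c x \<ominus>\<^bsub>K\<^esub> c s = \<zero>\<^bsub>K\<^esub>" using vanish[OF c] lin_minus[OF cl x sc] by simp
    then have "c x = c s" using lin_K_closed[OF cl] x sc K.eq_if_minus_zero by blast
    also have "\<dots> = (\<Oplus>\<^bsub>K\<^esub>p\<in>P. \<zero>\<^bsub>K\<^esub>)"
      unfolding cs[OF cl] using c0 lin_K_closed[OF dl x] by (intro K.finsum_cong') auto
    finally show "c x = \<zero>\<^bsub>K\<^esub>" by simp
  qed
  then show ?thesis by blast
qed

lemma Coefs_bialgebra: "\<exists>P. function_bialgebra K A \<Delta> \<epsilon> S Coefs P"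
proof -
  obtain P where P: "K.separating (carrier A) Coefs P" using Coefs_separating by blast
  have "function_bialgebra K A \<Delta> \<epsilon> S Coefs P"
  proof (intro function_bialgebra.intro hopf_algebra_axioms function_bialgebra_axioms.intro)
    show "K.fun_space (carrier A) Coefs" "K.separating (carrier A) Coefs P" by (rule Coefs_space, rule P)
    show "c \<in> lin A KK" if "c \<in> Coefs" for c by (rule Coefs_lin[OF that])
    show "\<epsilon> \<in> Coefs" using Coef_word[of "[]" 0] by (auto simp: Coefs_def)
    show "conv c d \<in> Coefs" if "c \<in> Coefs" "d \<in> Coefs" for c d
    proof -
      obtain n m where "c \<in> Coef n" "d \<in> Coef m" using \<open>c \<in> Coefs\<close> \<open>d \<in> Coefs\<close> by (auto simp: Coefs_def)
      from Coef_conv[OF this] show ?thesis by (auto simp: Coefs_def)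
    qed
    show "(\<lambda>a. c (b \<bullet> a)) \<in> Coefs" "(\<lambda>a. c (a \<bullet> b)) \<in> Coefs"
      if "c \<in> Coefs" "b \<in> carrier A" for c b
      using that by (rule Coefs_translate)+
  qed
  then show ?thesis by blast
qed

text \<open>Take the unit of the ring minus the unit \<open>e\<close> of the augmentation ideal: it is annihilated by the augmentation
ideal from both sides, and \<open>a - \<epsilon>(a)\<close> is in this ideal.\<close>
lemma ex_integral:
  "\<exists>\<Lambda>\<in>carrier A. \<epsilon> \<Lambda> = \<one>\<^bsub>K\<^esub> \<and>
    (\<forall>a\<in>carrier A. a \<bullet> \<Lambda> = \<epsilon> a \<odot>\<^bsub>A\<^esub> \<Lambda> \<and> \<Lambda> \<bullet> a = \<epsilon> a \<odot>\<^bsub>A\<^esub> \<Lambda>)"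
proof -
  define I where "I = {a \<in> carrier A. \<epsilon> a = \<zero>\<^bsub>K\<^esub>}"
  have I: "A.left_ideal I"
    unfolding A.left_ideal_def I_def using lin_zero[OF counit_lin] lin_add[OF counit_lin] counit_mult by auto
  have Ir: "x \<bullet> a \<in> I" if "a \<in> carrier A" "x \<in> I" for a x
    using that by (auto simp: I_def counit_mult)
  obtain e where e: "e \<in> I" "\<And>x. x \<in> I \<Longrightarrow> x \<bullet> e = x" "\<And>x. x \<in> I \<Longrightarrow> e \<bullet> x = x"
    using SS.ideal_central_idempotent[OF I Ir] by metis
  define \<Lambda> where "\<Lambda> = \<one>\<^bsub>A\<^esub> \<ominus>\<^bsub>A\<^esub> e"
  have ec: "e \<in> carrier A" "\<epsilon> e = \<zero>\<^bsub>K\<^esub>" using e(1) by (auto simp: I_def)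
  have L: "\<Lambda> \<in> carrier A" using ec by (simp add: \<Lambda>_def)
  have "\<epsilon> \<Lambda> = \<one>\<^bsub>K\<^esub>" using lin_minus[OF counit_lin A.one_closed ec(1)] ec by (simp add: \<Lambda>_def a_minus_def)
  moreover have xL: "x \<bullet> \<Lambda> = \<zero>\<^bsub>A\<^esub>" "\<Lambda> \<bullet> x = \<zero>\<^bsub>A\<^esub>" if x: "x \<in> I" for x
    using e(2,3)[OF x] ec x
    by (simp_all add: \<Lambda>_def a_minus_def A.l_distr A.r_distr A.l_minus A.r_minus I_def A.r_neg)
  have both: "a \<bullet> \<Lambda> = \<epsilon> a \<odot>\<^bsub>A\<^esub> \<Lambda>" "\<Lambda> \<bullet> a = \<epsilon> a \<odot>\<^bsub>A\<^esub> \<Lambda>" if a: "a \<in> carrier A" for a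
  proof -
    let ?u = "\<epsilon> a \<odot>\<^bsub>A\<^esub> \<one>\<^bsub>A\<^esub>"
    have u: "?u \<in> carrier A" using a by simp
    have "\<epsilon> (a \<ominus>\<^bsub>A\<^esub> ?u) = \<zero>\<^bsub>K\<^esub>"
      using lin_minus[OF counit_lin a u] a by (simp add: counit_smult a_minus_def K.r_neg)
    then have aI: "a \<ominus>\<^bsub>A\<^esub> ?u \<in> I" using a u by (simp add: I_def)
    have "a \<bullet> \<Lambda> \<ominus>\<^bsub>A\<^esub> \<epsilon> a \<odot>\<^bsub>A\<^esub> \<Lambda> = (a \<ominus>\<^bsub>A\<^esub> ?u) \<bullet> \<Lambda>"
      using a u L by (simp add: a_minus_def A.l_distr A.l_minus smult_mult_left)
    then have "a \<bullet> \<Lambda> \<ominus>\<^bsub>A\<^esub> \<epsilon> a \<odot>\<^bsub>A\<^esub> \<Lambda> = \<zero>\<^bsub>A\<^esub>" using xL(1)[OF aI] by simp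
    then show "a \<bullet> \<Lambda> = \<epsilon> a \<odot>\<^bsub>A\<^esub> \<Lambda>" using a L by - (rule A.eq_if_minus_zero; simp)
    have "\<Lambda> \<bullet> a \<ominus>\<^bsub>A\<^esub> \<epsilon> a \<odot>\<^bsub>A\<^esub> \<Lambda> = \<Lambda> \<bullet> (a \<ominus>\<^bsub>A\<^esub> ?u)"
      using a u L by (simp add: a_minus_def A.r_distr A.r_minus smult_mult_right)
    then have "\<Lambda> \<bullet> a \<ominus>\<^bsub>A\<^esub> \<epsilon> a \<odot>\<^bsub>A\<^esub> \<Lambda> = \<zero>\<^bsub>A\<^esub>" using xL(2)[OF aI] by simp
    then show "\<Lambda> \<bullet> a = \<epsilon> a \<odot>\<^bsub>A\<^esub> \<Lambda>" using a L by - (rule A.eq_if_minus_zero; simp)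
  qed
  show ?thesis using L \<open>\<epsilon> \<Lambda> = \<one>\<^bsub>K\<^esub>\<close> both by blast
qed

text \<open>The trace of the trace is \<open>x\<^sub>1 c(x\<^sub>2) t(x\<^sub>3) = x\<^sub>1 (c * t)(x\<^sub>2)\<close>.\<close>
lemma trace_trace:
  assumes c: "c \<in> lin A KK" and t: "t \<in> lin A KK" and x: "x \<in> carrier A"
    and inv: "\<And>a. a \<in> carrier A \<Longrightarrow> conv c t a = c \<one>\<^bsub>A\<^esub> \<ast> t a"
  shows "trace c (trace t x) = c \<one>\<^bsub>A\<^esub> \<odot>\<^bsub>A\<^esub> trace t x"
proof -
  note i = lin_intros module_hom_comp[OF c] module_hom_comp[OF t] lin_K_closed[OF c] lin_K_closed[OF t]
    K.m_closed A.m_closed V.smult_closed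
  have cl: "trace c \<in> lin A A"
    using sw_hom[OF A_module trace_bilinear[OF c] module_hom_ident] by (simp add: trace_def[abs_def])
  have "trace c (trace t x) = sw A (\<lambda>u v. trace c (t v \<odot>\<^bsub>A\<^esub> u)) x"
    unfolding trace_def[of t] by (rule sw_apply[OF A_module A_module trace_bilinear[OF t] cl x])
  also have "\<dots> = sw A (\<lambda>u v. sw A (\<lambda>p q. t v \<odot>\<^bsub>A\<^esub> (c q \<odot>\<^bsub>A\<^esub> p)) u) x"
  proof (rule sw_cong[OF A_module bilinear_comp[OF trace_bilinear[OF t] cl] x])
    fix u v assume uv: "u \<in> carrier A" "v \<in> carrier A"
    have "trace c (t v \<odot>\<^bsub>A\<^esub> u) = t v \<odot>\<^bsub>A\<^esub> trace c u" by (rule module_hom_smult[OF cl lin_K_closed[OF t uv(2)] uv(1)])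
    also have "\<dots> = sw A (\<lambda>p q. t v \<odot>\<^bsub>A\<^esub> (c q \<odot>\<^bsub>A\<^esub> p)) u"
      unfolding trace_def
      by (rule sw_apply[OF A_module A_module trace_bilinear[OF c] lin_smultr[OF A_module module_hom_ident lin_K_closed[OF t uv(2)]] uv(1)])
    finally show "trace c (t v \<odot>\<^bsub>A\<^esub> u) = sw A (\<lambda>p q. t v \<odot>\<^bsub>A\<^esub> (c q \<odot>\<^bsub>A\<^esub> p)) u" .
  qed
  also have "\<dots> = sw A (\<lambda>u v. sw A (\<lambda>p q. t q \<odot>\<^bsub>A\<^esub> (c p \<odot>\<^bsub>A\<^esub> u)) v) x"
    by (rule sw_coassoc[OF A_module x, where \<gamma> = "\<lambda>p q v. t v \<odot>\<^bsub>A\<^esub> (c q \<odot>\<^bsub>A\<^esub> p)"]; intro i; assumption?)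
  also have "\<dots> = sw A (\<lambda>u v. c \<one>\<^bsub>A\<^esub> \<odot>\<^bsub>A\<^esub> (t v \<odot>\<^bsub>A\<^esub> u)) x"
  proof (rule sw_cong[OF A_module _ x])
    show "bilinear K A A A (\<lambda>u v. sw A (\<lambda>p q. t q \<odot>\<^bsub>A\<^esub> (c p \<odot>\<^bsub>A\<^esub> u)) v)" by (intro i)
    fix u v assume uv: "u \<in> carrier A" "v \<in> carrier A"
    have "sw A (\<lambda>p q. t q \<odot>\<^bsub>A\<^esub> (c p \<odot>\<^bsub>A\<^esub> u)) v = sw A (\<lambda>p q. (c p \<ast> t q) \<odot>\<^bsub>A\<^esub> u) v"
    proof (rule sw_cong[OF A_module _ uv(2)])
      show "bilinear K A A A (\<lambda>p q. t q \<odot>\<^bsub>A\<^esub> (c p \<odot>\<^bsub>A\<^esub> u))" using uv by (intro i)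
    qed (use uv lin_K_closed[OF c] lin_K_closed[OF t] in \<open>simp add: V.smult_assoc1[symmetric] K.m_comm\<close>)
    also have "\<dots> = conv c t v \<odot>\<^bsub>A\<^esub> u"
      unfolding conv_def
      by (rule sw_apply[OF KK_module A_module conv_bilinear[OF c t] _ uv(2), symmetric])
        (intro lin_intros uv)
    also have "\<dots> = c \<one>\<^bsub>A\<^esub> \<odot>\<^bsub>A\<^esub> (t v \<odot>\<^bsub>A\<^esub> u)"
      using inv[OF uv(2)] uv lin_K_closed[OF c] lin_K_closed[OF t] by (simp add: V.smult_assoc1)
    finally show "sw A (\<lambda>p q. t q \<odot>\<^bsub>A\<^esub> (c p \<odot>\<^bsub>A\<^esub> u)) v = c \<one>\<^bsub>A\<^esub> \<odot>\<^bsub>A\<^esub> (t v \<odot>\<^bsub>A\<^esub> u)" .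
  qed
  also have "\<dots> = c \<one>\<^bsub>A\<^esub> \<odot>\<^bsub>A\<^esub> trace t x"
    unfolding trace_def
    by (rule sw_apply[OF A_module A_module trace_bilinear[OF t] _ x, symmetric])
      (intro lin_intros lin_K_closed[OF c] A.one_closed)
  finally show ?thesis .
qed

lemma coef_Coefs: "b \<in> B \<Longrightarrow> m \<in> carrier M \<Longrightarrow> coef b m \<in> Coefs"
proof -
  assume bm: "b \<in> B" "m \<in> carrier M"
  have "\<epsilon> \<in> Coef 0" using Coef_word[of "[]" 0] by simp
  from conv_coef_Coef[OF bm this] have "coef b m \<in> Coef 1"
    by (simp, elim K.fun_space_cong[OF Coef_space]) (simp add: conv_counit_right[OF coef_lin[OF bm]])
  then show ?thesis by (auto simp: Coefs_def)
qed

text \<open>The defining equation of the left kernel is compared in coordinates: the coordinate of \<open>l\<^sub>1 \<otimes> l\<^sub>2 m\<close> at the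
basis vector \<open>b\<close> is \<open>l\<^sub>1 \<xi>\<^sub>b(l\<^sub>2 m)\<close>.\<close>
lemma left_kernelI:
  assumes l: "l \<in> carrier A"
    and inv: "\<And>b m. b \<in> B \<Longrightarrow> m \<in> carrier M \<Longrightarrow> trace (coef b m) l = \<xi> b m \<odot>\<^bsub>A\<^esub> l"
  shows "l \<in> left_kernel K A \<Delta> M"
proof -
  interpret W: module K V by (rule V_module)
  let ?T = "tensor K A V" and ?p = "pure K A V"
  have T: "module K ?T" by (rule K.tensor_module[OF A_module V_module])
  interpret T: module K ?T by (rule T)
  have pb: "bilinear K A V ?T ?p" by (rule K.pure_bilinear[OF A_module V_module])
  have "sw ?T (\<lambda>a1 a2. ?p a1 (a2 \<odot>\<^bsub>M\<^esub> m)) l = ?p l m" if m: "m \<in> carrier M" for m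
  proof -
    have BV: "b \<in> carrier V" if "b \<in> B" for b using that B_subset by auto
    have expand: "?p x w = (\<Oplus>\<^bsub>?T\<^esub>b\<in>B. ?p (\<xi> b w \<odot>\<^bsub>A\<^esub> x) b)" if x: "x \<in> carrier A" and w: "w \<in> carrier M" for x w
    proof -
      have c: "(\<lambda>b. \<xi> b w \<odot>\<^bsub>V\<^esub> b) \<in> B \<rightarrow> carrier V"
        using \<xi>_closed[OF _ w] BV by (intro Pi_I W.smult_closed) auto
      have "?p x w = ?p x (\<Oplus>\<^bsub>V\<^esub>b\<in>B. \<xi> b w \<odot>\<^bsub>V\<^esub> b)" using \<xi>_expand[OF w] by simp
      also have "\<dots> = (\<Oplus>\<^bsub>?T\<^esub>b\<in>B. ?p x (\<xi> b w \<odot>\<^bsub>V\<^esub> b))"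
        by (rule module_hom_finsum[OF bilinearD(1)[OF pb x] W.M.abelian_group_axioms T.M.abelian_group_axioms c finite_B])
      also have "\<dots> = (\<Oplus>\<^bsub>?T\<^esub>b\<in>B. ?p (\<xi> b w \<odot>\<^bsub>A\<^esub> x) b)"
      proof (rule T.M.finsum_cong'[OF refl])
        show "(\<lambda>b. ?p (\<xi> b w \<odot>\<^bsub>A\<^esub> x) b) \<in> B \<rightarrow> carrier ?T"
          using \<xi>_closed[OF _ w] BV x bilinearD(3)[OF pb] by auto
        fix b assume b: "b \<in> B"
        show "?p x (\<xi> b w \<odot>\<^bsub>V\<^esub> b) = ?p (\<xi> b w \<odot>\<^bsub>A\<^esub> x) b"
          using module_hom_smult[OF bilinearD(1)[OF pb x] \<xi>_closed[OF b w] BV[OF b]]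
            module_hom_smult[OF bilinearD(2)[OF pb BV[OF b]] \<xi>_closed[OF b w] x] by simp
      qed
      finally show ?thesis .
    qed
    have mb: "bilinear K A A ?T (\<lambda>a1 a2. ?p a1 (a2 \<odot>\<^bsub>M\<^esub> m))"
      using LM.smult_closed[OF _ m]
      by (intro bilinearI module_hom_comp[OF bilinearD(1)[OF pb] act_lin[OF m]] bilinearD(2)[OF pb]) auto
    have bb: "bilinear K A A ?T (\<lambda>a1 a2. ?p (coef b m a2 \<odot>\<^bsub>A\<^esub> a1) b)" if b: "b \<in> B" for b
      by (rule bilinear_comp[OF trace_bilinear[OF coef_lin[OF b m]] bilinearD(2)[OF pb BV[OF b]]])
    have "sw ?T (\<lambda>a1 a2. ?p a1 (a2 \<odot>\<^bsub>M\<^esub> m)) l = sw ?T (\<lambda>a1 a2. \<Oplus>\<^bsub>?T\<^esub>b\<in>B. ?p (coef b m a2 \<odot>\<^bsub>A\<^esub> a1) b) l"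
      by (rule sw_cong[OF T mb l]) (simp add: coef_def expand LM.smult_closed[OF _ m])
    also have "\<dots> = (\<Oplus>\<^bsub>?T\<^esub>b\<in>B. sw ?T (\<lambda>a1 a2. ?p (coef b m a2 \<odot>\<^bsub>A\<^esub> a1) b) l)"
      by (rule sw_finsum[OF T finite_B bb l])
    also have "\<dots> = (\<Oplus>\<^bsub>?T\<^esub>b\<in>B. ?p (\<xi> b m \<odot>\<^bsub>A\<^esub> l) b)"
    proof (rule T.M.finsum_cong'[OF refl])
      show "(\<lambda>b. ?p (\<xi> b m \<odot>\<^bsub>A\<^esub> l) b) \<in> B \<rightarrow> carrier ?T"
        using \<xi>_closed[OF _ m] BV l bilinearD(3)[OF pb] by auto
      fix b assume b: "b \<in> B"
      show "sw ?T (\<lambda>a1 a2. ?p (coef b m a2 \<odot>\<^bsub>A\<^esub> a1) b) l = ?p (\<xi> b m \<odot>\<^bsub>A\<^esub> l) b"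
        using sw_apply[OF A_module T trace_bilinear[OF coef_lin[OF b m]] bilinearD(2)[OF pb BV[OF b]] l]
          inv[OF b m] by (simp add: trace_def)
    qed
    also have "\<dots> = ?p l m" using expand[OF l m] by simp
    finally show ?thesis .
  qed
  then show ?thesis using l by (simp add: left_kernel_def Let_def)
qed

abbreviation L where "L \<equiv> left_kernel K A \<Delta> M"

text \<open>The ideal \<open>J\<close> of the elements that act as zero on all tensor powers.\<close>
definition Ann :: "'a set" where "Ann = {a \<in> carrier A. \<forall>c\<in>Coefs. c a = \<zero>\<^bsub>K\<^esub>}"

lemma Ann_left_ideal: "A.left_ideal Ann"
  unfolding Ann_def
proof (rule annihilator_left_ideal)
  show "(\<lambda>a. c (b \<bullet> a)) \<in> Coefs" if "c \<in> Coefs" "b \<in> carrier A" for c b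
    using that by (rule Coefs_translate)
qed (auto intro: Coefs_lin)

lemma Ann_right_ideal: "b \<in> carrier A \<Longrightarrow> x \<in> Ann \<Longrightarrow> x \<bullet> b \<in> Ann"
  unfolding Ann_def
proof (erule annihilator_right_ideal[rotated])
  show "(\<lambda>a. c (a \<bullet> b)) \<in> Coefs" if "c \<in> Coefs" "b \<in> carrier A" for c b
    using that by (rule Coefs_translate)
qed

lemma ideal_prod_finsum:
  assumes "finite I" and "\<And>i. i \<in> I \<Longrightarrow> f i \<in> X" "\<And>i. i \<in> I \<Longrightarrow> g i \<in> Y"
    and "X \<subseteq> carrier A" "Y \<subseteq> carrier A" "x \<in> X" "\<zero>\<^bsub>A\<^esub> \<in> Y"
  shows "(\<Oplus>\<^bsub>A\<^esub>i\<in>I. f i \<bullet> g i) \<in> X \<cdot>\<^bsub>A\<^esub> Y"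
  using assms(1-3)
proof (induction rule: finite_induct)
  case empty
  show ?case using ideal_prod.prod[OF assms(6,7), of A] assms(4,6) by auto
next
  case (insert i I)
  have "f i \<bullet> g i \<in> X \<cdot>\<^bsub>A\<^esub> Y" using insert.prems by (intro ideal_prod.prod) auto
  moreover have "(\<lambda>i. f i \<bullet> g i) \<in> insert i I \<rightarrow> carrier A" using insert.prems assms(4,5) by blast
  ultimately show ?case using insert by (auto intro: ideal_prod.sum)
qed

text \<open>For \<open>a\<close> in \<open>J\<close> the trace formula \<open>a = S(\<Lambda>\<^sub>1) tr(\<Lambda>\<^sub>2 a)\<close> writes \<open>a\<close> as a sum of products with right factors
in \<open>L\<^sup>+\<close>: all traces lie in \<open>L\<close>, and \<open>\<epsilon>(tr(\<Lambda>\<^sub>2 a)) = t(\<Lambda>\<^sub>2 a) = 0\<close>.\<close>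
lemma Ann_subset_hopf_ideal: "Ann \<subseteq> hopf_ideal_of K A \<epsilon> L"
proof
  fix a assume a: "a \<in> Ann"
  have ac: "a \<in> carrier A" using a by (simp add: Ann_def)
  obtain P where P: "function_bialgebra K A \<Delta> \<epsilon> S Coefs P" using Coefs_bialgebra by blast
  interpret FB: function_bialgebra K A \<Delta> \<epsilon> S Coefs P by (rule P)
  obtain \<Lambda> where \<Lambda>: "\<Lambda> \<in> carrier A" "\<epsilon> \<Lambda> = \<one>\<^bsub>K\<^esub>"
    "\<And>a. a \<in> carrier A \<Longrightarrow> a \<bullet> \<Lambda> = \<epsilon> a \<odot>\<^bsub>A\<^esub> \<Lambda>" "\<And>a. a \<in> carrier A \<Longrightarrow> \<Lambda> \<bullet> a = \<epsilon> a \<odot>\<^bsub>A\<^esub> \<Lambda>"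
    using ex_integral by blast
  obtain t where t: "t \<in> Coefs" "t \<Lambda> = \<one>\<^bsub>K\<^esub>"
    "\<And>c a. c \<in> Coefs \<Longrightarrow> a \<in> carrier A \<Longrightarrow> conv c t a = c \<one>\<^bsub>A\<^esub> \<ast> t a"
    using FB.ex_function_integral[OF \<Lambda>(1,3,2)] by blast
  note tl = Coefs_lin[OF t(1)]
  have trL: "trace t x \<in> L" if x: "x \<in> carrier A" for x
  proof (rule left_kernelI[OF trace_closed[OF tl x]])
    fix b m assume bm: "b \<in> B" "m \<in> carrier M"
    show "trace (coef b m) (trace t x) = \<xi> b m \<odot>\<^bsub>A\<^esub> trace t x"
      using trace_trace[OF coef_lin[OF bm] tl x] t(3)[OF coef_Coefs[OF bm]] bm
      by (simp add: coef_def LM.smult_one)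
  qed
  have eps: "\<epsilon> (trace t x) = t x" if x: "x \<in> carrier A" for x
  proof -
    have "\<epsilon> (trace t x) = sw KK (\<lambda>u v. \<epsilon> (t v \<odot>\<^bsub>A\<^esub> u)) x"
      unfolding trace_def by (rule sw_apply[OF A_module KK_module trace_bilinear[OF tl] counit_lin x])
    also have "\<dots> = sw KK (\<lambda>u v. \<epsilon> u \<odot>\<^bsub>KK\<^esub> t v) x"
      by (rule sw_cong[OF KK_module bilinear_comp[OF trace_bilinear[OF tl] counit_lin] x])
        (simp add: counit_smult lin_K_closed[OF tl] K.m_comm)
    also have "\<dots> = t x" by (rule sw_counit_left[OF KK_module tl x])
    finally show ?thesis .
  qed
  let ?Y = "augmentation_part K \<epsilon> L"
  have LA: "L \<subseteq> carrier A" by (auto simp: left_kernel_def Let_def)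
  have trY: "trace t (y \<bullet> a) \<in> ?Y" if y: "y \<in> carrier A" for y
  proof -
    have ya: "y \<bullet> a \<in> Ann" by (rule A.left_idealD(4)[OF Ann_left_ideal y a])
    then have "t (y \<bullet> a) = \<zero>\<^bsub>K\<^esub>" using t(1) by (simp add: Ann_def)
    then show ?thesis using trL eps y ac by (simp add: augmentation_part_def)
  qed
  let ?I = "{p. formal_comult \<Lambda> p \<noteq> \<zero>\<^bsub>K\<^esub>}"
  have pA: "fst p \<in> carrier A" "snd p \<in> carrier A" if "p \<in> ?I" for p
    using that formal_comultD(3)[OF \<Lambda>(1), of "fst p" "snd p"] by auto
  note fc = formal_comultD(2)[OF \<Lambda>(1)]
  have trl: "trace t \<in> lin A A"
    using sw_hom[OF A_module trace_bilinear[OF tl] module_hom_ident] by (simp add: trace_def[abs_def])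
  have bi: "bilinear K A A A (\<lambda>x y. S x \<bullet> trace t (y \<bullet> a))"
    by (intro lin_intros module_hom_comp[OF trl] trace_closed[OF tl] A.m_closed antipode_closed ac)
  have "a = (\<Oplus>\<^bsub>A\<^esub>p\<in>?I. formal_comult \<Lambda> p \<odot>\<^bsub>A\<^esub> (S (fst p) \<bullet> trace t (snd p \<bullet> a)))"
    using trace_formula[OF tl \<Lambda>(1,4) t(2) ac] sw_eq[OF A_module bi \<Lambda>(1)] by (simp add: case_prod_unfold)
  also have "\<dots> = (\<Oplus>\<^bsub>A\<^esub>p\<in>?I. (formal_comult \<Lambda> p \<odot>\<^bsub>A\<^esub> S (fst p)) \<bullet> trace t (snd p \<bullet> a))"
    using pA fc ac trace_closed[OF tl] by (intro A.finsum_cong') (auto simp: smult_mult_left)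
  also have "\<dots> \<in> carrier A \<cdot>\<^bsub>A\<^esub> ?Y"
  proof (rule ideal_prod_finsum[OF formal_comultD(1)[OF \<Lambda>(1)]])
    show "formal_comult \<Lambda> p \<odot>\<^bsub>A\<^esub> S (fst p) \<in> carrier A" if "p \<in> ?I" for p using pA[OF that] fc by simp
    show "trace t (snd p \<bullet> a) \<in> ?Y" if "p \<in> ?I" for p by (rule trY[OF pA(2)[OF that]])
    show "?Y \<subseteq> carrier A" using LA by (auto simp: augmentation_part_def)
    show "\<one>\<^bsub>A\<^esub> \<in> carrier A" "carrier A \<subseteq> carrier A" by auto
    show "\<zero>\<^bsub>A\<^esub> \<in> ?Y"
      using trY[OF A.zero_closed] ac module_hom_zero[OF trl A.abelian_group_axioms A.abelian_group_axioms] by simp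
  qed
  finally show "a \<in> hopf_ideal_of K A \<epsilon> L" by (simp add: hopf_ideal_of_def)
qed

end

section \<open>Multilinear maps and tensor powers\<close>

definition multilinear ::
  "('k, 'q) ring_scheme \<Rightarrow> ('k, 'v, 'p) module_scheme \<Rightarrow> nat \<Rightarrow> ('k, 'u, 't) module_scheme \<Rightarrow>
   ('v list \<Rightarrow> 'u) \<Rightarrow> bool" where
  "multilinear K V n U \<beta> \<longleftrightarrow> (\<forall>vs\<in>words V n. \<beta> vs \<in> carrier U) \<and>
     (\<forall>us ws. set us \<subseteq> carrier V \<longrightarrow> set ws \<subseteq> carrier V \<longrightarrow> length us + Suc (length ws) = n \<longrightarrow>
        (\<lambda>v. \<beta> (us @ v # ws)) \<in> module_hom K V U)"

lemma multilinearI: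
  assumes "\<And>vs. vs \<in> words V n \<Longrightarrow> \<beta> vs \<in> carrier U"
    and "\<And>us ws. set us \<subseteq> carrier V \<Longrightarrow> set ws \<subseteq> carrier V \<Longrightarrow> length us + Suc (length ws) = n \<Longrightarrow>
        (\<lambda>v. \<beta> (us @ v # ws)) \<in> module_hom K V U"
  shows "multilinear K V n U \<beta>"
  using assms by (auto simp: multilinear_def)

lemma multilinearD:
  assumes "multilinear K V n U \<beta>"
  shows "vs \<in> words V n \<Longrightarrow> \<beta> vs \<in> carrier U"
    and "set us \<subseteq> carrier V \<Longrightarrow> set ws \<subseteq> carrier V \<Longrightarrow> length us + Suc (length ws) = n \<Longrightarrow>
        (\<lambda>v. \<beta> (us @ v # ws)) \<in> module_hom K V U"
  using assms by (auto simp: multilinear_def)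

lemma words_Cons: "v # vs \<in> words V (Suc n) \<longleftrightarrow> v \<in> carrier V \<and> vs \<in> words V n"
  by (auto simp: words_def)

lemma words_0: "vs \<in> words V 0 \<longleftrightarrow> vs = []"
  by (auto simp: words_def)

context cring begin

context
  fixes V :: "('a, 'v, 'p) module_scheme"
  assumes V: "module R V"
begin

interpretation V: module R V by (rule V)

lemma power_rel_subset: "power_rel R V n \<subseteq> carrier (free_module R (words V n))"
proof -
  interpret F: module R "free_module R (words V n)" by (rule free_module_module)
  have w: "us @ v' # ws \<in> words V n" "v \<in> carrier V"
    if "us @ v # ws \<in> words V n" "v' \<in> carrier V" for us v v' ws
    using that by (auto simp: words_def)
  show ?thesis
  proof
    fix \<rho> assume "\<rho> \<in> power_rel R V n"
    then show "\<rho> \<in> carrier (free_module R (words V n))"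
      unfolding power_rel_def Let_def Un_iff mem_Collect_eq
    proof (elim disjE exE conjE, goal_cases)
      case (1 us v v' ws)
      then show ?case unfolding 1(1)
        by (intro F.M.minus_closed F.M.a_closed single_closed w(1)[OF 1(2)] V.M.a_closed w(2)[OF 1(2,3)])
    next
      case (2 us c v ws)
      then show ?case unfolding 2(1)
        by (intro F.M.minus_closed F.smult_closed single_closed w(1)[OF 2(2)] V.smult_closed
            w(2)[OF 2(2) V.M.zero_closed])
    qed
  qed
qed

lemma multilinear_compatible:
  assumes U: "module R U" and b: "multilinear R V n U \<beta>"
  shows "compatible (words V n) (power_rel R V n) U \<beta>"
proof -
  interpret F: module R "free_module R (words V n)" by (rule free_module_module)
  have c: "\<beta> \<in> words V n \<rightarrow> carrier U" using multilinearD(1)[OF b] by auto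
  note ops = evaluation_ops[OF U c]
  note s = single_closed[of _ "words V n"]
  note rel = evaluation_relation[OF U c]
  show ?thesis
    unfolding compatible_def
  proof (intro conjI c ballI)
    fix \<rho> assume "\<rho> \<in> power_rel R V n"
    then show "evaluation R U \<beta> \<rho> = \<zero>\<^bsub>U\<^esub>"
      unfolding power_rel_def Let_def Un_iff mem_Collect_eq
    proof (elim disjE exE conjE, goal_cases)
      case (1 us v v' ws)
      then have w: "us @ v' # ws \<in> words V n" "us @ (v \<oplus>\<^bsub>V\<^esub> v') # ws \<in> words V n" by (auto simp: words_def)
      have h: "(\<lambda>v. \<beta> (us @ v # ws)) \<in> module_hom R V U"
        using 1(2) by (intro multilinearD(2)[OF b]) (auto simp: words_def)
      show ?case unfolding 1(1)
        by (rule rel) (use 1 w ops s module_hom_add[OF h] F.M.a_closed in \<open>simp_all add: words_def\<close>)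
    next
      case (2 us c v ws)
      then have w: "us @ (c \<odot>\<^bsub>V\<^esub> v) # ws \<in> words V n" by (auto simp: words_def)
      have h: "(\<lambda>v. \<beta> (us @ v # ws)) \<in> module_hom R V U"
        using 2(2) by (intro multilinearD(2)[OF b]) (auto simp: words_def)
      show ?case unfolding 2(1)
        by (rule rel) (use 2 w ops s module_hom_smult[OF h] F.smult_closed in \<open>simp_all add: words_def\<close>)
    qed
  qed
qed

lemma tensor_power_module_module: "module R (tensor_power R V n)"
  unfolding tensor_power_def by (rule presented_module_module[OF power_rel_subset])

lemma pure_word_closed: "vs \<in> words V n \<Longrightarrow> pure_word R V vs \<in> carrier (tensor_power R V n)"
  unfolding tensor_power_def pure_word_def
  using generator_closed[OF power_rel_subset, of vs n] by (auto simp: words_def)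

lemma pure_word_multilinear: "multilinear R V n (tensor_power R V n) (pure_word R V)"
proof (rule multilinearI[OF pure_word_closed])
  interpret F: module R "free_module R (words V n)" by (rule free_module_module)
  note s = single_closed[of _ "words V n"]
  note ops = presented_proj_ops[OF power_rel_subset, symmetric]
  note rel = generator_relation[OF power_rel_subset]
  fix us ws assume uw: "set us \<subseteq> carrier V" "set ws \<subseteq> carrier V" "length us + Suc (length ws) = n"
  have w: "us @ v # ws \<in> words V n" if "v \<in> carrier V" for v using that uw by (auto simp: words_def)
  have len: "length (us @ v # ws) = n" for v using uw by simp
  have defs: "pure_word R V (us @ v # ws) = generator R (words V n) (power_rel R V n) (us @ v # ws)" for v
    unfolding pure_word_def len ..
  show "(\<lambda>v. pure_word R V (us @ v # ws)) \<in> module_hom R V (tensor_power R V n)"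
  proof (rule module_homI)
    show "pure_word R V (us @ v # ws) \<in> carrier (tensor_power R V n)" if "v \<in> carrier V" for v
      by (rule pure_word_closed[OF w[OF that]])
    fix v v' assume v: "v \<in> carrier V" "v' \<in> carrier V"
    have "single R (us @ (v \<oplus>\<^bsub>V\<^esub> v') # ws) \<ominus>\<^bsub>free_module R (words V n)\<^esub>
      (single R (us @ v # ws) \<oplus>\<^bsub>free_module R (words V n)\<^esub> single R (us @ v' # ws)) \<in> power_rel R V n"
      unfolding power_rel_def Let_def using w[OF v(1)] v by blast
    then show "pure_word R V (us @ (v \<oplus>\<^bsub>V\<^esub> v') # ws) =
        pure_word R V (us @ v # ws) \<oplus>\<^bsub>tensor_power R V n\<^esub> pure_word R V (us @ v' # ws)"
      unfolding defs tensor_power_def using v w s by (simp add: rel ops F.M.a_closed)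
  next
    fix c v assume v: "c \<in> carrier R" "v \<in> carrier V"
    have "single R (us @ (c \<odot>\<^bsub>V\<^esub> v) # ws) \<ominus>\<^bsub>free_module R (words V n)\<^esub>
      (c \<odot>\<^bsub>free_module R (words V n)\<^esub> single R (us @ v # ws)) \<in> power_rel R V n"
      unfolding power_rel_def Let_def using w[OF v(2)] v by blast
    then show "pure_word R V (us @ (c \<odot>\<^bsub>V\<^esub> v) # ws) = c \<odot>\<^bsub>tensor_power R V n\<^esub> pure_word R V (us @ v # ws)"
      unfolding defs tensor_power_def using v w s by (simp add: rel ops F.smult_closed)
  qed
qed

lemma power_lift_hom:
  assumes "module R U" "multilinear R V n U \<beta>"
  shows "lift R U \<beta> \<in> module_hom R (tensor_power R V n) U"
  unfolding tensor_power_def by (rule lift_hom[OF power_rel_subset assms(1) multilinear_compatible[OF assms]])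

lemma power_lift_pure:
  assumes "module R U" "multilinear R V n U \<beta>" "vs \<in> words V n"
  shows "lift R U \<beta> (pure_word R V vs) = \<beta> vs"
  using lift_generator[OF power_rel_subset assms(1) multilinear_compatible[OF assms(1,2)] assms(3)] assms(3)
  by (auto simp: words_def pure_word_def)

lemma power_lift_hom_param:
  assumes "module R U" "module R W" "\<And>v. v \<in> carrier W \<Longrightarrow> multilinear R V n U (\<beta> v)"
    and "\<And>vs. vs \<in> words V n \<Longrightarrow> (\<lambda>v. \<beta> v vs) \<in> module_hom R W U"
    and "t \<in> carrier (tensor_power R V n)"
  shows "(\<lambda>v. lift R U (\<beta> v) t) \<in> module_hom R W U"
  by (rule lift_hom_param[OF power_rel_subset assms(1) multilinear_compatible[OF assms(1,3)] assms(2,4)])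
    (use assms(5) in \<open>simp_all add: tensor_power_def\<close>)

lemma power_hom_eq:
  assumes "module R U" "g \<in> module_hom R (tensor_power R V n) U" "h \<in> module_hom R (tensor_power R V n) U"
    and "\<And>vs. vs \<in> words V n \<Longrightarrow> g (pure_word R V vs) = h (pure_word R V vs)"
    and "t \<in> carrier (tensor_power R V n)"
  shows "g t = h t"
  by (rule hom_eq_on_generators[OF power_rel_subset assms(1)])
    (use assms(2-) in \<open>auto simp: tensor_power_def pure_word_def words_def\<close>)

lemma cons_multilinear:
  assumes v: "v \<in> carrier V"
  shows "multilinear R V n (tensor_power R V (Suc n)) (\<lambda>vs. pure_word R V (v # vs))"
proof (rule multilinearI)
  fix us ws assume "set us \<subseteq> carrier V" "set ws \<subseteq> carrier V" "length us + Suc (length ws) = n"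
  then show "(\<lambda>x. pure_word R V (v # us @ x # ws)) \<in> module_hom R V (tensor_power R V (Suc n))"
    using multilinearD(2)[OF pure_word_multilinear, of "v # us" ws "Suc n"] v by simp
qed (use v in \<open>simp add: words_Cons pure_word_closed\<close>)

lemma tensor_cons_bilinear:
  "bilinear R V (tensor_power R V n) (tensor_power R V (Suc n)) (tensor_cons R V n)"
proof (rule bilinearI)
  show "(\<lambda>t. tensor_cons R V n v t) \<in> module_hom R (tensor_power R V n) (tensor_power R V (Suc n))"
    if "v \<in> carrier V" for v
    unfolding tensor_cons_def by (rule power_lift_hom[OF tensor_power_module_module cons_multilinear[OF that]])
  show "(\<lambda>v. tensor_cons R V n v t) \<in> module_hom R V (tensor_power R V (Suc n))"
    if t: "t \<in> carrier (tensor_power R V n)" for t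
    unfolding tensor_cons_def
  proof (rule power_lift_hom_param[OF tensor_power_module_module V cons_multilinear _ t])
    fix vs assume "vs \<in> words V n"
    then show "(\<lambda>v. pure_word R V (v # vs)) \<in> module_hom R V (tensor_power R V (Suc n))"
      using multilinearD(2)[OF pure_word_multilinear, of "[]" vs "Suc n"] by (simp add: words_def)
  qed
qed

lemma tensor_cons_pure:
  assumes "v \<in> carrier V" "vs \<in> words V n"
  shows "tensor_cons R V n v (pure_word R V vs) = pure_word R V (v # vs)"
  unfolding tensor_cons_def
  by (rule power_lift_pure[OF tensor_power_module_module cons_multilinear assms(2)]) (rule assms(1))

end

end

section \<open>The diagonal action on tensor powers\<close>

context hopf_algebra begin

lemma sw_swap:
  assumes U: "module K U" and a: "a \<in> carrier A" and b: "b \<in> carrier A"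
    and b1: "\<And>x y. x \<in> carrier A \<Longrightarrow> y \<in> carrier A \<Longrightarrow> bilinear K A A U (\<gamma> x y)"
    and b2: "\<And>u v. u \<in> carrier A \<Longrightarrow> v \<in> carrier A \<Longrightarrow> bilinear K A A U (\<lambda>x y. \<gamma> x y u v)"
  shows "sw U (\<lambda>x y. sw U (\<gamma> x y) b) a = sw U (\<lambda>u v. sw U (\<lambda>x y. \<gamma> x y u v) a) b"
proof -
  note L = K.tensor_lift_hom[OF A_module A_module U] and Lp = K.tensor_lift_pure[OF A_module A_module U]
  have bb: "bilinear K A A U (\<lambda>x y. sw U (\<gamma> x y) b)"
    by (intro bilinearI sw_hom_param[OF U A_module b] b1 bilinearD(1,2)[OF b2])
  have par: "(\<lambda>t. lift K U (\<lambda>(x, y). \<gamma> x y u v) t) \<in> lin (tensor K A A) U"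
    if "u \<in> carrier A" "v \<in> carrier A" for u v by (rule L[OF b2[OF that]])
  have bt: "bilinear K A A U (\<lambda>u v. lift K U (\<lambda>(x, y). \<gamma> x y u v) t)" if "t \<in> carrier (tensor K A A)" for t
    using that by (intro bilinearI K.tensor_lift_hom_param[OF A_module A_module U A_module] b2 bilinearD(1,2)[OF b1])
  have "lift K U (\<lambda>(x, y). sw U (\<gamma> x y) b) (\<Delta> a) = sw U (\<lambda>u v. lift K U (\<lambda>(x, y). \<gamma> x y u v) (\<Delta> a)) b"
  proof (rule K.tensor_hom_eq[OF A_module A_module U L[OF bb] sw_hom_param[OF U AA_module b bt par] _ comult_closed[OF a]])
    fix v w assume vw: "v \<in> carrier A" "w \<in> carrier A"
    have "sw U (\<gamma> v w) b = sw U (\<lambda>u va. lift K U (\<lambda>(x, y). \<gamma> x y u va) (pure K A A v w)) b"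
      by (rule sw_cong[OF U b1[OF vw] b]) (simp add: Lp[OF b2] vw)
    then show "lift K U (\<lambda>(x, y). sw U (\<gamma> x y) b) (pure K A A v w)
      = sw U (\<lambda>u va. lift K U (\<lambda>(x, y). \<gamma> x y u va) (pure K A A v w)) b"
      by (simp add: Lp[OF bb vw])
  qed
  then show ?thesis by (simp add: sweedler_def[of K \<Delta> U "\<lambda>x y. sw U (\<gamma> x y) b"] sweedler_def[of K \<Delta> U "\<lambda>x y. \<gamma> x y _ _"])
qed

end

context hopf_module begin

abbreviation T where "T n \<equiv> tensor_power K V n"
abbreviation X where "X n \<equiv> tensor_power_module K A \<Delta> \<epsilon> M n"
abbreviation wact where "wact \<equiv> word_act K A \<Delta> \<epsilon> M"
abbreviation pw where "pw \<equiv> pure_word K V"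
abbreviation tcons where "tcons \<equiv> tensor_cons K V"

lemma T_module: "module K (T n)" by (rule K.tensor_power_module_module[OF V_module])

lemmas tcons_bilinear = K.tensor_cons_bilinear[OF V_module]

lemma wact_Cons:
  "ms \<in> words V n \<Longrightarrow> wact a (m # ms) = sw (T (Suc n)) (\<lambda>a1 a2. tcons n (a1 \<odot>\<^bsub>M\<^esub> m) (wact a2 ms)) a"
  by (simp add: words_def Let_def)

lemma tcons_lin1: "f \<in> lin Y V \<Longrightarrow> t \<in> carrier (T n) \<Longrightarrow> (\<lambda>x. tcons n (f x) t) \<in> lin Y (T (Suc n))"
  by (rule module_hom_comp[OF bilinearD(2)[OF tcons_bilinear]])

lemma tcons_lin2: "f \<in> lin Y (T n) \<Longrightarrow> m \<in> carrier M \<Longrightarrow> (\<lambda>x. tcons n m (f x)) \<in> lin Y (T (Suc n))"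
  by (rule module_hom_comp[OF bilinearD(1)[OF tcons_bilinear]]) simp_all

lemma wact_lin: "ms \<in> words V n \<Longrightarrow> (\<lambda>a. wact a ms) \<in> lin A (T n)"
proof (induction ms arbitrary: n)
  case Nil
  then have n: "n = 0" by (auto simp: words_def)
  have "pw [] \<in> carrier (T 0)" by (rule K.pure_word_closed[OF V_module]) (simp add: words_def)
  then show ?case unfolding n word_act.simps Let_def by (intro lin_smult[OF T_module] counit_lin)
next
  case (Cons m ms)
  obtain n' where n: "n = Suc n'" using Cons.prems by (cases n) (auto simp: words_def)
  have ms: "ms \<in> words V n'" and m: "m \<in> carrier M" using Cons.prems by (auto simp: n words_Cons)
  note IH = Cons.IH[OF ms]
  show ?case
    unfolding n wact_Cons[OF ms]
    by (intro sw_hom[OF T_module _ module_hom_ident] bilinearI tcons_lin1 tcons_lin2 IH act_lin m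
        module_hom_closed[OF IH] LM.smult_closed)
qed

lemma wact_closed: "a \<in> carrier A \<Longrightarrow> ms \<in> words V n \<Longrightarrow> wact a ms \<in> carrier (T n)"
  by (rule module_hom_closed[OF wact_lin])

lemma wact_bilinear:
  "m \<in> carrier M \<Longrightarrow> ms \<in> words V n \<Longrightarrow> bilinear K A A (T (Suc n)) (\<lambda>a1 a2. tcons n (a1 \<odot>\<^bsub>M\<^esub> m) (wact a2 ms))"
  by (intro bilinearI tcons_lin1 tcons_lin2 wact_lin act_lin wact_closed LM.smult_closed)

lemma wact_multilinear: "a \<in> carrier A \<Longrightarrow> multilinear K V n (T n) (wact a)"
proof (rule multilinearI)
  show "a \<in> carrier A \<Longrightarrow> vs \<in> words V n \<Longrightarrow> wact a vs \<in> carrier (T n)" for vs by (rule wact_closed)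
  fix us ws
  assume "a \<in> carrier A" "set us \<subseteq> carrier V" "set ws \<subseteq> carrier V" "length us + Suc (length ws) = n"
  then show "(\<lambda>v. wact a (us @ v # ws)) \<in> lin V (T n)"
  proof (induction us arbitrary: a n)
    case Nil
    then have n: "n = Suc (length ws)" and ws: "ws \<in> words V (length ws)" by (auto simp: words_def)
    have "(\<lambda>v. sw (T n) (\<lambda>a1 a2. tcons (length ws) (a1 \<odot>\<^bsub>M\<^esub> v) (wact a2 ws)) a) \<in> lin V (T n)"
      unfolding n
      using Nil wact_bilinear[OF _ ws]
      by (intro sw_hom_param[OF T_module V_module] tcons_lin1 act_lin2 wact_closed ws) auto
    then show ?case by (simp add: n Let_def)
  next
    case (Cons u us)
    then obtain n' where n: "n = Suc n'" "length us + Suc (length ws) = n'" by auto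
    have u: "u \<in> carrier M" and us: "set us \<subseteq> carrier V" using Cons.prems by auto
    have w: "us @ v # ws \<in> words V n'" if "v \<in> carrier V" for v
      using that us Cons.prems n by (auto simp: words_def)
    have "(\<lambda>v. sw (T n) (\<lambda>a1 a2. tcons n' (a1 \<odot>\<^bsub>M\<^esub> u) (wact a2 (us @ v # ws))) a) \<in> lin V (T n)"
      unfolding n(1)
    proof (rule sw_hom_param[OF T_module V_module Cons.prems(1)])
      show "bilinear K A A (T (Suc n')) (\<lambda>p q. tcons n' (p \<odot>\<^bsub>M\<^esub> u) (wact q (us @ x # ws)))"
        if "x \<in> carrier V" for x by (rule wact_bilinear[OF u w[OF that]])
      show "(\<lambda>x. tcons n' (p \<odot>\<^bsub>M\<^esub> u) (wact q (us @ x # ws))) \<in> lin V (T (Suc n'))"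
        if "p \<in> carrier A" "q \<in> carrier A" for p q
        by (intro tcons_lin2 Cons.IH[OF that(2) us Cons.prems(3) n(2)] LM.smult_closed that u)
    qed
    then show ?case using n by (simp add: Let_def)
  qed
qed

definition act :: "nat \<Rightarrow> 'a \<Rightarrow> ('m list \<Rightarrow> 'k) set \<Rightarrow> ('m list \<Rightarrow> 'k) set" where
  "act n a = lift K (T n) (wact a)"

lemma act_hom: "a \<in> carrier A \<Longrightarrow> act n a \<in> lin (T n) (T n)"
  unfolding act_def by (rule K.power_lift_hom[OF V_module T_module wact_multilinear])

lemma act_pure: "a \<in> carrier A \<Longrightarrow> ms \<in> words V n \<Longrightarrow> act n a (pw ms) = wact a ms"
  unfolding act_def by (rule K.power_lift_pure[OF V_module T_module wact_multilinear])

lemma act_hom2: "t \<in> carrier (T n) \<Longrightarrow> (\<lambda>a. act n a t) \<in> lin A (T n)"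
  unfolding act_def by (rule K.power_lift_hom_param[OF V_module T_module A_module wact_multilinear wact_lin])

lemma act_closed: "a \<in> carrier A \<Longrightarrow> t \<in> carrier (T n) \<Longrightarrow> act n a t \<in> carrier (T n)"
  by (rule module_hom_closed[OF act_hom])

text \<open>By definition of the action for pure words \<open>t\<close>, and by linearity for all \<open>t\<close>.\<close>
lemma act_tcons:
  assumes a: "a \<in> carrier A" and m: "m \<in> carrier M" and t: "t \<in> carrier (T n)"
  shows "act (Suc n) a (tcons n m t) = sw (T (Suc n)) (\<lambda>a1 a2. tcons n (a1 \<odot>\<^bsub>M\<^esub> m) (act n a2 t)) a"
proof (rule K.power_hom_eq[OF V_module T_module _ _ _ t])
  show "(\<lambda>t. act (Suc n) a (tcons n m t)) \<in> lin (T n) (T (Suc n))"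
    by (intro module_hom_comp[OF act_hom[OF a]] tcons_lin2 module_hom_ident m)
  have b: "bilinear K A A (T (Suc n)) (\<lambda>a1 a2. tcons n (a1 \<odot>\<^bsub>M\<^esub> m) (act n a2 t))" if "t \<in> carrier (T n)" for t
    using that by (intro bilinearI tcons_lin1 tcons_lin2 act_hom2 act_lin act_closed LM.smult_closed m)
  show "(\<lambda>t. sw (T (Suc n)) (\<lambda>a1 a2. tcons n (a1 \<odot>\<^bsub>M\<^esub> m) (act n a2 t)) a) \<in> lin (T n) (T (Suc n))"
    by (intro sw_hom_param[OF T_module T_module a b] tcons_lin2 act_hom LM.smult_closed m)
  fix vs assume vs: "vs \<in> words V n"
  have pv: "pw vs \<in> carrier (T n)" by (rule K.pure_word_closed[OF V_module vs])
  have "act (Suc n) a (tcons n m (pw vs)) = wact a (m # vs)"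
    using K.tensor_cons_pure[OF V_module _ vs, of m] m act_pure[OF a, of "m # vs" "Suc n"] vs
    by (simp add: words_Cons del: word_act.simps)
  also have "\<dots> = sw (T (Suc n)) (\<lambda>a1 a2. tcons n (a1 \<odot>\<^bsub>M\<^esub> m) (act n a2 (pw vs))) a"
    unfolding wact_Cons[OF vs] by (rule sw_cong[OF T_module wact_bilinear[OF m vs] a]) (simp add: act_pure[OF _ vs])
  finally show "act (Suc n) a (tcons n m (pw vs)) = sw (T (Suc n)) (\<lambda>a1 a2. tcons n (a1 \<odot>\<^bsub>M\<^esub> m) (act n a2 (pw vs))) a" .
qed

lemma wact_one: "ms \<in> words V n \<Longrightarrow> wact \<one>\<^bsub>A\<^esub> ms = pw ms"
proof (induction ms arbitrary: n)
  case Nil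
  interpret T0: module K "T 0" by (rule T_module)
  have "pw [] \<in> carrier (T 0)" by (rule K.pure_word_closed[OF V_module]) (simp add: words_def)
  then show ?case by (simp add: Let_def)
next
  case (Cons m ms)
  obtain n' where n: "n = Suc n'" using Cons.prems by (cases n) (auto simp: words_def)
  have ms: "ms \<in> words V n'" and m: "m \<in> carrier M" using Cons.prems by (auto simp: n words_Cons)
  have "wact \<one>\<^bsub>A\<^esub> (m # ms) = tcons n' (\<one>\<^bsub>A\<^esub> \<odot>\<^bsub>M\<^esub> m) (wact \<one>\<^bsub>A\<^esub> ms)"
    unfolding wact_Cons[OF ms] by (rule sw_one[OF T_module wact_bilinear[OF m ms]])
  also have "\<dots> = pw (m # ms)"
    using Cons.IH[OF ms] K.tensor_cons_pure[OF V_module _ ms, of m] m by (simp add: LM.smult_one)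
  finally show ?case .
qed

text \<open>By induction on the word: multiplicativity of \<open>\<Delta>\<close> turns the left-hand side for \<open>m \<otimes> w\<close> into
\<open>a\<^sub>1 b\<^sub>1 m \<otimes> a\<^sub>2 b\<^sub>2 w\<close>, and the right-hand side is the same sum with the two summations interchanged.\<close>
lemma wact_mult:
  "a \<in> carrier A \<Longrightarrow> b \<in> carrier A \<Longrightarrow> ms \<in> words V n \<Longrightarrow> wact (a \<bullet> b) ms = act n a (wact b ms)"
proof (induction ms arbitrary: n a b)
  case Nil
  then have n: "n = 0" by (auto simp: words_def)
  interpret T0: module K "T 0" by (rule T_module)
  have w: "[] \<in> words V 0" by (simp add: words_def)
  have p: "pw [] \<in> carrier (T 0)" by (rule K.pure_word_closed[OF V_module w])
  have "act 0 a (\<epsilon> b \<odot>\<^bsub>T 0\<^esub> pw []) = \<epsilon> b \<odot>\<^bsub>T 0\<^esub> act 0 a (pw [])"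
    using Nil by (intro module_hom_smult[OF act_hom] p) auto
  also have "act 0 a (pw []) = \<epsilon> a \<odot>\<^bsub>T 0\<^esub> pw []" using act_pure[OF Nil(1) w] by (simp add: Let_def)
  finally show ?case
    using Nil p by (simp add: n Let_def counit_mult T0.smult_assoc1[symmetric] K.m_comm)
next
  case (Cons m ms)
  obtain n' where n: "n = Suc n'" using Cons.prems by (cases n) (auto simp: words_def)
  have ms: "ms \<in> words V n'" and m: "m \<in> carrier M" using Cons.prems by (auto simp: n words_Cons)
  note a = Cons.prems(1) and b = Cons.prems(2)
  note wb = wact_bilinear[OF m ms]
  let ?\<gamma> = "\<lambda>a1 a2 b1 b2. tcons n' (a1 \<odot>\<^bsub>M\<^esub> (b1 \<odot>\<^bsub>M\<^esub> m)) (act n' a2 (wact b2 ms))"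
  have bm: "(\<lambda>x. x \<odot>\<^bsub>M\<^esub> m) \<in> lin A V" by (rule act_lin[OF m])
  have b1: "bilinear K A A (T (Suc n')) (?\<gamma> a1 a2)" if "a1 \<in> carrier A" "a2 \<in> carrier A" for a1 a2
    using that by (intro bilinearI tcons_lin1 tcons_lin2 module_hom_comp[OF act_lin2 bm]
        module_hom_comp[OF act_hom wact_lin[OF ms]] act_closed wact_closed[OF _ ms] LM.smult_closed m)
  have b2: "bilinear K A A (T (Suc n')) (\<lambda>a1 a2. ?\<gamma> a1 a2 b1 b2)" if "b1 \<in> carrier A" "b2 \<in> carrier A" for b1 b2
    using that by (intro bilinearI tcons_lin1 tcons_lin2 act_lin act_hom2 act_closed wact_closed[OF _ ms]
        LM.smult_closed m)
  have bmul: "bilinear K A A (T (Suc n')) (\<lambda>b1 b2. tcons n' ((a1 \<bullet> b1) \<odot>\<^bsub>M\<^esub> m) (wact (a2 \<bullet> b2) ms))"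
    if "a1 \<in> carrier A" "a2 \<in> carrier A" for a1 a2
    by (rule bilinear_cong[OF A_module A_module b1[OF that]])
      (use that m in \<open>simp add: LM.smult_assoc Cons.IH[OF _ _ ms]\<close>)
  have "wact (a \<bullet> b) (m # ms) = sw (T (Suc n')) (\<lambda>a1 a2. sw (T (Suc n'))
      (\<lambda>b1 b2. tcons n' ((a1 \<bullet> b1) \<odot>\<^bsub>M\<^esub> m) (wact (a2 \<bullet> b2) ms)) b) a"
    unfolding wact_Cons[OF ms] by (rule sw_mult[OF T_module wb a b])
  also have "\<dots> = sw (T (Suc n')) (\<lambda>a1 a2. sw (T (Suc n')) (?\<gamma> a1 a2) b) a"
  proof (rule sw_cong[OF T_module _ a])
    have eq: "sw (T (Suc n')) (\<lambda>b1 b2. tcons n' ((a1 \<bullet> b1) \<odot>\<^bsub>M\<^esub> m) (wact (a2 \<bullet> b2) ms)) b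
      = sw (T (Suc n')) (?\<gamma> a1 a2) b" if "a1 \<in> carrier A" "a2 \<in> carrier A" for a1 a2
      by (rule sw_cong[OF T_module bmul[OF that] b])
        (use that m in \<open>simp add: LM.smult_assoc Cons.IH[OF _ _ ms]\<close>)
    then show "sw (T (Suc n')) (\<lambda>b1 b2. tcons n' ((a1 \<bullet> b1) \<odot>\<^bsub>M\<^esub> m) (wact (a2 \<bullet> b2) ms)) b
      = sw (T (Suc n')) (?\<gamma> a1 a2) b" if "a1 \<in> carrier A" "a2 \<in> carrier A" for a1 a2 using that .
    have "bilinear K A A (T (Suc n')) (\<lambda>a1 a2. sw (T (Suc n')) (?\<gamma> a1 a2) b)"
      by (intro bilinearI sw_hom_param[OF T_module A_module b] b1 bilinearD(1,2)[OF b2])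
    then show "bilinear K A A (T (Suc n')) (\<lambda>a1 a2. sw (T (Suc n'))
        (\<lambda>b1 b2. tcons n' ((a1 \<bullet> b1) \<odot>\<^bsub>M\<^esub> m) (wact (a2 \<bullet> b2) ms)) b)"
      by (rule bilinear_cong[OF A_module A_module]) (simp add: eq)
  qed
  also have "\<dots> = sw (T (Suc n')) (\<lambda>b1 b2. sw (T (Suc n')) (\<lambda>a1 a2. ?\<gamma> a1 a2 b1 b2) a) b"
    by (rule sw_swap[OF T_module a b b1 b2])
  also have "\<dots> = sw (T (Suc n')) (\<lambda>b1 b2. act (Suc n') a (tcons n' (b1 \<odot>\<^bsub>M\<^esub> m) (wact b2 ms))) b"
    by (rule sw_cong[OF T_module bilinear_comp[OF wb act_hom[OF a]] b, symmetric])
      (rule act_tcons[OF a LM.smult_closed[OF _ m] wact_closed[OF _ ms]])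
  also have "\<dots> = act (Suc n') a (wact b (m # ms))"
    unfolding wact_Cons[OF ms] by (rule sw_apply[OF T_module T_module wb act_hom[OF a] b, symmetric])
  finally show ?case by (simp add: n)
qed

lemma X_simps [simp]:
  "carrier (X n) = carrier (T n)" "\<zero>\<^bsub>X n\<^esub> = \<zero>\<^bsub>T n\<^esub>" "u \<oplus>\<^bsub>X n\<^esub> v = u \<oplus>\<^bsub>T n\<^esub> v"
  "a \<odot>\<^bsub>X n\<^esub> t = act n a t"
  by (simp_all add: tensor_power_module_def Let_def act_def)

lemma X_left_module: "left_module A (X n)"
proof -
  interpret T: module K "T n" by (rule T_module)
  show ?thesis
  proof (intro left_module.intro left_module_axioms.intro A.ring_axioms)
    show "abelian_group (X n)"
      by (rule abelian_groupI) (auto simp: T.M.a_ac intro: T.M.l_neg)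
    show "(a \<bullet> b) \<odot>\<^bsub>X n\<^esub> x = a \<odot>\<^bsub>X n\<^esub> (b \<odot>\<^bsub>X n\<^esub> x)"
      if "a \<in> carrier A" "b \<in> carrier A" "x \<in> carrier (X n)" for a b x
    proof -
      have "act n (a \<bullet> b) x = act n a (act n b x)"
        by (rule K.power_hom_eq[OF V_module T_module act_hom module_hom_comp[OF act_hom act_hom]])
          (use that in \<open>auto simp: act_pure wact_mult\<close>)
      then show ?thesis by simp
    qed
    show "\<one>\<^bsub>A\<^esub> \<odot>\<^bsub>X n\<^esub> x = x" if "x \<in> carrier (X n)" for x
    proof -
      have "act n \<one>\<^bsub>A\<^esub> x = x"
        by (rule K.power_hom_eq[OF V_module T_module act_hom module_hom_ident])
          (use that in \<open>auto simp: act_pure wact_one\<close>)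
      then show ?thesis by simp
    qed
  qed (auto simp: act_closed module_hom_add[OF act_hom] module_hom_add[OF act_hom2])
qed

text \<open>The linear map induced by \<open>\<beta>\<close> on \<open>A \<otimes> M\<close>, applied to the defining equation.\<close>
lemma left_kernel_bilinear:
  assumes l: "l \<in> left_kernel K A \<Delta> M" and U: "module K U" and b: "bilinear K A V U \<beta>" and m: "m \<in> carrier M"
  shows "sw U (\<lambda>x y. \<beta> x (y \<odot>\<^bsub>M\<^esub> m)) l = \<beta> l m"
proof -
  have la: "l \<in> carrier A" using l by (simp add: left_kernel_def Let_def)
  have eq: "sw (tensor K A V) (\<lambda>a1 a2. pure K A V a1 (a2 \<odot>\<^bsub>M\<^esub> m)) l = pure K A V l m"
    using l m by (simp add: left_kernel_def Let_def)
  note pb = K.pure_bilinear[OF A_module V_module] and Tm = K.tensor_module[OF A_module V_module]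
  have mb: "bilinear K A A (tensor K A V) (\<lambda>a1 a2. pure K A V a1 (a2 \<odot>\<^bsub>M\<^esub> m))"
    using LM.smult_closed[OF _ m]
    by (intro bilinearI module_hom_comp[OF bilinearD(1)[OF pb] act_lin[OF m]] bilinearD(2)[OF pb]) auto
  note G = K.tensor_lift_hom[OF A_module V_module U b]
  note Gp = K.tensor_lift_pure[OF A_module V_module U b]
  have "\<beta> l m = lift K U (\<lambda>(x, y). \<beta> x y) (pure K A V l m)" using Gp[OF la] m by simp
  also have "\<dots> = sw U (\<lambda>a1 a2. lift K U (\<lambda>(x, y). \<beta> x y) (pure K A V a1 (a2 \<odot>\<^bsub>M\<^esub> m))) l"
    unfolding eq[symmetric] by (rule sw_apply[OF Tm U mb G la])
  also have "\<dots> = sw U (\<lambda>x y. \<beta> x (y \<odot>\<^bsub>M\<^esub> m)) l"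
    by (rule sw_cong[OF U bilinear_comp[OF mb G] la]) (simp add: Gp LM.smult_closed[OF _ m])
  finally show ?thesis by simp
qed

text \<open>The defining property of the left kernel passes from \<open>M\<close> to its tensor powers: if \<open>l\<^sub>1 \<otimes> l\<^sub>2 t = l \<otimes> t\<close> then
\<open>l\<^sub>1 \<otimes> l\<^sub>2 m \<otimes> l\<^sub>3 t = l\<^sub>1 \<otimes> l\<^sub>2 m \<otimes> t = l \<otimes> m \<otimes> t\<close>.  Equations in \<open>A \<otimes> M\<^sup>\<otimes>\<^sup>n\<close> are expressed by arbitrary bilinear
maps \<open>\<beta>\<close>; the induction applies the hypothesis to \<open>(x, t) \<mapsto> \<beta>(x\<^sub>1, x\<^sub>2 m \<otimes> t)\<close>.\<close>
lemma left_kernel_wact: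
  assumes l: "l \<in> left_kernel K A \<Delta> M" and U: "module K U"
  shows "ms \<in> words V n \<Longrightarrow> bilinear K A (T n) U \<beta> \<Longrightarrow> sw U (\<lambda>x y. \<beta> x (wact y ms)) l = \<beta> l (pw ms)"
proof (induction ms arbitrary: n \<beta>)
  have la: "l \<in> carrier A" using l by (simp add: left_kernel_def Let_def)
  case Nil
  then have n: "n = 0" by (auto simp: words_def)
  have p: "pw [] \<in> carrier (T 0)" by (rule K.pure_word_closed[OF V_module]) (simp add: words_def)
  note b = Nil(2)[unfolded n]
  have "sw U (\<lambda>x y. \<beta> x (wact y [])) l = sw U (\<lambda>x y. \<epsilon> y \<odot>\<^bsub>U\<^esub> \<beta> x (pw [])) l"
  proof (rule sw_cong[OF U _ la])
    have w: "[] \<in> words V 0" by (simp add: words_0)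
    show "bilinear K A A U (\<lambda>x y. \<beta> x (wact y []))"
      by (rule bilinearI[OF module_hom_comp[OF bilinearD(1)[OF b] wact_lin[OF w]]
            bilinearD(2)[OF b wact_closed[OF _ w]]])
    show "\<beta> x (wact y []) = \<epsilon> y \<odot>\<^bsub>U\<^esub> \<beta> x (pw [])" if "x \<in> carrier A" "y \<in> carrier A" for x y
      using module_hom_smult[OF bilinearD(1)[OF b that(1)] counit_closed[OF that(2)] p] by (simp add: Let_def)
  qed
  also have "\<dots> = \<beta> l (pw [])" by (rule sw_counit_right[OF U bilinearD(2)[OF b p] la])
  finally show ?case .
next
  have la: "l \<in> carrier A" using l by (simp add: left_kernel_def Let_def)
  case (Cons m ms)
  obtain n' where n: "n = Suc n'" using Cons.prems by (cases n) (auto simp: words_def)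
  have ms: "ms \<in> words V n'" and m: "m \<in> carrier M" using Cons.prems by (auto simp: n words_Cons)
  note b = Cons.prems(2)[unfolded n]
  have pc: "pw ms \<in> carrier (T n')" by (rule K.pure_word_closed[OF V_module ms])
  have tc: "tcons n' x t \<in> carrier (T (Suc n'))" if "x \<in> carrier M" "t \<in> carrier (T n')" for x t
    using bilinearD(3)[OF tcons_bilinear] that by simp
  note i = bilinearI module_hom_comp[OF bilinearD(1)[OF b]] module_hom_comp[OF bilinearD(2)[OF b]]
    module_hom_ident tcons_lin1 tcons_lin2 wact_lin[OF ms] act_lin m LM.smult_closed tc wact_closed[OF _ ms]
    sw_hom[OF U] sw_hom_param[OF U A_module] sw_hom_param[OF U T_module]
  let ?\<gamma> = "\<lambda>u v y. \<beta> u (tcons n' (v \<odot>\<^bsub>M\<^esub> m) (wact y ms))"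
  let ?\<beta>' = "\<lambda>x t. sw U (\<lambda>u v. \<beta> u (tcons n' (v \<odot>\<^bsub>M\<^esub> m) t)) x"
  have "sw U (\<lambda>x y. \<beta> x (wact y (m # ms))) l = sw U (\<lambda>x y. sw U (\<lambda>u v. ?\<gamma> x u v) y) l"
  proof (rule sw_cong[OF U _ la])
    show "bilinear K A A U (\<lambda>x y. \<beta> x (wact y (m # ms)))"
      using Cons.prems(1) unfolding n
      by (intro bilinearI module_hom_comp[OF bilinearD(1)[OF b]] bilinearD(2)[OF b] wact_lin wact_closed)
    show "\<beta> x (wact y (m # ms)) = sw U (\<lambda>u v. ?\<gamma> x u v) y" if "x \<in> carrier A" "y \<in> carrier A" for x y
      unfolding wact_Cons[OF ms]
      by (rule sw_apply[OF T_module U wact_bilinear[OF m ms] bilinearD(1)[OF b that(1)] that(2)])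
  qed
  also have "\<dots> = sw U (\<lambda>x y. ?\<beta>' x (wact y ms)) l"
    by (rule sw_coassoc[OF U la, where \<gamma> = ?\<gamma>, symmetric]; intro i; assumption?)
  also have "\<dots> = ?\<beta>' l (pw ms)"
    by (rule Cons.IH[OF ms]) (intro i)
  also have "\<dots> = \<beta> l (tcons n' m (pw ms))"
    by (rule left_kernel_bilinear[OF l U _ m, where \<beta> = "\<lambda>u v. \<beta> u (tcons n' v (pw ms))"])
      (intro i pc; simp)
  also have "\<dots> = \<beta> l (pw (m # ms))" using K.tensor_cons_pure[OF V_module _ ms, of m] m by simp
  finally show ?case .
qed

text \<open>The counit, applied to the first factor of \<open>l\<^sub>1 \<otimes> l\<^sub>2 t = l \<otimes> t\<close>, gives \<open>l t = \<epsilon>(l) t\<close>.\<close>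
lemma left_kernel_acts_trivially:
  assumes l: "l \<in> left_kernel K A \<Delta> M" and e: "\<epsilon> l = \<zero>\<^bsub>K\<^esub>" and t: "t \<in> carrier (T n)"
  shows "act n l t = \<zero>\<^bsub>T n\<^esub>"
proof -
  interpret T: module K "T n" by (rule T_module)
  have la: "l \<in> carrier A" using l by (simp add: left_kernel_def Let_def)
  show ?thesis
  proof (rule K.power_hom_eq[OF V_module T_module act_hom[OF la] T.module_hom_zerof _ t])
    fix vs assume vs: "vs \<in> words V n"
    have b: "bilinear K A (T n) (T n) (\<lambda>x t. \<epsilon> x \<odot>\<^bsub>T n\<^esub> t)"
      by (intro bilinearI lin_smult[OF T_module] lin_smultr[OF T_module] counit_lin module_hom_ident counit_closed)
    have "wact l vs = sw (T n) (\<lambda>x y. \<epsilon> x \<odot>\<^bsub>T n\<^esub> wact y vs) l"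
      by (rule sw_counit_left[OF T_module wact_lin[OF vs] la, symmetric])
    also have "\<dots> = \<epsilon> l \<odot>\<^bsub>T n\<^esub> pw vs" by (rule left_kernel_wact[OF l T_module vs b])
    also have "\<dots> = \<zero>\<^bsub>T n\<^esub>" using e K.pure_word_closed[OF V_module vs] by simp
    finally show "act n l (pw vs) = \<zero>\<^bsub>T n\<^esub>" using act_pure[OF la vs] by simp
  qed
qed

end

context fd_hopf_module begin

text \<open>The product of the coordinate functions of the letters.  The value on the empty words is the empty product;
words of different lengths are never compared.\<close>
fun word_functional :: "'m list \<Rightarrow> 'm list \<Rightarrow> 'k" where
  "word_functional (b # bs) (v # vs) = \<xi> b v \<ast> word_functional bs vs"
| "word_functional _ _ = \<one>\<^bsub>K\<^esub>"

lemma word_functional_closed: "bs \<in> lists B \<Longrightarrow> set vs \<subseteq> carrier M \<Longrightarrow> word_functional bs vs \<in> carrier K"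
  by (induction bs vs rule: word_functional.induct) (auto simp: \<xi>_closed)

lemma word_functional_multilinear:
  "bs \<in> lists B \<Longrightarrow> length bs = n \<Longrightarrow> multilinear K V n KK (word_functional bs)"
proof (rule multilinearI)
  assume bs: "bs \<in> lists B" and n: "length bs = n"
  show "word_functional bs vs \<in> carrier KK" if "vs \<in> words V n" for vs
    using word_functional_closed[OF bs] that by (simp add: words_def)
  fix us ws assume "set us \<subseteq> carrier V" "set ws \<subseteq> carrier V" "length us + Suc (length ws) = n"
  with bs n show "(\<lambda>v. word_functional bs (us @ v # ws)) \<in> lin V KK"
  proof (induction bs arbitrary: us n)
    case (Cons b bs)
    show ?case
    proof (cases us)
      case Nil
      then show ?thesis using Cons.prems Cons.hyps word_functional_closed[of bs ws]
        by (simp, intro lin_K_mult_left \<xi>_lin) auto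
    next
      case (Cons u us')
      then show ?thesis using Cons.prems Cons.hyps Cons.IH[of _ us'] \<xi>_closed[of b u]
        by (simp, intro lin_K_mult_right) auto
    qed
  qed simp
qed

lemma word_functional_tcons:
  assumes b: "b \<in> B" and bs: "bs \<in> lists B" "length bs = n" and m: "m \<in> carrier M" and t: "t \<in> carrier (T n)"
  shows "lift K KK (word_functional (b # bs)) (tcons n m t) = \<xi> b m \<ast> lift K KK (word_functional bs) t"
proof -
  have bbs: "b # bs \<in> lists B" "length (b # bs) = Suc n" using b bs by auto
  note ml = word_functional_multilinear[OF bs] and ml' = word_functional_multilinear[OF bbs]
  show ?thesis
  proof (rule K.power_hom_eq[OF V_module KK_module _ _ _ t])
    show "(\<lambda>t. lift K KK (word_functional (b # bs)) (tcons n m t)) \<in> lin (T n) KK"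
      by (rule module_hom_comp[OF K.power_lift_hom[OF V_module KK_module ml'] tcons_lin2[OF module_hom_ident m]])
    show "(\<lambda>t. \<xi> b m \<ast> lift K KK (word_functional bs) t) \<in> lin (T n) KK"
      by (rule lin_K_mult_right[OF K.power_lift_hom[OF V_module KK_module ml] \<xi>_closed[OF b m]])
    fix vs assume vs: "vs \<in> words V n"
    show "lift K KK (word_functional (b # bs)) (tcons n m (pw vs)) = \<xi> b m \<ast> lift K KK (word_functional bs) (pw vs)"
      using K.tensor_cons_pure[OF V_module _ vs, of m] m vs K.power_lift_pure[OF V_module KK_module ml vs]
        K.power_lift_pure[OF V_module KK_module ml', of "m # vs"] by (simp add: words_Cons)
  qed
qed

lemma word_coef_matrix_entry:
  assumes "ps \<in> lists (B \<times> B)" "a \<in> carrier A"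
  shows "word_coef ps a = lift K KK (word_functional (map fst ps)) (wact a (map snd ps))"
  using assms
proof (induction ps arbitrary: a)
  case Nil
  have w: "[] \<in> words V 0" by (simp add: words_def)
  have p: "pw [] \<in> carrier (T 0)" by (rule K.pure_word_closed[OF V_module w])
  have ml: "multilinear K V 0 KK (word_functional [])" by (rule word_functional_multilinear) auto
  have "lift K KK (word_functional []) (\<epsilon> a \<odot>\<^bsub>T 0\<^esub> pw []) = \<epsilon> a \<ast> lift K KK (word_functional []) (pw [])"
    using module_hom_smult[OF K.power_lift_hom[OF V_module KK_module ml] counit_closed[OF Nil] p] by simp
  then show ?case
    using K.power_lift_pure[OF V_module KK_module ml w] Nil
    by (simp add: Let_def del: word_functional.simps) (simp add: word_functional.simps)
next
  case (Cons p ps)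
  obtain b b' where p: "p = (b, b')" "b \<in> B" "b' \<in> B" using Cons.hyps by auto
  have ps: "ps \<in> lists (B \<times> B)" and a: "a \<in> carrier A" using Cons.hyps Cons.prems by auto
  have b'M: "b' \<in> carrier M" using p B_subset by auto
  let ?n = "length ps"
  have bs: "map fst ps \<in> lists B" and ms: "map snd ps \<in> words V ?n"
    using ps B_subset by (auto simp: words_def lists_eq_set)
  have bbs: "b # map fst ps \<in> lists B" "length (b # map fst ps) = Suc ?n" using p bs by auto
  note h = K.power_lift_hom[OF V_module KK_module word_functional_multilinear[OF bbs]]
  have "lift K KK (word_functional (b # map fst ps)) (wact a (b' # map snd ps))
    = sw KK (\<lambda>a1 a2. lift K KK (word_functional (b # map fst ps)) (tcons ?n (a1 \<odot>\<^bsub>M\<^esub> b') (wact a2 (map snd ps)))) a"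
    unfolding wact_Cons[OF ms] by (rule sw_apply[OF T_module KK_module wact_bilinear[OF b'M ms] h a])
  also have "\<dots> = conv (coef b b') (word_coef ps) a"
    unfolding conv_def
  proof (rule sw_cong[OF KK_module bilinear_comp[OF wact_bilinear[OF b'M ms] h] a])
    fix x y assume xy: "x \<in> carrier A" "y \<in> carrier A"
    show "lift K KK (word_functional (b # map fst ps)) (tcons ?n (x \<odot>\<^bsub>M\<^esub> b') (wact y (map snd ps)))
      = coef b b' x \<ast> word_coef ps y"
      using word_functional_tcons[OF p(2) bs _ LM.smult_closed[OF xy(1) b'M] wact_closed[OF xy(2) ms]]
        Cons.IH[OF xy(2)] by (simp add: coef_def)
  qed
  finally show ?case using p by simp
qed

lemma trivial_action_imp_Coef_zero:
  assumes a: "a \<in> carrier A" and act0: "\<And>n t. t \<in> carrier (T n) \<Longrightarrow> act n a t = \<zero>\<^bsub>T n\<^esub>" and c: "c \<in> Coef n"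
  shows "c a = \<zero>\<^bsub>K\<^esub>"
proof -
  have "word_coef ps a = \<zero>\<^bsub>K\<^esub>" if ps: "ps \<in> lists (B \<times> B)" for ps
  proof -
    have bs: "map fst ps \<in> lists B" and ms: "map snd ps \<in> words V (length ps)"
      using ps B_subset by (auto simp: words_def lists_eq_set)
    interpret T: module K "T (length ps)" by (rule T_module)
    have "wact a (map snd ps) = \<zero>\<^bsub>T (length ps)\<^esub>"
      using act0[OF K.pure_word_closed[OF V_module ms]] act_pure[OF a ms] by simp
    then show ?thesis
      using word_coef_matrix_entry[OF ps a]
        module_hom_zero[OF K.power_lift_hom[OF V_module KK_module word_functional_multilinear[OF bs]]
          _ K.regular_abelian_group, of "length ps"] T.M.abelian_group_axioms by simp
  qed
  then have "K.fun_space (carrier A) (lin A KK) \<Longrightarrow> Coef n \<subseteq> {c \<in> lin A KK. c a = \<zero>\<^bsub>K\<^esub>}"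
    unfolding Coef_def
  proof (intro K.fun_span_least)
    show "K.fun_space (carrier A) {c \<in> lin A KK. c a = \<zero>\<^bsub>K\<^esub>}"
      unfolding K.fun_space_def
    proof (intro conjI ballI allI impI)
      have "(\<lambda>_. \<zero>\<^bsub>K\<^esub>) \<in> lin A KK" by (rule K.fun_space_zero[OF lin_functionals_space]) simp
      then show "{c \<in> lin A KK. c a = \<zero>\<^bsub>K\<^esub>} \<noteq> {}" by auto
      show "c x \<in> carrier K" if "c \<in> {c \<in> lin A KK. c a = \<zero>\<^bsub>K\<^esub>}" "x \<in> carrier A" for c x
        using that lin_K_closed by auto
      fix c d k e assume c: "c \<in> {c \<in> lin A KK. c a = \<zero>\<^bsub>K\<^esub>}" and d: "d \<in> {c \<in> lin A KK. c a = \<zero>\<^bsub>K\<^esub>}"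
        and k: "k \<in> carrier K" and e: "\<forall>x\<in>carrier A. e x = k \<ast> c x \<oplus>\<^bsub>K\<^esub> d x"
      have "e \<in> lin A KK" by (rule K.fun_space_comb[OF lin_functionals_space, of c d k]) (use c d k e in auto)
      then show "e \<in> {c \<in> lin A KK. c a = \<zero>\<^bsub>K\<^esub>}" using c d k e a by simp
    qed
  qed (auto intro: word_coef_lin)
  then show ?thesis using lin_functionals_space c by auto
qed

end

section \<open>Simple modules over rings and their quotients\<close>

context left_module begin

lemma smult_zero_left: "x \<in> carrier M \<Longrightarrow> \<zero> \<odot>\<^bsub>M\<^esub> x = \<zero>\<^bsub>M\<^esub>"
proof -
  assume x: "x \<in> carrier M"
  have "\<zero> \<odot>\<^bsub>M\<^esub> x \<oplus>\<^bsub>M\<^esub> \<zero> \<odot>\<^bsub>M\<^esub> x = \<zero> \<odot>\<^bsub>M\<^esub> x"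
    using smult_l_distr[OF R.zero_closed R.zero_closed x] by simp
  then show ?thesis using smult_closed[OF R.zero_closed x] by simp
qed

lemma smult_zero_right: "a \<in> carrier R \<Longrightarrow> a \<odot>\<^bsub>M\<^esub> \<zero>\<^bsub>M\<^esub> = \<zero>\<^bsub>M\<^esub>"
proof -
  assume a: "a \<in> carrier R"
  have "a \<odot>\<^bsub>M\<^esub> \<zero>\<^bsub>M\<^esub> \<oplus>\<^bsub>M\<^esub> a \<odot>\<^bsub>M\<^esub> \<zero>\<^bsub>M\<^esub> = a \<odot>\<^bsub>M\<^esub> \<zero>\<^bsub>M\<^esub>"
    using smult_r_distr[OF a M.zero_closed M.zero_closed] by simp
  then show ?thesis using smult_closed[OF a M.zero_closed] by simp
qed

lemma smult_neg: "a \<in> carrier R \<Longrightarrow> x \<in> carrier M \<Longrightarrow> (\<ominus> a) \<odot>\<^bsub>M\<^esub> x = \<ominus>\<^bsub>M\<^esub> (a \<odot>\<^bsub>M\<^esub> x)"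
proof -
  assume a: "a \<in> carrier R" "x \<in> carrier M"
  have "(\<ominus> a) \<odot>\<^bsub>M\<^esub> x \<oplus>\<^bsub>M\<^esub> a \<odot>\<^bsub>M\<^esub> x = \<zero>\<^bsub>M\<^esub>"
    using smult_l_distr[of "\<ominus> a" a x] a smult_zero_left by (simp add: R.l_neg)
  then show ?thesis using a smult_closed[of _ x] M.minus_equality by (metis R.a_inv_closed)
qed

lemma left_submoduleI:
  assumes "H \<subseteq> carrier M" "\<zero>\<^bsub>M\<^esub> \<in> H" "\<And>x y. x \<in> H \<Longrightarrow> y \<in> H \<Longrightarrow> x \<oplus>\<^bsub>M\<^esub> y \<in> H"
    and sm: "\<And>a x. a \<in> carrier R \<Longrightarrow> x \<in> H \<Longrightarrow> a \<odot>\<^bsub>M\<^esub> x \<in> H"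
  shows "submodule H R M"
proof (intro submodule.intro subgroup.intro submodule_axioms.intro)
  fix x assume x: "x \<in> H"
  then have xc: "x \<in> carrier M" using assms(1) by auto
  have "\<ominus>\<^bsub>M\<^esub> x = (\<ominus> \<one>) \<odot>\<^bsub>M\<^esub> x" using smult_neg[OF R.one_closed xc] smult_one[OF xc] by simp
  then have "\<ominus>\<^bsub>M\<^esub> x \<in> H" using sm[of "\<ominus> \<one>"] x by simp
  then show "inv\<^bsub>add_monoid M\<^esub> x \<in> H" by (simp add: a_inv_def)
qed (use assms in auto)

lemma orbit_submodule:
  assumes N: "R.left_ideal N" and w: "w \<in> carrier M"
  shows "submodule ((\<lambda>y. y \<odot>\<^bsub>M\<^esub> w) ` N) R M"
proof (rule left_submoduleI)
  note N' = R.left_idealD[OF N]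
  show "(\<lambda>y. y \<odot>\<^bsub>M\<^esub> w) ` N \<subseteq> carrier M" using N'(1) smult_closed w by auto
  show "\<zero>\<^bsub>M\<^esub> \<in> (\<lambda>y. y \<odot>\<^bsub>M\<^esub> w) ` N"
    using smult_zero_left[OF w] by (intro image_eqI[OF _ N'(2)]) simp
  show "x \<oplus>\<^bsub>M\<^esub> y \<in> (\<lambda>y. y \<odot>\<^bsub>M\<^esub> w) ` N"
    if xy: "x \<in> (\<lambda>y. y \<odot>\<^bsub>M\<^esub> w) ` N" "y \<in> (\<lambda>y. y \<odot>\<^bsub>M\<^esub> w) ` N" for x y
  proof -
    obtain a b where ab: "a \<in> N" "b \<in> N" "x = a \<odot>\<^bsub>M\<^esub> w" "y = b \<odot>\<^bsub>M\<^esub> w" using xy by auto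
    show ?thesis
      using smult_l_distr[OF N'(1)[OF ab(1)] N'(1)[OF ab(2)] w] ab(3,4)
      by (intro image_eqI[OF _ N'(3)[OF ab(1,2)]]) simp
  qed
  show "a \<odot>\<^bsub>M\<^esub> x \<in> (\<lambda>y. y \<odot>\<^bsub>M\<^esub> w) ` N"
    if ax: "a \<in> carrier R" "x \<in> (\<lambda>y. y \<odot>\<^bsub>M\<^esub> w) ` N" for a x
  proof -
    obtain b where b: "b \<in> N" "x = b \<odot>\<^bsub>M\<^esub> w" using ax by auto
    show ?thesis
      using smult_assoc[OF ax(1) N'(1)[OF b(1)] w] b(2)
      by (intro image_eqI[OF _ N'(4)[OF ax(1) b(1)]]) simp
  qed
qed

lemma inj_on_orbit:
  assumes N: "R.left_ideal N" and w: "w \<in> carrier M"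
    and ker: "\<And>y. y \<in> N \<Longrightarrow> y \<odot>\<^bsub>M\<^esub> w = \<zero>\<^bsub>M\<^esub> \<Longrightarrow> y = \<zero>"
  shows "inj_on (\<lambda>y. y \<odot>\<^bsub>M\<^esub> w) N"
proof (rule inj_onI)
  fix x y assume xy: "x \<in> N" "y \<in> N" "x \<odot>\<^bsub>M\<^esub> w = y \<odot>\<^bsub>M\<^esub> w"
  note c = R.left_idealD(1)[OF N xy(1)] R.left_idealD(1)[OF N xy(2)]
  have "(x \<ominus> y) \<odot>\<^bsub>M\<^esub> w = \<zero>\<^bsub>M\<^esub>"
    using smult_l_distr[OF c(1) R.a_inv_closed[OF c(2)] w] smult_neg[OF c(2) w] xy(3) smult_closed[OF c(2) w]
    by (simp add: a_minus_def M.r_neg)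
  moreover have "x \<ominus> y \<in> N"
    unfolding a_minus_def by (rule R.left_idealD(3)[OF N xy(1) R.left_ideal_neg[OF N xy(2)]])
  ultimately show "x = y" using ker R.eq_if_minus_zero[OF c] by blast
qed

end

lemma submoduleD:
  assumes "submodule H R M"
  shows "H \<subseteq> carrier M" "\<zero>\<^bsub>M\<^esub> \<in> H" "x \<in> H \<Longrightarrow> y \<in> H \<Longrightarrow> x \<oplus>\<^bsub>M\<^esub> y \<in> H"
    "a \<in> carrier R \<Longrightarrow> x \<in> H \<Longrightarrow> a \<odot>\<^bsub>M\<^esub> x \<in> H"
proof -
  interpret submodule H R M by fact
  show "H \<subseteq> carrier M" "\<zero>\<^bsub>M\<^esub> \<in> H" "x \<in> H \<Longrightarrow> y \<in> H \<Longrightarrow> x \<oplus>\<^bsub>M\<^esub> y \<in> H"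
    "a \<in> carrier R \<Longrightarrow> x \<in> H \<Longrightarrow> a \<odot>\<^bsub>M\<^esub> x \<in> H"
    using subset one_closed m_closed[of x y] smult_closed[of a x] by auto
qed

context ideal begin

lemma quot_carrier: "carrier (R Quot I) = (\<lambda>a. I +> a) ` carrier R"
  by (auto simp: FactRing_def A_RCOSETS_def')

lemma quot_ops:
  assumes "a \<in> carrier R" "b \<in> carrier R"
  shows "(I +> a) \<oplus>\<^bsub>R Quot I\<^esub> (I +> b) = I +> (a \<oplus> b)"
    "(I +> a) \<otimes>\<^bsub>R Quot I\<^esub> (I +> b) = I +> (a \<otimes> b)"
  using assms by (simp_all add: FactRing_def a_rcos_sum rcoset_mult_add)

lemma quot_one_zero: "\<one>\<^bsub>R Quot I\<^esub> = I +> \<one>" "\<zero>\<^bsub>R Quot I\<^esub> = I"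
  by (simp_all add: FactRing_def)

text \<open>An action of \<open>R/I\<close> is the same as an action of \<open>R\<close> under which \<open>I\<close> acts as zero: cosets act through arbitrary
representatives.  Submodules agree for the two actions.\<close>
lemma simple_pullback_iff:
  fixes V :: "('a, 'v) module"
  assumes V: "left_module R V"
  shows "(\<exists>N :: ('a set, 'v) module. simple_module (R Quot I) N \<and> module_isomorphic R V (pullback_module R I N)) \<longleftrightarrow>
    simple_module R V \<and> (\<forall>a\<in>I. \<forall>v\<in>carrier V. a \<odot>\<^bsub>V\<^esub> v = \<zero>\<^bsub>V\<^esub>)"
    (is "?L \<longleftrightarrow> ?R")
proof
  interpret V: left_module R V by fact
  assume ?L
  then obtain N :: "('a set, 'v) module" and h where N: "simple_module (R Quot I) N"
    and h: "h \<in> module_hom R V (pullback_module R I N)" "bij_betw h (carrier V) (carrier N)"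
    by (auto simp: module_isomorphic_def pullback_module_def)
  interpret N: left_module "R Quot I" N using N by (simp add: simple_module_def)
  have hc: "h v \<in> carrier N" if "v \<in> carrier V" for v
    using module_hom_closed[OF h(1) that] by (simp add: pullback_module_def)
  have ha: "h (u \<oplus>\<^bsub>V\<^esub> v) = h u \<oplus>\<^bsub>N\<^esub> h v" if "u \<in> carrier V" "v \<in> carrier V" for u v
    using module_hom_add[OF h(1) that] by (simp add: pullback_module_def)
  have hs: "h (a \<odot>\<^bsub>V\<^esub> v) = (I +> a) \<odot>\<^bsub>N\<^esub> h v" if "a \<in> carrier R" "v \<in> carrier V" for a v
    using module_hom_smult[OF h(1) that] by (simp add: pullback_module_def)
  have inj: "inj_on h (carrier V)" and img: "h ` carrier V = carrier N"
    using h(2) by (auto simp: bij_betw_def)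
  have h0: "h \<zero>\<^bsub>V\<^esub> = \<zero>\<^bsub>N\<^esub>"
    using ha[of "\<zero>\<^bsub>V\<^esub>" "\<zero>\<^bsub>V\<^esub>"] hc[of "\<zero>\<^bsub>V\<^esub>"] by simp
  have "W = {\<zero>\<^bsub>V\<^esub>} \<or> W = carrier V" if W: "submodule W R V" for W
  proof -
    note W' = submoduleD[OF W]
    have "submodule (h ` W) (R Quot I) N"
    proof (rule N.left_submoduleI)
      show "h ` W \<subseteq> carrier N" using W'(1) hc by auto
      show "\<zero>\<^bsub>N\<^esub> \<in> h ` W" using W'(2) h0 by (metis imageI)
      show "x \<oplus>\<^bsub>N\<^esub> y \<in> h ` W" if xy: "x \<in> h ` W" "y \<in> h ` W" for x y
      proof -
        obtain u v where "u \<in> W" "v \<in> W" "x = h u" "y = h v" using xy by auto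
        moreover from this have "h (u \<oplus>\<^bsub>V\<^esub> v) = x \<oplus>\<^bsub>N\<^esub> y"
          using ha[OF subsetD[OF W'(1)] subsetD[OF W'(1)], of u v] by simp
        ultimately show ?thesis using W'(3) by (metis imageI)
      qed
      show "C \<odot>\<^bsub>N\<^esub> x \<in> h ` W" if Cx: "C \<in> carrier (R Quot I)" "x \<in> h ` W" for C x
      proof -
        obtain a u where "a \<in> carrier R" "C = I +> a" "u \<in> W" "x = h u" using Cx by (auto simp: quot_carrier)
        moreover from this have "h (a \<odot>\<^bsub>V\<^esub> u) = C \<odot>\<^bsub>N\<^esub> x"
          using hs[OF _ subsetD[OF W'(1)], of a u] by simp
        ultimately show ?thesis using W'(4) by (metis imageI)
      qed
    qed
    then consider "h ` W = {\<zero>\<^bsub>N\<^esub>}" | "h ` W = carrier N" using N by (auto simp: simple_module_def)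
    then show ?thesis
    proof cases
      case 1
      then have "h ` W = h ` {\<zero>\<^bsub>V\<^esub>}" using h0 by simp
      then show ?thesis using inj_on_image_eq_iff[OF inj W'(1), of "{\<zero>\<^bsub>V\<^esub>}"] by simp
    next
      case 2
      then have "h ` W = h ` carrier V" using img by simp
      then show ?thesis using inj_on_image_eq_iff[OF inj W'(1) order_refl] by simp
    qed
  qed
  moreover have "carrier V \<noteq> {\<zero>\<^bsub>V\<^esub>}"
  proof
    assume "carrier V = {\<zero>\<^bsub>V\<^esub>}"
    then have "carrier N = {\<zero>\<^bsub>N\<^esub>}" using img h0 by auto
    then show False using N by (simp add: simple_module_def)
  qed
  moreover have "a \<odot>\<^bsub>V\<^esub> v = \<zero>\<^bsub>V\<^esub>" if a: "a \<in> I" and v: "v \<in> carrier V" for a v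
  proof -
    have ac: "a \<in> carrier R" using a by (rule a_Hcarr)
    have "h (a \<odot>\<^bsub>V\<^esub> v) = h \<zero>\<^bsub>V\<^esub>"
      using hs[OF ac v] a_rcos_const[OF a] N.smult_zero_left[OF hc[OF v]] h0 by (simp add: quot_one_zero)
    then show ?thesis using inj_onD[OF inj] V.smult_closed[OF ac v] by auto
  qed
  ultimately show ?R using V by (auto simp: simple_module_def)
next
  interpret V: left_module R V by fact
  assume R: ?R
  then have simple: "simple_module R V" and kill: "\<And>a v. a \<in> I \<Longrightarrow> v \<in> carrier V \<Longrightarrow> a \<odot>\<^bsub>V\<^esub> v = \<zero>\<^bsub>V\<^esub>" by auto
  define N :: "('a set, 'v) module" where
    "N = mk_module (carrier V) \<zero>\<^bsub>V\<^esub> (add V) (\<lambda>C v. (SOME a. a \<in> C) \<odot>\<^bsub>V\<^esub> v)"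
  have N_simps: "carrier N = carrier V" "\<zero>\<^bsub>N\<^esub> = \<zero>\<^bsub>V\<^esub>" "\<And>u v. u \<oplus>\<^bsub>N\<^esub> v = u \<oplus>\<^bsub>V\<^esub> v"
    by (simp_all add: N_def)
  have N_smult: "(I +> a) \<odot>\<^bsub>N\<^esub> v = a \<odot>\<^bsub>V\<^esub> v" if a: "a \<in> carrier R" and v: "v \<in> carrier V" for a v
  proof -
    have "(SOME b. b \<in> I +> a) \<in> I +> a" using a_rcos_self[OF a] by (rule someI)
    then obtain i where i: "i \<in> I" "(SOME b. b \<in> I +> a) = i \<oplus> a" by (auto simp: a_r_coset_def')
    have "(i \<oplus> a) \<odot>\<^bsub>V\<^esub> v = a \<odot>\<^bsub>V\<^esub> v"
      using V.smult_l_distr[OF a_Hcarr[OF i(1)] a v] kill[OF i(1) v] V.smult_closed[OF a v] by simp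
    then show ?thesis using i(2) by (simp add: N_def)
  qed
  have N: "left_module (R Quot I) N"
  proof (intro left_module.intro left_module_axioms.intro quotient_is_ring)
    show "abelian_group N"
      by (rule abelian_groupI) (auto simp: N_simps V.M.a_ac intro: V.M.l_neg)
  qed (auto simp: quot_carrier N_simps N_smult quot_ops quot_one_zero V.smult_closed V.smult_l_distr
      V.smult_r_distr V.smult_assoc V.smult_one)
  have "W = {\<zero>\<^bsub>N\<^esub>} \<or> W = carrier N" if W: "submodule W (R Quot I) N" for W
  proof -
    note W' = submoduleD[OF W, unfolded N_simps]
    have "submodule W R V"
    proof (rule V.left_submoduleI[OF W'(1,2,3)])
      fix a x assume a: "a \<in> carrier R" and x: "x \<in> W"
      have "(I +> a) \<odot>\<^bsub>N\<^esub> x \<in> W" using W'(4)[of "I +> a" x] a x by (auto simp: quot_carrier)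
      then show "a \<odot>\<^bsub>V\<^esub> x \<in> W" using N_smult[OF a, of x] x W'(1) by auto
    qed
    then show ?thesis using simple by (auto simp: simple_module_def N_simps)
  qed
  then have "simple_module (R Quot I) N" using N simple by (auto simp: simple_module_def N_simps)
  moreover have "module_isomorphic R V (pullback_module R I N)"
    unfolding module_isomorphic_def
  proof (intro bexI[of _ "\<lambda>v. v"])
    show "bij_betw (\<lambda>v. v) (carrier V) (carrier (pullback_module R I N))"
      by (simp add: pullback_module_def N_simps bij_betw_def inj_on_def)
    show "(\<lambda>v. v) \<in> module_hom R V (pullback_module R I N)"
      by (rule module_homI) (auto simp: pullback_module_def N_simps N_smult)
  qed
  ultimately show ?L by blast
qed

end

section \<open>The irreducible modules of the quotient\<close>

context semisimple_hopf_module begin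

lemma left_kernel_augmentation_Ann:
  assumes "l \<in> augmentation_part K \<epsilon> L" shows "l \<in> Ann"
proof -
  have l: "l \<in> L" "\<epsilon> l = \<zero>\<^bsub>K\<^esub>" using assms by (auto simp: augmentation_part_def)
  have la: "l \<in> carrier A" using l by (simp add: left_kernel_def Let_def)
  show ?thesis
    using la trivial_action_imp_Coef_zero[OF la left_kernel_acts_trivially[OF l]]
    by (auto simp: Ann_def Coefs_def)
qed

lemma hopf_ideal_eq_Ann: "hopf_ideal_of K A \<epsilon> L = Ann"
proof
  show "hopf_ideal_of K A \<epsilon> L \<subseteq> Ann"
  proof
    fix x assume "x \<in> hopf_ideal_of K A \<epsilon> L"
    then show "x \<in> Ann"
      unfolding hopf_ideal_of_def
    proof (induction rule: ideal_prod.induct)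
      case (prod i j)
      then show ?case using A.left_idealD(4)[OF Ann_left_ideal _ left_kernel_augmentation_Ann] by blast
    next
      case (sum s1 s2)
      then show ?case using A.left_idealD(3)[OF Ann_left_ideal] by blast
    qed
  qed
qed (rule Ann_subset_hopf_ideal)

lemma Ann_ideal: "ideal Ann A"
proof (rule idealI[OF A.ring_axioms])
  show "subgroup Ann (add_monoid A)"
    using A.left_idealD[OF Ann_left_ideal] A.left_ideal_neg[OF Ann_left_ideal]
    by (intro subgroup.intro) (auto simp: a_inv_def)
qed (use A.left_idealD(4)[OF Ann_left_ideal] Ann_right_ideal in auto)

text \<open>On \<open>M\<^sup>\<otimes>\<^sup>n\<close> the elements of \<open>L\<^sup>+\<close> act as zero, hence also on its subquotients, and \<open>L\<^sup>+\<close> generates \<open>J\<close> as a left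
ideal.\<close>
lemma constituent_annihilated:
  assumes V': "irreducible_constituent A V' (X n)" and a: "a \<in> Ann" and v: "v \<in> carrier V'"
  shows "a \<odot>\<^bsub>V'\<^esub> v = \<zero>\<^bsub>V'\<^esub>"
proof -
  interpret V': left_module A V' using V' by (simp add: irreducible_constituent_def simple_module_def)
  interpret Xn: left_module A "X n" by (rule X_left_module)
  interpret Tn: module K "T n" by (rule T_module)
  obtain P Q h where P: "submodule P A (X n)" and Q: "submodule Q A (X n)" "P \<subseteq> Q"
    and h: "h \<in> module_hom A V' (quotient_module ((X n)\<lparr>carrier := Q\<rparr>) P)"
      "bij_betw h (carrier V') (carrier (quotient_module ((X n)\<lparr>carrier := Q\<rparr>) P))"
    using V' by (auto simp: irreducible_constituent_def module_isomorphic_def)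
  note P' = submoduleD[OF P] and Q' = submoduleD[OF Q(1)]
  have P0: "P +>\<^bsub>(X n)\<lparr>carrier := Q\<rparr>\<^esub> \<zero>\<^bsub>T n\<^esub> = P"
  proof -
    have "(\<Union>p\<in>P. {p \<oplus>\<^bsub>T n\<^esub> \<zero>\<^bsub>T n\<^esub>}) = (\<Union>p\<in>P. {p})" by (rule SUP_cong) (use P'(1) in auto)
    then show ?thesis by (simp add: a_r_coset_def')
  qed
  \<comment> \<open>The zero of the quotient by \<open>P\<close> is the coset \<open>P\<close>.\<close>
  have h_trivial: "h (l \<odot>\<^bsub>V'\<^esub> v) = P"
    if l: "l \<in> carrier A" and l0: "\<And>t. t \<in> carrier (T n) \<Longrightarrow> act n l t = \<zero>\<^bsub>T n\<^esub>" and v: "v \<in> carrier V'" for l v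
  proof -
    have "h v \<in> a_rcosets\<^bsub>(X n)\<lparr>carrier := Q\<rparr>\<^esub> P"
      using module_hom_closed[OF h(1) v] by (simp add: quotient_module_def)
    then obtain q where q: "q \<in> Q" "h v = (\<Union>p\<in>P. {p \<oplus>\<^bsub>T n\<^esub> q})"
      by (auto simp: A_RCOSETS_def' a_r_coset_def')
    have sub: "h v \<subseteq> carrier (T n)" and ne: "h v \<noteq> {}" using q P' Q'(1) by auto
    have "h (l \<odot>\<^bsub>V'\<^esub> v) = (\<Union>x\<in>h v. P +>\<^bsub>(X n)\<lparr>carrier := Q\<rparr>\<^esub> (act n l x))"
      using module_hom_smult[OF h(1) l v] by (simp add: quotient_module_def)
    also have "\<dots> = (\<Union>x\<in>h v. P)" by (rule SUP_cong[OF refl]) (use sub l0 P0 in auto)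
    finally show ?thesis using ne by simp
  qed
  have inj: "inj_on h (carrier V')" using h(2) by (simp add: bij_betw_def)
  have kill: "l \<odot>\<^bsub>V'\<^esub> v = \<zero>\<^bsub>V'\<^esub>" if l: "l \<in> augmentation_part K \<epsilon> L" and v: "v \<in> carrier V'" for l v
  proof -
    have l': "l \<in> L" "\<epsilon> l = \<zero>\<^bsub>K\<^esub>" using l by (auto simp: augmentation_part_def)
    have la: "l \<in> carrier A" using l' by (simp add: left_kernel_def Let_def)
    have z: "act n \<zero>\<^bsub>A\<^esub> t = \<zero>\<^bsub>T n\<^esub>" if "t \<in> carrier (T n)" for t
      using Xn.smult_zero_left[of t] that by simp
    have "h (l \<odot>\<^bsub>V'\<^esub> v) = h (\<zero>\<^bsub>A\<^esub> \<odot>\<^bsub>V'\<^esub> v)"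
      using h_trivial[OF la left_kernel_acts_trivially[OF l'] v] h_trivial[OF A.zero_closed z v] by simp
    then have "l \<odot>\<^bsub>V'\<^esub> v = \<zero>\<^bsub>A\<^esub> \<odot>\<^bsub>V'\<^esub> v"
      using inj_onD[OF inj] V'.smult_closed[OF la v] V'.smult_closed[OF A.zero_closed v] by blast
    then show ?thesis using V'.smult_zero_left[OF v] by simp
  qed
  have "a \<in> carrier A \<cdot>\<^bsub>A\<^esub> augmentation_part K \<epsilon> L"
    using a hopf_ideal_eq_Ann by (simp add: hopf_ideal_of_def)
  then have "a \<in> carrier A \<and> (\<forall>v\<in>carrier V'. a \<odot>\<^bsub>V'\<^esub> v = \<zero>\<^bsub>V'\<^esub>)"
  proof (induction rule: ideal_prod.induct)
    case (prod i j)
    then have "j \<in> carrier A" by (auto simp: augmentation_part_def left_kernel_def Let_def)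
    then show ?case using prod kill V'.smult_assoc[of i j] V'.smult_zero_right by auto
  next
    case (sum s1 s2)
    then show ?case using V'.smult_l_distr[of s1 s2] by auto
  qed
  then show ?thesis using v by blast
qed

text \<open>Let \<open>v\<^sub>0\<close> be nonzero in \<open>V'\<close>.  A complement \<open>N\<close> of the annihilator of \<open>v\<^sub>0\<close> is mapped isomorphically onto \<open>V'\<close>
by \<open>y \<mapsto> y v\<^sub>0\<close>, and contains an \<open>e\<close> with \<open>e v\<^sub>0 = v\<^sub>0\<close>.  So \<open>e\<close> is not in \<open>J\<close>, and \<open>e t\<close> is nonzero for some
\<open>t\<close> in a tensor power.  As \<open>N\<close> is simple, \<open>y \<mapsto> y t\<close> embeds it into this tensor power.\<close>
lemma annihilated_imp_constituent:
  assumes simple: "simple_module A V'" and kill: "\<And>a v. a \<in> Ann \<Longrightarrow> v \<in> carrier V' \<Longrightarrow> a \<odot>\<^bsub>V'\<^esub> v = \<zero>\<^bsub>V'\<^esub>"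
  shows "\<exists>n. irreducible_constituent A V' (X n)"
proof -
  interpret V': left_module A V' using simple by (simp add: simple_module_def)
  obtain v0 where v0: "v0 \<in> carrier V'" "v0 \<noteq> \<zero>\<^bsub>V'\<^esub>"
    using simple V'.M.zero_closed unfolding simple_module_def by blast
  define N0 where "N0 = {a \<in> carrier A. a \<odot>\<^bsub>V'\<^esub> v0 = \<zero>\<^bsub>V'\<^esub>}"
  have N0: "A.left_ideal N0"
    unfolding A.left_ideal_def N0_def using v0 V'.smult_zero_left V'.smult_l_distr V'.smult_assoc V'.smult_zero_right
    by auto
  obtain e1 N where N: "A.left_ideal N" "N0 \<inter> N = {\<zero>\<^bsub>A\<^esub>}" "e1 \<in> N0" "\<one>\<^bsub>A\<^esub> \<ominus>\<^bsub>A\<^esub> e1 \<in> N"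
    using SS.left_ideal_complement[OF N0] by metis
  note N' = A.left_idealD[OF N(1)]
  define e where "e = \<one>\<^bsub>A\<^esub> \<ominus>\<^bsub>A\<^esub> e1"
  have eN: "e \<in> N" using N(4) by (simp add: e_def)
  have ec: "e \<in> carrier A" using N'(1) eN .
  have e1: "e1 \<in> carrier A" "e1 \<odot>\<^bsub>V'\<^esub> v0 = \<zero>\<^bsub>V'\<^esub>" using N(3) by (auto simp: N0_def)
  have ev: "e \<odot>\<^bsub>V'\<^esub> v0 = v0"
    using e1 v0(1) V'.smult_l_distr[of "\<one>\<^bsub>A\<^esub>" "\<ominus>\<^bsub>A\<^esub> e1" v0] V'.smult_neg[OF e1(1) v0(1)] V'.smult_one[OF v0(1)]
    by (simp add: e_def a_minus_def)
  have "e \<notin> Ann" using kill[OF _ v0(1), of e] ev v0(2) by auto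
  then obtain c n' where "c \<in> Coef n'" "c e \<noteq> \<zero>\<^bsub>K\<^esub>" using ec by (auto simp: Ann_def Coefs_def)
  then obtain n t where t: "t \<in> carrier (T n)" "act n e t \<noteq> \<zero>\<^bsub>T n\<^esub>"
    using trivial_action_imp_Coef_zero[OF ec] by blast
  interpret Xn: left_module A "X n" by (rule X_left_module)
  interpret Tn: module K "T n" by (rule T_module)
  have N_neg: "\<ominus>\<^bsub>A\<^esub> y \<in> N" if "y \<in> N" for y using A.left_ideal_neg[OF N(1) that] .
  have inj: "inj_on (\<lambda>y. y \<odot>\<^bsub>V'\<^esub> v0) N"
  proof (rule V'.inj_on_orbit[OF N(1) v0(1)])
    fix y assume "y \<in> N" "y \<odot>\<^bsub>V'\<^esub> v0 = \<zero>\<^bsub>V'\<^esub>"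
    then have "y \<in> N0 \<inter> N" using N'(1) by (auto simp: N0_def)
    then show "y = \<zero>\<^bsub>A\<^esub>" using N(2) by simp
  qed
  have surj: "(\<lambda>y. y \<odot>\<^bsub>V'\<^esub> v0) ` N = carrier V'"
  proof -
    have "v0 \<in> (\<lambda>y. y \<odot>\<^bsub>V'\<^esub> v0) ` N" using ev by (intro image_eqI[OF _ eN]) simp
    then show ?thesis
      using V'.orbit_submodule[OF N(1) v0(1)] simple v0(2) unfolding simple_module_def by blast
  qed
  have inj_t: "inj_on (\<lambda>y. y \<odot>\<^bsub>X n\<^esub> t) N"
  proof (rule Xn.inj_on_orbit[OF N(1)])
    show "t \<in> carrier (X n)" using t by simp
    fix y assume y: "y \<in> N" "y \<odot>\<^bsub>X n\<^esub> t = \<zero>\<^bsub>X n\<^esub>"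
    define N1 where "N1 = {y \<in> N. y \<odot>\<^bsub>X n\<^esub> t = \<zero>\<^bsub>X n\<^esub>}"
    have tX: "t \<in> carrier (X n)" using t by simp
    have N1: "A.left_ideal N1"
      unfolding A.left_ideal_def N1_def
    proof (intro conjI ballI)
      show "{y \<in> N. y \<odot>\<^bsub>X n\<^esub> t = \<zero>\<^bsub>X n\<^esub>} \<subseteq> carrier A" using N'(1) by auto
      show "\<zero>\<^bsub>A\<^esub> \<in> {y \<in> N. y \<odot>\<^bsub>X n\<^esub> t = \<zero>\<^bsub>X n\<^esub>}" using N'(2) Xn.smult_zero_left[OF tX] by simp
      show "x \<oplus>\<^bsub>A\<^esub> y \<in> {y \<in> N. y \<odot>\<^bsub>X n\<^esub> t = \<zero>\<^bsub>X n\<^esub>}"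
        if "x \<in> {y \<in> N. y \<odot>\<^bsub>X n\<^esub> t = \<zero>\<^bsub>X n\<^esub>}" "y \<in> {y \<in> N. y \<odot>\<^bsub>X n\<^esub> t = \<zero>\<^bsub>X n\<^esub>}" for x y
        using that N'(3) Xn.smult_l_distr[OF N'(1) N'(1) tX, of x y] Xn.M.zero_closed Xn.M.l_zero by auto
      show "a \<bullet> x \<in> {y \<in> N. y \<odot>\<^bsub>X n\<^esub> t = \<zero>\<^bsub>X n\<^esub>}"
        if "a \<in> carrier A" "x \<in> {y \<in> N. y \<odot>\<^bsub>X n\<^esub> t = \<zero>\<^bsub>X n\<^esub>}" for a x
        using that N'(4) Xn.smult_assoc[OF that(1) N'(1) tX, of x] Xn.smult_zero_right[OF that(1)] by auto
    qed
    have sub: "submodule ((\<lambda>y. y \<odot>\<^bsub>V'\<^esub> v0) ` N1) A V'" by (rule V'.orbit_submodule[OF N1 v0(1)])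
    have "v0 \<notin> (\<lambda>y. y \<odot>\<^bsub>V'\<^esub> v0) ` N1"
    proof
      assume "v0 \<in> (\<lambda>y. y \<odot>\<^bsub>V'\<^esub> v0) ` N1"
      then obtain z where z: "z \<in> N" "z \<odot>\<^bsub>X n\<^esub> t = \<zero>\<^bsub>X n\<^esub>" "z \<odot>\<^bsub>V'\<^esub> v0 = v0" by (auto simp: N1_def)
      then have "z = e" using inj_onD[OF inj _ z(1) eN] ev by simp
      then show False using z(2) t(2) by simp
    qed
    then have "(\<lambda>y. y \<odot>\<^bsub>V'\<^esub> v0) ` N1 \<noteq> carrier V'" using v0(1) by auto
    then have "(\<lambda>y. y \<odot>\<^bsub>V'\<^esub> v0) ` N1 = {\<zero>\<^bsub>V'\<^esub>}" using sub simple unfolding simple_module_def by blast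
    moreover have "y \<in> N1" using y by (simp add: N1_def)
    ultimately have "y \<odot>\<^bsub>V'\<^esub> v0 = \<zero>\<^bsub>V'\<^esub>" by blast
    then have "y \<in> N0 \<inter> N" using y N'(1) by (auto simp: N0_def)
    then show "y = \<zero>\<^bsub>A\<^esub>" using N(2) by simp
  qed
  define g where "g = the_inv_into N (\<lambda>y. y \<odot>\<^bsub>V'\<^esub> v0)"
  have gN: "g v \<in> N" if "v \<in> carrier V'" for v
    unfolding g_def using that surj by (intro the_inv_into_into[OF inj]) auto
  have gv: "g v \<odot>\<^bsub>V'\<^esub> v0 = v" if "v \<in> carrier V'" for v
    using f_the_inv_into_f[OF inj, of v] that surj by (simp add: g_def)
  have g_eq: "g v = y" if "y \<in> N" "y \<odot>\<^bsub>V'\<^esub> v0 = v" for v y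
    using the_inv_into_f_f[OF inj that(1)] that(2) by (simp add: g_def)
  have g_add: "g (u \<oplus>\<^bsub>V'\<^esub> v) = g u \<oplus>\<^bsub>A\<^esub> g v" if "u \<in> carrier V'" "v \<in> carrier V'" for u v
    using that gN gv N'(3) V'.smult_l_distr[OF N'(1) N'(1) v0(1), of "g u" "g v"] by (intro g_eq) auto
  have g_smult: "g (a \<odot>\<^bsub>V'\<^esub> v) = a \<bullet> g v" if "a \<in> carrier A" "v \<in> carrier V'" for a v
    using that gN gv N'(4) V'.smult_assoc[OF that(1) N'(1) v0(1), of "g v"] by (intro g_eq) auto
  have g_bij: "g ` carrier V' = N" "inj_on g (carrier V')"
  proof -
    show "inj_on g (carrier V')" by (rule inj_onI) (metis gv)
    have "y \<in> g ` carrier V'" if "y \<in> N" for y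
      using g_eq[OF that refl] surj that by (intro image_eqI[of _ g "y \<odot>\<^bsub>V'\<^esub> v0"]) auto
    then show "g ` carrier V' = N" using gN by auto
  qed
  define Q where "Q = (\<lambda>y. y \<odot>\<^bsub>X n\<^esub> t) ` N"
  have Q: "submodule Q A (X n)" unfolding Q_def by (rule Xn.orbit_submodule[OF N(1)]) (use t in simp)
  have QT: "Q \<subseteq> carrier (T n)" using submoduleD(1)[OF Q] by simp
  have "submodule {\<zero>\<^bsub>X n\<^esub>} A (X n)"
    by (rule Xn.left_submoduleI) (use Xn.smult_zero_right in \<open>auto simp del: X_simps(4)\<close>)
  then have Z: "submodule {\<zero>\<^bsub>T n\<^esub>} A (X n)" by simp
  let ?W = "quotient_module ((X n)\<lparr>carrier := Q\<rparr>) {\<zero>\<^bsub>T n\<^esub>}"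
  have W_carrier: "carrier ?W = (\<lambda>q. {q}) ` Q"
  proof -
    have "carrier ?W = (\<Union>q\<in>Q. {{\<zero>\<^bsub>T n\<^esub> \<oplus>\<^bsub>T n\<^esub> q}})"
      by (simp add: quotient_module_def A_RCOSETS_def' a_r_coset_def')
    also have "\<dots> = (\<Union>q\<in>Q. {{q}})" by (rule SUP_cong[OF refl]) (use QT in \<open>simp add: subset_eq\<close>)
    also have "\<dots> = (\<lambda>q. {q}) ` Q" by (rule UNION_singleton_eq_range)
    finally show ?thesis .
  qed
  have W_add: "{p} \<oplus>\<^bsub>?W\<^esub> {q} = {p \<oplus>\<^bsub>T n\<^esub> q}" for p q
    by (simp add: quotient_module_def set_add_def')
  have W_smult: "a \<odot>\<^bsub>?W\<^esub> {q} = {act n a q}" if "a \<in> carrier A" "q \<in> carrier (T n)" for a q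
    using act_closed[OF that] by (simp add: quotient_module_def a_r_coset_def')
  define h where "h = (\<lambda>v. {act n (g v) t})"
  have gc: "g v \<in> carrier A" if "v \<in> carrier V'" for v using N'(1)[OF gN[OF that]] .
  have "h \<in> module_hom A V' ?W"
  proof (rule module_homI)
    show "h v \<in> carrier ?W" if "v \<in> carrier V'" for v
    proof -
      have "act n (g v) t \<in> Q" using imageI[OF gN[OF that], of "\<lambda>y. y \<odot>\<^bsub>X n\<^esub> t"] by (simp add: Q_def)
      then show ?thesis unfolding W_carrier h_def by (rule imageI)
    qed
    show "h (u \<oplus>\<^bsub>V'\<^esub> v) = h u \<oplus>\<^bsub>?W\<^esub> h v" if "u \<in> carrier V'" "v \<in> carrier V'" for u v
      using module_hom_add[OF act_hom2[OF t(1)] gc[OF that(1)] gc[OF that(2)]]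
      by (simp add: h_def g_add[OF that] W_add)
    show "h (a \<odot>\<^bsub>V'\<^esub> v) = a \<odot>\<^bsub>?W\<^esub> h v" if "a \<in> carrier A" "v \<in> carrier V'" for a v
      using Xn.smult_assoc[OF that(1) gc[OF that(2)], of t] t(1) act_closed[OF gc[OF that(2)] t(1)]
      by (simp add: h_def g_smult[OF that] W_smult[OF that(1)])
  qed
  moreover have "bij_betw h (carrier V') (carrier ?W)"
    unfolding bij_betw_def
  proof
    show "inj_on h (carrier V')"
    proof (rule inj_onI)
      fix u v assume uv: "u \<in> carrier V'" "v \<in> carrier V'" "h u = h v"
      then have "g u \<odot>\<^bsub>X n\<^esub> t = g v \<odot>\<^bsub>X n\<^esub> t" by (simp add: h_def)
      then have "g u = g v" using inj_onD[OF inj_t] gN uv by blast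
      then show "u = v" using inj_onD[OF g_bij(2)] uv by blast
    qed
    have "h ` carrier V' = (\<lambda>q. {q}) ` (\<lambda>y. y \<odot>\<^bsub>X n\<^esub> t) ` g ` carrier V'"
      by (simp add: h_def image_image)
    then show "h ` carrier V' = carrier ?W" unfolding g_bij(1) W_carrier by (simp only: Q_def)
  qed
  ultimately have "module_isomorphic A V' ?W" by (auto simp: module_isomorphic_def)
  moreover have "{\<zero>\<^bsub>T n\<^esub>} \<subseteq> Q" using submoduleD(2)[OF Q] by simp
  ultimately have "irreducible_constituent A V' (X n)"
    using simple Z Q unfolding irreducible_constituent_def by blast
  then show ?thesis by blast
qed

theorem simple_quotient_iff_constituent:
  fixes V' :: "('a, 'v) module"
  assumes V': "left_module A V'"
  shows "(\<exists>N :: ('a set, 'v) module. simple_module (hopf_quotient K A \<epsilon> L) N \<and>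
            module_isomorphic A V' (pullback_module A (hopf_ideal_of K A \<epsilon> L) N)) \<longleftrightarrow>
         (\<exists>n. irreducible_constituent A V' (X n))"
  unfolding hopf_quotient_def hopf_ideal_eq_Ann ideal.simple_pullback_iff[OF Ann_ideal V']
proof
  assume "simple_module A V' \<and> (\<forall>a\<in>Ann. \<forall>v\<in>carrier V'. a \<odot>\<^bsub>V'\<^esub> v = \<zero>\<^bsub>V'\<^esub>)"
  then show "\<exists>n. irreducible_constituent A V' (X n)" by (intro annihilated_imp_constituent) auto
next
  assume "\<exists>n. irreducible_constituent A V' (X n)"
  then obtain n where n: "irreducible_constituent A V' (X n)" by blast
  then have "simple_module A V'" by (simp add: irreducible_constituent_def)
  then show "simple_module A V' \<and> (\<forall>a\<in>Ann. \<forall>v\<in>carrier V'. a \<odot>\<^bsub>V'\<^esub> v = \<zero>\<^bsub>V'\<^esub>)"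
    using constituent_annihilated[OF n] by blast
qed

end

theorem theorem4p2p1:
  fixes K :: "('k, 'q) ring_scheme"
    and A :: "('k, 'a, 'p) module_scheme"
    and \<Delta> :: "'a \<Rightarrow> ('a \<times> 'a \<Rightarrow> 'k) set"
    and \<epsilon> :: "'a \<Rightarrow> 'k"
    and S :: "'a \<Rightarrow> 'a"
    and M :: "('a, 'm, 's) module_scheme"
    and L :: "'a set"
    and V :: "('a, 'v) module"
  assumes "hopf_algebra K A \<Delta> \<epsilon> S"
    and "semisimple_ring A"
    and "left_module A M"
    and "finite_dimensional K (underlying_space A M)"
    and "L = left_kernel K A \<Delta> M"
    and "left_module A V"
  shows "(\<exists>N :: ('a set, 'v) module.
            simple_module (hopf_quotient K A \<epsilon> L) N \<and>
            module_isomorphic A V (pullback_module A (hopf_ideal_of K A \<epsilon> L) N)) \<longleftrightarrow>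
         (\<exists>n. irreducible_constituent A V (tensor_power_module K A \<Delta> \<epsilon> M n))"
proof -
  interpret H: hopf_algebra K A \<Delta> \<epsilon> S by fact
  interpret HM: hopf_module K A \<Delta> \<epsilon> S M
    by (intro hopf_module.intro hopf_module_axioms.intro assms(1,3))
  have "\<exists>B \<xi>. finite B \<and> B \<subseteq> carrier HM.V \<and> (\<forall>b\<in>B. \<xi> b \<in> module_hom K HM.V H.KK) \<and>
    (\<forall>v\<in>carrier HM.V. v = (\<Oplus>\<^bsub>HM.V\<^esub>b\<in>B. \<xi> b v \<odot>\<^bsub>HM.V\<^esub> b))"
    by (rule H.K.ex_coordinates[OF HM.V_module assms(4)]) blast
  then obtain B \<xi> where B: "finite B" "B \<subseteq> carrier HM.V" "\<And>b. b \<in> B \<Longrightarrow> \<xi> b \<in> module_hom K HM.V H.KK"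
    "\<And>v. v \<in> carrier HM.V \<Longrightarrow> v = (\<Oplus>\<^bsub>HM.V\<^esub>b\<in>B. \<xi> b v \<odot>\<^bsub>HM.V\<^esub> b)"
    by blast
  interpret SM: semisimple_hopf_module K A \<Delta> \<epsilon> S M B \<xi>
  proof (intro semisimple_hopf_module.intro fd_hopf_module.intro HM.hopf_module_axioms
      fd_hopf_module_axioms.intro semisimple_hopf_module_axioms.intro assms(2) B(1,3))
    show "B \<subseteq> carrier M" using B(2) by simp
    show "v = (\<Oplus>\<^bsub>HM.V\<^esub>b\<in>B. \<xi> b v \<odot>\<^bsub>HM.V\<^esub> b)" if "v \<in> carrier M" for v using B(4) that by simp
  qed
  show ?thesis unfolding assms(5) by (rule SM.simple_quotient_iff_constituent[OF assms(6)])
qed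

end
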